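(* Let $\lambda,\kappa\in\mathbb{R}\setminus\{0\}$, $T>0$, and let $a_0,b_0:\mathbb{R}\to\mathbb{C}$ be smooth functions with bounded support, all independent of $\varepsilon$. Put $\omega=\sqrt{1+\kappa^2}$, $c_g=\kappa/\omega$ and $a_0^{\pm}(x)=\tfrac12\bigl(a_0(x)\pm\mathrm{i}b_0(x)/\omega\bigr)$. Consider the nonlinear Klein–Gordon equation $$\varepsilon^2\partial_t^2u-\partial_x^2u+\frac1{\varepsilon^2}u+\lambda|u|^2u=0,\qquad x\in\mathbb{R},\ 0\le t\le T. \qquad (\mathrm{KG})$$ There exist $\varepsilon_0>0$ and $C$ independent of $\varepsilon$ such that for all $0<\varepsilon\le\varepsilon_0$ the solution $u$ of (KG) with initial data $$u(0,x)=a_0(x)e^{\mathrm{i}\kappa x/\varepsilon},\qquad \partial_tu(0,x)=\frac1{\varepsilon^2}b_0(x)e^{\mathrm{i}\kappa x/\varepsilon}$$ can be decomposed as $$u(t,x)=u^{+}(t,x)+u^{-}(t,x)+r(t,x)\qquad\text{with}\quad \|r\|_{L^\infty([0,T]\times\mathbb{R})}\le C\varepsilon,$$ where $u^{\pm}$ are the solutions of (KG) with polarized initial data corresponding to the frequencies $\pm\omega$: $$u^{\pm}(0,x)=a_0^{\pm}(x)e^{\mathrm{i}\kappa x/\varepsilon},\qquad \partial_tu^{\pm}(0,x)=-\frac1{\varepsilon^2}\bigl(\pm\mathrm{i}\omega a_0^{\pm}(x)\pm\varepsilon c_g\,\partial_xa_0^{\pm}(x)\bigr)e^{\mathrm{i}\kappa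 x/\varepsilon}.$$
   Context: Solutions of (KG) are complex-valued functions $u=u(t,x)$ on $[0,T]\times\mathbb{R}$. *)

theory Defs
  imports "HOL-Analysis.Analysis" "HOL-Probability.Essential_Supremum"
begin

definition smooth :: "(real \<Rightarrow> complex) \<Rightarrow> bool" where
  "smooth f \<longleftrightarrow> (\<forall>n x. ((\<lambda>g y. vector_derivative g (at y)) ^^ n) f differentiable (at x))"

definition slab :: "real \<Rightarrow> (real \<times> real) set" where
  "slab T = {0..T} \<times> UNIV"

(* Functions of (t, x) are curried. Only their values for 0 <= t <= T matter; the time
   derivative is one-sided at t = 0 and t = T. *)

definition partial_t :: "real \<Rightarrow> (real \<Rightarrow> real \<Rightarrow> complex) \<Rightarrow> real \<Rightarrow> real \<Rightarrow> complex" where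
  "partial_t T u t x = vector_derivative (\<lambda>s. u s x) (at t within {0..T})"

definition partial_x :: "(real \<Rightarrow> real \<Rightarrow> complex) \<Rightarrow> real \<Rightarrow> real \<Rightarrow> complex" where
  "partial_x u t x = vector_derivative (u t) (at x)"

definition C1_slab :: "real \<Rightarrow> (real \<Rightarrow> real \<Rightarrow> complex) \<Rightarrow> bool" where
  "C1_slab T u \<longleftrightarrow>
     (\<forall>t\<in>{0..T}. \<forall>x. (\<lambda>s. u s x) differentiable (at t within {0..T}) \<and> u t differentiable (at x)) \<and>
     continuous_on (slab T) (case_prod u) \<and>
     continuous_on (slab T) (case_prod (partial_t T u)) \<and>
     continuous_on (slab T) (case_prod (partial_x u))"

definition C2_slab :: "real \<Rightarrow> (real \<Rightarrow> real \<Rightarrow> complex) \<Rightarrow> bool" where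
  "C2_slab T u \<longleftrightarrow> C1_slab T u \<and> C1_slab T (partial_t T u) \<and> C1_slab T (partial_x u)"

definition KG_equation :: "real \<Rightarrow> real \<Rightarrow> real \<Rightarrow> (real \<Rightarrow> real \<Rightarrow> complex) \<Rightarrow> bool" where
  "KG_equation lam eps T u \<longleftrightarrow>
     (\<forall>t\<in>{0..T}. \<forall>x.
        of_real (eps\<^sup>2) * partial_t T (partial_t T u) t x - partial_x (partial_x u) t x
        + of_real (1 / eps\<^sup>2) * u t x + of_real (lam * (cmod (u t x))\<^sup>2) * u t x = 0)"

definition KG_solution ::
  "real \<Rightarrow> real \<Rightarrow> real \<Rightarrow> (real \<Rightarrow> complex) \<Rightarrow> (real \<Rightarrow> complex) \<Rightarrow> (real \<Rightarrow> real \<Rightarrow> complex) \<Rightarrow> bool" where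
  "KG_solution lam eps T f g u \<longleftrightarrow>
     C2_slab T u \<and> KG_equation lam eps T u \<and>
     (\<forall>x. u 0 x = f x) \<and> (\<forall>x. partial_t T u 0 x = g x)"

(* "u is the solution": u is a classical solution, and the only one as a function on the slab.
   HOL functions are total, so uniqueness is required on the slab rather than as equality. *)
definition is_the_KG_solution ::
  "real \<Rightarrow> real \<Rightarrow> real \<Rightarrow> (real \<Rightarrow> complex) \<Rightarrow> (real \<Rightarrow> complex) \<Rightarrow> (real \<Rightarrow> real \<Rightarrow> complex) \<Rightarrow> bool" where
  "is_the_KG_solution lam eps T f g u \<longleftrightarrow>
     KG_solution lam eps T f g u \<and>
     (\<forall>v. KG_solution lam eps T f g v \<longrightarrow> (\<forall>t\<in>{0..T}. \<forall>x. v t x = u t x))"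

definition Linfty_norm :: "real \<Rightarrow> (real \<Rightarrow> real \<Rightarrow> complex) \<Rightarrow> ereal" where
  "Linfty_norm T r = esssup (lebesgue_on (slab T)) (\<lambda>(t, x). ereal (cmod (r t x)))"

definition omega :: "real \<Rightarrow> real" where
  "omega \<kappa> = sqrt (1 + \<kappa>\<^sup>2)"

definition c_g :: "real \<Rightarrow> real" where
  "c_g \<kappa> = \<kappa> / omega \<kappa>"

definition plane_wave :: "real \<Rightarrow> real \<Rightarrow> real \<Rightarrow> complex" where
  "plane_wave \<kappa> eps x = exp (\<i> * of_real (\<kappa> * x / eps))"

(* The sign of the polarization is passed as s = 1 or s = -1. *)

definition pol_amp ::
  "real \<Rightarrow> real \<Rightarrow> (real \<Rightarrow> complex) \<Rightarrow> (real \<Rightarrow> complex) \<Rightarrow> real \<Rightarrow> complex" where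
  "pol_amp \<kappa> s a0 b0 x = (1 / 2) * (a0 x + of_real s * (\<i> * b0 x / of_real (omega \<kappa>)))"

definition pol_init ::
  "real \<Rightarrow> real \<Rightarrow> real \<Rightarrow> (real \<Rightarrow> complex) \<Rightarrow> (real \<Rightarrow> complex) \<Rightarrow> real \<Rightarrow> complex" where
  "pol_init \<kappa> eps s a0 b0 x = pol_amp \<kappa> s a0 b0 x * plane_wave \<kappa> eps x"

definition pol_init_dt ::
  "real \<Rightarrow> real \<Rightarrow> real \<Rightarrow> (real \<Rightarrow> complex) \<Rightarrow> (real \<Rightarrow> complex) \<Rightarrow> real \<Rightarrow> complex" where
  "pol_init_dt \<kappa> eps s a0 b0 x =
     - of_real (1 / eps\<^sup>2) *
       (of_real s * (\<i> * of_real (omega \<kappa>) * pol_amp \<kappa> s a0 b0 x)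
        + of_real s * (of_real (eps * c_g \<kappa>) * vector_derivative (pol_amp \<kappa> s a0 b0) (at x)))
     * plane_wave \<kappa> eps x"

end

theory Submission
  imports Defs
begin

text \<open>In the variables \<open>t/\<epsilon>\<^sup>2\<close>, \<open>x/\<epsilon>\<close> the equation becomes
  \<open>u\<^sub>t\<^sub>t - u\<^sub>x\<^sub>x + u + \<mu> |u|\<^sup>2 u = 0\<close> with \<open>\<mu> = \<epsilon>\<^sup>2 \<lambda>\<close> on a time interval of length
  \<open>T/\<epsilon>\<^sup>2\<close>. Put \<open>Du = u\<^sub>x - \<i> \<kappa> u\<close> and \<open>Zu = u\<^sub>t + c u\<^sub>x + \<i> u/\<Omega>\<close>, where
  \<open>\<Omega>\<^sup>2 = 1 + \<kappa>\<^sup>2\<close> and \<open>c = \<kappa>/\<Omega>\<close>. Then \<open>(\<partial>\<^sub>t - c \<partial>\<^sub>x - \<i>/\<Omega>) Zu = D\<^sup>2u/\<Omega>\<^sup>2 - \<mu> |u|\<^sup>2 u\<close>,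
  so besides the energy also \<open>\<integral> |Zu|\<^sup>2 + |Du|\<^sup>2/\<Omega>\<^sup>2 + \<mu>|u|\<^sup>4/2\<close> is conserved. For polarized data \<open>Zu\<close>
  vanishes initially and this quantity is \<open>O(\<epsilon>)\<close>, whence \<open>u = O(1)\<close> uniformly; the energy of \<open>Zu\<close>, which
  is initially \<open>O(\<epsilon>\<^sup>3)\<close> and stays so by Gronwall, then gives \<open>Du = O(\<epsilon>)\<close>.

  The remainder \<open>r = u - u\<^sup>+ - u\<^sup>-\<close> is driven by products of \<open>u\<^sup>+\<close> and \<open>u\<^sup>-\<close>, which travel with
  opposite velocities \<open>\<plusminus>c\<close>. Weighting the energies of \<open>u\<^sup>\<plusminus>\<close> and \<open>Du\<^sup>\<plusminus>\<close> by a ramp that moves with speed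
  \<open>c/2\<close> yields a functional whose decay controls the part of \<open>u\<^sup>\<plusminus>\<close> lagging behind its front. After a time
  \<open>O(1/\<epsilon>)\<close> at every point one of the two waves lags, so the decay absorbs the products; before that time they
  have no time to act. Gronwall bounds \<open>E(Dr) + \<epsilon>\<^sup>2 E(r)\<close> by \<open>O(\<epsilon>\<^sup>3)\<close>, and a weighted Sobolev inequality
  gives \<open>r = O(\<epsilon>)\<close>. The a priori bounds also yield global existence, by continuation of solutions with
  truncated nonlinearity.\<close>

section \<open>Regularity on a space-time strip\<close>

text \<open>The obstacle is a count of powers of \<open>eps\<close>. In the rescaled variables the
  data occupy a length of order 1/\<open>eps\<close>, so energies are of size 1/\<open>eps\<close>,
  while the waves must stay O(1) and the remainder O(\<open>eps\<close>) in sup norm for times of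
  order 1/\<open>eps\<close>^2. Sup norms come from |\<phi>|^2 \<le> \<delta> \<integral>|\<phi>|^2
  + \<integral>|D\<phi>|^2/\<delta> with \<delta> = \<open>eps\<close>, which is sharp only if D
  gains a factor \<open>eps\<close>; hence D instead of the full x-derivative, and the weight
  \<open>eps\<close>^2 on E(r). The second conserved quantity is energy plus 2c times momentum plus
  2/\<Omega> times charge, the combination whose quadratic part vanishes on exp(i(\<kappa>x -
  \<Omega>t)). The term with \<open>c_g\<close> in the polarized velocity makes Z vanish exactly at
  time 0; with Z = O(\<open>eps\<close>) its energy would start at O(\<open>eps\<close>) instead of
  O(\<open>eps\<close>^3). Products of the two waves carry the factor \<mu> =
  O(\<open>eps\<close>^2): acting for the whole time 1/\<open>eps\<close>^2 they would contribute
  O(1), acting for a time 1/\<open>eps\<close> they contribute O(\<open>eps\<close>), the accuracy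
  claimed.\<close>

text \<open>Functions of \<open>(t, x)\<close> matter for \<open>0 \<le> t \<le> B\<close> only, and the time derivative is one-sided at the ends.\<close>

definition contS :: "real \<Rightarrow> (real \<Rightarrow> real \<Rightarrow> 'a::topological_space) \<Rightarrow> bool" where
  "contS B f \<longleftrightarrow> continuous_on ({0..B} \<times> UNIV) (\<lambda>z. f (fst z) (snd z))"

lemma contS_compose:
  assumes "contS B f" "continuous_on S g" "continuous_on S h" "\<And>s. s \<in> S \<Longrightarrow> g s \<in> {0..B}"
  shows "continuous_on S (\<lambda>s. f (g s) (h s))"
proof -
  have "continuous_on S (\<lambda>s. (g s, h s))"
    using assms by (intro continuous_intros)
  moreover have "(\<lambda>s. (g s, h s)) ` S \<subseteq> {0..B} \<times> UNIV"
    using assms(4) by auto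
  ultimately have "continuous_on S (\<lambda>s. f (fst (g s, h s)) (snd (g s, h s)))"
    by (rule continuous_on_compose2[OF assms(1)[unfolded contS_def]])
  then show ?thesis by simp
qed

lemma contS_mono: "contS B f \<Longrightarrow> B' \<le> B \<Longrightarrow> contS B' f"
  unfolding contS_def by (erule continuous_on_subset) auto

lemma contS_cong: "contS B f \<Longrightarrow> (\<And>t x. t \<in> {0..B} \<Longrightarrow> f t x = g t x) \<Longrightarrow> contS B g"
  unfolding contS_def by (erule continuous_on_eq) auto

lemma contS_const: "contS B (\<lambda>t x. c)"
  unfolding contS_def by (intro continuous_intros)

lemma contS_add:
  fixes f g :: "real \<Rightarrow> real \<Rightarrow> 'a::real_normed_vector"
  shows "contS B f \<Longrightarrow> contS B g \<Longrightarrow> contS B (\<lambda>t x. f t x + g t x)"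
  unfolding contS_def by (intro continuous_intros)

lemma contS_bilinear:
  assumes "bounded_bilinear p" "contS B f" "contS B g"
  shows "contS B (\<lambda>t x. p (f t x) (g t x))"
  using bounded_bilinear.continuous_on[OF assms(1)] assms(2,3) unfolding contS_def by blast

lemma contS_linear:
  assumes "bounded_linear p" "contS B f"
  shows "contS B (\<lambda>t x. p (f t x))"
  using bounded_linear.continuous_on[OF assms(1)] assms(2) unfolding contS_def by blast

text \<open>A relation with the derivatives as arguments rather than a pair of operators:
  derivatives are certified by rules that follow the structure of \<open>f\<close>, and the
  one-sided time derivatives at 0 and \<open>B\<close> need no separate treatment. Joint continuity
  makes it C^1 on the strip.\<close>

definition pd :: "real \<Rightarrow> (real \<Rightarrow> real \<Rightarrow> 'a::real_normed_vector) \<Rightarrow> (real \<Rightarrow> real \<Rightarrow> 'a) \<Rightarrow> (real \<Rightarrow> real \<Rightarrow> 'a) \<Rightarrow> bool" where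
  "pd B f ft fx \<longleftrightarrow>
     (\<forall>t\<in>{0..B}. \<forall>x. ((\<lambda>s. f s x) has_vector_derivative ft t x) (at t within {0..B}) \<and>
                     (f t has_vector_derivative fx t x) (at x)) \<and>
     contS B f \<and> contS B ft \<and> contS B fx"

lemma pd_t: "pd B f ft fx \<Longrightarrow> t \<in> {0..B} \<Longrightarrow> ((\<lambda>s. f s x) has_vector_derivative ft t x) (at t within {0..B})"
  and pd_x: "pd B f ft fx \<Longrightarrow> t \<in> {0..B} \<Longrightarrow> (f t has_vector_derivative fx t x) (at x)"
  and pd_cont: "pd B f ft fx \<Longrightarrow> contS B f" "pd B f ft fx \<Longrightarrow> contS B ft" "pd B f ft fx \<Longrightarrow> contS B fx"
  unfolding pd_def by auto

lemma pd_mono: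
  assumes "pd B f ft fx" "B' \<le> B"
  shows "pd B' f ft fx"
  using assms unfolding pd_def
  by (auto intro: contS_mono has_vector_derivative_within_subset[where S="{0..B}"])

lemma pd_cong:
  assumes "pd B f ft fx" "\<And>t x. t \<in> {0..B} \<Longrightarrow> f t x = g t x" "\<And>t x. t \<in> {0..B} \<Longrightarrow> ft t x = gt t x"
    "\<And>t x. t \<in> {0..B} \<Longrightarrow> fx t x = gx t x"
  shows "pd B g gt gx"
proof -
  have "((\<lambda>s. g s x) has_vector_derivative gt t x) (at t within {0..B})"
    "(g t has_vector_derivative gx t x) (at x)" if t: "t \<in> {0..B}" for t x
  proof -
    show "((\<lambda>s. g s x) has_vector_derivative gt t x) (at t within {0..B})"
      by (rule has_vector_derivative_transform[OF t])
        (use pd_t[OF assms(1) t, of x] assms(2) assms(3)[OF t] in auto)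
    have "f t = g t" using assms(2) t by auto
    then show "(g t has_vector_derivative gx t x) (at x)"
      using pd_x[OF assms(1) t, of x] assms(4)[OF t, of x] by simp
  qed
  then show ?thesis
    using contS_cong[OF pd_cont(1)[OF assms(1)] assms(2)] contS_cong[OF pd_cont(2)[OF assms(1)] assms(3)]
      contS_cong[OF pd_cont(3)[OF assms(1)] assms(4)]
    unfolding pd_def by blast
qed

lemma pd_const: "pd B (\<lambda>t x. c) (\<lambda>t x. 0) (\<lambda>t x. 0)"
  unfolding pd_def by (auto intro: contS_const)

lemma pd_add:
  assumes "pd B f ft fx" "pd B g gt gx"
  shows "pd B (\<lambda>t x. f t x + g t x) (\<lambda>t x. ft t x + gt t x) (\<lambda>t x. fx t x + gx t x)"
  using assms unfolding pd_def by (auto intro!: contS_add has_vector_derivative_add)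

lemma pd_linear:
  assumes "bounded_linear p" "pd B f ft fx"
  shows "pd B (\<lambda>t x. p (f t x)) (\<lambda>t x. p (ft t x)) (\<lambda>t x. p (fx t x))"
  using assms(2) unfolding pd_def
  by (simp add: contS_linear[OF assms(1), of B f] contS_linear[OF assms(1), of B ft]
      contS_linear[OF assms(1), of B fx] bounded_linear.has_vector_derivative[OF assms(1)])

lemma pd_bilinear:
  assumes "bounded_bilinear p" "pd B f ft fx" "pd B g gt gx"
  shows "pd B (\<lambda>t x. p (f t x) (g t x)) (\<lambda>t x. p (f t x) (gt t x) + p (ft t x) (g t x))
    (\<lambda>t x. p (f t x) (gx t x) + p (fx t x) (g t x))"
  unfolding pd_def
proof (intro conjI ballI allI)
  note f = pd_cont[OF assms(2)] and g = pd_cont[OF assms(3)]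
  note c = contS_bilinear[OF assms(1)]
  show "contS B (\<lambda>t x. p (f t x) (g t x))" by (rule c[OF f(1) g(1)])
  show "contS B (\<lambda>t x. p (f t x) (gt t x) + p (ft t x) (g t x))"
    by (rule contS_add[OF c[OF f(1) g(2)] c[OF f(2) g(1)]])
  show "contS B (\<lambda>t x. p (f t x) (gx t x) + p (fx t x) (g t x))"
    by (rule contS_add[OF c[OF f(1) g(3)] c[OF f(3) g(1)]])
  fix t x assume t: "t \<in> {0..B}"
  show "((\<lambda>s. p (f s x) (g s x)) has_vector_derivative p (f t x) (gt t x) + p (ft t x) (g t x)) (at t within {0..B})"
    by (rule bounded_bilinear.has_vector_derivative[OF assms(1) pd_t[OF assms(2) t] pd_t[OF assms(3) t]])
  show "((\<lambda>x. p (f t x) (g t x)) has_vector_derivative p (f t x) (gx t x) + p (fx t x) (g t x)) (at x)"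
    by (rule bounded_bilinear.has_vector_derivative[OF assms(1) pd_x[OF assms(2) t] pd_x[OF assms(3) t]])
qed

lemmas pd_cmult = pd_linear[OF bounded_linear_mult_right]
lemmas pd_cnj = pd_linear[OF bounded_linear_cnj]
lemmas pd_mult = pd_bilinear[OF bounded_bilinear_mult]
lemmas pd_inner = pd_bilinear[OF bounded_bilinear_inner]
lemmas contS_mult = contS_bilinear[OF bounded_bilinear_mult]
lemmas contS_inner = contS_bilinear[OF bounded_bilinear_inner]
lemmas contS_cmult = contS_linear[OF bounded_linear_mult_right]

lemma pd_minus: "pd B f ft fx \<Longrightarrow> pd B (\<lambda>t x. - f t x) (\<lambda>t x. - ft t x) (\<lambda>t x. - fx t x)"
  by (rule pd_linear[OF bounded_linear_minus[OF bounded_linear_ident]])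

lemma pd_diff:
  assumes "pd B f ft fx" "pd B g gt gx"
  shows "pd B (\<lambda>t x. f t x - g t x) (\<lambda>t x. ft t x - gt t x) (\<lambda>t x. fx t x - gx t x)"
  using pd_add[OF assms(1) pd_minus[OF assms(2)]] by simp

lemma contS_diff:
  fixes f g :: "real \<Rightarrow> real \<Rightarrow> 'a::real_normed_vector"
  shows "contS B f \<Longrightarrow> contS B g \<Longrightarrow> contS B (\<lambda>t x. f t x - g t x)"
  unfolding contS_def by (intro continuous_intros)

text \<open>Partial derivatives yield the total derivative as soon as one of them is continuous;
  here it is \<open>fx\<close>. The total derivative is what the chain rule along the lines of
  \<open>pd_chain\<close> requires.\<close>

lemma pd_has_derivative:
  assumes "pd B f ft fx" "t \<in> {0..B}"
  shows "((\<lambda>(t, x). f t x) has_derivative (\<lambda>(a, b). a *\<^sub>R ft t x + b *\<^sub>R fx t x)) (at (t, x) within {0..B} \<times> UNIV)"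
proof -
  let ?fy = "\<lambda>t x. blinfun_scaleR_left (fx t x)"
  have "((\<lambda>(t, x). f t x) has_derivative (\<lambda>(a, b). a *\<^sub>R ft t x + ?fy t x b)) (at (t, x) within {0..B} \<times> UNIV)"
  proof (rule has_derivative_partialsI[where fy = ?fy])
    show "((\<lambda>s. f s x) has_derivative (\<lambda>a. a *\<^sub>R ft t x)) (at t within {0..B})"
      using pd_t[OF assms] by (simp add: has_vector_derivative_def)
    show "(f s has_derivative blinfun_apply (?fy s y)) (at y within UNIV)" if "s \<in> {0..B}" for s y
      using pd_x[OF assms(1) that, of y] by (simp add: has_vector_derivative_def)
    have "continuous_on ({0..B} \<times> UNIV) (\<lambda>z. ?fy (fst z) (snd z))"
      using pd_cont(3)[OF assms(1)] unfolding contS_def by (intro continuous_intros)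
    then show "continuous (at (t, x) within {0..B} \<times> UNIV) (\<lambda>(s, y). ?fy s y)"
      using assms(2) unfolding continuous_on_eq_continuous_within case_prod_beta by blast
  qed auto
  then show ?thesis by (simp add: case_prod_beta)
qed

lemma pd_chain:
  assumes "pd B f ft fx" "t \<in> {0..B}"
  shows "((\<lambda>s. f s (a + b * s)) has_vector_derivative ft t (a + b * t) + b *\<^sub>R fx t (a + b * t)) (at t within {0..B})"
proof -
  have 1: "((\<lambda>s. (s, a + b * s)) has_derivative (\<lambda>h. (h, b * h))) (at t within {0..B})"
    by (auto intro!: derivative_eq_intros)
  have 2: "((\<lambda>(t, x). f t x) has_derivative (\<lambda>(h, k). h *\<^sub>R ft t (a + b * t) + k *\<^sub>R fx t (a + b * t)))
     (at (t, a + b * t) within (\<lambda>s. (s, a + b * s)) ` {0..B})"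
    by (rule has_derivative_subset[OF pd_has_derivative[OF assms]]) auto
  from has_derivative_in_compose[OF 1 2]
  show ?thesis by (simp add: has_vector_derivative_def algebra_simps)
qed

text \<open>The variable occurs as limit and as parameter. The two roles are separated into a
  function of (a, b) on a square, which is why \<open>K\<close> is given for all s in
  \<open>{0..B}\<close> and not just for s \<le> t; the chain rule along the diagonal then adds the
  two derivatives.\<close>

lemma integral_upper_param:
  fixes K :: "real \<Rightarrow> real \<Rightarrow> 'a::banach"
  assumes K: "continuous_on ({0..B} \<times> {0..B}) (\<lambda>z. K (fst z) (snd z))"
    and Kt: "continuous_on ({0..B} \<times> {0..B}) (\<lambda>z. Kt (fst z) (snd z))"
    and D: "\<And>t s. t \<in> {0..B} \<Longrightarrow> s \<in> {0..B} \<Longrightarrow> ((\<lambda>t. K t s) has_vector_derivative Kt t s) (at t within {0..B})"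
    and t: "t \<in> {0..B}"
  shows "((\<lambda>t. integral {0..t} (K t)) has_vector_derivative K t t + integral {0..t} (Kt t)) (at t within {0..B})"
proof -
  let ?fy = "\<lambda>t s. blinfun_scaleR_left (K t s)"
  have Kc: "continuous_on {0..b} (K a)" if "a \<in> {0..B}" "b \<le> B" for a b
  proof -
    have "continuous_on {0..b} (\<lambda>s. K (fst (a, s)) (snd (a, s)))"
      by (rule continuous_on_compose2[OF K]) (use that in \<open>auto intro!: continuous_intros\<close>)
    then show ?thesis by simp
  qed
  have "((\<lambda>(a, b). integral {0..b} (K a)) has_derivative (\<lambda>(h, k). h *\<^sub>R integral {0..t} (Kt t) + ?fy t t k))
     (at (t, t) within {0..B} \<times> {0..B})"
  proof (rule has_derivative_partialsI[where fy = ?fy])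
    have "((\<lambda>a. integral (cbox 0 t) (K a)) has_vector_derivative integral (cbox 0 t) (Kt t)) (at t within {0..B})"
    proof (rule leibniz_rule_vector_derivative)
      show "((\<lambda>a. K a s) has_vector_derivative Kt a s) (at a within {0..B})" if "a \<in> {0..B}" "s \<in> cbox 0 t" for a s
        using D that t by auto
      show "K a integrable_on cbox 0 t" if "a \<in> {0..B}" for a
        using Kc[OF that, of t] t by (auto intro: integrable_continuous_real)
      show "continuous_on ({0..B} \<times> cbox 0 t) (\<lambda>(x, t). Kt x t)"
        using Kt t by (auto simp: case_prod_beta intro: continuous_on_subset)
    qed (use t in auto)
    then show "((\<lambda>a. integral {0..t} (K a)) has_derivative (\<lambda>h. h *\<^sub>R integral {0..t} (Kt t))) (at t within {0..B})"
      by (simp add: has_vector_derivative_def)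
    show "((\<lambda>b. integral {0..b} (K a)) has_derivative blinfun_apply (?fy a b)) (at b within {0..B})"
      if "a \<in> {0..B}" "b \<in> {0..B}" for a b
      using integral_has_vector_derivative[OF Kc[OF that(1) order_refl] that(2)]
      by (simp add: has_vector_derivative_def)
    have "continuous_on ({0..B} \<times> {0..B}) (\<lambda>z. ?fy (fst z) (snd z))"
      using K by (intro continuous_intros)
    then show "continuous (at (t, t) within {0..B} \<times> {0..B}) (\<lambda>(s, y). ?fy s y)"
      using t unfolding continuous_on_eq_continuous_within case_prod_beta by blast
  qed (use t in auto)
  then have 2: "((\<lambda>(a, b). integral {0..b} (K a)) has_derivative (\<lambda>(h, k). h *\<^sub>R integral {0..t} (Kt t) + ?fy t t k))
     (at (t, t) within (\<lambda>s. (s, s)) ` {0..B})"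
    by (rule has_derivative_subset) auto
  have 1: "((\<lambda>s. (s, s)) has_derivative (\<lambda>h. (h, h))) (at t within {0..B})"
    by (auto intro!: derivative_eq_intros)
  from has_derivative_in_compose[OF 1 2]
  show ?thesis by (simp add: has_vector_derivative_def algebra_simps)
qed

lemma contS_ivl:
  assumes "contS B f" "t \<in> {0..B}"
  shows "continuous_on S (f t)" 
  using contS_compose[OF assms(1), of S "\<lambda>_. t" "\<lambda>x. x"] assms(2) by (auto intro: continuous_intros)

text \<open>Differentiating f(s) - f(0) = \<integral> ft under the integral in x gives fx(s) - fx(0)
  = \<integral> ftx, and the time derivative of this is the claim. The argument also reaches the
  times 0 and \<open>B\<close>, where only one-sided time derivatives exist.\<close>

lemma pd_symmetric:
  fixes f :: "real \<Rightarrow> real \<Rightarrow> 'a::banach"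
  assumes f: "pd B f ft fx" and ft: "pd B ft ftt ftx" and fx: "pd B fx fxt fxx"
    and t: "t \<in> {0..B}" and "B > 0"
  shows "fxt t x = ftx t x"
proof -
  have FTC: "integral {0..s} (\<lambda>r. ft r y) = f s y - f 0 y" if "s \<in> {0..B}" for s y
  proof (rule integral_unique, rule fundamental_theorem_of_calculus)
    fix r assume "r \<in> {0..s}"
    then show "((\<lambda>s. f s y) has_vector_derivative ft r y) (at r within {0..s})"
      using pd_t[OF f, of r y] that by (auto intro: has_vector_derivative_within_subset)
  qed (use that in auto)
  have eq: "fx s x - fx 0 x = integral {0..s} (\<lambda>r. ftx r x)" if s: "s \<in> {0..B}" for s
  proof -
    have "((\<lambda>y. integral (cbox 0 s) (\<lambda>r. ft r y)) has_vector_derivative integral (cbox 0 s) (\<lambda>r. ftx r x)) (at x within UNIV)"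
    proof (rule leibniz_rule_vector_derivative)
      show "((\<lambda>y. ft r y) has_vector_derivative ftx r y) (at y within UNIV)" if "r \<in> cbox 0 s" for r y
        using pd_x[OF ft, of r y] that s by auto
      show "(\<lambda>r. ft r y) integrable_on cbox 0 s" for y
        using contS_compose[OF pd_cont(2)[OF f], of "{0..s}" "\<lambda>r. r" "\<lambda>_. y"] s
        by (auto intro!: integrable_continuous_real continuous_intros)
      show "continuous_on (UNIV \<times> cbox 0 s) (\<lambda>(y, r). ftx r y)"
        unfolding case_prod_beta
        using s by (intro contS_compose[OF pd_cont(3)[OF ft]] continuous_intros) auto
    qed auto
    then have 1: "((\<lambda>y. f s y - f 0 y) has_vector_derivative integral {0..s} (\<lambda>r. ftx r x)) (at x)"
      using FTC[OF s] by simp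
    have "((\<lambda>y. f s y - f 0 y) has_vector_derivative fx s x - fx 0 x) (at x)"
      using pd_x[OF f] s by (auto intro!: derivative_intros)
    from vector_derivative_unique_at[OF this 1] show ?thesis .
  qed
  have c: "continuous_on {0..B} (\<lambda>r. ftx r x)"
    using contS_compose[OF pd_cont(3)[OF ft], of "{0..B}" "\<lambda>r. r" "\<lambda>_. x"]
    by (auto intro!: continuous_intros)
  have "((\<lambda>s. fx 0 x + integral {0..s} (\<lambda>r. ftx r x)) has_vector_derivative ftx t x) (at t within {0..B})"
    using has_vector_derivative_add[OF has_vector_derivative_const integral_has_vector_derivative[OF c t]] by simp
  then have "((\<lambda>s. fx s x) has_vector_derivative ftx t x) (at t within {0..B})"
    by (rule has_vector_derivative_transform[OF t, rotated]) (simp add: eq[symmetric])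
  with pd_t[OF fx t, of x] show ?thesis
    using vector_derivative_unique_within_closed_interval[OF \<open>B > 0\<close>, of t] t by auto
qed

section \<open>Classes of k times continuously differentiable functions on the strip\<close>

primrec Ck :: "real \<Rightarrow> nat \<Rightarrow> (real \<Rightarrow> real \<Rightarrow> complex) \<Rightarrow> bool" where
  "Ck B 0 f = contS B f"
| "Ck B (Suc k) f = (\<exists>ft fx. pd B f ft fx \<and> Ck B k ft \<and> Ck B k fx)"

declare Ck.simps(2) [simp del]

lemma Ck_SucI: "pd B f ft fx \<Longrightarrow> Ck B k ft \<Longrightarrow> Ck B k fx \<Longrightarrow> Ck B (Suc k) f"
  unfolding Ck.simps(2) by blast

lemma Ck_SucE:
  assumes "Ck B (Suc k) f"
  obtains ft fx where "pd B f ft fx" "Ck B k ft" "Ck B k fx"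
  using assms unfolding Ck.simps(2) by blast

lemma Ck_cont: "Ck B k f \<Longrightarrow> contS B f"
  by (cases k) (auto elim!: Ck_SucE dest: pd_cont)

lemma Ck_Suc: "Ck B (Suc k) f \<Longrightarrow> Ck B k f"
proof (induction k arbitrary: f)
  case 0 then show ?case by (auto elim!: Ck_SucE dest: pd_cont)
next
  case (Suc k)
  from Suc.prems show ?case by (rule Ck_SucE) (blast intro: Ck_SucI Suc.IH)
qed

lemma Ck_cong: "Ck B k f \<Longrightarrow> (\<And>t x. t \<in> {0..B} \<Longrightarrow> f t x = g t x) \<Longrightarrow> Ck B k g"
proof (cases k)
  case 0 then show "Ck B k f \<Longrightarrow> (\<And>t x. t \<in> {0..B} \<Longrightarrow> f t x = g t x) \<Longrightarrow> ?thesis"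
    by (auto intro: contS_cong)
next
  case (Suc n)
  assume f: "Ck B k f" and eq: "\<And>t x. t \<in> {0..B} \<Longrightarrow> f t x = g t x"
  obtain ft fx where *: "pd B f ft fx" "Ck B n ft" "Ck B n fx"
    using f unfolding Suc by (rule Ck_SucE)
  have "pd B g ft fx"
    by (rule pd_cong[OF *(1)]) (auto intro: eq)
  with *(2,3) show ?thesis unfolding Suc by (blast intro: Ck_SucI)
qed

lemma Ck_add: "Ck B k f \<Longrightarrow> Ck B k g \<Longrightarrow> Ck B k (\<lambda>t x. f t x + g t x)"
proof (induction k arbitrary: f g)
  case 0 then show ?case unfolding Ck.simps(1) by (rule contS_add)
next
  case (Suc k)
  obtain ft fx where f: "pd B f ft fx" "Ck B k ft" "Ck B k fx"
    using Suc.prems(1) by (rule Ck_SucE)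
  obtain gt gx where g: "pd B g gt gx" "Ck B k gt" "Ck B k gx"
    using Suc.prems(2) by (rule Ck_SucE)
  show ?case
    by (rule Ck_SucI[OF pd_add[OF f(1) g(1)] Suc.IH[OF f(2) g(2)] Suc.IH[OF f(3) g(3)]])
qed

lemma Ck_linear: "bounded_linear p \<Longrightarrow> Ck B k f \<Longrightarrow> Ck B k (\<lambda>t x. p (f t x))"
proof (induction k arbitrary: f)
  case 0 then show ?case unfolding Ck.simps(1) by (rule contS_linear)
next
  case (Suc k)
  obtain ft fx where f: "pd B f ft fx" "Ck B k ft" "Ck B k fx"
    using Suc.prems(2) by (rule Ck_SucE)
  show ?case
    by (rule Ck_SucI[OF pd_linear[OF Suc.prems(1) f(1)] Suc.IH[OF Suc.prems(1) f(2)] Suc.IH[OF Suc.prems(1) f(3)]])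
qed

lemmas Ck_cmult = Ck_linear[OF bounded_linear_mult_right]
lemmas Ck_minus = Ck_linear[OF bounded_linear_minus[OF bounded_linear_ident]]

lemma Ck_diff: "Ck B k f \<Longrightarrow> Ck B k g \<Longrightarrow> Ck B k (\<lambda>t x. f t x - g t x)"
  unfolding diff_conv_add_uminus by (rule Ck_add[OF _ Ck_minus])

lemma Ck_mult: "Ck B k f \<Longrightarrow> Ck B k g \<Longrightarrow> Ck B k (\<lambda>t x. f t x * g t x)"
proof (induction k arbitrary: f g)
  case 0 then show ?case unfolding Ck.simps(1) by (rule contS_mult)
next
  case (Suc k)
  obtain ft fx where f: "pd B f ft fx" "Ck B k ft" "Ck B k fx"
    using Suc.prems(1) by (rule Ck_SucE)
  obtain gt gx where g: "pd B g gt gx" "Ck B k gt" "Ck B k gx"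
    using Suc.prems(2) by (rule Ck_SucE)
  note f' = Ck_Suc[OF Suc.prems(1)] and g' = Ck_Suc[OF Suc.prems(2)]
  show ?case
    by (rule Ck_SucI[OF pd_mult[OF f(1) g(1)] Ck_add[OF Suc.IH[OF f' g(2)] Suc.IH[OF f(2) g']]
      Ck_add[OF Suc.IH[OF f' g(3)] Suc.IH[OF f(3) g']]])
qed

lemma Ck_const: "Ck B k (\<lambda>t x. c)"
proof (induction k arbitrary: c)
  case 0 then show ?case by (simp add: contS_const)
next
  case (Suc k)
  show ?case by (rule Ck_SucI[OF pd_const Suc Suc])
qed

section \<open>Duhamel integrals for the wave equation\<close>

text \<open>Moves the variable limit into the integrand, so that continuity in t becomes continuity
  in a parameter. Comparing both sides through an antiderivative also covers t = 0, where the
  substitution degenerates.\<close>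

lemma integral_rescale_unit:
  fixes h :: "real \<Rightarrow> 'a::banach"
  assumes "0 \<le> t" "continuous_on {0..t} h"
  shows "integral {0..t} h = t *\<^sub>R integral {0..1} (\<lambda>r. h (t * r))"
proof -
  obtain H where H: "\<And>x. x \<in> {0..t} \<Longrightarrow> (H has_vector_derivative h x) (at x within {0..t})"
    using antiderivative_continuous[OF assms(2)] by blast
  have "(h has_integral H t - H 0) {0..t}"
    using assms(1) H by (intro fundamental_theorem_of_calculus)
  moreover have "((\<lambda>r. t *\<^sub>R h (t * r)) has_integral H (t * 1) - H (t * 0)) {0..1}"
  proof (rule fundamental_theorem_of_calculus)
    fix r :: real assume r: "r \<in> {0..1}"
    then have im: "t * r \<in> {0..t}" using assms(1) by (auto simp: mult_left_le)
    have 1: "((\<lambda>r. t * r) has_vector_derivative t) (at r within {0..1})"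
      by (auto intro!: derivative_eq_intros simp: has_real_derivative_iff_has_vector_derivative[symmetric])
    have 2: "(H has_vector_derivative h (t * r)) (at (t * r) within (\<lambda>r. t * r) ` {0..1})"
      using H[OF im] by (rule has_vector_derivative_within_subset) (use assms(1) in \<open>auto simp: mult_left_le\<close>)
    from vector_diff_chain_within[OF 1 2]
    show "((\<lambda>r. H (t * r)) has_vector_derivative t *\<^sub>R h (t * r)) (at r within {0..1})"
      by (simp add: o_def)
  qed simp
  ultimately show ?thesis by (simp add: integral_unique flip: integral_cmul)
qed

lemma contS_integral_upper:
  fixes K :: "real \<Rightarrow> real \<Rightarrow> real \<Rightarrow> 'a::banach"
  assumes "continuous_on (({0..B} \<times> UNIV) \<times> {0..B}) (\<lambda>z. K (fst (fst z)) (snd (fst z)) (snd z))"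
  shows "contS B (\<lambda>t x. integral {0..t} (K t x))"
proof -
  have "continuous_on ({0..B} \<times> UNIV) (\<lambda>z. fst z *\<^sub>R integral (cbox 0 1) (\<lambda>r. K (fst z) (snd z) (fst z * r)))"
  proof (intro continuous_intros integral_continuous_on_param)
    show "continuous_on (({0..B} \<times> UNIV) \<times> cbox 0 1) (\<lambda>(z, r). K (fst z) (snd z) (fst z * r))"
      unfolding case_prod_beta
      using continuous_on_compose2[OF assms, of "({0..B} \<times> UNIV) \<times> cbox 0 1" "\<lambda>z. (fst z, fst (fst z) * snd z)"]
      by (force intro!: continuous_intros mult_left_le order_trans[OF mult_left_le])
  qed
  then show ?thesis
    unfolding contS_def
  proof (rule continuous_on_eq)
    fix z :: "real \<times> real" assume z: "z \<in> {0..B} \<times> UNIV"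
    have "continuous_on {0..fst z} (\<lambda>s. K (fst (fst (z, s))) (snd (fst (z, s))) (snd (z, s)))"
      by (rule continuous_on_compose2[OF assms]) (use z in \<open>auto intro!: continuous_intros\<close>)
    then have "continuous_on {0..fst z} (K (fst z) (snd z))" by simp
    with integral_rescale_unit[OF _ this] z
    show "fst z *\<^sub>R integral (cbox 0 1) (\<lambda>r. K (fst z) (snd z) (fst z * r)) = integral {0..fst z} (K (fst z) (snd z))"
      by auto
  qed
qed

text \<open>The solution of the transport equation \<open>w_t - \<sigma> w_x = G\<close> with zero
  data. The first derivatives of \<open>duhamel\<close> are the half sum and half difference of the
  cases \<sigma> = 1 and \<sigma> = -1.\<close>

definition char_int :: "real \<Rightarrow> (real \<Rightarrow> real \<Rightarrow> complex) \<Rightarrow> real \<Rightarrow> real \<Rightarrow> complex" where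
  "char_int \<sigma> G t x = integral {0..t} (\<lambda>s. G s (x + \<sigma> * (t - s)))"

lemma contS_char_int: "contS B G \<Longrightarrow> contS B (char_int \<sigma> G)"
  unfolding char_int_def
  by (rule contS_integral_upper) (rule contS_compose, assumption, auto intro!: continuous_intros)

lemma pd_char_int:
  assumes "pd B G Gt Gx"
  shows "pd B (char_int \<sigma> G) (\<lambda>t x. G t x + of_real \<sigma> * char_int \<sigma> Gx t x) (char_int \<sigma> Gx)"
  unfolding pd_def
proof (intro conjI ballI allI)
  note G = pd_cont[OF assms]
  show "contS B (char_int \<sigma> G)" "contS B (char_int \<sigma> Gx)" 
    using G by (auto intro: contS_char_int)
  then show "contS B (\<lambda>t x. G t x + of_real \<sigma> * char_int \<sigma> Gx t x)"
    by (intro contS_add contS_cmult G)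
  fix t x assume t: "t \<in> {0..B}"
  have "((\<lambda>t. integral {0..t} (\<lambda>s. G s (x + \<sigma> * (t - s)))) has_vector_derivative
     G t (x + \<sigma> * (t - t)) + integral {0..t} (\<lambda>s. of_real \<sigma> * Gx s (x + \<sigma> * (t - s)))) (at t within {0..B})"
  proof (rule integral_upper_param[OF _ _ _ t])
    show "continuous_on ({0..B} \<times> {0..B}) (\<lambda>z. G (snd z) (x + \<sigma> * (fst z - snd z)))"
      by (rule contS_compose[OF G(1)]) (auto intro!: continuous_intros)
    show "continuous_on ({0..B} \<times> {0..B}) (\<lambda>z. of_real \<sigma> * Gx (snd z) (x + \<sigma> * (fst z - snd z)))"
      by (intro continuous_intros contS_compose[OF G(3)]) auto
    fix r s assume "r \<in> {0..B}" "s \<in> {0..B}"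
    have 1: "((\<lambda>r. x + \<sigma> * (r - s)) has_vector_derivative \<sigma>) (at r within {0..B})"
      by (auto intro!: derivative_eq_intros simp: has_real_derivative_iff_has_vector_derivative[symmetric])
    have 2: "(G s has_vector_derivative Gx s (x + \<sigma> * (r - s))) (at (x + \<sigma> * (r - s)) within (\<lambda>r. x + \<sigma> * (r - s)) ` {0..B})"
      using pd_x[OF assms \<open>s \<in> {0..B}\<close>] by (rule has_vector_derivative_at_within)
    from vector_diff_chain_within[OF 1 2]
    show "((\<lambda>r. G s (x + \<sigma> * (r - s))) has_vector_derivative of_real \<sigma> * Gx s (x + \<sigma> * (r - s))) (at r within {0..B})"
      by (simp add: o_def scaleR_conv_of_real)
  qed
  then show "((\<lambda>s. char_int \<sigma> G s x) has_vector_derivative G t x + of_real \<sigma> * char_int \<sigma> Gx t x) (at t within {0..B})"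
    by (simp add: char_int_def)
  have "((\<lambda>x. integral (cbox 0 t) (\<lambda>s. G s (x + \<sigma> * (t - s)))) has_vector_derivative
     integral (cbox 0 t) (\<lambda>s. Gx s (x + \<sigma> * (t - s)))) (at x within UNIV)"
  proof (rule leibniz_rule_vector_derivative)
    fix y s assume s: "s \<in> cbox 0 t"
    have 1: "((\<lambda>y. y + \<sigma> * (t - s)) has_vector_derivative 1) (at y)"
      by (auto intro!: derivative_eq_intros simp: has_real_derivative_iff_has_vector_derivative[symmetric])
    from vector_diff_chain_at[OF 1 pd_x[OF assms]] s t
    show "((\<lambda>y. G s (y + \<sigma> * (t - s))) has_vector_derivative Gx s (y + \<sigma> * (t - s))) (at y within UNIV)"
      by (auto simp: o_def)
  next
    show "(\<lambda>s. G s (y + \<sigma> * (t - s))) integrable_on cbox 0 t" for y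
      unfolding box_real
      by (intro integrable_continuous_real contS_compose[OF G(1)] continuous_intros) (use t in auto)
    show "continuous_on (UNIV \<times> cbox 0 t) (\<lambda>(y, s). Gx s (y + \<sigma> * (t - s)))"
      unfolding case_prod_beta
      by (intro contS_compose[OF G(3)] continuous_intros) (use t in auto)
  qed auto
  then show "(char_int \<sigma> G t has_vector_derivative char_int \<sigma> Gx t x) (at x)"
    by (simp add: char_int_def[abs_def])
qed

lemma Ck_char_int: "Ck B k G \<Longrightarrow> Ck B k (char_int \<sigma> G)"
proof (induction k arbitrary: G)
  case 0 then show ?case by (simp add: contS_char_int)
next
  case (Suc k)
  obtain Gt Gx where G: "pd B G Gt Gx" "Ck B k Gt" "Ck B k Gx"
    using Suc.prems by (rule Ck_SucE)
  show ?case
    by (rule Ck_SucI[OF pd_char_int[OF G(1)] Ck_add[OF Ck_Suc[OF Suc.prems]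
        Ck_linear[OF bounded_linear_mult_right Suc.IH[OF G(3)]]] Suc.IH[OF G(3)]])
qed

text \<open>Equals \<open>1/2\<close> times the integral of \<open>\<phi>\<close> over \<open>{x - h..x + h}\<close>, written over a fixed interval so that
  the dependence on \<open>x\<close> and \<open>h\<close> is that of a parameter.\<close>

definition avg_int :: "(real \<Rightarrow> complex) \<Rightarrow> real \<Rightarrow> real \<Rightarrow> complex" where
  "avg_int \<phi> x h = of_real (h / 2) * integral {-1..1} (\<lambda>r. \<phi> (x + h * r))"

text \<open>With an antiderivative \<Gamma> the integral becomes d'Alembert's expression
  (\<Gamma>(x+h) - \<Gamma>(x-h))/2, from which the derivatives in x and h can be read off. They are
  local, so \<Gamma> on a bounded interval of radius \<open>Y\<close> suffices.\<close>

lemma avg_int_antiderivative: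
  assumes "continuous_on UNIV \<phi>"
  obtains \<Gamma> where "\<And>y. \<bar>y\<bar> < Y \<Longrightarrow> (\<Gamma> has_vector_derivative \<phi> y) (at y)"
    "\<And>x h. \<bar>x\<bar> + \<bar>h\<bar> < Y \<Longrightarrow> avg_int \<phi> x h = (\<Gamma> (x + h) - \<Gamma> (x - h)) / 2"
proof -
  obtain \<Gamma> where \<Gamma>: "\<And>x. x \<in> {-Y..Y} \<Longrightarrow> (\<Gamma> has_vector_derivative \<phi> x) (at x within {-Y..Y})"
    using antiderivative_continuous[OF continuous_on_subset[OF assms subset_UNIV]] by blast
  have D: "(\<Gamma> has_vector_derivative \<phi> y) (at y)" if "\<bar>y\<bar> < Y" for y
  proof -
    have "y \<in> interior {-Y..Y}" using that by auto
    then have "at y within {-Y..Y} = at y" by (rule at_within_interior)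
    moreover have "y \<in> {-Y..Y}" using that by auto
    ultimately show ?thesis using \<Gamma>[of y] by simp
  qed
  have "avg_int \<phi> x h = (\<Gamma> (x + h) - \<Gamma> (x - h)) / 2" if "\<bar>x\<bar> + \<bar>h\<bar> < Y" for x h
  proof -
    have "((\<lambda>r. h *\<^sub>R \<phi> (x + h * r)) has_integral \<Gamma> (x + h * 1) - \<Gamma> (x + h * (-1))) {-1..1}"
    proof (rule fundamental_theorem_of_calculus)
      fix r :: real assume "r \<in> {-1..1}"
      then have "\<bar>h * r\<bar> \<le> \<bar>h\<bar>" unfolding abs_mult by (intro mult_left_le) auto
      then have *: "\<bar>x + h * r\<bar> < Y" using that by linarith
      have 1: "((\<lambda>r. x + h * r) has_vector_derivative h) (at r within {-1..1})"
        by (auto intro!: derivative_eq_intros simp: has_real_derivative_iff_has_vector_derivative[symmetric])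
      from vector_diff_chain_within[OF 1 has_vector_derivative_at_within[OF D[OF *]]]
      show "((\<lambda>r. \<Gamma> (x + h * r)) has_vector_derivative h *\<^sub>R \<phi> (x + h * r)) (at r within {-1..1})"
        by (simp add: o_def)
    qed simp
    then have "h *\<^sub>R integral {-1..1} (\<lambda>r. \<phi> (x + h * r)) = \<Gamma> (x + h) - \<Gamma> (x - h)"
      by (simp add: integral_unique flip: integral_cmul)
    then show ?thesis by (simp add: avg_int_def scaleR_conv_of_real)
  qed
  with D that show thesis by blast
qed

lemma avg_int_deriv_x:
  assumes "continuous_on UNIV \<phi>"
  shows "((\<lambda>x. avg_int \<phi> x h) has_vector_derivative (\<phi> (x + h) - \<phi> (x - h)) / 2) (at x)"
proof -
  define Y where "Y = \<bar>x\<bar> + \<bar>h\<bar> + 1"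
  obtain \<Gamma> where \<Gamma>: "\<And>y. \<bar>y\<bar> < Y \<Longrightarrow> (\<Gamma> has_vector_derivative \<phi> y) (at y)"
    "\<And>x h. \<bar>x\<bar> + \<bar>h\<bar> < Y \<Longrightarrow> avg_int \<phi> x h = (\<Gamma> (x + h) - \<Gamma> (x - h)) / 2"
    using avg_int_antiderivative[OF assms] by metis
  have sh: "((\<lambda>y. y + a) has_vector_derivative 1) (at x)" for a
    by (auto intro!: derivative_eq_intros simp: has_real_derivative_iff_has_vector_derivative[symmetric])
  have "((\<lambda>y. \<Gamma> (y + h)) has_vector_derivative \<phi> (x + h)) (at x)"
    using vector_diff_chain_at[OF sh \<Gamma>(1)[of "x + h"]] by (auto simp: o_def Y_def)
  moreover have "((\<lambda>y. \<Gamma> (y - h)) has_vector_derivative \<phi> (x - h)) (at x)"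
    using vector_diff_chain_at[OF sh[of "-h"] \<Gamma>(1)] by (auto simp: o_def Y_def)
  ultimately have "((\<lambda>y. (\<Gamma> (y + h) - \<Gamma> (y - h)) / 2) has_vector_derivative (\<phi> (x + h) - \<phi> (x - h)) / 2) (at x)"
    by (auto intro!: derivative_intros)
  then show ?thesis
  proof (rule has_vector_derivative_transform_within_open)
    show "open (ball x 1)" "x \<in> ball x 1" by auto
    fix y assume "y \<in> ball x 1"
    then have "\<bar>y\<bar> + \<bar>h\<bar> < Y" unfolding Y_def by (auto simp: dist_real_def)
    then show "(\<Gamma> (y + h) - \<Gamma> (y - h)) / 2 = avg_int \<phi> y h" by (simp add: \<Gamma>(2))
  qed
qed

lemma avg_int_deriv_h:
  assumes "continuous_on UNIV \<phi>"
  shows "((\<lambda>h. avg_int \<phi> x h) has_vector_derivative (\<phi> (x + h) + \<phi> (x - h)) / 2) (at h)"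
proof -
  define Y where "Y = \<bar>x\<bar> + \<bar>h\<bar> + 1"
  obtain \<Gamma> where \<Gamma>: "\<And>y. \<bar>y\<bar> < Y \<Longrightarrow> (\<Gamma> has_vector_derivative \<phi> y) (at y)"
    "\<And>x h. \<bar>x\<bar> + \<bar>h\<bar> < Y \<Longrightarrow> avg_int \<phi> x h = (\<Gamma> (x + h) - \<Gamma> (x - h)) / 2"
    using avg_int_antiderivative[OF assms] by metis
  have sh: "((\<lambda>y. x + y) has_vector_derivative 1) (at h)" "((\<lambda>y. x - y) has_vector_derivative -1) (at h)"
    by (auto intro!: derivative_eq_intros simp: has_real_derivative_iff_has_vector_derivative[symmetric])
  have "((\<lambda>y. \<Gamma> (x + y)) has_vector_derivative \<phi> (x + h)) (at h)"
    using vector_diff_chain_at[OF sh(1) \<Gamma>(1)[of "x + h"]] by (auto simp: o_def Y_def)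
  moreover have "((\<lambda>y. \<Gamma> (x - y)) has_vector_derivative - \<phi> (x - h)) (at h)"
    using vector_diff_chain_at[OF sh(2) \<Gamma>(1)[of "x - h"]] by (auto simp: o_def Y_def)
  ultimately have "((\<lambda>y. (\<Gamma> (x + y) - \<Gamma> (x - y)) / 2) has_vector_derivative (\<phi> (x + h) - (- \<phi> (x - h))) / 2) (at h)"
    by (intro derivative_intros)
  then have "((\<lambda>y. (\<Gamma> (x + y) - \<Gamma> (x - y)) / 2) has_vector_derivative (\<phi> (x + h) + \<phi> (x - h)) / 2) (at h)"
    by simp
  then show ?thesis
  proof (rule has_vector_derivative_transform_within_open)
    show "open (ball h 1)" "h \<in> ball h 1" by auto
    fix y assume "y \<in> ball h 1"
    then have "\<bar>x\<bar> + \<bar>y\<bar> < Y" unfolding Y_def by (auto simp: dist_real_def)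
    then show "(\<Gamma> (x + y) - \<Gamma> (x - y)) / 2 = avg_int \<phi> x y" by (simp add: \<Gamma>(2))
  qed
qed

text \<open>Duhamel's formula for \<open>w_tt - w_xx = G\<close> with zero data: the integral of G/2
  over the backward light cone of (t, x). The mass term of the Klein-Gordon equation is counted as
  source, so this elementary kernel is enough.\<close>

definition duhamel :: "(real \<Rightarrow> real \<Rightarrow> complex) \<Rightarrow> real \<Rightarrow> real \<Rightarrow> complex" where
  "duhamel G t x = integral {0..t} (\<lambda>s. avg_int (G s) x (t - s))"

lemma continuous_on_avg_int:
  assumes "contS B G" "continuous_on S a" "continuous_on S b" "continuous_on S c"
    "\<And>z. z \<in> S \<Longrightarrow> a z \<in> {0..B}"
  shows "continuous_on S (\<lambda>z. avg_int (G (a z)) (b z) (c z))"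
  unfolding avg_int_def box_real(2)[symmetric]
proof (intro continuous_intros integral_continuous_on_param assms(4))
  have f: "continuous_on (S \<times> cbox (-1) 1) (\<lambda>z. g (fst z))" if "continuous_on S g" for g :: "'a \<Rightarrow> real"
    by (rule continuous_on_compose2[OF that]) (auto intro!: continuous_intros)
  show "continuous_on (S \<times> cbox (-1) 1) (\<lambda>(z, r). G (a z) (b z + c z * r))"
    unfolding case_prod_beta
    by (intro contS_compose[OF assms(1)] continuous_intros f assms(2-4)) (use assms(5) in auto)
qed simp

lemma contS_duhamel: "contS B G \<Longrightarrow> contS B (duhamel G)"
  unfolding duhamel_def
  by (intro contS_integral_upper continuous_on_avg_int continuous_intros) auto

lemma pd_duhamel:
  assumes "contS B G"
  shows "pd B (duhamel G) (\<lambda>t x. (1/2) * (char_int 1 G t x + char_int (-1) G t x))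
     (\<lambda>t x. (1/2) * (char_int 1 G t x - char_int (-1) G t x))"
  unfolding pd_def
proof (intro conjI ballI allI)
  show "contS B (duhamel G)" by (rule contS_duhamel[OF assms])
  show "contS B (\<lambda>t x. (1/2) * (char_int 1 G t x + char_int (-1) G t x))"
     "contS B (\<lambda>t x. (1/2) * (char_int 1 G t x - char_int (-1) G t x))"
    by (intro contS_cmult contS_add contS_diff contS_char_int assms)+
  fix t x assume t: "t \<in> {0..B}"
  have Gc: "continuous_on S (G s)" if "s \<in> {0..B}" for s S by (rule contS_ivl[OF assms that])
  have int1: "(\<lambda>s. G s (x + (t - s))) integrable_on {0..t}"
    and int2: "(\<lambda>s. G s (x - (t - s))) integrable_on {0..t}"
    by (intro integrable_continuous_real contS_compose[OF assms] continuous_intros; use t in auto)+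
  have ch: "char_int 1 G t x = integral {0..t} (\<lambda>s. G s (x + (t - s)))"
    "char_int (-1) G t x = integral {0..t} (\<lambda>s. G s (x - (t - s)))"
    unfolding char_int_def by (rule integral_cong, simp add: algebra_simps)+
  have plus: "integral {0..t} (\<lambda>s. (G s (x + (t - s)) + G s (x - (t - s))) / 2)
      = (1/2) * (char_int 1 G t x + char_int (-1) G t x)"
    unfolding ch using integral_add[OF int1 int2] by simp
  have minus: "integral {0..t} (\<lambda>s. (G s (x + (t - s)) - G s (x - (t - s))) / 2)
      = (1/2) * (char_int 1 G t x - char_int (-1) G t x)"
    unfolding ch using integral_diff[OF int1 int2] by simp
  have "((\<lambda>t. integral {0..t} (\<lambda>s. avg_int (G s) x (t - s))) has_vector_derivative
     avg_int (G t) x (t - t) + integral {0..t} (\<lambda>s. (G s (x + (t - s)) + G s (x - (t - s))) / 2)) (at t within {0..B})"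
  proof (rule integral_upper_param[OF _ _ _ t])
    show "continuous_on ({0..B} \<times> {0..B}) (\<lambda>z. avg_int (G (snd z)) x (fst z - snd z))"
      by (intro continuous_on_avg_int[OF assms] continuous_intros) auto
    show "continuous_on ({0..B} \<times> {0..B}) (\<lambda>z. (G (snd z) (x + (fst z - snd z)) + G (snd z) (x - (fst z - snd z))) / 2)"
      by (intro continuous_intros contS_compose[OF assms]) auto
    fix r s assume "r \<in> {0..B}" "s \<in> {0..B}"
    have 1: "((\<lambda>r. r - s) has_vector_derivative 1) (at r within {0..B})"
      by (auto intro!: derivative_eq_intros simp: has_real_derivative_iff_has_vector_derivative[symmetric])
    from vector_diff_chain_within[OF 1 has_vector_derivative_at_within[OF avg_int_deriv_h[OF Gc[OF \<open>s \<in> {0..B}\<close>]]]]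
    show "((\<lambda>r. avg_int (G s) x (r - s)) has_vector_derivative (G s (x + (r - s)) + G s (x - (r - s))) / 2) (at r within {0..B})"
      by (simp add: o_def)
  qed
  then show "((\<lambda>s. duhamel G s x) has_vector_derivative (1/2) * (char_int 1 G t x + char_int (-1) G t x)) (at t within {0..B})"
    unfolding plus by (simp add: duhamel_def avg_int_def)
  have "((\<lambda>x. integral (cbox 0 t) (\<lambda>s. avg_int (G s) x (t - s))) has_vector_derivative
     integral (cbox 0 t) (\<lambda>s. (G s (x + (t - s)) - G s (x - (t - s))) / 2)) (at x within UNIV)"
  proof (rule leibniz_rule_vector_derivative)
    fix y s assume "s \<in> cbox 0 t"
    then show "((\<lambda>y. avg_int (G s) y (t - s)) has_vector_derivative (G s (y + (t - s)) - G s (y - (t - s))) / 2) (at y within UNIV)"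
      using t by (intro avg_int_deriv_x Gc) auto
  next
    show "(\<lambda>s. avg_int (G s) y (t - s)) integrable_on cbox 0 t" for y
      unfolding box_real
      by (intro integrable_continuous_real continuous_on_avg_int[OF assms] continuous_intros) (use t in auto)
    show "continuous_on (UNIV \<times> cbox 0 t) (\<lambda>(y, s). (G s (y + (t - s)) - G s (y - (t - s))) / 2)"
      unfolding case_prod_beta
      by (intro continuous_intros contS_compose[OF assms]) (use t in auto)
  qed auto
  then show "(duhamel G t has_vector_derivative (1/2) * (char_int 1 G t x - char_int (-1) G t x)) (at x)"
    unfolding box_real minus by (simp add: duhamel_def[abs_def])
qed

text \<open>The first derivatives of \<open>duhamel G\<close> are integrals along characteristics,
  which keep the class of \<open>G\<close>; so one derivative is gained. This gain lifts a merely
  continuous fixed point to every class C^n.\<close>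

lemma Ck_duhamel:
  assumes "Ck B k G"
  shows "Ck B (Suc k) (duhamel G)"
  by (rule Ck_SucI[OF pd_duhamel[OF Ck_cont[OF assms]]
        Ck_cmult[OF Ck_add[OF Ck_char_int[OF assms] Ck_char_int[OF assms]]]
        Ck_cmult[OF Ck_diff[OF Ck_char_int[OF assms] Ck_char_int[OF assms]]]])

lemma duhamel_cong: "(\<And>s y. s \<in> {0..t} \<Longrightarrow> G s y = G' s y) \<Longrightarrow> duhamel G t x = duhamel G' t x"
  unfolding duhamel_def avg_int_def by (intro integral_cong) simp

lemma duhamel_diff:
  assumes "contS B G" "contS B G'" "t \<in> {0..B}"
  shows "duhamel (\<lambda>s y. G s y - G' s y) t x = duhamel G t x - duhamel G' t x"
proof -
  have i: "(\<lambda>r. H s (x + h * r)) integrable_on {-1..1}" if "contS B H" "s \<in> {0..t}" for H :: "real \<Rightarrow> real \<Rightarrow> complex" and h s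
    by (intro integrable_continuous_real contS_compose[OF that(1)] continuous_intros) (use assms(3) that in auto)
  have j: "(\<lambda>s. avg_int (H s) x (t - s)) integrable_on {0..t}" if "contS B H" for H
    by (intro integrable_continuous_real continuous_on_avg_int[OF that] continuous_intros) (use assms(3) in auto)
  have "duhamel (\<lambda>s y. G s y - G' s y) t x = integral {0..t} (\<lambda>s. avg_int (G s) x (t - s) - avg_int (G' s) x (t - s))"
    unfolding duhamel_def avg_int_def
    by (intro integral_cong)
      (simp only: integral_diff[OF i[OF assms(1)] i[OF assms(2)]] right_diff_distrib)
  then show ?thesis
    unfolding duhamel_def using integral_diff[OF j[OF assms(1)] j[OF assms(2)]] by simp
qed

text \<open>Integrating exp(\<Lambda>s) gains the factor 1/\<Lambda>. In a norm weighted by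
  exp(-\<Lambda>t) the Duhamel operator is thus as small as desired on the whole strip at once,
  without short time steps.\<close>

lemma norm_duhamel_le:
  assumes G: "contS B G" and t: "t \<in> {0..B}" and "\<Lambda> > 0" "a \<ge> 0"
    and bd: "\<And>s y. s \<in> {0..t} \<Longrightarrow> cmod (G s y) \<le> a * exp (\<Lambda> * s)"
  shows "cmod (duhamel G t x) \<le> B * a / \<Lambda> * exp (\<Lambda> * t)"
proof -
  have 1: "cmod (avg_int (G s) x (t - s)) \<le> B * a * exp (\<Lambda> * s)" if s: "s \<in> {0..t}" for s
  proof -
    have "cmod (integral {-1..1} (\<lambda>r. G s (x + (t - s) * r))) \<le> integral {-1..1} (\<lambda>r::real. a * exp (\<Lambda> * s))"
    proof (rule Henstock_Kurzweil_Integration.integral_norm_bound_integral)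
      show "(\<lambda>r. G s (x + (t - s) * r)) integrable_on {-1..1}"
        by (intro integrable_continuous_real contS_compose[OF G] continuous_intros) (use t s in auto)
    qed (use bd[OF s] in auto)
    then have *: "cmod (integral {-1..1} (\<lambda>r. G s (x + (t - s) * r))) \<le> a * exp (\<Lambda> * s) * 2" by simp
    have "cmod (avg_int (G s) x (t - s)) = (t - s) / 2 * cmod (integral {-1..1} (\<lambda>r. G s (x + (t - s) * r)))"
      using s by (simp add: avg_int_def norm_mult norm_divide)
        (metis abs_of_nonneg diff_ge_0_iff_ge norm_of_real of_real_diff)
    also have "\<dots> \<le> (t - s) / 2 * (a * exp (\<Lambda> * s) * 2)"
      using s * by (intro mult_left_mono) auto
    also have "\<dots> = (t - s) * (a * exp (\<Lambda> * s))" by simp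
    also have "\<dots> \<le> B * (a * exp (\<Lambda> * s))"
      using s t assms(4) by (intro mult_right_mono) auto
    finally show ?thesis by simp
  qed
  have I: "((\<lambda>s. B * a * exp (\<Lambda> * s)) has_integral B * a * exp (\<Lambda> * t) / \<Lambda> - B * a * exp (\<Lambda> * 0) / \<Lambda>) {0..t}"
    by (rule fundamental_theorem_of_calculus)
      (use t assms(3) in \<open>auto intro!: derivative_eq_intros simp: has_real_derivative_iff_has_vector_derivative[symmetric]\<close>)
  have "cmod (duhamel G t x) \<le> integral {0..t} (\<lambda>s. B * a * exp (\<Lambda> * s))"
    unfolding duhamel_def
  proof (rule Henstock_Kurzweil_Integration.integral_norm_bound_integral)
    show "(\<lambda>s. avg_int (G s) x (t - s)) integrable_on {0..t}"
      by (intro integrable_continuous_real continuous_on_avg_int[OF G] continuous_intros) (use t in auto)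
  qed (use I 1 in auto)
  also have "\<dots> = B * a * exp (\<Lambda> * t) / \<Lambda> - B * a / \<Lambda>"
    using integral_unique[OF I] by simp
  also have "\<dots> \<le> B * a / \<Lambda> * exp (\<Lambda> * t)"
    using assms(3,4) t by (simp add: field_simps)
  finally show ?thesis .
qed

text \<open>Finite propagation speed 1: for |x| \<ge> R + t the backward cone of (t, x) contains at
  time s only points with |y| \<ge> R + s.\<close>

lemma duhamel_support:
  assumes "\<And>s y. s \<in> {0..t} \<Longrightarrow> R + s \<le> \<bar>y\<bar> \<Longrightarrow> G s y = 0" "R + t \<le> \<bar>x\<bar>"
  shows "duhamel G t x = 0"
proof -
  have "avg_int (G s) x (t - s) = 0" if s: "s \<in> {0..t}" for s
  proof -
    have "G s (x + (t - s) * r) = 0" if r: "r \<in> {-1..1}" for r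
    proof (rule assms(1)[OF s])
      have "\<bar>(t - s) * r\<bar> \<le> t - s" using s r by (auto simp: abs_mult intro!: mult_left_le)
      then show "R + s \<le> \<bar>x + (t - s) * r\<bar>" using assms(2) by linarith
    qed
    then have "integral {-1..1} (\<lambda>r. G s (x + (t - s) * r)) = integral {-1..1} (\<lambda>r::real. 0)"
      by (intro integral_cong)
    then show ?thesis by (simp add: avg_int_def)
  qed
  then have "duhamel G t x = integral {0..t} (\<lambda>r::real. 0)"
    unfolding duhamel_def by (intro integral_cong)
  then show ?thesis by simp
qed

lemma contS_bounded_support:
  fixes h :: "real \<Rightarrow> real \<Rightarrow> complex"
  assumes "contS B h" "\<And>t x. t \<in> {0..B} \<Longrightarrow> R + t \<le> \<bar>x\<bar> \<Longrightarrow> h t x = 0"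
  obtains C where "C \<ge> 0" "\<And>t x. t \<in> {0..B} \<Longrightarrow> cmod (h t x) \<le> C"
proof -
  have "compact ((\<lambda>z. h (fst z) (snd z)) ` ({0..B} \<times> {-(R+B)..R+B}))"
    using assms(1) unfolding contS_def
    by (intro compact_continuous_image continuous_on_subset[OF assms(1)[unfolded contS_def]] compact_Times) auto
  then obtain C where C: "\<And>z. z \<in> {0..B} \<times> {-(R+B)..R+B} \<Longrightarrow> cmod (h (fst z) (snd z)) \<le> C"
    by (meson bounded_iff compact_imp_bounded image_eqI)
  show thesis
  proof (rule that[of "max C 0"])
    fix t x :: real assume t: "t \<in> {0..B}"
    show "cmod (h t x) \<le> max C 0"
    proof (cases "R + t \<le> \<bar>x\<bar>")
      case True then show ?thesis using assms(2)[OF t] by simp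
    next
      case False
      then have "(t, x) \<in> {0..B} \<times> {-(R+B)..R+B}" using t by auto
      from C[OF this] show ?thesis by simp
    qed
  qed simp
qed

text \<open>Banach's theorem for the weighted unknown W = exp(-\<Lambda>t) w in the bounded
  continuous functions. The support condition cuts out a closed invariant set, so the support of the
  solution comes with the fixed point.\<close>

lemma duhamel_fixed_point:
  fixes F :: "complex \<Rightarrow> complex"
  assumes B: "B > 0" and L: "L \<ge> 0" "\<And>a b. cmod (F a - F b) \<le> L * cmod (a - b)" and F0: "F 0 = 0"
    and h: "contS B h" "\<And>t x. t \<in> {0..B} \<Longrightarrow> R + t \<le> \<bar>x\<bar> \<Longrightarrow> h t x = 0"
  obtains w where "contS B w" "\<And>t x. t \<in> {0..B} \<Longrightarrow> R + t \<le> \<bar>x\<bar> \<Longrightarrow> w t x = 0"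
    "\<And>t x. t \<in> {0..B} \<Longrightarrow> w t x = h t x + duhamel (\<lambda>s y. F (w s y)) t x"
proof -
  \<comment> \<open>Makes the contraction constant \<open>L * B / \<Lambda>\<close> at most 1/2; the
    summand 1 keeps \<Lambda> positive when L = 0.\<close>
  define \<Lambda> where "\<Lambda> = 2 * (L * B + 1)"
  have "L * B \<ge> 0" using B L(1) by simp
  then have \<Lambda>: "\<Lambda> > 0" "L * B / \<Lambda> \<le> 1/2"
    unfolding \<Lambda>_def by (simp_all add: divide_le_eq)
  \<comment> \<open>Bounded continuous functions live on the whole plane; clamping the time to
    \<open>{0..B}\<close> extends the image of the map to all times by its values at the
    ends.\<close>
  define cl where "cl t = max 0 (min B t)" for t :: real
  have cl: "cl t \<in> {0..B}" "t \<in> {0..B} \<Longrightarrow> cl t = t" for t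
    using B by (auto simp: cl_def)
  define ex where "ex W s y = of_real (exp (\<Lambda> * s)) * apply_bcontfun W (s, y)" for W :: "(real \<times> real) \<Rightarrow>\<^sub>C complex" and s y
  define P where "P W z = of_real (exp (- \<Lambda> * cl (fst z))) *
    (h (cl (fst z)) (snd z) + duhamel (\<lambda>s y. F (ex W s y)) (cl (fst z)) (snd z))" for W z
  have Fc: "continuous_on S F" for S
  proof (rule continuous_on_subset[of UNIV])
    show "continuous_on UNIV F"
      unfolding continuous_on_iff
    proof (intro ballI allI impI)
      fix x :: complex and e :: real assume e: "e > 0"
      show "\<exists>d>0. \<forall>x'\<in>UNIV. dist x' x < d \<longrightarrow> dist (F x') (F x) < e"
      proof (intro exI[of _ "e / (L + 1)"] conjI ballI impI)
        show "e / (L + 1) > 0" using e L(1) by simp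
        fix x' assume "dist x' x < e / (L + 1)"
        then have "(L + 1) * cmod (x' - x) < e" using L(1) by (simp add: dist_norm field_simps)
        moreover have "L * cmod (x' - x) \<le> (L + 1) * cmod (x' - x)" by (intro mult_right_mono) auto
        ultimately show "dist (F x') (F x) < e" using L(2)[of x' x] by (simp add: dist_norm)
      qed
    qed
  qed auto
  have exc: "contS B (ex W)" for W
    unfolding contS_def ex_def
    by (intro continuous_intros continuous_on_subset[OF continuous_on_apply_bcontfun[of UNIV]]) (auto simp: case_prod_beta)
  have Fec: "contS B (\<lambda>s y. F (ex W s y))" for W
    using exc[of W] unfolding contS_def by (intro continuous_on_compose2[OF Fc[of UNIV]]) auto
  have diff_est: "cmod (duhamel (\<lambda>s y. F (ex W s y)) t x - duhamel (\<lambda>s y. F (ex V s y)) t x) \<le> 1/2 * dist W V * exp (\<Lambda> * t)"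
    if t: "t \<in> {0..B}" for W V t x
  proof -
    have "cmod (duhamel (\<lambda>s y. F (ex W s y) - F (ex V s y)) t x) \<le> B * (L * dist W V) / \<Lambda> * exp (\<Lambda> * t)"
    proof (rule norm_duhamel_le[OF _ t \<Lambda>(1)])
      show "contS B (\<lambda>s y. F (ex W s y) - F (ex V s y))" by (intro contS_diff Fec)
      show "0 \<le> L * dist W V" using L(1) by simp
      fix s y
      have "cmod (F (ex W s y) - F (ex V s y)) \<le> L * cmod (ex W s y - ex V s y)" by (rule L(2))
      also have "ex W s y - ex V s y = of_real (exp (\<Lambda> * s)) * (apply_bcontfun W (s, y) - apply_bcontfun V (s, y))"
        by (simp add: ex_def algebra_simps)
      also have "cmod \<dots> = exp (\<Lambda> * s) * dist (apply_bcontfun W (s, y)) (apply_bcontfun V (s, y))"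
        by (simp add: norm_mult dist_norm)
      also have "L * \<dots> \<le> L * (exp (\<Lambda> * s) * dist W V)"
        by (intro mult_left_mono dist_bounded L(1)) auto
      finally show "cmod (F (ex W s y) - F (ex V s y)) \<le> L * dist W V * exp (\<Lambda> * s)" by (simp add: mult_ac)
    qed
    also have "\<dots> = (L * B / \<Lambda>) * (dist W V * exp (\<Lambda> * t))" by simp
    also have "\<dots> \<le> 1/2 * (dist W V * exp (\<Lambda> * t))"
      by (intro mult_right_mono \<Lambda>(2)) auto
    finally show ?thesis
      by (simp add: duhamel_diff[OF Fec Fec t])
  qed
  have ecl: "exp (- \<Lambda> * cl t) \<le> 1" "exp (- \<Lambda> * cl t) * exp (\<Lambda> * cl t) = 1" for t
    using cl(1)[of t] \<Lambda>(1) by (auto simp flip: exp_add)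
  have dP: "cmod (P W z - P V z) \<le> 1/2 * dist W V" for W V z
  proof -
    have "cmod (P W z - P V z) = exp (- \<Lambda> * cl (fst z)) *
      cmod (duhamel (\<lambda>s y. F (ex W s y)) (cl (fst z)) (snd z) - duhamel (\<lambda>s y. F (ex V s y)) (cl (fst z)) (snd z))"
      by (simp add: P_def norm_mult flip: right_diff_distrib)
    also have "\<dots> \<le> exp (- \<Lambda> * cl (fst z)) * (1/2 * dist W V * exp (\<Lambda> * cl (fst z)))"
      by (intro mult_left_mono diff_est cl) auto
    also have "\<dots> = 1/2 * dist W V * (exp (- \<Lambda> * cl (fst z)) * exp (\<Lambda> * cl (fst z)))" by (simp only: mult_ac)
    finally show ?thesis by (simp only: ecl mult_1_right)
  qed
  obtain C where C: "C \<ge> 0" "\<And>t x. t \<in> {0..B} \<Longrightarrow> cmod (h t x) \<le> C"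
    using contS_bounded_support[OF h] by blast
  have duh0: "duhamel (\<lambda>s y. 0) t x = 0" for t x by (simp add: duhamel_def avg_int_def)
  have P0: "cmod (P 0 z) \<le> C" for z
  proof -
    have "cmod (P 0 z) = exp (- \<Lambda> * cl (fst z)) * cmod (h (cl (fst z)) (snd z))"
      by (simp add: P_def ex_def F0 duh0 norm_mult)
    also have "\<dots> \<le> 1 * C" by (intro mult_mono ecl C cl) auto
    finally show ?thesis by simp
  qed
  have Pb: "P W \<in> bcontfun" for W
  proof (rule bcontfun_normI)
    have c: "continuous_on UNIV (\<lambda>z::real\<times>real. cl (fst z))" unfolding cl_def by (intro continuous_intros)
    show "continuous_on UNIV (P W)"
      unfolding P_def
      by (intro continuous_intros c contS_compose[OF h(1)] contS_compose[OF contS_duhamel[OF Fec]] cl)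
    fix z
    have "cmod (P W z) \<le> cmod (P W z - P 0 z) + cmod (P 0 z)"
      by (metis diff_add_cancel norm_triangle_ineq)
    then show "cmod (P W z) \<le> 1/2 * dist W 0 + C" using dP[of W z 0] P0[of z] by linarith
  qed
  define T where "T W = Bcontfun (P W)" for W
  have T: "apply_bcontfun (T W) = P W" for W
    unfolding T_def by (rule Bcontfun_inverse[OF Pb])
  define S where "S = (PiC {z. fst z \<in> {0..B} \<and> R + fst z \<le> \<bar>snd z\<bar>} (\<lambda>_. {0}) :: ((real \<times> real) \<Rightarrow>\<^sub>C complex) set)"
  have memS: "W \<in> S \<longleftrightarrow> (\<forall>t\<in>{0..B}. \<forall>x. R + t \<le> \<bar>x\<bar> \<longrightarrow> apply_bcontfun W (t, x) = 0)" for W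
    unfolding S_def mem_PiC_iff by (auto simp: Pi_def)
  have "\<exists>!W. W \<in> S \<and> T W = W"
  proof (rule Banach_fix[where c = "1/2"])
    show "complete S"
      unfolding complete_eq_closed S_def by (rule closed_PiC) auto
    show "S \<noteq> {}" using memS[of 0] by auto
    show "T ` S \<subseteq> S"
    proof
      fix V assume "V \<in> T ` S"
      then obtain W where W: "W \<in> S" "V = T W" by auto
      have "P W (t, x) = 0" if t: "t \<in> {0..B}" and x: "R + t \<le> \<bar>x\<bar>" for t x
      proof -
        have "duhamel (\<lambda>s y. F (ex W s y)) t x = 0"
        proof (rule duhamel_support[OF _ x])
          fix s y assume "s \<in> {0..t}" "R + s \<le> \<bar>y\<bar>"
          then have "apply_bcontfun W (s, y) = 0" using W(1) t unfolding memS by auto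
          then show "F (ex W s y) = 0" by (simp add: ex_def F0)
        qed
        then show ?thesis using h(2)[OF t x] by (simp add: P_def cl(2)[OF t])
      qed
      then show "V \<in> S" unfolding memS W(2) T by simp
    qed
    show "dist (T W) (T V) \<le> 1/2 * dist W V" if "W \<in> S" "V \<in> S" for W V
      by (rule dist_bound) (simp only: T dist_norm[of "P _ _"] dP)
  qed auto
  then obtain W where W: "W \<in> S" "T W = W" by auto
  show thesis
  proof (rule that[of "ex W"])
    show "contS B (ex W)" by (rule exc)
    show "ex W t x = 0" if "t \<in> {0..B}" "R + t \<le> \<bar>x\<bar>" for t x
      using W(1) that unfolding memS ex_def by simp
    fix t x :: real assume t: "t \<in> {0..B}"
    have "apply_bcontfun W (t, x) = P W (t, x)" using T[of W] W(2) by simp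
    then have "ex W t x = of_real (exp (\<Lambda> * t)) * of_real (exp (- \<Lambda> * t)) * (h t x + duhamel (\<lambda>s y. F (ex W s y)) t x)"
      by (simp add: ex_def[of W t x] P_def cl(2)[OF t])
    also have "complex_of_real (exp (\<Lambda> * t)) * of_real (exp (- \<Lambda> * t)) = 1"
      by (simp flip: of_real_mult exp_add)
    finally show "ex W t x = h t x + duhamel (\<lambda>s y. F (ex W s y)) t x" by simp
  qed
qed

section \<open>Existence and uniqueness for the rescaled equation\<close>

text \<open>This is |a|^2 a as a polynomial in a and its conjugate, the form to which the product
  rules for \<open>Ck\<close> and \<open>pd\<close> apply.\<close>

definition cubic :: "complex \<Rightarrow> complex" where
  "cubic a = a * a * cnj a"

lemma cubic_eq: "cubic a = of_real ((cmod a)\<^sup>2) * a"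
  unfolding cubic_def using complex_norm_square[of a] by simp

lemma cubic_0 [simp]: "cubic 0 = 0"
  by (simp add: cubic_def)

lemma cubic_diff_le:
  assumes "cmod a \<le> M" "cmod b \<le> M"
  shows "cmod (cubic a - cubic b) \<le> 3 * M\<^sup>2 * cmod (a - b)"
proof -
  have "cubic a - cubic b = a * a * cnj (a - b) + (a + b) * (a - b) * cnj b"
    by (simp add: cubic_def algebra_simps)
  then have "cmod (cubic a - cubic b) \<le> cmod (a * a * cnj (a - b)) + cmod ((a + b) * (a - b) * cnj b)"
    by (metis norm_triangle_ineq)
  also have "\<dots> = cmod a * cmod a * cmod (a - b) + cmod (a + b) * cmod (a - b) * cmod b"
    by (simp only: norm_mult complex_mod_cnj)
  also have "\<dots> \<le> M * M * cmod (a - b) + (M + M) * cmod (a - b) * M"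
    using assms norm_triangle_le[of a b "M + M"] order_trans[OF norm_ge_zero assms(1)]
    by (intro add_mono mult_mono) auto
  finally show ?thesis by (simp add: power2_eq_square algebra_simps)
qed

lemma Ck_cubic: "Ck B k u \<Longrightarrow> Ck B k (\<lambda>t x. cubic (u t x))"
  unfolding cubic_def by (intro Ck_mult Ck_linear[OF bounded_linear_cnj])

lemma pd_unique:
  assumes "pd B f ft fx" "pd B f gt gx" "B > 0" "t \<in> {0..B}"
  shows "ft t x = gt t x" "fx t x = gx t x"
  using vector_derivative_unique_within_closed_interval[OF assms(3), of t] assms(4)
    pd_t[OF assms(1,4), of x] pd_t[OF assms(2,4), of x]
    vector_derivative_unique_at[OF pd_x[OF assms(1,4)] pd_x[OF assms(2,4)]]
  by auto

text \<open>\<open>utx\<close> serves as both mixed derivatives. \<open>jet3\<close> goes to order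
  three because the second-order equation is also used for \<open>D\<close> and \<open>Z\<close>,
  which are already first derivatives of the solution.\<close>

definition jet2 where
  "jet2 B u ut ux utt utx uxx \<longleftrightarrow> pd B u ut ux \<and> pd B ut utt utx \<and> pd B ux utx uxx"

definition jet3 where
  "jet3 B u ut ux utt utx uxx uttt uttx utxx uxxx \<longleftrightarrow> jet2 B u ut ux utt utx uxx \<and>
     jet2 B ut utt utx uttt uttx utxx \<and> jet2 B ux utx uxx uttx utxx uxxx"

lemma jet2_exists:
  assumes "Ck B 2 u" "B > 0"
  obtains ut ux utt utx uxx where "jet2 B u ut ux utt utx uxx"
proof -
  obtain ut ux where 1: "pd B u ut ux" "Ck B 1 ut" "Ck B 1 ux"
    using assms(1) unfolding numeral_2_eq_2 One_nat_def by (rule Ck_SucE)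
  obtain utt utx where 2: "pd B ut utt utx"
    using 1(2) unfolding One_nat_def by (rule Ck_SucE)
  obtain uxt uxx where 3: "pd B ux uxt uxx"
    using 1(3) unfolding One_nat_def by (rule Ck_SucE)
  have "pd B ux utx uxx"
    by (rule pd_cong[OF 3]) (auto simp: pd_symmetric[OF 1(1) 2 3 _ assms(2)])
  with 1 2 that show thesis unfolding jet2_def by blast
qed

lemma jet2_unique:
  assumes "jet2 B u ut ux utt utx uxx" "jet2 B u vt vx vtt vtx vxx" "B > 0" "t \<in> {0..B}"
  shows "ut t x = vt t x" "ux t x = vx t x" "utt t x = vtt t x" "utx t x = vtx t x" "uxx t x = vxx t x"
proof -
  note u = assms(1)[unfolded jet2_def] and v = assms(2)[unfolded jet2_def]
  have e: "ut t x = vt t x" "ux t x = vx t x" if "t \<in> {0..B}" for t x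
    using pd_unique[of B u ut ux vt vx t x] u v assms(3) that by auto
  then show "ut t x = vt t x" "ux t x = vx t x" using assms(4) by auto
  have "pd B vt utt utx" "pd B vx utx uxx"
    by (rule pd_cong[of B ut utt utx], use u e in auto) (rule pd_cong[of B ux utx uxx], use u e in auto)
  then show "utt t x = vtt t x" "utx t x = vtx t x" "uxx t x = vxx t x"
    using pd_unique[of B vt utt utx vtt vtx t x] pd_unique[of B vx utx uxx vtx vxx t x] v assms(3,4) by auto
qed

lemma jet3_exists:
  assumes "Ck B 3 u" "B > 0"
  obtains ut ux utt utx uxx uttt uttx utxx uxxx where "jet3 B u ut ux utt utx uxx uttt uttx utxx uxxx"
proof -
  obtain ut ux where 1: "pd B u ut ux" "Ck B 2 ut" "Ck B 2 ux"
    using assms(1) unfolding numeral_3_eq_3 numeral_2_eq_2 by (rule Ck_SucE)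
  obtain utt utx uttt uttx utxx where 2: "jet2 B ut utt utx uttt uttx utxx"
    using jet2_exists[OF 1(2) assms(2)] .
  obtain uxt uxx uxtt uxtx uxxx where 3: "jet2 B ux uxt uxx uxtt uxtx uxxx"
    using jet2_exists[OF 1(3) assms(2)] .
  have s: "uxt t x = utx t x" if "t \<in> {0..B}" for t x
    using pd_symmetric[OF 1(1) _ _ that assms(2)] 2 3 unfolding jet2_def by blast
  have a: "pd B ux utx uxx" by (rule pd_cong[of B ux uxt uxx]) (use 3 s in \<open>auto simp: jet2_def\<close>)
  have b: "pd B uxt uttx utxx" by (rule pd_cong[of B utx uttx utxx]) (use 2 s in \<open>auto simp: jet2_def\<close>)
  have e: "uxtt t x = uttx t x" "uxtx t x = utxx t x" if "t \<in> {0..B}" for t x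
    using pd_unique[OF b _ assms(2) that, of uxtt uxtx x] 3 unfolding jet2_def by auto
  have c: "pd B uxx utxx uxxx" by (rule pd_cong[of B uxx uxtx uxxx]) (use 3 e in \<open>auto simp: jet2_def\<close>)
  show thesis
    by (rule that[of ut ux utt utx uxx uttt uttx utxx uxxx]) (use 1 2 a c in \<open>auto simp: jet3_def jet2_def\<close>)
qed

section \<open>Smooth amplitudes as time-independent functions on the strip\<close>

primrec dk :: "nat \<Rightarrow> (real \<Rightarrow> complex) \<Rightarrow> bool" where
  "dk 0 f = True"
| "dk (Suc n) f = (\<exists>f'. (\<forall>x. (f has_vector_derivative f' x) (at x)) \<and> dk n f')"

declare dk.simps(2) [simp del]

lemma dk_SucI: "(\<And>x. (f has_vector_derivative f' x) (at x)) \<Longrightarrow> dk n f' \<Longrightarrow> dk (Suc n) f"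
  unfolding dk.simps(2) by blast

lemma dk_SucE:
  assumes "dk (Suc n) f"
  obtains f' where "\<And>x. (f has_vector_derivative f' x) (at x)" "dk n f'"
  using assms unfolding dk.simps(2) by blast

lemma dk_Suc: "dk (Suc n) f \<Longrightarrow> dk n f"
proof (induction n arbitrary: f)
  case (Suc n)
  from Suc.prems show ?case by (rule dk_SucE) (blast intro: dk_SucI Suc.IH)
qed simp

lemma dk_linear: "bounded_linear p \<Longrightarrow> dk n f \<Longrightarrow> dk n (\<lambda>x. p (f x))"
proof (induction n arbitrary: f)
  case (Suc n)
  obtain f' where f': "\<And>x. (f has_vector_derivative f' x) (at x)" "dk n f'"
    using Suc.prems(2) unfolding dk.simps(2) by blast
  show ?case
    by (rule dk_SucI[OF bounded_linear.has_vector_derivative[OF Suc.prems(1) f'(1)] Suc.IH[OF Suc.prems(1) f'(2)]])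
qed simp

lemma dk_add: "dk n f \<Longrightarrow> dk n g \<Longrightarrow> dk n (\<lambda>x. f x + g x)"
proof (induction n arbitrary: f g)
  case (Suc n)
  obtain f' where f': "\<And>x. (f has_vector_derivative f' x) (at x)" "dk n f'"
    using Suc.prems(1) unfolding dk.simps(2) by blast
  obtain g' where g': "\<And>x. (g has_vector_derivative g' x) (at x)" "dk n g'"
    using Suc.prems(2) unfolding dk.simps(2) by blast
  show ?case
    by (rule dk_SucI[OF has_vector_derivative_add[OF f'(1) g'(1)] Suc.IH[OF f'(2) g'(2)]])
qed simp

lemma dk_mult: "dk n f \<Longrightarrow> dk n g \<Longrightarrow> dk n (\<lambda>x. f x * g x)"
proof (induction n arbitrary: f g)
  case (Suc n)
  obtain f' where f': "\<And>x. (f has_vector_derivative f' x) (at x)" "dk n f'"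
    using Suc.prems(1) unfolding dk.simps(2) by blast
  obtain g' where g': "\<And>x. (g has_vector_derivative g' x) (at x)" "dk n g'"
    using Suc.prems(2) unfolding dk.simps(2) by blast
  show ?case
    by (rule dk_SucI[OF has_vector_derivative_mult[OF f'(1) g'(1)]
      dk_add[OF Suc.IH[OF dk_Suc[OF Suc.prems(1)] g'(2)] Suc.IH[OF f'(2) dk_Suc[OF Suc.prems(2)]]]])
qed simp

lemma dk_scale: "dk n f \<Longrightarrow> dk n (\<lambda>x. f (c * x))"
proof (induction n arbitrary: f)
  case (Suc n)
  obtain f' where f': "\<And>x. (f has_vector_derivative f' x) (at x)" "dk n f'"
    using Suc.prems(1) unfolding dk.simps(2) by blast
  have 1: "((\<lambda>x. c * x) has_vector_derivative c) (at x)" for x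
    by (auto intro!: derivative_eq_intros simp: has_real_derivative_iff_has_vector_derivative[symmetric])
  have 2: "((\<lambda>x. f (c * x)) has_vector_derivative c *\<^sub>R f' (c * x)) (at x)" for x
    using vector_diff_chain_at[OF 1 f'(1)] by (simp add: o_def)
  show ?case
    by (rule dk_SucI[OF 2 dk_linear[OF bounded_linear_scaleR_right Suc.IH[OF f'(2)]]])
qed simp

lemma dk_exp: "dk n (\<lambda>x. exp (\<i> * of_real (c * x)))"
proof (induction n)
  case (Suc n)
  have 1: "((\<lambda>x. exp (\<i> * of_real (c * x))) has_vector_derivative \<i> * of_real c * exp (\<i> * of_real (c * x))) (at x)" for x
  proof -
    have "((\<lambda>z. exp (\<i> * (of_real c * z))) has_field_derivative \<i> * of_real c * exp (\<i> * of_real (c * x))) (at (of_real x))"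
      by (auto intro!: derivative_eq_intros)
    from has_vector_derivative_real_field[OF this] show ?thesis by simp
  qed
  show ?case
    by (rule dk_SucI[OF 1 dk_linear[OF bounded_linear_mult_right Suc.IH]])
qed simp

lemma smooth_imp_dk:
  assumes "smooth f"
  shows "dk n f"
proof -
  let ?D = "\<lambda>g y. vector_derivative g (at y)"
  have "dk n ((?D ^^ m) f)" for m
  proof (induction n arbitrary: m)
    case (Suc n)
    have "((?D ^^ m) f has_vector_derivative (?D ^^ Suc m) f x) (at x)" for x
      using assms unfolding smooth_def by (simp add: vector_derivative_works[symmetric])
    from dk_SucI[OF this Suc.IH] show ?case .
  qed simp
  from this[of 0] show ?thesis by simp
qed

text \<open>Each \<open>dk n f\<close> supplies its own derivative; uniqueness of derivatives
  identifies them all, so that a single \<open>f'\<close> is smooth to every order.\<close>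

lemma dk_deriv:
  assumes "\<And>n. dk n f"
  obtains f' where "\<And>x. (f has_vector_derivative f' x) (at x)" "\<And>n. dk n f'"
proof -
  obtain f' where f': "\<And>x. (f has_vector_derivative f' x) (at x)"
    using assms[of "Suc 0"] unfolding dk.simps(2) by blast
  have "dk n f'" for n
  proof -
    obtain f'' where f'': "\<And>x. (f has_vector_derivative f'' x) (at x)" "dk n f''"
      using assms[of "Suc n"] unfolding dk.simps(2) by blast
    have "f' = f''" by (rule ext) (rule vector_derivative_unique_at[OF f' f''(1)])
    with f'' show ?thesis by simp
  qed
  with f' that show thesis by blast
qed

lemma contS_space: "continuous_on UNIV f \<Longrightarrow> contS B (\<lambda>t. f)"
  unfolding contS_def by (erule continuous_on_compose2) (auto intro: continuous_intros)

lemma pd_space: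
  assumes "\<And>x. (f has_vector_derivative f' x) (at x)" "continuous_on UNIV f'"
  shows "pd B (\<lambda>t. f) (\<lambda>t x. 0) (\<lambda>t. f')"
  unfolding pd_def
  using assms by (auto intro!: contS_space contS_const continuous_at_imp_continuous_on
      has_vector_derivative_continuous)

lemma dk_continuous: "dk (Suc n) f \<Longrightarrow> continuous_on UNIV f"
  by (erule dk_SucE) (auto intro!: continuous_at_imp_continuous_on has_vector_derivative_continuous)

text \<open>\<open>dk\<close> does not ask for continuity of the last derivative, hence the shift of
  the index by one.\<close>

lemma Ck_space: "dk (Suc k) f \<Longrightarrow> Ck B k (\<lambda>t. f)"
proof (induction k arbitrary: f)
  case 0 then show ?case by (auto intro: contS_space dk_continuous)
next
  case (Suc k)
  obtain f' where f': "\<And>x. (f has_vector_derivative f' x) (at x)" "dk (Suc k) f'"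
    using Suc.prems unfolding dk.simps(2) by blast
  show ?case
    by (rule Ck_SucI[OF pd_space[OF f'(1) dk_continuous[OF f'(2)]] Ck_const Suc.IH[OF f'(2)]])
qed

lemma pd_time: "pd B (\<lambda>t x. of_real t :: complex) (\<lambda>t x. 1) (\<lambda>t x. 0)"
  unfolding pd_def
proof (intro conjI ballI allI)
  show "contS B (\<lambda>t x. of_real t :: complex)" unfolding contS_def by (intro continuous_intros)
  fix t x :: real
  show "((\<lambda>s. of_real s :: complex) has_vector_derivative 1) (at t within {0..B})"
    using bounded_linear.has_vector_derivative[OF bounded_linear_of_real has_vector_derivative_id] by simp
qed (auto intro: contS_const)

lemma Ck_time: "Ck B k (\<lambda>t x. of_real t)"
proof (cases k)
  case 0 then show ?thesis using pd_cont(1)[OF pd_time] by simp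
next
  case (Suc n) show ?thesis unfolding Suc by (rule Ck_SucI[OF pd_time Ck_const Ck_const])
qed

lemma deriv_zero_outside:
  fixes f :: "real \<Rightarrow> complex"
  assumes "(f has_vector_derivative f') (at x)" "\<And>y. r \<le> \<bar>y\<bar> \<Longrightarrow> f y = 0" "r < \<bar>x\<bar>"
  shows "f' = 0"
proof -
  have "((\<lambda>y. 0) has_vector_derivative f') (at x)"
  proof (rule has_vector_derivative_transform_within_open[OF assms(1)])
    show "open {y. r < \<bar>y\<bar>}" by (intro open_Collect_less continuous_intros)
  qed (use assms in auto)
  then show ?thesis using vector_derivative_unique_at[OF has_vector_derivative_const] by blast
qed

text \<open>One bundle for the rescaled problem, with all derivatives up to order three named.
  \<open>X\<close> bounds the support at all times, so that every energy is an integral over one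
  fixed interval.\<close>

locale kg_solution =
  fixes B \<mu> X :: real and f g :: "real \<Rightarrow> complex"
    and u ut ux utt utx uxx uttt uttx utxx uxxx :: "real \<Rightarrow> real \<Rightarrow> complex"
  assumes B_pos: "B > 0"
    and jet: "jet3 B u ut ux utt utx uxx uttt uttx utxx uxxx"
    and eqn: "\<And>t x. t \<in> {0..B} \<Longrightarrow> utt t x - uxx t x + u t x + of_real \<mu> * cubic (u t x) = 0"
    and supp: "\<And>t x. t \<in> {0..B} \<Longrightarrow> X \<le> \<bar>x\<bar> \<Longrightarrow> u t x = 0"
    and init: "\<And>x. u 0 x = f x" "\<And>x. ut 0 x = g x"

text \<open>The nonlinearity is composed with the projection onto the ball of radius \<open>M\<close>, which makes it globally
  Lipschitz; as long as the solution stays in that ball, the projection is invisible.\<close>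

lemma truncated_solution:
  fixes f g :: "real \<Rightarrow> complex"
  assumes B: "B > 0" and M: "M > 0"
    and f: "\<And>n. dk n f" "\<And>x. r \<le> \<bar>x\<bar> \<Longrightarrow> f x = 0"
    and g: "\<And>n. dk n g" "\<And>x. r \<le> \<bar>x\<bar> \<Longrightarrow> g x = 0"
  obtains u where "contS B u" "\<And>t x. t \<in> {0..B} \<Longrightarrow> r + 1 + B \<le> \<bar>x\<bar> \<Longrightarrow> u t x = 0" "\<And>x. u 0 x = f x"
    "\<And>t1. \<lbrakk>0 < t1; t1 \<le> B; \<And>t x. t \<in> {0..t1} \<Longrightarrow> cmod (u t x) \<le> M\<rbrakk> \<Longrightarrow>
       \<exists>ut ux utt utx uxx uttt uttx utxx uxxx.
         kg_solution t1 \<mu> (r + 1 + B) f g u ut ux utt utx uxx uttt uttx utxx uxxx"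
proof -
  obtain f1 where f1: "\<And>x. (f has_vector_derivative f1 x) (at x)" "\<And>n. dk n f1"
    using dk_deriv[OF f(1)] by blast
  obtain f2 where f2: "\<And>x. (f1 has_vector_derivative f2 x) (at x)" "\<And>n. dk n f2"
    using dk_deriv[OF f1(2)] by blast
  obtain g1 where g1: "\<And>x. (g has_vector_derivative g1 x) (at x)" "\<And>n. dk n g1"
    using dk_deriv[OF g(1)] by blast
  obtain g2 where g2: "\<And>x. (g1 has_vector_derivative g2 x) (at x)" "\<And>n. dk n g2"
    using dk_deriv[OF g1(2)] by blast
  \<comment> \<open>\<open>deriv_zero_outside\<close> yields zeros on an open set only. The
    intermediate radius lets it be applied twice, so that \<open>f2\<close> and \<open>g2\<close>
    vanish from r + 1 on.\<close>
  obtain ff where ff: "ff > r" "ff < r + 1" by (metis less_add_one dense)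
  have f1z: "f1 x = 0" and g1z: "g1 x = 0" if "ff \<le> \<bar>x\<bar>" for x
    using deriv_zero_outside[OF f1(1) f(2), where r=r] deriv_zero_outside[OF g1(1) g(2), where r=r] that ff by auto
  have f2z: "f2 x = 0" and g2z: "g2 x = 0" if "r + 1 \<le> \<bar>x\<bar>" for x
    using deriv_zero_outside[OF f2(1) f1z, where r=ff] deriv_zero_outside[OF g2(1) g1z, where r=ff] that ff by auto
  define Pr where "Pr = closest_point (cball (0::complex) M)"
  have Pr: "cmod (Pr a) \<le> M" "cmod (Pr a - Pr b) \<le> cmod (a - b)" for a b
  proof -
    show "cmod (Pr a) \<le> M"
      using closest_point_in_set[of "cball 0 M" a] M unfolding Pr_def by auto
    show "cmod (Pr a - Pr b) \<le> cmod (a - b)"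
      using closest_point_lipschitz[of "cball 0 M" a b] M unfolding Pr_def by (simp add: dist_norm)
  qed
  have PrM: "Pr a = a" if "cmod a \<le> M" for a
    unfolding Pr_def using that by (intro closest_point_self) auto
  define F where "F a = - (a + of_real \<mu> * cubic (Pr a))" for a
  define L where "L = 1 + \<bar>\<mu>\<bar> * (3 * M\<^sup>2)"
  have L: "L \<ge> 0" by (simp add: L_def)
  have FL: "cmod (F a - F b) \<le> L * cmod (a - b)" for a b
  proof -
    have "cmod (F a - F b) = cmod ((a - b) + of_real \<mu> * (cubic (Pr a) - cubic (Pr b)))"
      unfolding F_def by (subst norm_minus_cancel[symmetric]) (simp add: algebra_simps)
    also have "\<dots> \<le> cmod (a - b) + \<bar>\<mu>\<bar> * cmod (cubic (Pr a) - cubic (Pr b))"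
      by (rule order_trans[OF norm_triangle_ineq]) (simp add: norm_mult)
    also have "\<dots> \<le> cmod (a - b) + \<bar>\<mu>\<bar> * (3 * M\<^sup>2 * cmod (a - b))"
      using cubic_diff_le[OF Pr(1) Pr(1), of a b] Pr(2)[of a b] 
      by (intro add_left_mono mult_left_mono order_trans[OF cubic_diff_le[OF Pr(1) Pr(1)]]) auto
    finally show ?thesis by (simp add: L_def algebra_simps)
  qed
  have F0: "F 0 = 0" using M by (simp add: F_def PrM)
  \<comment> \<open>\<open>h0\<close> has the right data, but its wave operator gives
    -\<open>k\<close>; adding \<open>duhamel k\<close> turns it into the free wave with data (f,
    g).\<close>
  define k where "k t x = f2 x + of_real t * g2 x" for t x
  define h0 where "h0 t x = f x + of_real t * g x" for t x
  have kCk: "Ck b n k" and h0Ck: "Ck b n h0" for b n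
    unfolding k_def h0_def
    by (intro Ck_add[OF Ck_space Ck_mult[OF Ck_time Ck_space]] f f2 g g2)+
  have h: "contS B (\<lambda>t x. h0 t x + duhamel k t x)"
    by (intro contS_add contS_duhamel Ck_cont[OF kCk] Ck_cont[OF h0Ck])
  have hs: "h0 t x + duhamel k t x = 0" if "t \<in> {0..B}" "r + 1 + t \<le> \<bar>x\<bar>" for t x
  proof -
    have "duhamel k t x = 0"
      by (rule duhamel_support[of t "r + 1"]) (use that f2z g2z in \<open>auto simp: k_def\<close>)
    moreover have "h0 t x = 0" using f(2)[of x] g(2)[of x] that by (simp add: h0_def)
    ultimately show ?thesis by simp
  qed
  obtain w where w: "contS B w" "\<And>t x. t \<in> {0..B} \<Longrightarrow> r + 1 + t \<le> \<bar>x\<bar> \<Longrightarrow> w t x = 0"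
    "\<And>t x. t \<in> {0..B} \<Longrightarrow> w t x = (h0 t x + duhamel k t x) + duhamel (\<lambda>s y. F (w s y)) t x"
    using duhamel_fixed_point[OF B L FL F0 h hs] by blast
  show thesis
  proof (rule that[of w])
    show "contS B w" by (rule w)
    show ws: "w t x = 0" if "t \<in> {0..B}" "r + 1 + B \<le> \<bar>x\<bar>" for t x
      using w(2)[of t x] that by auto
    show w0: "w 0 x = f x" for x
      using w(3)[of 0 x] B by (simp add: h0_def duhamel_def)
    fix t1 assume t1: "0 < t1" "t1 \<le> B" and wM: "\<And>t x. t \<in> {0..t1} \<Longrightarrow> cmod (w t x) \<le> M"
    \<comment> \<open>As long as |w| \<le> M the projection is the identity, and all Duhamel terms
      merge into one with source \<open>G\<close>. The identity w = \<open>h0\<close> +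
      \<open>duhamel G\<close> then gains one derivative at a time, without end.\<close>
    define G where "G s y = k s y - (w s y + of_real \<mu> * cubic (w s y))" for s y
    have GCk: "Ck t1 n G" if "Ck t1 n w" for n
      unfolding G_def by (intro Ck_diff Ck_add Ck_cmult Ck_cubic kCk that)
    have wc: "contS t1 w" by (rule contS_mono[OF w(1) t1(2)])
    have wG: "w t x = h0 t x + duhamel G t x" if t: "t \<in> {0..t1}" for t x
    proof -
      have c: "contS t1 (\<lambda>s y. w s y + of_real \<mu> * cubic (w s y))"
        using Ck_cont[of t1 0] Ck_add[OF _ Ck_cmult[OF Ck_cubic], of t1 0 w w] wc by simp
      have "duhamel G t x = duhamel k t x - duhamel (\<lambda>s y. w s y + of_real \<mu> * cubic (w s y)) t x"
        unfolding G_def by (rule duhamel_diff[OF Ck_cont[OF kCk] c t])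
      moreover have "duhamel (\<lambda>s y. F (w s y)) t x = duhamel (\<lambda>s y. 0 - (w s y + of_real \<mu> * cubic (w s y))) t x"
        by (rule duhamel_cong) (use t in \<open>auto simp: F_def PrM wM\<close>)
      moreover have "\<dots> = duhamel (\<lambda>s y. 0) t x - duhamel (\<lambda>s y. w s y + of_real \<mu> * cubic (w s y)) t x"
        by (rule duhamel_diff[OF contS_const c t])
      moreover have "duhamel (\<lambda>s y. 0) t x = 0" by (simp add: duhamel_def avg_int_def)
      ultimately show ?thesis using w(3)[of t x] t t1 by simp
    qed
    have step: "Ck t1 (Suc n) w" if "Ck t1 n w" for n
      by (rule Ck_cong[OF Ck_add[OF h0Ck Ck_duhamel[OF GCk[OF that]]]]) (simp add: wG)
    have wCk: "Ck t1 n w" for n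
      by (induction n) (simp add: wc, rule step)
    obtain ut ux utt utx uxx uttt uttx utxx uxxx where j: "jet3 t1 w ut ux utt utx uxx uttt uttx utxx uxxx"
      using jet3_exists[OF wCk t1(1)] .
    obtain Gt Gx where G: "pd t1 G Gt Gx"
      using GCk[OF wCk, of 1] unfolding One_nat_def by (rule Ck_SucE)
    define c1 where "c1 = char_int 1 G"
    define c2 where "c2 = char_int (-1) G"
    define d1 where "d1 = char_int 1 Gx"
    define d2 where "d2 = char_int (-1) Gx"
    have c1: "pd t1 c1 (\<lambda>t x. G t x + d1 t x) d1" and c2: "pd t1 c2 (\<lambda>t x. G t x - d2 t x) d2"
      unfolding c1_def c2_def d1_def d2_def using pd_char_int[OF G, of 1] pd_char_int[OF G, of "-1"] by simp_all
    have ps: "pd t1 (\<lambda>t. f) (\<lambda>t x. 0) (\<lambda>t. f1)" "pd t1 (\<lambda>t. f1) (\<lambda>t x. 0) (\<lambda>t. f2)"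
       "pd t1 (\<lambda>t. g) (\<lambda>t x. 0) (\<lambda>t. g1)" "pd t1 (\<lambda>t. g1) (\<lambda>t x. 0) (\<lambda>t. g2)"
      by (intro pd_space f1 f2 g1 g2 dk_continuous[of 0])+
    have v1: "pd t1 w (\<lambda>t x. g x + (1/2) * (c1 t x + c2 t x)) (\<lambda>t x. f1 x + of_real t * g1 x + (1/2) * (c1 t x - c2 t x))"
      unfolding c1_def c2_def
      by (rule pd_cong[OF pd_add[OF pd_add[OF ps(1) pd_mult[OF pd_time ps(3)]] pd_duhamel[OF pd_cont(1)[OF G]]]])
        (auto simp: wG h0_def)
    have v2: "pd t1 (\<lambda>t x. g x + (1/2) * (c1 t x + c2 t x)) (\<lambda>t x. (1/2) * (G t x + d1 t x + (G t x - d2 t x)))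
       (\<lambda>t x. g1 x + (1/2) * (d1 t x + d2 t x))"
      by (rule pd_cong[OF pd_add[OF ps(3) pd_cmult[where x = "1/2", OF pd_add[OF c1 c2]]]]) auto
    have v3: "pd t1 (\<lambda>t x. f1 x + of_real t * g1 x + (1/2) * (c1 t x - c2 t x))
       (\<lambda>t x. g1 x + (1/2) * (G t x + d1 t x - (G t x - d2 t x)))
       (\<lambda>t x. f2 x + of_real t * g2 x + (1/2) * (d1 t x - d2 t x))"
      by (rule pd_cong[OF pd_add[OF pd_add[OF ps(2) pd_mult[OF pd_time ps(4)]] pd_cmult[where x = "1/2", OF pd_diff[OF c1 c2]]]]) auto
    have v3': "pd t1 (\<lambda>t x. f1 x + of_real t * g1 x + (1/2) * (c1 t x - c2 t x))
       (\<lambda>t x. g1 x + (1/2) * (d1 t x + d2 t x))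
       (\<lambda>t x. f2 x + of_real t * g2 x + (1/2) * (d1 t x - d2 t x))"
      by (rule pd_cong[OF v3]) auto
    \<comment> \<open>\<open>jet3_exists\<close> gives anonymous derivatives. Here the first two
      orders are computed from the Duhamel formula; by uniqueness both agree, and the equation
      reduces to \<open>G - k\<close>, the initial velocity to \<open>g\<close>.\<close>
    have j2: "jet2 t1 w (\<lambda>t x. g x + (1/2) * (c1 t x + c2 t x)) (\<lambda>t x. f1 x + of_real t * g1 x + (1/2) * (c1 t x - c2 t x))
       (\<lambda>t x. (1/2) * (G t x + d1 t x + (G t x - d2 t x)))
       (\<lambda>t x. g1 x + (1/2) * (d1 t x + d2 t x))
       (\<lambda>t x. f2 x + of_real t * g2 x + (1/2) * (d1 t x - d2 t x))"
      using v1 v2 v3' unfolding jet2_def by blast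
    have ju: "jet2 t1 w ut ux utt utx uxx" using j unfolding jet3_def by blast
    note un = jet2_unique[OF ju j2 t1(1)]
    have "kg_solution t1 \<mu> (r + 1 + B) f g w ut ux utt utx uxx uttt uttx utxx uxxx"
    proof
      show "utt t x - uxx t x + w t x + of_real \<mu> * cubic (w t x) = 0" if t: "t \<in> {0..t1}" for t x
        unfolding un(3)[OF t] un(5)[OF t] G_def k_def by (simp add: algebra_simps)
      show "ut 0 x = g x" for x
        using un(1)[of 0 x] t1 by (simp add: c1_def c2_def char_int_def)
    qed (use t1 j ws w0 in auto)
    then show "\<exists>ut ux utt utx uxx uttt uttx utxx uxxx.
         kg_solution t1 \<mu> (r + 1 + B) f g w ut ux utt utx uxx uttt uttx utxx uxxx" by blast
  qed
qed

text \<open>The truncated solution exists on all of \<open>{0..B}\<close>, so continuation is not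
  about existence but about the truncation staying invisible: the a priori hypothesis turns |u|
  \<le> M into |u| < M on any initial interval, and therefore |u| can never reach M.\<close>

lemma kg_exists:
  fixes f g :: "real \<Rightarrow> complex"
  assumes B: "B > 0" and M: "M > 0"
    and f: "\<And>n. dk n f" "\<And>x. r \<le> \<bar>x\<bar> \<Longrightarrow> f x = 0" "\<And>x. cmod (f x) < M"
    and g: "\<And>n. dk n g" "\<And>x. r \<le> \<bar>x\<bar> \<Longrightarrow> g x = 0"
    and apriori: "\<And>t1 u ut ux utt utx uxx uttt uttx utxx uxxx t x.
      \<lbrakk>t1 \<le> B; kg_solution t1 \<mu> (r + 1 + B) f g u ut ux utt utx uxx uttt uttx utxx uxxx;
       \<And>t x. t \<in> {0..t1} \<Longrightarrow> cmod (u t x) \<le> M; t \<in> {0..t1}\<rbrakk> \<Longrightarrow> cmod (u t x) < M"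
  obtains u ut ux utt utx uxx uttt uttx utxx uxxx
  where "kg_solution B \<mu> (r + 1 + B) f g u ut ux utt utx uxx uttt uttx utxx uxxx"
    "\<And>t x. t \<in> {0..B} \<Longrightarrow> cmod (u t x) < M"
proof -
  obtain u where u: "contS B u" "\<And>t x. t \<in> {0..B} \<Longrightarrow> r + 1 + B \<le> \<bar>x\<bar> \<Longrightarrow> u t x = 0" "\<And>x. u 0 x = f x"
    and reg: "\<And>t1. \<lbrakk>0 < t1; t1 \<le> B; \<And>t x. t \<in> {0..t1} \<Longrightarrow> cmod (u t x) \<le> M\<rbrakk> \<Longrightarrow>
       \<exists>ut ux utt utx uxx uttt uttx utxx uxxx.
         kg_solution t1 \<mu> (r + 1 + B) f g u ut ux utt utx uxx uttt uttx utxx uxxx"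
    using truncated_solution[OF B M f(1,2) g] by metis
  have lt: "cmod (u t x) < M" if t1: "0 < t1" "t1 \<le> B" and le: "\<forall>t\<in>{0..t1}. \<forall>x. cmod (u t x) \<le> M" and t: "t \<in> {0..t1}" for t1 t x
  proof -
    obtain ut ux utt utx uxx uttt uttx utxx uxxx
      where "kg_solution t1 \<mu> (r + 1 + B) f g u ut ux utt utx uxx uttt uttx utxx uxxx"
      using reg[OF t1] le by blast
    from apriori[OF t1(2) this] le t show ?thesis by blast
  qed
  define X where "X = \<bar>r + 1 + B\<bar>"
  \<comment> \<open>Bounded support makes this set compact, so if it is nonempty it has an earliest
    point, at a positive time because the data are below M. Up to that time |u| \<le> M holds by
    continuity, and the a priori hypothesis excludes equality.\<close>
  define bad where "bad = {z \<in> {0..B} \<times> {-X..X}. M \<le> cmod (u (fst z) (snd z))}"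
  have "bad = {}"
  proof (rule ccontr)
    assume ne: "bad \<noteq> {}"
    have "compact bad"
    proof -
      have c: "continuous_on ({0..B} \<times> {-X..X}) (\<lambda>z. cmod (u (fst z) (snd z)))"
        using u(1) unfolding contS_def by (intro continuous_intros continuous_on_subset[OF u(1)[unfolded contS_def]]) auto
      have "closed ({0..B} \<times> {-X..X} :: (real \<times> real) set)" by (intro closed_Times) auto
      then have "closed bad"
      proof -
        assume "closed ({0..B} \<times> {-X..X} :: (real \<times> real) set)"
        from continuous_closed_preimage[OF c this closed_atLeast[of M]]
        have "closed ({0..B} \<times> {-X..X} \<inter> (\<lambda>z. cmod (u (fst z) (snd z))) -` {M..})" .
        moreover have "bad = {0..B} \<times> {-X..X} \<inter> (\<lambda>z. cmod (u (fst z) (snd z))) -` {M..}"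
          unfolding bad_def by (rule set_eqI) (simp only: mem_Collect_eq Int_iff vimage_eq atLeast_iff)
        ultimately show ?thesis by simp
      qed
      moreover have "bounded bad"
        by (rule bounded_subset[of "{0..B} \<times> {-X..X}"]) (auto simp: bad_def bounded_Times)
      ultimately show ?thesis by (simp add: compact_eq_bounded_closed)
    qed
    then obtain z where z: "z \<in> bad" "\<And>y. y \<in> bad \<Longrightarrow> fst z \<le> fst y"
      using continuous_attains_inf[OF _ ne continuous_on_fst[OF continuous_on_id]] by blast
    define t1 where "t1 = fst z"
    have t1: "t1 \<in> {0..B}" "M \<le> cmod (u t1 (snd z))" using z(1) by (auto simp: bad_def t1_def)
    have "t1 \<noteq> 0" using t1(2) u(3) f(3)[of "snd z"] by auto
    then have t1p: "0 < t1" using t1 by auto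
    have before: "cmod (u t x) \<le> M" if "t \<in> {0..<t1}" for t x
    proof (cases "\<bar>x\<bar> \<le> X")
      case True
      have "(t, x) \<notin> bad" using z(2)[of "(t, x)"] that by (auto simp: t1_def)
      then show ?thesis using True that t1(1) by (auto simp: bad_def)
    next
      case False
      then have "u t x = 0" using u(2)[of t x] that t1(1) by (auto simp: X_def)
      then show ?thesis using M by simp
    qed
    have "cmod (u t x) \<le> M" if t: "t \<in> {0..t1}" for t x
    proof (cases "t = t1")
      case True
      have c: "continuous_on {0..t1} (\<lambda>t. cmod (u t x))"
        by (intro continuous_intros contS_compose[OF u(1)]) (use t1 in auto)
      have "cmod (u t1 x) \<le> M"
      proof (rule continuous_le_on_closure[where S = "{0..<t1}" and f = "\<lambda>t. cmod (u t x)"])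
        show "continuous_on (closure {0..<t1}) (\<lambda>t. cmod (u t x))" using c t1p by simp
        show "t1 \<in> closure {0..<t1}" using t1p by simp
      qed (rule before)
      then show ?thesis using True by simp
    qed (use before t in auto)
    then have "cmod (u t1 (snd z)) < M" using t1(1) t1p by (intro lt[of t1]) auto
    with t1(2) show False by simp
  qed
  have le: "cmod (u t x) \<le> M" if "t \<in> {0..B}" for t x
  proof (cases "\<bar>x\<bar> \<le> X")
    case True
    then have "(t, x) \<notin> bad" using \<open>bad = {}\<close> by auto
    then show ?thesis using True that by (auto simp: bad_def)
  next
    case False
    then have "u t x = 0" using u(2)[of t x] that by (auto simp: X_def)
    then show ?thesis using M by simp
  qed
  obtain ut ux utt utx uxx uttt uttx utxx uxxx
    where "kg_solution B \<mu> (r + 1 + B) f g u ut ux utt utx uxx uttt uttx utxx uxxx"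
    using reg[OF B order_refl] le by blast
  moreover have "cmod (u t x) < M" if "t \<in> {0..B}" for t x
    using le that B by (intro lt[of B]) auto
  ultimately show thesis by (rule that)
qed

section \<open>Uniqueness of classical solutions\<close>

lemma exp_growth_bound:
  fixes \<phi> :: "real \<Rightarrow> complex"
  assumes "\<And>s. s \<in> {0..t} \<Longrightarrow> (\<phi> has_vector_derivative \<phi>' s) (at s within {0..t})" "\<phi> 0 = 0"
    "\<And>s. s \<in> {0..t} \<Longrightarrow> cmod (\<phi>' s) \<le> A * exp (\<Lambda> * s)" "\<Lambda> > 0" "A \<ge> 0" "t \<ge> 0"
  shows "cmod (\<phi> t) \<le> A / \<Lambda> * exp (\<Lambda> * t)"
proof -
  have 1: "(\<phi>' has_integral \<phi> t - \<phi> 0) {0..t}"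
    by (rule fundamental_theorem_of_calculus) (use assms in auto)
  have 2: "((\<lambda>s. A * exp (\<Lambda> * s)) has_integral A * exp (\<Lambda> * t) / \<Lambda> - A * exp (\<Lambda> * 0) / \<Lambda>) {0..t}"
    by (rule fundamental_theorem_of_calculus)
      (use assms in \<open>auto intro!: derivative_eq_intros simp: has_real_derivative_iff_has_vector_derivative[symmetric]\<close>)
  have "cmod (integral {0..t} \<phi>') \<le> integral {0..t} (\<lambda>s. A * exp (\<Lambda> * s))"
    by (rule Henstock_Kurzweil_Integration.integral_norm_bound_integral) (use 1 2 assms(3) in auto)
  then have "cmod (\<phi> t) \<le> A * exp (\<Lambda> * t) / \<Lambda> - A / \<Lambda>"
    using integral_unique[OF 1] integral_unique[OF 2] assms(2) by simp
  moreover have "A / \<Lambda> \<ge> 0" using assms by simp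
  ultimately show ?thesis by simp
qed

text \<open>No decay or boundedness of the competitors is assumed, so the comparison is confined to
  the backward light cone of one point. It is compact, which provides the bound needed for the cubic
  term, and the characteristics through its points stay inside on their way back to time 0.\<close>

lemma kg_unique:
  assumes B: "B > 0" and u: "jet2 B u ut ux utt utx uxx" and v: "jet2 B v vt vx vtt vtx vxx"
    and eu: "\<And>t x. t \<in> {0..B} \<Longrightarrow> utt t x - uxx t x + u t x + of_real \<mu> * cubic (u t x) = 0"
    and ev: "\<And>t x. t \<in> {0..B} \<Longrightarrow> vtt t x - vxx t x + v t x + of_real \<mu> * cubic (v t x) = 0"
    and i: "\<And>x. u 0 x = v 0 x" "\<And>x. ut 0 x = vt 0 x"
    and t0: "t0 \<in> {0..B}"
  shows "u t0 x0 = v t0 x0"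
proof -
  define K where "K = {z::real\<times>real. 0 \<le> fst z \<and> fst z \<le> t0 \<and> \<bar>snd z - x0\<bar> \<le> t0 - fst z}"
  have sub: "K \<subseteq> {0..t0} \<times> {x0 - t0..x0 + t0}" unfolding K_def by auto
  have "closed K" unfolding K_def by (intro closed_Collect_conj closed_Collect_le continuous_intros)
  then have K: "compact K"
    using bounded_subset[OF _ sub] by (simp add: bounded_Times compact_eq_bounded_closed)
  have KB: "fst z \<in> {0..B}" if "z \<in> K" for z using that t0 by (auto simp: K_def)
  have bdd: "\<exists>C. \<forall>z\<in>K. cmod (w (fst z) (snd z)) \<le> C" if "contS B w" for w :: "real \<Rightarrow> real \<Rightarrow> complex"
  proof -
    have "compact ((\<lambda>z. w (fst z) (snd z)) ` K)"
      by (intro compact_continuous_image K contS_compose[OF that] continuous_intros KB)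
    then show ?thesis by (meson bounded_iff compact_imp_bounded image_eqI)
  qed
  have uv: "pd B u ut ux" "pd B ut utt utx" "pd B ux utx uxx" "pd B v vt vx" "pd B vt vtt vtx" "pd B vx vtx vxx"
    using u v by (auto simp: jet2_def)
  obtain C1 C2 where C12: "\<And>z. z \<in> K \<Longrightarrow> cmod (u (fst z) (snd z)) \<le> C1" "\<And>z. z \<in> K \<Longrightarrow> cmod (v (fst z) (snd z)) \<le> C2"
    using bdd[OF pd_cont(1)[OF uv(1)]] bdd[OF pd_cont(1)[OF uv(4)]] by metis
  define M where "M = max C1 C2"
  have M: "cmod (u t x) \<le> M" "cmod (v t x) \<le> M" if "(t, x) \<in> K" for t x
    using C12(1)[OF that] C12(2)[OF that] by (auto simp: M_def)
  define d where "d t x = u t x - v t x" for t x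
  define dt where "dt t x = ut t x - vt t x" for t x
  define dx where "dx t x = ux t x - vx t x" for t x
  define dtt where "dtt t x = utt t x - vtt t x" for t x
  define dtx where "dtx t x = utx t x - vtx t x" for t x
  define dxx where "dxx t x = uxx t x - vxx t x" for t x
  have d: "pd B d dt dx" "pd B dt dtt dtx" "pd B dx dtx dxx"
    unfolding d_def dt_def dx_def dtt_def dtx_def dxx_def by (intro pd_diff uv)+
  define L where "L = 1 + \<bar>\<mu>\<bar> * (3 * M\<^sup>2)"
  have L: "L \<ge> 1" by (simp add: L_def)
  have Ld: "cmod (dtt t x - dxx t x) \<le> L * cmod (d t x)" if z: "(t, x) \<in> K" for t x
  proof -
    have t: "t \<in> {0..B}" using KB[OF z] by simp
    have "dtt t x - dxx t x = - (d t x + of_real \<mu> * (cubic (u t x) - cubic (v t x)))"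
      using eu[OF t, of x] ev[OF t, of x] unfolding dtt_def dxx_def d_def by algebra
    then have "cmod (dtt t x - dxx t x) = cmod (d t x + of_real \<mu> * (cubic (u t x) - cubic (v t x)))"
      by (simp only: norm_minus_cancel)
    also have "\<dots> \<le> cmod (d t x) + \<bar>\<mu>\<bar> * cmod (cubic (u t x) - cubic (v t x))"
      by (rule order_trans[OF norm_triangle_ineq]) (simp add: norm_mult)
    also have "\<dots> \<le> cmod (d t x) + \<bar>\<mu>\<bar> * (3 * M\<^sup>2 * cmod (d t x))"
      unfolding d_def by (intro add_left_mono mult_left_mono cubic_diff_le M z) auto
    finally show ?thesis by (simp add: L_def algebra_simps)
  qed
  \<comment> \<open>The sup of exp(-\<Lambda>t)|d| reproduces itself after two integrations with the
    factor L/\<Lambda>^2, at most 1/4 since L \<ge> 1, and must be zero.\<close>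
  define \<Lambda> where "\<Lambda> = 2 * L"
  have \<Lambda>: "\<Lambda> > 0" "L / \<Lambda> / \<Lambda> \<le> 1/4" using L by (auto simp: \<Lambda>_def field_simps)
  have "continuous_on K (\<lambda>z. exp (- \<Lambda> * fst z) * cmod (d (fst z) (snd z)))"
    by (intro continuous_intros contS_compose[OF pd_cont(1)[OF d(1)]] KB)
  moreover have "(t0, x0) \<in> K" using t0 by (auto simp: K_def)
  ultimately obtain zm where zm: "zm \<in> K"
    "\<And>z. z \<in> K \<Longrightarrow> exp (- \<Lambda> * fst z) * cmod (d (fst z) (snd z)) \<le> exp (- \<Lambda> * fst zm) * cmod (d (fst zm) (snd zm))"
    using continuous_attains_sup[OF K] by blast
  define m where "m = exp (- \<Lambda> * fst zm) * cmod (d (fst zm) (snd zm))"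
  have m0: "m \<ge> 0" by (simp add: m_def)
  have md: "cmod (d t x) \<le> m * exp (\<Lambda> * t)" if "(t, x) \<in> K" for t x
  proof -
    have "exp (- \<Lambda> * t) * cmod (d t x) \<le> m" using zm(2)[OF that] by (simp add: m_def)
    then have "exp (\<Lambda> * t) * (exp (- \<Lambda> * t) * cmod (d t x)) \<le> exp (\<Lambda> * t) * m" by (intro mult_left_mono) auto
    then show ?thesis by (simp add: mult_ac flip: exp_add)
  qed
  \<comment> \<open>Along a characteristic of slope -\<sigma> the derivative of dt + \<sigma> dx is
    dtt - dxx, because \<sigma>^2 = 1 removes the mixed terms; this is the quantity bounded by
    \<open>Ld\<close>.\<close>
  have char: "cmod (dt t x + of_real \<sigma> * dx t x) \<le> L * m / \<Lambda> * exp (\<Lambda> * t)"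
    if z: "(t, x) \<in> K" and \<sigma>: "\<sigma> = 1 \<or> \<sigma> = -1" for t x \<sigma>
  proof -
    have t: "t \<in> {0..B}" using KB[OF z] by simp
    have inK: "(s, x + \<sigma> * t + - \<sigma> * s) \<in> K" if "s \<in> {0..t}" for s
      using z \<sigma> that by (auto simp: K_def)
    have p: "pd B (\<lambda>t x. dt t x + of_real \<sigma> * dx t x) (\<lambda>t x. dtt t x + of_real \<sigma> * dtx t x) (\<lambda>t x. dtx t x + of_real \<sigma> * dxx t x)"
      by (intro pd_add pd_cmult d)
    have "cmod (dt t (x + \<sigma> * t + - \<sigma> * t) + of_real \<sigma> * dx t (x + \<sigma> * t + - \<sigma> * t)) \<le> L * m / \<Lambda> * exp (\<Lambda> * t)"
    proof (rule exp_growth_bound[where \<phi> = "\<lambda>s. dt s (x + \<sigma> * t + - \<sigma> * s) + of_real \<sigma> * dx s (x + \<sigma> * t + - \<sigma> * s)" and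
        \<phi>' = "\<lambda>s. dtt s (x + \<sigma> * t + - \<sigma> * s) - dxx s (x + \<sigma> * t + - \<sigma> * s)"])
      fix s assume s: "s \<in> {0..t}"
      then have sB: "s \<in> {0..B}" using t by auto
      have "((\<lambda>s. dt s (x + \<sigma> * t + - \<sigma> * s) + of_real \<sigma> * dx s (x + \<sigma> * t + - \<sigma> * s)) has_vector_derivative
         dtt s (x + \<sigma> * t + - \<sigma> * s) - dxx s (x + \<sigma> * t + - \<sigma> * s)) (at s within {0..B})"
        using pd_chain[OF p sB, of "x + \<sigma> * t" "-\<sigma>"] \<sigma> by (auto simp: algebra_simps)
      then show "((\<lambda>s. dt s (x + \<sigma> * t + - \<sigma> * s) + of_real \<sigma> * dx s (x + \<sigma> * t + - \<sigma> * s)) has_vector_derivative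
         dtt s (x + \<sigma> * t + - \<sigma> * s) - dxx s (x + \<sigma> * t + - \<sigma> * s)) (at s within {0..t})"
        by (rule has_vector_derivative_within_subset) (use t in auto)
      have "cmod (dtt s (x + \<sigma> * t + - \<sigma> * s) - dxx s (x + \<sigma> * t + - \<sigma> * s)) \<le> L * (m * exp (\<Lambda> * s))"
        using Ld[OF inK[OF s]] md[OF inK[OF s]] L
        by (meson dual_order.trans mult_left_mono order_trans zero_le_one)
      then show "cmod (dtt s (x + \<sigma> * t + - \<sigma> * s) - dxx s (x + \<sigma> * t + - \<sigma> * s)) \<le> L * m * exp (\<Lambda> * s)"
        by (simp add: mult_ac)
    next
      have "dt 0 y = 0" for y using i(2) by (simp add: dt_def)
      moreover have "dx 0 y = 0" for y
      proof -
        have "0 \<in> {0..B}" using B by auto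
        from pd_x[OF d(1) this, of y] have "(d 0 has_vector_derivative dx 0 y) (at y)" .
        moreover have "d 0 = (\<lambda>y. 0)" using i(1) by (auto simp: d_def)
        ultimately show ?thesis using vector_derivative_unique_at[OF has_vector_derivative_const] by metis
      qed
      ultimately show "dt 0 (x + \<sigma> * t + - \<sigma> * 0) + of_real \<sigma> * dx 0 (x + \<sigma> * t + - \<sigma> * 0) = 0" by simp
    qed (use \<Lambda> m0 L t in auto)
    then show ?thesis by simp
  qed
  have dtb: "cmod (dt t x) \<le> L * m / \<Lambda> * exp (\<Lambda> * t)" if z: "(t, x) \<in> K" for t x
  proof -
    have "2 * cmod (dt t x) = cmod ((dt t x + of_real 1 * dx t x) + (dt t x + of_real (-1) * dx t x))"
      by (simp add: norm_mult flip: mult_2)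
    also have "\<dots> \<le> cmod (dt t x + of_real 1 * dx t x) + cmod (dt t x + of_real (-1) * dx t x)" by (rule norm_triangle_ineq)
    also have "\<dots> \<le> L * m / \<Lambda> * exp (\<Lambda> * t) + L * m / \<Lambda> * exp (\<Lambda> * t)" by (intro add_mono char z) auto
    finally show ?thesis by simp
  qed
  have "cmod (d t x) \<le> L * m / \<Lambda> / \<Lambda> * exp (\<Lambda> * t)" if z: "(t, x) \<in> K" for t x
  proof (rule exp_growth_bound[where \<phi> = "\<lambda>s. d s x" and \<phi>' = "\<lambda>s. dt s x"])
    fix s assume s: "s \<in> {0..t}"
    have t: "t \<in> {0..B}" using KB[OF z] by simp
    show "((\<lambda>s. d s x) has_vector_derivative dt s x) (at s within {0..t})"
      by (rule has_vector_derivative_within_subset[OF pd_t[OF d(1)]]) (use s t in auto)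
    show "cmod (dt s x) \<le> L * m / \<Lambda> * exp (\<Lambda> * s)"
      by (rule dtb) (use z s in \<open>auto simp: K_def\<close>)
  qed (use \<Lambda> m0 L i z in \<open>auto simp: d_def K_def\<close>)
  from this[of "fst zm" "snd zm"] zm(1)
  have "cmod (d (fst zm) (snd zm)) \<le> L * m / \<Lambda> / \<Lambda> * exp (\<Lambda> * fst zm)" by simp
  then have "m \<le> exp (- \<Lambda> * fst zm) * (L * m / \<Lambda> / \<Lambda> * exp (\<Lambda> * fst zm))"
    unfolding m_def by (intro mult_left_mono) auto
  also have "\<dots> = (L / \<Lambda> / \<Lambda>) * m * (exp (- \<Lambda> * fst zm) * exp (\<Lambda> * fst zm))" by simp
  also have "\<dots> = (L / \<Lambda> / \<Lambda>) * m" by (simp flip: exp_add)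
  also have "\<dots> \<le> 1/4 * m" by (intro mult_right_mono \<Lambda> m0)
  finally have "m = 0" using m0 by simp
  with md[OF \<open>(t0, x0) \<in> K\<close>] show ?thesis by (simp add: d_def)
qed

section \<open>Weighted energy estimates\<close>

lemma gronwall_linear:
  fixes \<Psi> :: "real \<Rightarrow> real"
  assumes D: "\<And>t. t \<in> {a..b} \<Longrightarrow> (\<Psi> has_real_derivative \<Psi>' t) (at t within {a..b})"
    and le: "\<And>t. t \<in> {a..b} \<Longrightarrow> \<Psi>' t \<le> k * \<Psi> t + h" and "k \<ge> 0" "h \<ge> 0" "t \<in> {a..b}"
  shows "\<Psi> t \<le> (\<Psi> a + h * (t - a)) * exp (k * (t - a))"
proof -
  define \<phi> where "\<phi> s = exp (- k * (s - a)) * \<Psi> s - h * (s - a)" for s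
  have \<phi>: "(\<phi> has_real_derivative exp (- k * (s - a)) * \<Psi>' s + exp (- k * (s - a)) * (- k) * \<Psi> s - h) (at s within {a..b})"
    if "s \<in> {a..b}" for s
    unfolding \<phi>_def by (auto intro!: derivative_eq_intros D[OF that])
  let ?\<phi>' = "\<lambda>s. exp (- k * (s - a)) * \<Psi>' s + exp (- k * (s - a)) * (- k) * \<Psi> s - h"
  have I: "(?\<phi>' has_integral \<phi> t - \<phi> a) {a..t}"
  proof (rule fundamental_theorem_of_calculus)
    fix s assume "s \<in> {a..t}"
    then have "s \<in> {a..b}" using assms(5) by auto
    from DERIV_subset[OF \<phi>[OF this], of "{a..t}"] assms(5)
    show "(\<phi> has_vector_derivative ?\<phi>' s) (at s within {a..t})"
      by (auto simp: has_real_derivative_iff_has_vector_derivative)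
  qed (use assms(5) in auto)
  have "\<phi> t - \<phi> a \<le> 0"
  proof (rule has_integral_le[OF I has_integral_0])
    fix s assume s: "s \<in> {a..t}"
    then have s': "s \<in> {a..b}" using assms(5) by auto
    show "?\<phi>' s \<le> 0"
    proof -
      have "exp (- k * (s - a)) * (\<Psi>' s - k * \<Psi> s) \<le> exp (- k * (s - a)) * h"
        using le[OF s'] by (intro mult_left_mono) auto
      also have "\<dots> \<le> 1 * h" using assms(3,4) s by (intro mult_right_mono) auto
      finally show ?thesis by (simp add: algebra_simps)
    qed
  qed
  then have "exp (- k * (t - a)) * \<Psi> t \<le> \<Psi> a + h * (t - a)" by (simp add: \<phi>_def)
  then have "exp (k * (t - a)) * (exp (- k * (t - a)) * \<Psi> t) \<le> exp (k * (t - a)) * (\<Psi> a + h * (t - a))"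
    by (intro mult_left_mono) auto
  then show ?thesis by (simp add: mult_ac flip: exp_add mult.assoc)
qed

text \<open>For a balance law \<open>Dt = Px + s\<close> the flux \<open>P\<close> enters only
  through its values at the two ends, which cancel. The energy identities and both conservation laws
  are instances.\<close>

lemma integral_flux_deriv:
  fixes D :: "real \<Rightarrow> real \<Rightarrow> real"
  assumes "B > 0" "Y \<ge> 0" and D: "pd B D Dt Dx" and P: "pd B P Pt Px"
    and eq: "\<And>t x. t \<in> {0..B} \<Longrightarrow> Dt t x = Px t x + s t x"
    and bdry: "\<And>t. t \<in> {0..B} \<Longrightarrow> P t Y = P t (-Y)" and t: "t \<in> {0..B}"
  shows "((\<lambda>t. integral {-Y..Y} (D t)) has_real_derivative integral {-Y..Y} (s t)) (at t within {0..B})"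
proof -
  have "((\<lambda>t. integral (cbox (-Y) Y) (D t)) has_vector_derivative integral (cbox (-Y) Y) (Dt t)) (at t within {0..B})"
  proof (rule leibniz_rule_vector_derivative)
    show "((\<lambda>t. D t x) has_vector_derivative Dt s x) (at s within {0..B})" if "s \<in> {0..B}" for s x
      by (rule pd_t[OF D that])
    show "D s integrable_on cbox (- Y) Y" if "s \<in> {0..B}" for s
      unfolding box_real by (intro integrable_continuous_real contS_ivl[OF pd_cont(1)[OF D] that])
    show "continuous_on ({0..B} \<times> cbox (- Y) Y) (\<lambda>(x, t). Dt x t)"
      using continuous_on_subset[OF pd_cont(2)[OF D, unfolded contS_def], of "{0..B} \<times> cbox (- Y) Y"]
      by (auto simp: case_prod_beta)
  qed (use t in auto)
  moreover have "integral {-Y..Y} (Dt t) = integral {-Y..Y} (s t)"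
  proof -
    have 1: "(Px t has_integral P t Y - P t (-Y)) {-Y..Y}"
      by (rule fundamental_theorem_of_calculus)
        (use \<open>Y \<ge> 0\<close> in \<open>auto intro: has_vector_derivative_at_within pd_x[OF P t]\<close>)
    have 2: "Dt t integrable_on {-Y..Y}"
      by (intro integrable_continuous_real contS_ivl[OF pd_cont(2)[OF D] t])
    have "((\<lambda>x. Dt t x - Px t x) has_integral integral {-Y..Y} (Dt t) - 0) {-Y..Y}"
      using has_integral_diff[OF integrable_integral[OF 2] 1] bdry[OF t] by simp
    moreover have "(\<lambda>x. Dt t x - Px t x) = s t" using eq[OF t] by auto
    ultimately show ?thesis by (simp add: integral_unique)
  qed
  ultimately show ?thesis by (simp add: has_real_derivative_iff_has_vector_derivative)
qed

lemma contS_integrable: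
  fixes D :: "real \<Rightarrow> real \<Rightarrow> real"
  assumes "contS B D" "t \<in> {0..B}"
  shows "D t integrable_on {a..b}"
  by (intro integrable_continuous_real contS_ivl[OF assms])

lemma pd_vanish:
  fixes f :: "real \<Rightarrow> real \<Rightarrow> complex"
  assumes "pd B f ft fx" "B > 0" "\<And>t x. t \<in> {0..B} \<Longrightarrow> X < \<bar>x\<bar> \<Longrightarrow> f t x = 0" "t \<in> {0..B}" "X < \<bar>x\<bar>"
  shows "ft t x = 0" "fx t x = 0"
proof -
  have "((\<lambda>s. 0) has_vector_derivative ft t x) (at t within {0..B})"
    by (rule has_vector_derivative_transform[OF assms(4) _ pd_t[OF assms(1,4), of x]]) (use assms in auto)
  then show "ft t x = 0"
    using vector_derivative_unique_within_closed_interval[OF assms(2), of t "\<lambda>s. 0" "ft t x" 0] assms(4) by auto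
  have "((\<lambda>y. 0) has_vector_derivative fx t x) (at x)"
  proof (rule has_vector_derivative_transform_within_open[OF pd_x[OF assms(1,4)]])
    show "open {y. X < \<bar>y\<bar>}" by (intro open_Collect_less continuous_intros)
  qed (use assms in auto)
  from vector_derivative_unique_at[OF has_vector_derivative_const this] show "fx t x = 0" by simp
qed

section \<open>A continuously differentiable ramp as moving weight\<close>

lemma has_real_derivative_max_square:
  "((\<lambda>\<sigma>::real. (max 0 \<sigma>)\<^sup>2 / 2) has_real_derivative max 0 \<sigma>) (at \<sigma>)"
proof -
  consider "\<sigma> < 0" | "\<sigma> = 0" | "\<sigma> > 0" by linarith
  then show ?thesis
  proof cases
    case 1
    have "((\<lambda>\<sigma>::real. 0) has_real_derivative max 0 \<sigma>) (at \<sigma>)" using 1 by simp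
    then show ?thesis
      by (rule has_field_derivative_transform_within_open[of _ _ _ "{..<0}"]) (use 1 in auto)
  next
    case 2
    \<comment> \<open>At the kink, Caratheodory's criterion with the continuous factor in (max 0
      z)^2/2 = (max 0 z/2) z.\<close>
    show ?thesis
      unfolding 2 CARAT_DERIV
    proof (intro exI[of _ "\<lambda>z::real. max 0 z / 2"] conjI allI)
      show "isCont (\<lambda>z::real. max 0 z / 2) 0" by (intro continuous_intros) simp
    qed (auto simp: max_def power2_eq_square)
  next
    case 3
    have "((\<lambda>\<sigma>::real. \<sigma>\<^sup>2 / 2) has_real_derivative max 0 \<sigma>) (at \<sigma>)"
      using 3 by (auto intro!: derivative_eq_intros)
    then show ?thesis
      by (rule has_field_derivative_transform_within_open[of _ _ _ "{0<..}"]) (use 3 in auto)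
  qed
qed

text \<open>Zero up to 0, quadratic on [0, 1], then linear with slope 1. A weight in
  \<open>pd\<close> has to be C^1, which excludes max 0 \<sigma> itself; the constant slope 1
  afterwards is what produces decay at a uniform rate everywhere behind the front.\<close>

definition ramp :: "real \<Rightarrow> real" where "ramp \<sigma> = (max 0 \<sigma>)\<^sup>2 / 2 - (max 0 (\<sigma> - 1))\<^sup>2 / 2"
definition ramp' :: "real \<Rightarrow> real" where "ramp' \<sigma> = max 0 \<sigma> - max 0 (\<sigma> - 1)"

lemma ramp_deriv: "(ramp has_real_derivative ramp' \<sigma>) (at \<sigma>)"
proof -
  have 1: "((\<lambda>\<sigma>::real. \<sigma> - 1) has_real_derivative 1) (at \<sigma>)" by (auto intro!: derivative_eq_intros)
  from DERIV_diff[OF has_real_derivative_max_square DERIV_chain2[OF has_real_derivative_max_square 1]]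
  show ?thesis unfolding ramp_def[abs_def] ramp'_def by simp
qed

lemma ramp_nonneg: "ramp \<sigma> \<ge> 0"
proof -
  have "(max 0 (\<sigma> - 1))\<^sup>2 \<le> (max 0 \<sigma>)\<^sup>2" by (intro power_mono) auto
  then show ?thesis by (simp add: ramp_def)
qed

lemma ramp_0: "\<sigma> \<le> 0 \<Longrightarrow> ramp \<sigma> = 0" by (simp add: ramp_def)

lemma ramp'_bounds: "0 \<le> ramp' \<sigma>" "ramp' \<sigma> \<le> 1" "1 \<le> \<sigma> \<Longrightarrow> ramp' \<sigma> = 1"
  by (auto simp: ramp'_def max_def)

lemma ramp'_cont: "continuous_on S ramp'"
  unfolding ramp'_def by (intro continuous_intros)

lemma pd_ramp:
  "pd B (\<lambda>t x. ramp (\<nu> * t - r - \<theta> * x)) (\<lambda>t x. \<nu> * ramp' (\<nu> * t - r - \<theta> * x)) (\<lambda>t x. - \<theta> * ramp' (\<nu> * t - r - \<theta> * x))"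
  unfolding pd_def
proof (intro conjI ballI allI)
  have r: "continuous_on UNIV ramp"
    unfolding ramp_def[abs_def] by (intro continuous_intros) auto
  show "contS B (\<lambda>t x. ramp (\<nu> * t - r - \<theta> * x))" "contS B (\<lambda>t x. \<nu> * ramp' (\<nu> * t - r - \<theta> * x))"
    "contS B (\<lambda>t x. - \<theta> * ramp' (\<nu> * t - r - \<theta> * x))"
    unfolding contS_def
    by (intro continuous_intros continuous_on_compose2[OF r] continuous_on_compose2[OF ramp'_cont[of UNIV]] subset_UNIV)+
  fix t x
  have 1: "((\<lambda>t. \<nu> * t - r - \<theta> * x) has_real_derivative \<nu>) (at t within {0..B})"
    and 2: "((\<lambda>x. \<nu> * t - r - \<theta> * x) has_real_derivative - \<theta>) (at x)"
    by (auto intro!: derivative_eq_intros)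
  show "((\<lambda>s. ramp (\<nu> * s - r - \<theta> * x)) has_vector_derivative \<nu> * ramp' (\<nu> * t - r - \<theta> * x)) (at t within {0..B})"
    using DERIV_chain2[OF ramp_deriv 1] by (simp add: has_real_derivative_iff_has_vector_derivative[symmetric] mult.commute)
  show "((\<lambda>x. ramp (\<nu> * t - r - \<theta> * x)) has_vector_derivative - \<theta> * ramp' (\<nu> * t - r - \<theta> * x)) (at x)"
    using DERIV_chain2[OF ramp_deriv 2] by (simp add: has_real_derivative_iff_has_vector_derivative[symmetric] mult.commute)
qed

text \<open>The derivative of |\<phi>|^2 is 2 \<phi> \<bullet> \<phi>', and \<phi> is orthogonal to
  i\<kappa>\<phi>, so the carrier oscillation drops out and \<phi>' - i\<kappa>\<phi> may replace
  \<phi>'. The parameter \<delta> balances the two integrals when they are of different orders in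
  \<open>eps\<close>.\<close>

lemma sup_le_integral:
  fixes \<phi> :: "real \<Rightarrow> complex"
  assumes D: "\<And>x. (\<phi> has_vector_derivative \<phi>' x) (at x)" and c: "continuous_on UNIV \<phi>" "continuous_on UNIV \<phi>'"
    and z: "\<phi> (-Y) = 0" and x: "x \<in> {-Y..Y}" and \<delta>: "\<delta> > 0"
  shows "(cmod (\<phi> x))\<^sup>2 \<le> \<delta> * integral {-Y..Y} (\<lambda>y. (cmod (\<phi> y))\<^sup>2)
     + integral {-Y..Y} (\<lambda>y. (cmod (\<phi>' y - \<i> * of_real \<kappa> * \<phi> y))\<^sup>2) / \<delta>"
proof -
  let ?D = "\<lambda>y. \<phi>' y - \<i> * of_real \<kappa> * \<phi> y"
  let ?h = "\<lambda>y. \<delta> * (cmod (\<phi> y))\<^sup>2 + (cmod (?D y))\<^sup>2 / \<delta>"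
  have cc: "continuous_on S \<phi>" "continuous_on S \<phi>'" for S using c by (auto intro: continuous_on_subset)
  have 1: "((\<lambda>y. \<phi> y \<bullet> \<phi>' y + \<phi>' y \<bullet> \<phi> y) has_integral \<phi> x \<bullet> \<phi> x - \<phi> (-Y) \<bullet> \<phi> (-Y)) {-Y..x}"
  proof (rule fundamental_theorem_of_calculus)
    show "((\<lambda>y. \<phi> y \<bullet> \<phi> y) has_vector_derivative \<phi> y \<bullet> \<phi>' y + \<phi>' y \<bullet> \<phi> y) (at y within {-Y..x})" for y
      by (rule bounded_bilinear.has_vector_derivative[OF bounded_bilinear_inner
            has_vector_derivative_at_within[OF D] has_vector_derivative_at_within[OF D]])
  qed (use x in auto)
  have h: "?h integrable_on {a..b}" for a b
    by (intro integrable_continuous_real continuous_intros cc) (use \<delta> in auto)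
  have "(cmod (\<phi> x))\<^sup>2 = integral {-Y..x} (\<lambda>y. \<phi> y \<bullet> \<phi>' y + \<phi>' y \<bullet> \<phi> y)"
    using integral_unique[OF 1] z by (simp add: power2_norm_eq_inner)
  also have "\<dots> \<le> integral {-Y..x} ?h"
  proof (rule integral_le)
    fix y
    have "\<phi> y \<bullet> \<phi>' y = \<phi> y \<bullet> ?D y" by (simp add: inner_complex_def algebra_simps)
    also have "\<dots> \<le> cmod (\<phi> y) * cmod (?D y)" by (rule norm_cauchy_schwarz)
    finally have "\<phi> y \<bullet> \<phi>' y + \<phi>' y \<bullet> \<phi> y \<le> 2 * (cmod (\<phi> y) * cmod (?D y))" by (simp add: inner_commute)
    also have "\<dots> \<le> ?h y"
    proof -
      have "0 \<le> (\<delta> * cmod (\<phi> y) - cmod (?D y))\<^sup>2 / \<delta>" using \<delta> by simp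
      also have "\<dots> = ?h y - 2 * (cmod (\<phi> y) * cmod (?D y))" using \<delta> by (simp add: power2_eq_square field_simps)
      finally show ?thesis by simp
    qed
    finally show "\<phi> y \<bullet> \<phi>' y + \<phi>' y \<bullet> \<phi> y \<le> ?h y" .
  qed (use 1 h in auto)
  also have "\<dots> \<le> integral {-Y..Y} ?h"
    by (rule integral_subset_le) (use h x \<delta> in auto)
  also have "\<dots> = \<delta> * integral {-Y..Y} (\<lambda>y. (cmod (\<phi> y))\<^sup>2) + integral {-Y..Y} (\<lambda>y. (cmod (?D y))\<^sup>2) / \<delta>"
  proof -
    have "(\<lambda>y. \<delta> * (cmod (\<phi> y))\<^sup>2) integrable_on {-Y..Y}" "(\<lambda>y. (cmod (?D y))\<^sup>2 / \<delta>) integrable_on {-Y..Y}"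
      by (intro integrable_continuous_real continuous_intros cc; use \<delta> in simp)+
    from integral_add[OF this] show ?thesis by simp
  qed
  finally show ?thesis .
qed

text \<open>Initial energies live on an interval of length 2R/\<open>eps\<close>, however large
  \<open>Y\<close> is; this is where their factor 1/\<open>eps\<close> comes from.\<close>

lemma integral_le_support:
  fixes h :: "real \<Rightarrow> real"
  assumes "continuous_on UNIV h" "\<And>x. h x \<le> A" "\<And>x. r < \<bar>x\<bar> \<Longrightarrow> h x = 0" "0 \<le> r" "r \<le> Y"
  shows "integral {-Y..Y} h \<le> 2 * r * A"
proof -
  have i: "h integrable_on {-r..r}" by (intro integrable_continuous_real continuous_on_subset[OF assms(1)]) auto
  have "(h has_integral integral {-r..r} h) {-Y..Y}"
    by (rule has_integral_on_superset[OF integrable_integral[OF i]]) (use assms(3-5) in auto)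
  then have "integral {-Y..Y} h = integral {-r..r} h" by (rule integral_unique)
  also have "\<dots> \<le> integral {-r..r} (\<lambda>x::real. A)"
    by (rule integral_le) (use i assms(2) in auto)
  finally show ?thesis using assms(4) by simp
qed

text \<open>The source \<open>S\<close> is an arbitrary function, so that one set of energy
  estimates serves the solution, its combinations \<open>D\<close> and \<open>Z\<close>, and the
  differences \<open>R0\<close> and \<open>R1\<close> in the collision. For the flux 2 ft \<bullet>
  fx it is enough that \<open>ft\<close> vanishes at the ends.\<close>

locale linear_kg =
  fixes B Y :: real and f ft fx ftt ftx fxx S :: "real \<Rightarrow> real \<Rightarrow> complex"
  assumes B_pos: "B > 0" and Y_nonneg: "Y \<ge> 0"
    and jet: "jet2 B f ft fx ftt ftx fxx"
    and eqn: "\<And>t x. t \<in> {0..B} \<Longrightarrow> ftt t x - fxx t x + f t x + S t x = 0"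
    and bdry: "\<And>t. t \<in> {0..B} \<Longrightarrow> ft t Y = 0" "\<And>t. t \<in> {0..B} \<Longrightarrow> ft t (-Y) = 0"
begin

definition "e t x = (cmod (ft t x))\<^sup>2 + (cmod (fx t x))\<^sup>2 + (cmod (f t x))\<^sup>2"
definition "E t = integral {-Y..Y} (e t)"

lemma jets: "pd B f ft fx" "pd B ft ftt ftx" "pd B fx ftx fxx"
  using jet by (auto simp: jet2_def)

lemma contS_jets: "contS B f" "contS B ft" "contS B fx"
  using jets pd_cont by blast+

lemma contS_S: "contS B S"
proof (rule contS_cong)
  show "contS B (\<lambda>t x. fxx t x - ftt t x - f t x)"
    using jets pd_cont by (intro contS_diff) blast+
  show "fxx t x - ftt t x - f t x = S t x" if "t \<in> {0..B}" for t x
    using eqn[OF that, of x] by algebra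
qed

lemma contS_e: "contS B e"
  unfolding e_def[abs_def] power2_norm_eq_inner
  by (intro contS_add contS_inner contS_jets)

text \<open>The density \<open>e\<close> has the flux 2 ft \<bullet> fx and loses 2 ft \<bullet> S
  to the source; a weight adds only terms with its own derivatives. For a travelling weight these
  acquire a sign once the flux is tied to the density by a velocity.\<close>

lemma weighted_energy_deriv:
  assumes w: "pd B w wt wx" and t: "t \<in> {0..B}"
  shows "((\<lambda>t. integral {-Y..Y} (\<lambda>x. w t x * e t x)) has_real_derivative
    integral {-Y..Y} (\<lambda>x. wt t x * e t x - 2 * wx t x * (ft t x \<bullet> fx t x) - 2 * w t x * (ft t x \<bullet> S t x))) (at t within {0..B})"
proof (rule integral_flux_deriv[OF B_pos Y_nonneg _ _ _ _ t])
  let ?e = "\<lambda>t x. ft t x \<bullet> ft t x + fx t x \<bullet> fx t x + f t x \<bullet> f t x"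
  have e: "e t x = ?e t x" for t x by (simp add: e_def power2_norm_eq_inner)
  show "pd B (\<lambda>t x. w t x * e t x)
    (\<lambda>t x. w t x * (ft t x \<bullet> ftt t x + ftt t x \<bullet> ft t x + (fx t x \<bullet> ftx t x + ftx t x \<bullet> fx t x) + (f t x \<bullet> ft t x + ft t x \<bullet> f t x)) + wt t x * ?e t x)
    (\<lambda>t x. w t x * (ft t x \<bullet> ftx t x + ftx t x \<bullet> ft t x + (fx t x \<bullet> fxx t x + fxx t x \<bullet> fx t x) + (f t x \<bullet> fx t x + fx t x \<bullet> f t x)) + wx t x * ?e t x)"
    unfolding e by (intro pd_mult pd_add pd_inner w jets)
  show "pd B (\<lambda>t x. w t x * (2 * (ft t x \<bullet> fx t x)))
    (\<lambda>t x. w t x * (2 * (ft t x \<bullet> ftx t x + ftt t x \<bullet> fx t x)) + wt t x * (2 * (ft t x \<bullet> fx t x)))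
    (\<lambda>t x. w t x * (2 * (ft t x \<bullet> fxx t x + ftx t x \<bullet> fx t x)) + wx t x * (2 * (ft t x \<bullet> fx t x)))"
    by (intro pd_mult pd_cmult pd_inner w jets)
  show "w t x * (ft t x \<bullet> ftt t x + ftt t x \<bullet> ft t x + (fx t x \<bullet> ftx t x + ftx t x \<bullet> fx t x) + (f t x \<bullet> ft t x + ft t x \<bullet> f t x)) + wt t x * ?e t x
    = w t x * (2 * (ft t x \<bullet> fxx t x + ftx t x \<bullet> fx t x)) + wx t x * (2 * (ft t x \<bullet> fx t x))
      + (wt t x * e t x - 2 * wx t x * (ft t x \<bullet> fx t x) - 2 * w t x * (ft t x \<bullet> S t x))" if "t \<in> {0..B}" for t x
  proof -
    have s: "S t x = fxx t x - ftt t x - f t x" using eqn[OF that, of x] by algebra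
    show ?thesis
      unfolding e s by (simp add: inner_diff_right inner_commute algebra_simps)
  qed
  show "w t Y * (2 * (ft t Y \<bullet> fx t Y)) = w t (- Y) * (2 * (ft t (- Y) \<bullet> fx t (- Y)))" if "t \<in> {0..B}" for t
    using bdry[OF that] by simp
qed

lemma energy_deriv:
  assumes t: "t \<in> {0..B}"
  shows "(E has_real_derivative integral {-Y..Y} (\<lambda>x. - 2 * (ft t x \<bullet> S t x))) (at t within {0..B})"
  using weighted_energy_deriv[OF pd_const[of B 1] t] by (simp add: E_def[abs_def])

lemma energy_growth:
  assumes \<sigma>: "\<sigma> \<ge> 0" and S: "\<And>t x. t \<in> {0..B} \<Longrightarrow> cmod (S t x) \<le> \<sigma> * cmod (f t x)" and t: "t \<in> {0..B}"
  shows "E t \<le> E 0 * exp (\<sigma> * t)"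
proof -
  have "E t \<le> (E 0 + 0 * (t - 0)) * exp (\<sigma> * (t - 0))"
  proof (rule gronwall_linear[OF energy_deriv])
    fix t assume t: "t \<in> {0..B}"
    have "integral {-Y..Y} (\<lambda>x. - 2 * (ft t x \<bullet> S t x)) \<le> integral {-Y..Y} (\<lambda>x. \<sigma> * e t x)"
    proof (rule integral_le)
      have c1: "contS B (\<lambda>t x. - 2 * (ft t x \<bullet> S t x))" "contS B (\<lambda>t x. \<sigma> * e t x)"
        by (intro contS_cmult contS_inner contS_jets contS_S contS_e)+
      show "(\<lambda>x. - 2 * (ft t x \<bullet> S t x)) integrable_on {-Y..Y}" "(\<lambda>x. \<sigma> * e t x) integrable_on {-Y..Y}"
        using contS_integrable[OF c1(1) t] contS_integrable[OF c1(2) t] by auto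
      fix x
      have "- (ft t x \<bullet> S t x) \<le> cmod (ft t x) * cmod (S t x)"
        using Cauchy_Schwarz_ineq2[of "ft t x" "S t x"] by linarith
      also have "\<dots> \<le> cmod (ft t x) * (\<sigma> * cmod (f t x))" by (intro mult_left_mono S t) auto
      finally have "- 2 * (ft t x \<bullet> S t x) \<le> 2 * (cmod (ft t x) * (\<sigma> * cmod (f t x)))" by linarith
      also have "\<dots> = \<sigma> * (2 * cmod (ft t x) * cmod (f t x))" by algebra
      also have "\<dots> \<le> \<sigma> * e t x"
      proof (rule mult_left_mono[OF _ \<sigma>])
        show "2 * cmod (ft t x) * cmod (f t x) \<le> e t x"
          unfolding e_def using sum_squares_bound[of "cmod (ft t x)" "cmod (f t x)"] zero_le_power2[of "cmod (fx t x)"]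
          by linarith
      qed
      finally show "- 2 * (ft t x \<bullet> S t x) \<le> \<sigma> * e t x" .
    qed
    then show "integral {-Y..Y} (\<lambda>x. - 2 * (ft t x \<bullet> S t x)) \<le> \<sigma> * E t + 0" by (simp add: E_def)
  qed (use \<sigma> t in auto)
  then show ?thesis by simp
qed

end

text \<open>The derivative of \<open>cubic\<close> at u in direction g. Because of the conjugate it
  is linear over the reals only.\<close>

definition bil :: "complex \<Rightarrow> complex \<Rightarrow> complex" where
  "bil u g = 2 * u * cnj u * g + u * u * cnj g"

lemma cmod_bil_le: "cmod (bil u g) \<le> 3 * (cmod u)\<^sup>2 * cmod g"
proof -
  have "cmod (bil u g) \<le> cmod (2 * u * cnj u * g) + cmod (u * u * cnj g)"
    unfolding bil_def by (rule norm_triangle_ineq)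
  also have "\<dots> = 3 * (cmod u)\<^sup>2 * cmod g" by (simp add: norm_mult power2_eq_square)
  finally show ?thesis .
qed

lemma cmod_cubic: "cmod (cubic u) = (cmod u)\<^sup>2 * cmod u"
  by (simp add: cubic_def norm_mult power2_eq_square)

lemma inner_cubic: "cubic u \<bullet> g = (cmod u)\<^sup>2 * (u \<bullet> g)"
  unfolding cubic_eq by (simp add: inner_complex_def algebra_simps)

lemma pd_cubic:
  assumes "pd B u ut ux"
  shows "pd B (\<lambda>t x. cubic (u t x)) (\<lambda>t x. bil (u t x) (ut t x)) (\<lambda>t x. bil (u t x) (ux t x))"
  unfolding cubic_def
  by (rule pd_cong[OF pd_mult[OF pd_mult[OF assms assms] pd_cnj[OF assms]]]) (auto simp: bil_def algebra_simps)

text \<open>Near the carrier frequency both \<open>f\<^sub>t + c f\<^sub>x + \<i> f / \<Omega>\<close> and \<open>f\<^sub>x - \<i> \<kappa> f\<close> are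
  small, so that the energy flux is \<open>c\<close> times the energy density up to these two quantities.
  Along a ramp moving with speed \<open>c / 2\<close> the energy therefore decreases.\<close>

lemma flux_bound:
  fixes f ft fx :: complex and \<kappa> \<Omega> :: real
  assumes \<Omega>: "\<Omega>\<^sup>2 = 1 + \<kappa>\<^sup>2" and \<kappa>: "\<kappa> \<noteq> 0" and c: "c = \<kappa> / \<Omega>"
  defines "Z \<equiv> ft + of_real c * fx + \<i> * of_real (1 / \<Omega>) * f" and "D \<equiv> fx - \<i> * of_real \<kappa> * f"
  shows "\<bar>c\<bar> / 2 * ((cmod ft)\<^sup>2 + (cmod fx)\<^sup>2 + (cmod f)\<^sup>2) + 2 * sgn c * (ft \<bullet> fx)
    \<le> - \<bar>c\<bar> / 2 * \<Omega>\<^sup>2 * (cmod f)\<^sup>2 + (27 / \<bar>c\<bar> + 9 / 2) * ((cmod Z)\<^sup>2 + (cmod D)\<^sup>2)"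
proof -
  have \<Omega>0: "\<Omega> \<noteq> 0"
  proof
    assume "\<Omega> = 0"
    then have "1 + \<kappa>\<^sup>2 = 0" using \<Omega> by simp
    then show False using zero_le_power2[of \<kappa>] by linarith
  qed
  \<comment> \<open>\<open>P\<close> equals ft + i\<Omega>f. Thus the time derivative is the carrier
    value -i\<Omega>f plus the error \<open>P\<close>, just as the space derivative is i\<kappa>f
    plus the error \<open>D\<close>.\<close>
  define P where "P = Z - of_real c * D"
  have c0: "c \<noteq> 0" using \<kappa> \<Omega>0 by (simp add: c)
  have \<kappa>c: "\<kappa> = c * \<Omega>" using \<Omega>0 by (simp add: c)
  have c\<Omega>: "c * \<kappa> + 1 / \<Omega> = \<Omega>"
    using \<Omega> \<Omega>0 by (simp add: c power2_eq_square field_simps)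
  have le: "\<bar>\<kappa>\<bar> \<le> \<bar>\<Omega>\<bar>" using \<Omega> by (simp add: abs_le_square_iff)
  have c1: "\<bar>c\<bar> \<le> 1" using le \<Omega>0 by (simp add: c abs_divide divide_le_eq)
  have ft: "ft = P - \<i> * of_real \<Omega> * f"
  proof -
    have "of_real \<Omega> = (of_real c * of_real \<kappa> + of_real (1 / \<Omega>) :: complex)"
      using arg_cong[OF c\<Omega>, of "of_real :: real \<Rightarrow> complex"] by (simp only: of_real_add of_real_mult)
    then show ?thesis unfolding P_def Z_def D_def by algebra
  qed
  have fx: "fx = D + \<i> * of_real \<kappa> * f" by (simp add: D_def)
  have sc: "sgn c * c = \<bar>c\<bar>" by (simp add: sgn_if)
  define s where "s = sgn c"
  have e: "(cmod ft)\<^sup>2 + (cmod fx)\<^sup>2 + (cmod f)\<^sup>2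
    = (cmod P)\<^sup>2 + (cmod D)\<^sup>2 + (\<Omega>\<^sup>2 + \<kappa>\<^sup>2 + 1) * (cmod f)\<^sup>2 + 2 * (\<kappa> * (D \<bullet> (\<i> * f)) - \<Omega> * (P \<bullet> (\<i> * f)))"
    unfolding ft fx power2_norm_eq_inner by (simp add: inner_complex_def power2_eq_square algebra_simps)
  have fl: "ft \<bullet> fx = P \<bullet> D + \<kappa> * (P \<bullet> (\<i> * f)) - \<Omega> * (D \<bullet> (\<i> * f)) - \<Omega> * \<kappa> * (cmod f)\<^sup>2"
    unfolding ft fx power2_norm_eq_inner by (simp add: inner_complex_def power2_eq_square algebra_simps)
  have "\<bar>c\<bar> / 2 * ((cmod ft)\<^sup>2 + (cmod fx)\<^sup>2 + (cmod f)\<^sup>2) + 2 * s * (ft \<bullet> fx)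
     = \<bar>c\<bar> / 2 * ((cmod P)\<^sup>2 + (cmod D)\<^sup>2) + (\<bar>c\<bar> * \<Omega>\<^sup>2 - 2 * (s * c) * \<Omega>\<^sup>2) * (cmod f)\<^sup>2 + 2 * s * (P \<bullet> D)
       + (2 * s * \<kappa> - \<bar>c\<bar> * \<Omega>) * (P \<bullet> (\<i> * f)) + (\<bar>c\<bar> * \<kappa> - 2 * s * \<Omega>) * (D \<bullet> (\<i> * f))"
  proof -
    have o: "\<Omega>\<^sup>2 + \<kappa>\<^sup>2 + 1 = 2 * \<Omega>\<^sup>2" using \<Omega> by simp
    have k: "\<Omega> * \<kappa> = c * \<Omega>\<^sup>2" by (simp add: \<kappa>c power2_eq_square)
    show ?thesis unfolding e fl o k by (simp add: algebra_simps)
  qed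
  also have "\<dots> \<le> \<bar>c\<bar> / 2 * ((cmod P)\<^sup>2 + (cmod D)\<^sup>2) - \<bar>c\<bar> * \<Omega>\<^sup>2 * (cmod f)\<^sup>2 + 2 * (cmod P * cmod D)
       + 3 * \<bar>\<Omega>\<bar> * (cmod P * cmod f) + 3 * \<bar>\<Omega>\<bar> * (cmod D * cmod f)"
  proof -
    have s1: "\<bar>s\<bar> \<le> 1" by (simp add: s_def sgn_if)
    have b: "a * r \<le> k * m" if "\<bar>a\<bar> \<le> k" "\<bar>r\<bar> \<le> m" for a r k m :: real
    proof -
      have "a * r \<le> \<bar>a\<bar> * \<bar>r\<bar>" by (simp add: abs_mult[symmetric])
      also have "\<dots> \<le> k * m" using that by (intro mult_mono) auto
      finally show ?thesis .
    qed
    have "2 * s * (P \<bullet> D) \<le> 2 * (cmod P * cmod D)"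
      using s1 by (intro b Cauchy_Schwarz_ineq2) (auto simp: abs_mult)
    moreover have "(2 * s * \<kappa> - \<bar>c\<bar> * \<Omega>) * (P \<bullet> (\<i> * f)) \<le> 3 * \<bar>\<Omega>\<bar> * (cmod P * cmod f)"
    proof (rule b)
      have "\<bar>2 * s * \<kappa>\<bar> \<le> 2 * \<bar>\<Omega>\<bar>" using mult_mono[OF s1 le] by (simp add: abs_mult)
      moreover have "\<bar>\<bar>c\<bar> * \<Omega>\<bar> \<le> \<bar>\<Omega>\<bar>" using mult_right_mono[OF c1, of "\<bar>\<Omega>\<bar>"] by (simp add: abs_mult)
      ultimately show "\<bar>2 * s * \<kappa> - \<bar>c\<bar> * \<Omega>\<bar> \<le> 3 * \<bar>\<Omega>\<bar>" by linarith
      show "\<bar>P \<bullet> (\<i> * f)\<bar> \<le> cmod P * cmod f" using Cauchy_Schwarz_ineq2[of P "\<i> * f"] by (simp add: norm_mult)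
    qed
    moreover have "(\<bar>c\<bar> * \<kappa> - 2 * s * \<Omega>) * (D \<bullet> (\<i> * f)) \<le> 3 * \<bar>\<Omega>\<bar> * (cmod D * cmod f)"
    proof (rule b)
      have "\<bar>2 * s * \<Omega>\<bar> \<le> 2 * \<bar>\<Omega>\<bar>" using mult_right_mono[OF s1, of "\<bar>\<Omega>\<bar>"] by (simp add: abs_mult)
      moreover have "\<bar>\<bar>c\<bar> * \<kappa>\<bar> \<le> \<bar>\<Omega>\<bar>" using mult_mono[OF c1 le] by (simp add: abs_mult)
      ultimately show "\<bar>\<bar>c\<bar> * \<kappa> - 2 * s * \<Omega>\<bar> \<le> 3 * \<bar>\<Omega>\<bar>" by linarith
      show "\<bar>D \<bullet> (\<i> * f)\<bar> \<le> cmod D * cmod f" using Cauchy_Schwarz_ineq2[of D "\<i> * f"] by (simp add: norm_mult)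
    qed
    moreover have "(\<bar>c\<bar> * \<Omega>\<^sup>2 - 2 * (s * c) * \<Omega>\<^sup>2) * (cmod f)\<^sup>2 = - \<bar>c\<bar> * \<Omega>\<^sup>2 * (cmod f)\<^sup>2"
      unfolding s_def sc by (simp add: algebra_simps)
    ultimately show ?thesis by linarith
  qed
  also have "\<dots> \<le> - \<bar>c\<bar> / 2 * \<Omega>\<^sup>2 * (cmod f)\<^sup>2 + (9 / \<bar>c\<bar> + 3 / 2) * ((cmod P)\<^sup>2 + (cmod D)\<^sup>2)"
  proof -
    \<comment> \<open>Used for \<open>P\<close> and for \<open>D\<close>, each time spending a
      quarter of |c| \<Omega>^2 |f|^2, so that half of the decay survives.\<close>
    have amgm: "3 * \<bar>\<Omega>\<bar> * (a * cmod f) \<le> \<bar>c\<bar> / 4 * \<Omega>\<^sup>2 * (cmod f)\<^sup>2 + 9 / \<bar>c\<bar> * a\<^sup>2" for a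
    proof -
      have "0 \<le> (\<bar>c\<bar> / 2 * \<bar>\<Omega>\<bar> * cmod f - 3 * a)\<^sup>2 / \<bar>c\<bar>" by simp
      also have "\<dots> = \<bar>c\<bar> / 4 * \<bar>\<Omega>\<bar>\<^sup>2 * (cmod f)\<^sup>2 + 9 / \<bar>c\<bar> * a\<^sup>2 - 3 * \<bar>\<Omega>\<bar> * (a * cmod f)"
        using c0 by (simp add: power2_eq_square field_simps)
      finally show ?thesis by simp
    qed
    have 1: "2 * (cmod P * cmod D) \<le> (cmod P)\<^sup>2 + (cmod D)\<^sup>2" using sum_squares_bound[of "cmod P" "cmod D"] by simp
    have 2: "\<bar>c\<bar> / 2 * ((cmod P)\<^sup>2 + (cmod D)\<^sup>2) \<le> 1 / 2 * ((cmod P)\<^sup>2 + (cmod D)\<^sup>2)"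
      using c1 by (intro mult_right_mono) auto
    show ?thesis using amgm[of "cmod P"] amgm[of "cmod D"] 1 2 by (simp add: algebra_simps)
  qed
  also have "\<dots> \<le> - \<bar>c\<bar> / 2 * \<Omega>\<^sup>2 * (cmod f)\<^sup>2 + (9 / \<bar>c\<bar> + 3 / 2) * (3 * ((cmod Z)\<^sup>2 + (cmod D)\<^sup>2))"
  proof -
    have "cmod P \<le> cmod Z + cmod D"
    proof -
      have "cmod P \<le> cmod Z + cmod (of_real c * D)" unfolding P_def by (rule norm_triangle_ineq4)
      also have "cmod (of_real c * D) \<le> cmod D" using c1 by (simp add: norm_mult mult_left_le_one_le)
      finally show ?thesis by simp
    qed
    then have "(cmod P)\<^sup>2 \<le> (cmod Z + cmod D)\<^sup>2" by (intro power_mono) auto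
    also have "\<dots> \<le> 2 * (cmod Z)\<^sup>2 + 2 * (cmod D)\<^sup>2"
      using sum_squares_bound[of "cmod Z" "cmod D"] by (simp add: power2_sum)
    finally have "(cmod P)\<^sup>2 + (cmod D)\<^sup>2 \<le> 3 * ((cmod Z)\<^sup>2 + (cmod D)\<^sup>2)"
      using zero_le_power2[of "cmod Z"] unfolding distrib_left by linarith
    then show ?thesis by (intro add_left_mono mult_left_mono) auto
  qed
  also have "\<dots> = - \<bar>c\<bar> / 2 * \<Omega>\<^sup>2 * (cmod f)\<^sup>2 + (27 / \<bar>c\<bar> + 9 / 2) * ((cmod Z)\<^sup>2 + (cmod D)\<^sup>2)"
    by (simp add: algebra_simps)
  finally show ?thesis unfolding s_def .
qed

context linear_kg
begin

definition "wgt \<nu> r \<theta> t = integral {-Y..Y} (\<lambda>x. ramp (\<nu> * t - r - \<theta> * x) * e t x)"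

lemma wgt_nonneg: "t \<in> {0..B} \<Longrightarrow> wgt \<nu> r \<theta> t \<ge> 0"
  unfolding wgt_def
  by (intro integral_nonneg contS_integrable[of B "\<lambda>t x. ramp (\<nu> * t - r - \<theta> * x) * e t x"] contS_mult
      pd_cont(1)[OF pd_ramp] contS_e) (auto simp: ramp_nonneg e_def)

text \<open>On the carrier wave the flux 2 ft \<bullet> fx is -c times \<open>e\<close>, while the
  weight advances in the direction of c with speed |c|/2; together they give -|c|/2 times the slope
  times \<open>e\<close>. The error terms in Z and D simply give up the slope, which is at most
  1.\<close>

lemma wgt_deriv:
  assumes \<Omega>: "\<Omega>\<^sup>2 = 1 + \<kappa>\<^sup>2" and \<kappa>: "\<kappa> \<noteq> 0" and c: "c = \<kappa> / \<Omega>"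
    and \<sigma>: "\<sigma> \<ge> 0" and S: "\<And>t x. t \<in> {0..B} \<Longrightarrow> cmod (S t x) \<le> \<sigma> * cmod (f t x)" and t: "t \<in> {0..B}"
  shows "\<exists>w'. (wgt (\<bar>c\<bar> / 2) r (sgn c) has_real_derivative w') (at t within {0..B}) \<and>
    w' \<le> integral {-Y..Y} (\<lambda>x. - \<bar>c\<bar> / 2 * \<Omega>\<^sup>2 * ramp' (\<bar>c\<bar> / 2 * t - r - sgn c * x) * (cmod (f t x))\<^sup>2
       + (27 / \<bar>c\<bar> + 9 / 2) * ((cmod (ft t x + of_real c * fx t x + \<i> * of_real (1 / \<Omega>) * f t x))\<^sup>2 + (cmod (fx t x - \<i> * of_real \<kappa> * f t x))\<^sup>2))
      + \<sigma> * wgt (\<bar>c\<bar> / 2) r (sgn c) t"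
proof -
  let ?w = "\<lambda>t x. ramp (\<bar>c\<bar> / 2 * t - r - sgn c * x)"
  let ?w' = "\<lambda>t x. ramp' (\<bar>c\<bar> / 2 * t - r - sgn c * x)"
  let ?Z = "\<lambda>t x. ft t x + of_real c * fx t x + \<i> * of_real (1 / \<Omega>) * f t x"
  let ?D = "\<lambda>t x. fx t x - \<i> * of_real \<kappa> * f t x"
  let ?g = "\<lambda>t x. - \<bar>c\<bar> / 2 * \<Omega>\<^sup>2 * ?w' t x * (cmod (f t x))\<^sup>2
       + (27 / \<bar>c\<bar> + 9 / 2) * ((cmod (?Z t x))\<^sup>2 + (cmod (?D t x))\<^sup>2)"
  let ?h = "\<lambda>t x. \<bar>c\<bar> / 2 * ?w' t x * e t x - 2 * (- sgn c * ?w' t x) * (ft t x \<bullet> fx t x) - 2 * ?w t x * (ft t x \<bullet> S t x)"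
  have D: "(wgt (\<bar>c\<bar> / 2) r (sgn c) has_real_derivative integral {-Y..Y} (?h t)) (at t within {0..B})"
    unfolding wgt_def[abs_def] by (rule weighted_energy_deriv[OF pd_ramp t])
  have w'c: "contS B ?w'"
    unfolding contS_def by (intro continuous_intros continuous_on_compose2[OF ramp'_cont[of UNIV]]) auto
  have gc: "contS B ?g"
    unfolding power2_norm_eq_inner
    by (intro contS_add contS_mult contS_inner contS_diff contS_const contS_jets w'c)
  have hc: "contS B ?h"
    by (intro contS_diff contS_mult contS_inner contS_const contS_jets contS_e contS_S w'c pd_cont(1)[OF pd_ramp])
  have wc: "contS B (\<lambda>t x. \<sigma> * (?w t x * e t x))"
    by (intro contS_mult contS_const contS_e pd_cont(1)[OF pd_ramp])
  have "integral {-Y..Y} (?h t) \<le> integral {-Y..Y} (\<lambda>x. ?g t x + \<sigma> * (?w t x * e t x))"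
  proof (rule integral_le)
    show "?h t integrable_on {-Y..Y}" by (rule contS_integrable[OF hc t])
    show "(\<lambda>x. ?g t x + \<sigma> * (?w t x * e t x)) integrable_on {-Y..Y}"
      by (rule contS_integrable[OF contS_add[OF gc wc] t])
    fix x
    have 1: "?w' t x * (\<bar>c\<bar> / 2 * e t x + 2 * sgn c * (ft t x \<bullet> fx t x)) \<le> ?g t x"
    proof -
      have "?w' t x * (\<bar>c\<bar> / 2 * e t x + 2 * sgn c * (ft t x \<bullet> fx t x))
        \<le> ?w' t x * (- \<bar>c\<bar> / 2 * \<Omega>\<^sup>2 * (cmod (f t x))\<^sup>2 + (27 / \<bar>c\<bar> + 9 / 2) * ((cmod (?Z t x))\<^sup>2 + (cmod (?D t x))\<^sup>2))"
        unfolding e_def by (intro mult_left_mono flux_bound[OF \<Omega> \<kappa> c] ramp'_bounds)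
      also have "\<dots> = - \<bar>c\<bar> / 2 * \<Omega>\<^sup>2 * ?w' t x * (cmod (f t x))\<^sup>2 + ?w' t x * ((27 / \<bar>c\<bar> + 9 / 2) * ((cmod (?Z t x))\<^sup>2 + (cmod (?D t x))\<^sup>2))"
        by (simp only: distrib_left mult_ac)
      also have "\<dots> \<le> - \<bar>c\<bar> / 2 * \<Omega>\<^sup>2 * ?w' t x * (cmod (f t x))\<^sup>2 + 1 * ((27 / \<bar>c\<bar> + 9 / 2) * ((cmod (?Z t x))\<^sup>2 + (cmod (?D t x))\<^sup>2))"
        by (intro add_left_mono mult_right_mono ramp'_bounds) auto
      finally show ?thesis by simp
    qed
    have "- 2 * (ft t x \<bullet> S t x) \<le> \<sigma> * e t x"
    proof -
      have "- 2 * (ft t x \<bullet> S t x) \<le> 2 * (cmod (ft t x) * cmod (S t x))"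
        using Cauchy_Schwarz_ineq2[of "ft t x" "S t x"] by linarith
      also have "\<dots> \<le> 2 * (cmod (ft t x) * (\<sigma> * cmod (f t x)))" by (intro mult_left_mono S t) auto
      also have "\<dots> = \<sigma> * (2 * cmod (ft t x) * cmod (f t x))" by algebra
      also have "\<dots> \<le> \<sigma> * e t x"
      proof (rule mult_left_mono[OF _ \<sigma>])
        show "2 * cmod (ft t x) * cmod (f t x) \<le> e t x"
          unfolding e_def using sum_squares_bound[of "cmod (ft t x)" "cmod (f t x)"] zero_le_power2[of "cmod (fx t x)"]
          by linarith
      qed
      finally show ?thesis .
    qed
    then have "?w t x * (- 2 * (ft t x \<bullet> S t x)) \<le> ?w t x * (\<sigma> * e t x)"
      by (intro mult_left_mono ramp_nonneg)
    with 1 show "?h t x \<le> ?g t x + \<sigma> * (?w t x * e t x)" by (simp add: algebra_simps)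
  qed
  also have "\<dots> = integral {-Y..Y} (?g t) + \<sigma> * wgt (\<bar>c\<bar> / 2) r (sgn c) t"
    unfolding wgt_def
    using integral_add[OF contS_integrable[OF gc t, of "-Y" Y] contS_integrable[OF wc t, of "-Y" Y]] by simp
  finally show ?thesis using D by blast
qed

end

section \<open>Waves in the moving frame\<close>

lemma jet2_comb:
  fixes \<alpha> \<beta> \<gamma> :: complex
  assumes "jet3 B u ut ux utt utx uxx uttt uttx utxx uxxx"
  shows "jet2 B (\<lambda>t x. \<alpha> * ut t x + \<beta> * ux t x + \<gamma> * u t x) (\<lambda>t x. \<alpha> * utt t x + \<beta> * utx t x + \<gamma> * ut t x)
    (\<lambda>t x. \<alpha> * utx t x + \<beta> * uxx t x + \<gamma> * ux t x) (\<lambda>t x. \<alpha> * uttt t x + \<beta> * uttx t x + \<gamma> * utt t x)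
    (\<lambda>t x. \<alpha> * uttx t x + \<beta> * utxx t x + \<gamma> * utx t x) (\<lambda>t x. \<alpha> * utxx t x + \<beta> * uxxx t x + \<gamma> * uxx t x)"
proof -
  note p = assms[unfolded jet3_def jet2_def]
  show ?thesis unfolding jet2_def
    by (intro conjI pd_add pd_cmult) (use p in auto)
qed

text \<open>Gauge invariance: the directional derivatives of the cubic term and its rotations
  combine to a real-linear function of the differentiated solution.\<close>

lemma bil_comb:
  "of_real \<alpha> * bil u a + of_real \<beta> * bil u b + \<i> * of_real \<gamma> * cubic u
    = bil u (of_real \<alpha> * a + of_real \<beta> * b + \<i> * of_real \<gamma> * u)"
  by (simp add: bil_def cubic_def algebra_simps)

text \<open>The local form of the conservation of \<open>F\<close>, with k = 1/\<Omega>^2: the left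
  side is the time derivative of its density, the right side the x-derivative of a flux. Written
  with DD and DZ, the carrier terms have the form a \<bullet> (i a) = 0 or cancel in pairs.\<close>

lemma moving_frame_identity:
  fixes Z D DD DZ u Zt Zx Dt Dx ut ux :: complex
  assumes "Zt = of_real c * DZ + \<i> * of_real \<Omega> * Z + of_real k * DD - of_real \<mu> * cubic u"
    "Dt = DZ - of_real c * DD - \<i> * of_real \<Omega> * D" "ut = Z - of_real c * D - \<i> * of_real \<Omega> * u"
    "Zx = DZ + \<i> * of_real \<kappa> * Z" "Dx = DD + \<i> * of_real \<kappa> * D" "ux = D + \<i> * of_real \<kappa> * u"
  shows "2 * (Z \<bullet> Zt) + 2 * k * (D \<bullet> Dt) + 2 * \<mu> * ((u \<bullet> u) * (u \<bullet> ut))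
    = 2 * c * (Z \<bullet> Zx) - 2 * c * k * (D \<bullet> Dx) - 2 * c * \<mu> * ((u \<bullet> u) * (u \<bullet> ux)) + 2 * k * (Zx \<bullet> D + Z \<bullet> Dx)"
proof -
  have r: "a \<bullet> (of_real r * b) = r * (a \<bullet> b)" "(of_real r * b) \<bullet> a = r * (b \<bullet> a)"
     "a \<bullet> (\<i> * of_real r * b) = r * (a \<bullet> (\<i> * b))" "(\<i> * of_real r * b) \<bullet> a = - r * (b \<bullet> (\<i> * a))" for a b :: complex and r
    by (simp_all add: inner_complex_def algebra_simps)
  have z: "a \<bullet> (\<i> * a) = 0" for a :: complex by (simp add: inner_complex_def)
  have s: "Z \<bullet> cubic u = (u \<bullet> u) * (u \<bullet> Z)"
    using inner_cubic[of u Z] by (simp add: inner_commute power2_norm_eq_inner)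
  show ?thesis
    unfolding assms
    by (simp only: inner_add_left inner_add_right inner_diff_left inner_diff_right r z s)
      (simp add: inner_commute algebra_simps)
qed

text \<open>Only \<Omega>^2 is fixed: the sign of \<Omega> selects the polarization and with it the
  direction of c = \<kappa>/\<Omega>, so both polarized waves are instances. On exp(i(\<kappa>x -
  \<Omega>t)) both \<open>Z\<close> and \<open>D\<close> vanish.\<close>

locale kg_wave = kg_solution B \<mu> X f g u ut ux utt utx uxx uttt uttx utxx uxxx
  for B \<mu> X f g u ut ux utt utx uxx uttt uttx utxx uxxx +
  fixes \<kappa> \<Omega> :: real
  assumes \<Omega>: "\<Omega>\<^sup>2 = 1 + \<kappa>\<^sup>2" and \<kappa>: "\<kappa> \<noteq> 0" and X_nonneg: "X \<ge> 0"
begin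

definition "c = \<kappa> / \<Omega>"
text \<open>One unit beyond the support, so that the derivatives vanish at the ends of the interval
  too.\<close>

definition "Y = X + 1"
definition "D t x = ux t x - \<i> * of_real \<kappa> * u t x"
definition "Dt t x = utx t x - \<i> * of_real \<kappa> * ut t x"
definition "Dx t x = uxx t x - \<i> * of_real \<kappa> * ux t x"
definition "Dtt t x = uttx t x - \<i> * of_real \<kappa> * utt t x"
definition "Dtx t x = utxx t x - \<i> * of_real \<kappa> * utx t x"
definition "Dxx t x = uxxx t x - \<i> * of_real \<kappa> * uxx t x"
definition "Z t x = ut t x + of_real c * ux t x + \<i> * of_real (1 / \<Omega>) * u t x"
definition "Zt t x = utt t x + of_real c * utx t x + \<i> * of_real (1 / \<Omega>) * ut t x"
definition "Zx t x = utx t x + of_real c * uxx t x + \<i> * of_real (1 / \<Omega>) * ux t x"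
definition "Ztt t x = uttt t x + of_real c * uttx t x + \<i> * of_real (1 / \<Omega>) * utt t x"
definition "Ztx t x = uttx t x + of_real c * utxx t x + \<i> * of_real (1 / \<Omega>) * utx t x"
definition "Zxx t x = utxx t x + of_real c * uxxx t x + \<i> * of_real (1 / \<Omega>) * uxx t x"
definition "DD t x = Dx t x - \<i> * of_real \<kappa> * D t x"
definition "DZ t x = Zx t x - \<i> * of_real \<kappa> * Z t x"

lemma \<Omega>_ge: "1 \<le> \<Omega>\<^sup>2" "\<Omega> \<noteq> 0" "\<bar>c\<bar> \<le> 1" "c \<noteq> 0" "\<bar>\<kappa>\<bar> \<le> \<bar>\<Omega>\<bar>"
proof -
  show 1: "1 \<le> \<Omega>\<^sup>2" using \<Omega> by simp
  then show 0: "\<Omega> \<noteq> 0" by auto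
  show le: "\<bar>\<kappa>\<bar> \<le> \<bar>\<Omega>\<bar>" using \<Omega> by (simp add: abs_le_square_iff)
  then show "\<bar>c\<bar> \<le> 1" using 0 by (simp add: c_def abs_divide divide_le_eq)
  show "c \<noteq> 0" using \<kappa> 0 by (simp add: c_def)
qed

lemma jets: "pd B u ut ux" "pd B ut utt utx" "pd B ux utx uxx" "pd B utt uttt uttx" "pd B utx uttx utxx" "pd B uxx utxx uxxx"
  using jet by (auto simp: jet3_def jet2_def)

lemma vanish:
  assumes "t \<in> {0..B}" "X < \<bar>x\<bar>"
  shows "u t x = 0" "ut t x = 0" "ux t x = 0" "utt t x = 0" "utx t x = 0" "uxx t x = 0"
    "uttx t x = 0" "utxx t x = 0" "uttt t x = 0"
proof -
  have 0: "u t x = 0" if "t \<in> {0..B}" "X < \<bar>x\<bar>" for t x using supp that by auto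
  have 1: "ut t x = 0" "ux t x = 0" if "t \<in> {0..B}" "X < \<bar>x\<bar>" for t x
    by (rule pd_vanish[OF jets(1) B_pos _ that], erule (1) 0)+
  have 2: "utt t x = 0" "utx t x = 0" if "t \<in> {0..B}" "X < \<bar>x\<bar>" for t x
    by (rule pd_vanish[OF jets(2) B_pos _ that], erule (1) 1(1))+
  have 3: "utx t x = 0" "uxx t x = 0" if "t \<in> {0..B}" "X < \<bar>x\<bar>" for t x
    by (rule pd_vanish[OF jets(3) B_pos _ that], erule (1) 1(2))+
  have 4: "uttt t x = 0" "uttx t x = 0" if "t \<in> {0..B}" "X < \<bar>x\<bar>" for t x
    by (rule pd_vanish[OF jets(4) B_pos _ that], erule (1) 2(1))+
  have 5: "uttx t x = 0" "utxx t x = 0" if "t \<in> {0..B}" "X < \<bar>x\<bar>" for t x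
    by (rule pd_vanish[OF jets(5) B_pos _ that], erule (1) 2(2))+
  show "u t x = 0" "ut t x = 0" "ux t x = 0" "utt t x = 0" "utx t x = 0" "uxx t x = 0" "uttx t x = 0" "utxx t x = 0" "uttt t x = 0"
    using 0[OF assms] 1[OF assms] 2[OF assms] 3[OF assms] 4[OF assms] 5[OF assms] by auto
qed

lemma vanish_Y:
  assumes "t \<in> {0..B}" "\<bar>x\<bar> = Y"
  shows "u t x = 0" "ut t x = 0" "ux t x = 0" "utt t x = 0" "utx t x = 0" "uxx t x = 0" "uttx t x = 0"
  using vanish[OF assms(1), of x] assms(2) by (auto simp: Y_def)

lemma eqn_deriv:
  assumes t: "t \<in> {0..B}"
  shows "uttt t x - utxx t x + ut t x + of_real \<mu> * bil (u t x) (ut t x) = 0"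
    "uttx t x - uxxx t x + ux t x + of_real \<mu> * bil (u t x) (ux t x) = 0"
proof -
  have p: "pd B (\<lambda>t x. utt t x - uxx t x + u t x + of_real \<mu> * cubic (u t x))
    (\<lambda>t x. uttt t x - utxx t x + ut t x + of_real \<mu> * bil (u t x) (ut t x))
    (\<lambda>t x. uttx t x - uxxx t x + ux t x + of_real \<mu> * bil (u t x) (ux t x))"
    by (intro pd_add pd_diff pd_cmult pd_cubic jets)
  have "pd B (\<lambda>t x. 0::complex) (\<lambda>t x. uttt t x - utxx t x + ut t x + of_real \<mu> * bil (u t x) (ut t x))
    (\<lambda>t x. uttx t x - uxxx t x + ux t x + of_real \<mu> * bil (u t x) (ux t x))"
    by (rule pd_cong[OF p]) (auto simp: eqn)
  from pd_unique[OF this pd_const B_pos t]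
  show "uttt t x - utxx t x + ut t x + of_real \<mu> * bil (u t x) (ut t x) = 0"
    "uttx t x - uxxx t x + ux t x + of_real \<mu> * bil (u t x) (ux t x) = 0" by auto
qed

text \<open>\<open>ut\<close>, \<open>ux\<close> and i u generate translations and rotations, so
  they solve the equation linearized at u, and so do their combinations with real coefficients.
  \<open>D\<close> and \<open>Z\<close> are the two cases of interest.\<close>

lemma linear_comb:
  "linear_kg B Y (\<lambda>t x. of_real \<alpha> * ut t x + of_real \<beta> * ux t x + \<i> * of_real \<gamma> * u t x)
    (\<lambda>t x. of_real \<alpha> * utt t x + of_real \<beta> * utx t x + \<i> * of_real \<gamma> * ut t x)
    (\<lambda>t x. of_real \<alpha> * utx t x + of_real \<beta> * uxx t x + \<i> * of_real \<gamma> * ux t x)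
    (\<lambda>t x. of_real \<alpha> * uttt t x + of_real \<beta> * uttx t x + \<i> * of_real \<gamma> * utt t x)
    (\<lambda>t x. of_real \<alpha> * uttx t x + of_real \<beta> * utxx t x + \<i> * of_real \<gamma> * utx t x)
    (\<lambda>t x. of_real \<alpha> * utxx t x + of_real \<beta> * uxxx t x + \<i> * of_real \<gamma> * uxx t x)
    (\<lambda>t x. of_real \<mu> * bil (u t x) (of_real \<alpha> * ut t x + of_real \<beta> * ux t x + \<i> * of_real \<gamma> * u t x))"
proof
  show "jet2 B (\<lambda>t x. of_real \<alpha> * ut t x + of_real \<beta> * ux t x + \<i> * of_real \<gamma> * u t x)
    (\<lambda>t x. of_real \<alpha> * utt t x + of_real \<beta> * utx t x + \<i> * of_real \<gamma> * ut t x)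
    (\<lambda>t x. of_real \<alpha> * utx t x + of_real \<beta> * uxx t x + \<i> * of_real \<gamma> * ux t x)
    (\<lambda>t x. of_real \<alpha> * uttt t x + of_real \<beta> * uttx t x + \<i> * of_real \<gamma> * utt t x)
    (\<lambda>t x. of_real \<alpha> * uttx t x + of_real \<beta> * utxx t x + \<i> * of_real \<gamma> * utx t x)
    (\<lambda>t x. of_real \<alpha> * utxx t x + of_real \<beta> * uxxx t x + \<i> * of_real \<gamma> * uxx t x)"
    by (rule jet2_comb[OF jet])
  fix t x assume t: "t \<in> {0..B}"
  show "of_real \<alpha> * uttt t x + of_real \<beta> * uttx t x + \<i> * of_real \<gamma> * utt t x -
      (of_real \<alpha> * utxx t x + of_real \<beta> * uxxx t x + \<i> * of_real \<gamma> * uxx t x) +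
      (of_real \<alpha> * ut t x + of_real \<beta> * ux t x + \<i> * of_real \<gamma> * u t x) +
      of_real \<mu> * bil (u t x) (of_real \<alpha> * ut t x + of_real \<beta> * ux t x + \<i> * of_real \<gamma> * u t x) = 0"
    unfolding bil_comb[symmetric]
    using eqn_deriv[OF t, of x] eqn[OF t, of x] by algebra
next
  fix t assume t: "t \<in> {0..B}"
  have Y: "\<bar>Y\<bar> = Y" "\<bar>-Y\<bar> = Y" using X_nonneg by (auto simp: Y_def)
  show "of_real \<alpha> * utt t Y + of_real \<beta> * utx t Y + \<i> * of_real \<gamma> * ut t Y = 0"
    "of_real \<alpha> * utt t (-Y) + of_real \<beta> * utx t (-Y) + \<i> * of_real \<gamma> * ut t (-Y) = 0"
    using vanish_Y[OF t Y(1)] vanish_Y[OF t Y(2)] by auto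
qed (use B_pos X_nonneg in \<open>auto simp: Y_def\<close>)

sublocale U: linear_kg B Y u ut ux utt utx uxx "\<lambda>t x. of_real \<mu> * cubic (u t x)"
proof
  show "jet2 B u ut ux utt utx uxx" using jet by (simp add: jet3_def)
  fix t assume t: "t \<in> {0..B}"
  have Y: "\<bar>Y\<bar> = Y" "\<bar>-Y\<bar> = Y" using X_nonneg by (auto simp: Y_def)
  show "ut t Y = 0" "ut t (-Y) = 0" using vanish_Y[OF t Y(1)] vanish_Y[OF t Y(2)] by auto
qed (use B_pos X_nonneg eqn in \<open>auto simp: Y_def\<close>)

sublocale DU: linear_kg B Y D Dt Dx Dtt Dtx Dxx "\<lambda>t x. of_real \<mu> * bil (u t x) (D t x)"
  unfolding D_def[abs_def] Dt_def[abs_def] Dx_def[abs_def] Dtt_def[abs_def] Dtx_def[abs_def] Dxx_def[abs_def]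
  using linear_comb[of 0 1 "- \<kappa>"] by simp

sublocale ZU: linear_kg B Y Z Zt Zx Ztt Ztx Zxx "\<lambda>t x. of_real \<mu> * bil (u t x) (Z t x)"
  unfolding Z_def[abs_def] Zt_def[abs_def] Zx_def[abs_def] Ztt_def[abs_def] Ztx_def[abs_def] Zxx_def[abs_def]
  using linear_comb[of 1 c "1 / \<Omega>"] by simp

lemma c\<Omega>: "c * \<Omega> = \<kappa>" "c * \<kappa> + 1 / \<Omega> = \<Omega>"
  using \<Omega> \<Omega>_ge(2) by (auto simp: c_def power2_eq_square field_simps)

lemma c\<Omega>_complex: "of_real c * of_real \<Omega> = (of_real \<kappa> :: complex)"
   "of_real c * of_real \<kappa> + of_real (1 / \<Omega>) = (of_real \<Omega> :: complex)"
   "of_real (1 / \<Omega>) * of_real \<Omega> = (1 :: complex)" "of_real \<Omega> * of_real \<Omega> = (1 + of_real \<kappa> * of_real \<kappa> :: complex)"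
proof -
  note a = arg_cong[where f = complex_of_real] and o = of_real_add of_real_mult of_real_1
  show "of_real c * of_real \<Omega> = (of_real \<kappa> :: complex)" using a[OF c\<Omega>(1)] by (simp only: o)
  show "of_real c * of_real \<kappa> + of_real (1 / \<Omega>) = (of_real \<Omega> :: complex)" using a[OF c\<Omega>(2)] by (simp only: o)
  show "of_real (1 / \<Omega>) * of_real \<Omega> = (1 :: complex)" using \<Omega>_ge(2) by simp
  show "of_real \<Omega> * of_real \<Omega> = (1 + of_real \<kappa> * of_real \<kappa> :: complex)"
    using a[OF \<Omega>[unfolded power2_eq_square]] by (simp only: o)
qed

text \<open>The equations of motion with every x-derivative split into its D-part and the carrier
  part i\<kappa>. Z rotates with +\<Omega> whereas u and D rotate with -\<Omega>: it measures the
  admixture of the opposite polarization.\<close>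

lemma frame_relations:
  assumes t: "t \<in> {0..B}"
  shows "Zt t x = of_real c * DZ t x + \<i> * of_real \<Omega> * Z t x + of_real (1 / \<Omega>\<^sup>2) * DD t x - of_real \<mu> * cubic (u t x)"
    "Dt t x = DZ t x - of_real c * DD t x - \<i> * of_real \<Omega> * D t x"
    "ut t x = Z t x - of_real c * D t x - \<i> * of_real \<Omega> * u t x"
    "Zx t x = DZ t x + \<i> * of_real \<kappa> * Z t x" "Dx t x = DD t x + \<i> * of_real \<kappa> * D t x" "ux t x = D t x + \<i> * of_real \<kappa> * u t x"
proof -
  \<comment> \<open>The real coefficients become complex atoms, so that the ring normalization sees
    no embedding of the reals and uses just the relations \<open>c1\<close> to
    \<open>c4\<close>.\<close>
  define w where "w = complex_of_real (1 / \<Omega>)"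
  define C where "C = complex_of_real c"
  define O1 where "O1 = complex_of_real \<Omega>"
  define k where "k = complex_of_real \<kappa>"
  note r = c\<Omega>_complex[folded w_def C_def O1_def k_def]
  have k2: "of_real (1 / \<Omega>\<^sup>2) = w * w" unfolding w_def by (simp add: power2_eq_square)
  have Ck: "C = k * w"
  proof -
    have "C = C * (w * O1)" by (simp add: r(3))
    also have "\<dots> = (C * O1) * w" by (simp only: mult_ac)
    finally show ?thesis by (simp add: r(1))
  qed
  have c1: "C * C + w * w = 1"
  proof -
    have "C * C + w * w = (1 + k * k) * (w * w)" by (simp add: Ck algebra_simps)
    also have "\<dots> = (w * O1) * (w * O1)" by (simp only: r(4)[symmetric] mult_ac)
    finally show ?thesis by (simp add: r(3))
  qed
  have c2: "O1 - C * k = w" using r(2) by (simp add: algebra_simps)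
  have c3: "C * w - C * C * k + O1 * C - 2 * k * w * w = 0"
  proof -
    have "C * w - C * C * k + O1 * C - 2 * k * w * w = C * w + C * (O1 - C * k) - 2 * k * w * w" by (simp add: algebra_simps)
    then show ?thesis unfolding c2 by (simp add: Ck)
  qed
  have c4: "C * k * w - O1 * w - w * w * k * k = - 1"
    using r(3) by (simp add: Ck mult_ac)
  have "C * DZ t x + \<i> * O1 * Z t x + w * w * DD t x = (C * C + w * w) * uxx t x + C * utx t x + \<i> * (O1 - C * k) * ut t x
      + \<i> * (C * w - C * C * k + O1 * C - 2 * k * w * w) * ux t x + (C * k * w - O1 * w - w * w * k * k) * u t x"
    unfolding DZ_def DD_def Z_def Zx_def D_def Dx_def k2 C_def[symmetric] O1_def[symmetric] k_def[symmetric] w_def[symmetric]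
    by (simp add: algebra_simps)
  also have "\<dots> = uxx t x + C * utx t x + \<i> * w * ut t x - u t x"
    unfolding c1 c2 c3 c4 by simp
  finally show "Zt t x = of_real c * DZ t x + \<i> * of_real \<Omega> * Z t x + of_real (1 / \<Omega>\<^sup>2) * DD t x - of_real \<mu> * cubic (u t x)"
    unfolding Zt_def k2 C_def[symmetric] O1_def[symmetric] k_def[symmetric] w_def[symmetric]
    using eqn[OF t, of x] by algebra
  show "Dt t x = DZ t x - of_real c * DD t x - \<i> * of_real \<Omega> * D t x"
  proof -
    have "DZ t x - C * DD t x - \<i> * O1 * D t x = utx t x - \<i> * k * ut t x
       + \<i> * (w + C * k - O1) * (ux t x - \<i> * k * u t x)"
      unfolding DZ_def DD_def Z_def Zx_def D_def Dx_def C_def[symmetric] O1_def[symmetric] k_def[symmetric] w_def[symmetric]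
      by (simp add: algebra_simps)
    also have "w + C * k - O1 = 0" using r(2) by (simp add: algebra_simps)
    finally show ?thesis unfolding Dt_def C_def[symmetric] O1_def[symmetric] k_def[symmetric] by simp
  qed
  show "ut t x = Z t x - of_real c * D t x - \<i> * of_real \<Omega> * u t x"
  proof -
    have "Z t x - C * D t x - \<i> * O1 * u t x = ut t x + \<i> * (w + C * k - O1) * u t x"
      unfolding Z_def D_def C_def[symmetric] O1_def[symmetric] k_def[symmetric] w_def[symmetric]
      by (simp add: algebra_simps)
    also have "w + C * k - O1 = 0" using r(2) by (simp add: algebra_simps)
    finally show ?thesis unfolding C_def[symmetric] O1_def[symmetric] by simp
  qed
  show "Zx t x = DZ t x + \<i> * of_real \<kappa> * Z t x" "Dx t x = DD t x + \<i> * of_real \<kappa> * D t x" "ux t x = D t x + \<i> * of_real \<kappa> * u t x"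
    by (simp_all add: DZ_def DD_def D_def)
qed

lemma contS_all: "contS B u" "contS B ut" "contS B ux" "contS B D" "contS B Z" "contS B DD" "contS B DZ"
proof -
  show "contS B u" "contS B ut" "contS B ux" "contS B D" "contS B Z"
    using U.contS_jets DU.contS_jets ZU.contS_jets by auto
  show "contS B DD" "contS B DZ"
    unfolding DD_def[abs_def] DZ_def[abs_def]
    by (intro contS_diff contS_mult contS_const DU.contS_jets ZU.contS_jets)+
qed

definition "H t = integral {-Y..Y} (\<lambda>x. U.e t x + \<mu> / 2 * (cmod (u t x))^4)"
definition "F t = integral {-Y..Y} (\<lambda>x. (cmod (Z t x))\<^sup>2 + 1 / \<Omega>\<^sup>2 * (cmod (D t x))\<^sup>2 + \<mu> / 2 * (cmod (u t x))^4)"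

lemma cmod4: "(cmod a)^4 = (a \<bullet> a) * (a \<bullet> a)"
  by (simp add: power2_norm_eq_inner[symmetric] flip: power_add)

lemma const_of_deriv_0:
  assumes "\<And>t. t \<in> {0..B} \<Longrightarrow> (\<phi> has_real_derivative 0) (at t within {0..B})" "t \<in> {0..B}"
  shows "\<phi> t = \<phi> (0::real)"
proof -
  have "\<exists>k. \<forall>x\<in>{0..B}. \<phi> x = k"
    by (rule has_field_derivative_zero_constant) (use assms(1) in auto)
  then show ?thesis using assms(2) by fastforce
qed

lemma H_conserved: "t \<in> {0..B} \<Longrightarrow> H t = H 0"
proof (rule const_of_deriv_0)
  fix t assume t: "t \<in> {0..B}"
  have "((\<lambda>t. integral {-Y..Y} (\<lambda>x. (ut t x \<bullet> ut t x + ux t x \<bullet> ux t x + u t x \<bullet> u t x) + \<mu> / 2 * ((u t x \<bullet> u t x) * (u t x \<bullet> u t x))))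
     has_real_derivative integral {-Y..Y} (\<lambda>x. 0)) (at t within {0..B})"
  proof (rule integral_flux_deriv[OF B_pos U.Y_nonneg _ _ _ _ t])
    show "pd B (\<lambda>t x. (ut t x \<bullet> ut t x + ux t x \<bullet> ux t x + u t x \<bullet> u t x) + \<mu> / 2 * ((u t x \<bullet> u t x) * (u t x \<bullet> u t x)))
       (\<lambda>t x. ((ut t x \<bullet> utt t x + utt t x \<bullet> ut t x) + (ux t x \<bullet> utx t x + utx t x \<bullet> ux t x) + (u t x \<bullet> ut t x + ut t x \<bullet> u t x))
          + \<mu> / 2 * ((u t x \<bullet> u t x) * (u t x \<bullet> ut t x + ut t x \<bullet> u t x) + (u t x \<bullet> ut t x + ut t x \<bullet> u t x) * (u t x \<bullet> u t x)))
       (\<lambda>t x. ((ut t x \<bullet> utx t x + utx t x \<bullet> ut t x) + (ux t x \<bullet> uxx t x + uxx t x \<bullet> ux t x) + (u t x \<bullet> ux t x + ux t x \<bullet> u t x))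
          + \<mu> / 2 * ((u t x \<bullet> u t x) * (u t x \<bullet> ux t x + ux t x \<bullet> u t x) + (u t x \<bullet> ux t x + ux t x \<bullet> u t x) * (u t x \<bullet> u t x)))"
      by (intro pd_add pd_cmult pd_mult pd_inner jets)
    show "pd B (\<lambda>t x. 2 * (ut t x \<bullet> ux t x)) (\<lambda>t x. 2 * (ut t x \<bullet> utx t x + utt t x \<bullet> ux t x)) (\<lambda>t x. 2 * (ut t x \<bullet> uxx t x + utx t x \<bullet> ux t x))"
      by (intro pd_cmult pd_inner jets)
    fix t x assume t: "t \<in> {0..B}"
    have s: "utt t x = uxx t x - u t x - of_real \<mu> * cubic (u t x)"
      using eqn[OF t, of x] by algebra
    have m: "ut t x \<bullet> (of_real \<mu> * cubic (u t x)) = \<mu> * ((u t x \<bullet> u t x) * (u t x \<bullet> ut t x))"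
    proof -
      have "ut t x \<bullet> (of_real \<mu> * cubic (u t x)) = \<mu> * (cubic (u t x) \<bullet> ut t x)"
        by (simp add: inner_complex_def algebra_simps)
      then show ?thesis unfolding inner_cubic power2_norm_eq_inner .
    qed
    show "((ut t x \<bullet> utt t x + utt t x \<bullet> ut t x) + (ux t x \<bullet> utx t x + utx t x \<bullet> ux t x) + (u t x \<bullet> ut t x + ut t x \<bullet> u t x))
          + \<mu> / 2 * ((u t x \<bullet> u t x) * (u t x \<bullet> ut t x + ut t x \<bullet> u t x) + (u t x \<bullet> ut t x + ut t x \<bullet> u t x) * (u t x \<bullet> u t x))
      = 2 * (ut t x \<bullet> uxx t x + utx t x \<bullet> ux t x) + 0"
    proof -
      have "ut t x \<bullet> utt t x = ut t x \<bullet> uxx t x - ut t x \<bullet> u t x - \<mu> * ((u t x \<bullet> u t x) * (u t x \<bullet> ut t x))"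
        unfolding s inner_diff_right m ..
      then show ?thesis by (simp add: inner_commute algebra_simps)
    qed
  qed (use U.bdry in auto)
  then show "(H has_real_derivative 0) (at t within {0..B})"
    unfolding H_def[abs_def] U.e_def cmod4 power2_norm_eq_inner by simp
qed

text \<open>Expanding the squares with c^2 + 1/\<Omega>^2 = 1 cancels the products ux \<bullet> (i
  u) and leaves \<open>H\<close> + 2c \<integral> ut \<bullet> ux + (2/\<Omega>) \<integral> ut
  \<bullet> (i u). The grouping into squares of Z and D displays the positivity that the a priori
  bounds exploit.\<close>

lemma F_conserved: "t \<in> {0..B} \<Longrightarrow> F t = F 0"
proof (rule const_of_deriv_0)
  fix t assume t: "t \<in> {0..B}"
  let ?k = "1 / \<Omega>\<^sup>2"
  have "((\<lambda>t. integral {-Y..Y} (\<lambda>x. Z t x \<bullet> Z t x + ?k * (D t x \<bullet> D t x) + \<mu> / 2 * ((u t x \<bullet> u t x) * (u t x \<bullet> u t x))))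
     has_real_derivative integral {-Y..Y} (\<lambda>x. 0)) (at t within {0..B})"
  proof (rule integral_flux_deriv[OF B_pos U.Y_nonneg _ _ _ _ t])
    show "pd B (\<lambda>t x. Z t x \<bullet> Z t x + ?k * (D t x \<bullet> D t x) + \<mu> / 2 * ((u t x \<bullet> u t x) * (u t x \<bullet> u t x)))
       (\<lambda>t x. (Z t x \<bullet> Zt t x + Zt t x \<bullet> Z t x) + ?k * (D t x \<bullet> Dt t x + Dt t x \<bullet> D t x)
          + \<mu> / 2 * ((u t x \<bullet> u t x) * (u t x \<bullet> ut t x + ut t x \<bullet> u t x) + (u t x \<bullet> ut t x + ut t x \<bullet> u t x) * (u t x \<bullet> u t x)))
       (\<lambda>t x. (Z t x \<bullet> Zx t x + Zx t x \<bullet> Z t x) + ?k * (D t x \<bullet> Dx t x + Dx t x \<bullet> D t x)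
          + \<mu> / 2 * ((u t x \<bullet> u t x) * (u t x \<bullet> ux t x + ux t x \<bullet> u t x) + (u t x \<bullet> ux t x + ux t x \<bullet> u t x) * (u t x \<bullet> u t x)))"
      by (intro pd_add pd_cmult pd_mult pd_inner jets DU.jets ZU.jets)
    show "pd B (\<lambda>t x. c * (Z t x \<bullet> Z t x) - c * ?k * (D t x \<bullet> D t x) - c * (\<mu> / 2) * ((u t x \<bullet> u t x) * (u t x \<bullet> u t x)) + 2 * ?k * (Z t x \<bullet> D t x))
       (\<lambda>t x. c * (Z t x \<bullet> Zt t x + Zt t x \<bullet> Z t x) - c * ?k * (D t x \<bullet> Dt t x + Dt t x \<bullet> D t x)
          - c * (\<mu> / 2) * ((u t x \<bullet> u t x) * (u t x \<bullet> ut t x + ut t x \<bullet> u t x) + (u t x \<bullet> ut t x + ut t x \<bullet> u t x) * (u t x \<bullet> u t x))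
          + 2 * ?k * (Z t x \<bullet> Dt t x + Zt t x \<bullet> D t x))
       (\<lambda>t x. c * (Z t x \<bullet> Zx t x + Zx t x \<bullet> Z t x) - c * ?k * (D t x \<bullet> Dx t x + Dx t x \<bullet> D t x)
          - c * (\<mu> / 2) * ((u t x \<bullet> u t x) * (u t x \<bullet> ux t x + ux t x \<bullet> u t x) + (u t x \<bullet> ux t x + ux t x \<bullet> u t x) * (u t x \<bullet> u t x))
          + 2 * ?k * (Z t x \<bullet> Dx t x + Zx t x \<bullet> D t x))"
      by (intro pd_add pd_diff pd_cmult pd_mult pd_inner jets DU.jets ZU.jets)
    fix t x assume t: "t \<in> {0..B}"
    show "(Z t x \<bullet> Zt t x + Zt t x \<bullet> Z t x) + ?k * (D t x \<bullet> Dt t x + Dt t x \<bullet> D t x)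
          + \<mu> / 2 * ((u t x \<bullet> u t x) * (u t x \<bullet> ut t x + ut t x \<bullet> u t x) + (u t x \<bullet> ut t x + ut t x \<bullet> u t x) * (u t x \<bullet> u t x))
      = c * (Z t x \<bullet> Zx t x + Zx t x \<bullet> Z t x) - c * ?k * (D t x \<bullet> Dx t x + Dx t x \<bullet> D t x)
          - c * (\<mu> / 2) * ((u t x \<bullet> u t x) * (u t x \<bullet> ux t x + ux t x \<bullet> u t x) + (u t x \<bullet> ux t x + ux t x \<bullet> u t x) * (u t x \<bullet> u t x))
          + 2 * ?k * (Z t x \<bullet> Dx t x + Zx t x \<bullet> D t x) + 0"
      using moving_frame_identity[OF frame_relations[OF t, of x]]
      by (simp add: inner_commute algebra_simps)
  next
    fix t assume t: "t \<in> {0..B}"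
    have Y: "\<bar>Y\<bar> = Y" "\<bar>-Y\<bar> = Y" using X_nonneg by (auto simp: Y_def)
    show "c * (Z t Y \<bullet> Z t Y) - c * ?k * (D t Y \<bullet> D t Y) - c * (\<mu> / 2) * ((u t Y \<bullet> u t Y) * (u t Y \<bullet> u t Y)) + 2 * ?k * (Z t Y \<bullet> D t Y)
      = c * (Z t (-Y) \<bullet> Z t (-Y)) - c * ?k * (D t (-Y) \<bullet> D t (-Y)) - c * (\<mu> / 2) * ((u t (-Y) \<bullet> u t (-Y)) * (u t (-Y) \<bullet> u t (-Y))) + 2 * ?k * (Z t (-Y) \<bullet> D t (-Y))"
      using vanish_Y[OF t Y(1)] vanish_Y[OF t Y(2)] by (simp add: Z_def D_def)
  qed
  then show "(F has_real_derivative 0) (at t within {0..B})"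
    unfolding F_def[abs_def] cmod4 power2_norm_eq_inner by simp
qed

end

section \<open>A priori bounds for polarized waves\<close>

definition sqn :: "real \<Rightarrow> (real \<Rightarrow> real \<Rightarrow> complex) \<Rightarrow> real \<Rightarrow> real" where
  "sqn Y \<phi> t = integral {-Y..Y} (\<lambda>x. (cmod (\<phi> t x))\<^sup>2)"

lemma contS_sq: "contS B \<phi> \<Longrightarrow> contS B (\<lambda>t x. (cmod (\<phi> t x))\<^sup>2)"
  unfolding power2_norm_eq_inner by (rule contS_inner)

lemma contS_integral_mono:
  fixes g h :: "real \<Rightarrow> real \<Rightarrow> real"
  assumes "contS B g" "contS B h" "t \<in> {0..B}" "\<And>x. g t x \<le> h t x"
  shows "integral {a..b} (g t) \<le> integral {a..b} (h t)"
  by (rule integral_le) (use assms contS_integrable[OF assms(1,3)] contS_integrable[OF assms(2,3)] in auto)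

lemma contS_integral_lin:
  fixes g h :: "real \<Rightarrow> real \<Rightarrow> real"
  assumes "contS B g" "contS B h" "t \<in> {0..B}"
  shows "integral {a..b} (\<lambda>x. p * g t x + q * h t x) = p * integral {a..b} (g t) + q * integral {a..b} (h t)"
proof -
  have "(\<lambda>x. p * g t x) integrable_on {a..b}" "(\<lambda>x. q * h t x) integrable_on {a..b}"
    using contS_integrable[OF contS_cmult[OF assms(1)] assms(3)] contS_integrable[OF contS_cmult[OF assms(2)] assms(3)] by auto
  from integral_add[OF this] show ?thesis by simp
qed

lemma sqn_nonneg: "contS B \<phi> \<Longrightarrow> t \<in> {0..B} \<Longrightarrow> sqn Y \<phi> t \<ge> 0"
  unfolding sqn_def by (intro integral_nonneg contS_integrable[OF contS_sq]) auto

lemma (in linear_kg) sqn_le_E: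
  assumes "t \<in> {0..B}"
  shows "sqn Y f t \<le> E t" "sqn Y fx t \<le> E t" "sqn Y ft t \<le> E t" "0 \<le> E t"
  unfolding sqn_def E_def
  by (intro contS_integral_mono[OF contS_sq contS_e assms] contS_jets; simp add: e_def)+
    (intro integral_nonneg contS_integrable[OF contS_e assms]; simp add: e_def)

lemma (in kg_wave) sup_bound:
  assumes t: "t \<in> {0..B}" and \<delta>: "\<delta> > 0"
  shows "(cmod (u t x))\<^sup>2 \<le> \<delta> * sqn Y u t + sqn Y D t / \<delta>"
    and "(cmod (D t x))\<^sup>2 \<le> \<delta> * sqn Y D t + sqn Y DD t / \<delta>"
proof -
  have Y: "\<bar>-Y\<bar> = Y" using X_nonneg by (auto simp: Y_def)
  have nn: "0 \<le> \<delta> * sqn Y u t + sqn Y D t / \<delta>" "0 \<le> \<delta> * sqn Y D t + sqn Y DD t / \<delta>"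
    using sqn_nonneg[OF contS_all(1) t] sqn_nonneg[OF contS_all(4) t] sqn_nonneg[OF contS_all(6) t] \<delta> by auto
  show "(cmod (u t x))\<^sup>2 \<le> \<delta> * sqn Y u t + sqn Y D t / \<delta>"
  proof (cases "x \<in> {-Y..Y}")
    case True
    show ?thesis unfolding sqn_def D_def
      by (rule sup_le_integral[OF pd_x[OF jets(1) t] contS_ivl[OF contS_all(1) t] contS_ivl[OF contS_all(3) t] _ True \<delta>])
        (rule vanish_Y[OF t Y])
  next
    case False
    then have "u t x = 0" using vanish(1)[OF t, of x] by (auto simp: Y_def)
    then show ?thesis using nn by simp
  qed
  show "(cmod (D t x))\<^sup>2 \<le> \<delta> * sqn Y D t + sqn Y DD t / \<delta>"
  proof (cases "x \<in> {-Y..Y}")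
    case True
    show ?thesis unfolding sqn_def DD_def
    proof (rule sup_le_integral[OF pd_x[OF DU.jets(1) t] contS_ivl[OF contS_all(4) t] contS_ivl[OF DU.contS_jets(3) t] _ True \<delta>])
      show "D t (-Y) = 0" using vanish_Y[OF t Y] by (simp add: D_def)
    qed
  next
    case False
    then have "D t x = 0" using vanish(1,3)[OF t, of x] by (auto simp: Y_def D_def)
    then show ?thesis using nn by simp
  qed
qed

text \<open>\<open>M\<close> is the bootstrap bound: with |\<mu>| M^2 \<le> 1 the quartic energy is
  at most half of the quadratic one, for either sign of \<open>lam\<close>. \<open>A\<close> and
  \<open>R\<close> measure the profile in the original variables; the powers of \<open>eps\<close>
  are written out.\<close>

locale polarized = kg_wave B \<mu> X f g u ut ux utt utx uxx uttt uttx utxx uxxx \<kappa> \<Omega>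
  for B \<mu> X f g u ut ux utt utx uxx uttt uttx utxx uxxx \<kappa> \<Omega> +
  fixes lam T eps A R M :: real
  assumes eps: "0 < eps" "eps \<le> 1" and lam: "lam \<noteq> 0" and \<mu>: "\<mu> = eps\<^sup>2 * lam" and BT: "eps\<^sup>2 * B \<le> T" and T: "T > 0"
    and A: "A > 0" and R: "R > 0" "R / eps \<le> X"
    and M: "\<bar>\<mu>\<bar> * M\<^sup>2 \<le> 1" "\<And>t x. t \<in> {0..B} \<Longrightarrow> cmod (u t x) \<le> M"
    and i1: "\<And>x. cmod (u 0 x) \<le> A" "\<And>x. cmod (ut 0 x) \<le> A" "\<And>x. cmod (ux 0 x) \<le> A"
    and i2: "\<And>x. cmod (D 0 x) \<le> A * eps" "\<And>x. cmod (DD 0 x) \<le> A * eps\<^sup>2"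
    and i3: "\<And>x. Z 0 x = 0"
    and i4: "\<And>x. R / eps \<le> \<bar>x\<bar> \<Longrightarrow> u 0 x = 0"
begin

text \<open>None of these constants contains \<open>eps\<close>, \<open>B\<close> or
  \<open>M\<close>. Because \<open>K2\<close> is free of \<open>M\<close>, a bound M above its
  square root can be chosen afterwards, which closes the bootstrap.\<close>

definition "C1 = 18 * R * A\<^sup>2"
definition "C2' = 2 * R * A\<^sup>2 / \<Omega>\<^sup>2 + \<bar>lam\<bar> * R * A^4 + lam\<^sup>2 * C1^3 * \<Omega>\<^sup>2 / 2"
definition "C2 = 2 * \<Omega>\<^sup>2 * C2'"
definition "K2 = C1 + C2"
definition "C3 = 2 * R * (A + \<bar>lam\<bar> * A^3)\<^sup>2 * exp (3 * \<bar>lam\<bar> * K2 * T)"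
definition "C4 = 4 * \<Omega>^4 * (C3 + lam\<^sup>2 * K2\<^sup>2 * C1)"
definition "C5 = C4 + 2 * \<Omega>\<^sup>2 * C3"

lemma zero_in: "0 \<in> {0..B}" using B_pos by auto

lemma Y_ge: "R / eps \<le> Y" "0 \<le> R / eps" using R eps by (auto simp: Y_def)

lemma init_zero:
  assumes "R / eps < \<bar>x\<bar>"
  shows "u 0 x = 0" "ux 0 x = 0" "uxx 0 x = 0" "ut 0 x = 0" "D 0 x = 0" "DD 0 x = 0" "Z 0 x = 0"
proof -
  have u: "u 0 x = 0" if "R / eps < \<bar>x\<bar>" for x using i4 that by auto
  have ux: "ux 0 x = 0" if "R / eps < \<bar>x\<bar>" for x
    by (rule deriv_zero_outside[OF pd_x[OF jets(1) zero_in] i4 that])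
  obtain r where r: "R / eps < r" "r < \<bar>x\<bar>" using assms dense by blast
  show uxx: "uxx 0 x = 0"
    by (rule deriv_zero_outside[OF pd_x[OF jets(3) zero_in] _ r(2)]) (use ux r in auto)
  show "D 0 x = 0" "DD 0 x = 0" "Z 0 x = 0"
    using u[OF assms] ux[OF assms] uxx i3 by (auto simp: D_def DD_def Dx_def)
  then show "ut 0 x = 0" using frame_relations(3)[OF zero_in, of x] u[OF assms] by simp
  show "u 0 x = 0" "ux 0 x = 0" using u[OF assms] ux[OF assms] by auto
qed

lemma E_bound:
  assumes t: "t \<in> {0..B}"
  shows "U.E t \<le> C1 / eps"
proof -
  have c4: "contS B (\<lambda>t x. (cmod (u t x))^4)"
    unfolding cmod4 by (intro contS_mult contS_inner contS_all)
  have half: "\<bar>\<mu> / 2 * (cmod (u t x))^4\<bar> \<le> 1/2 * U.e t x" if "t \<in> {0..B}" for t x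
  proof -
    have "\<bar>\<mu> / 2 * (cmod (u t x))^4\<bar> = 1/2 * (\<bar>\<mu>\<bar> * (cmod (u t x))\<^sup>2) * (cmod (u t x))\<^sup>2"
      by (simp add: abs_mult power2_eq_square power4_eq_xxxx)
    also have "\<dots> \<le> 1/2 * 1 * (cmod (u t x))\<^sup>2"
    proof (intro mult_right_mono mult_left_mono)
      have "\<bar>\<mu>\<bar> * (cmod (u t x))\<^sup>2 \<le> \<bar>\<mu>\<bar> * M\<^sup>2"
        by (intro mult_left_mono power_mono M that) auto
      then show "\<bar>\<mu>\<bar> * (cmod (u t x))\<^sup>2 \<le> 1" using M(1) by linarith
    qed auto
    also have "\<dots> \<le> 1/2 * U.e t x" by (simp add: U.e_def)
    finally show ?thesis .
  qed
  have H: "H t = U.E t + \<mu> / 2 * integral {-Y..Y} (\<lambda>x. (cmod (u t x))^4)" if "t \<in> {0..B}" for t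
    unfolding H_def U.E_def using contS_integral_lin[OF U.contS_e c4 that, where p=1 and q="\<mu> / 2"] by simp
  have q: "\<bar>\<mu> / 2 * integral {-Y..Y} (\<lambda>x. (cmod (u t x))^4)\<bar> \<le> 1/2 * U.E t" if "t \<in> {0..B}" for t
  proof -
    have a: "integral {-Y..Y} (\<lambda>x. \<mu> / 2 * (cmod (u t x))^4) \<le> integral {-Y..Y} (\<lambda>x. 1/2 * U.e t x)"
      by (rule contS_integral_mono[OF contS_cmult[OF c4] contS_cmult[OF U.contS_e] that])
        (use half[OF that] in \<open>simp only: abs_le_iff mult_minus_left\<close>)
    have b: "integral {-Y..Y} (\<lambda>x. - (\<mu> / 2) * (cmod (u t x))^4) \<le> integral {-Y..Y} (\<lambda>x. 1/2 * U.e t x)"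
      by (rule contS_integral_mono[OF contS_cmult[OF c4] contS_cmult[OF U.contS_e] that])
        (use half[OF that] in \<open>simp only: abs_le_iff mult_minus_left\<close>)
    have e: "integral {-Y..Y} (\<lambda>x. 1/2 * U.e t x) = 1/2 * U.E t" by (simp add: U.E_def)
    have j: "integral {-Y..Y} (\<lambda>x. s * (cmod (u t x))^4) = s * integral {-Y..Y} (\<lambda>x. (cmod (u t x))^4)" for s by simp
    show ?thesis using a b unfolding e j abs_le_iff by simp
  qed
  have E0: "U.E 0 \<le> 2 * (R / eps) * (3 * A\<^sup>2)"
    unfolding U.E_def
  proof (rule integral_le_support[OF contS_ivl[OF U.contS_e zero_in] _ _ Y_ge(2,1)])
    fix x
    have "(cmod (ut 0 x))\<^sup>2 \<le> A\<^sup>2" "(cmod (ux 0 x))\<^sup>2 \<le> A\<^sup>2" "(cmod (u 0 x))\<^sup>2 \<le> A\<^sup>2"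
      by (intro power_mono i1 norm_ge_zero)+
    then show "U.e 0 x \<le> 3 * A\<^sup>2" by (simp add: U.e_def)
    show "U.e 0 x = 0" if "R / eps < \<bar>x\<bar>" using init_zero[OF that] by (simp add: U.e_def)
  qed
  \<comment> \<open>1/2 E \<le> H \<le> 3/2 E, hence the factor 3; the initial density is at most 3
    A^2 on a length 2R/\<open>eps\<close>, which makes 18 R A^2/\<open>eps\<close>.\<close>
  have "1/2 * U.E t \<le> H t" using H[OF t] q[OF t] unfolding abs_le_iff by linarith
  also have "\<dots> = H 0" by (rule H_conserved[OF t])
  also have "\<dots> \<le> 3/2 * U.E 0" using H[OF zero_in] q[OF zero_in] unfolding abs_le_iff by linarith
  finally have "U.E t \<le> 3 * U.E 0" by simp
  also have "\<dots> \<le> 3 * (2 * (R / eps) * (3 * A\<^sup>2))" using E0 by simp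
  also have "\<dots> = C1 / eps" by (simp add: C1_def)
  finally show ?thesis .
qed

lemma C1_pos: "C1 > 0" using R A by (simp add: C1_def)

lemma C2'_nonneg: "C2' \<ge> 0"
  unfolding C2'_def using R A C1_pos by (intro add_nonneg_nonneg) auto

lemma u_sqn: "t \<in> {0..B} \<Longrightarrow> sqn Y u t \<le> C1 / eps"
  using U.sqn_le_E(1) E_bound by fastforce

text \<open>The quartic part of \<open>F\<close> has no definite sign. It is bounded by sup |u|^2
  times the mass, and the sup again by the mass and the L^2 norm of D; the latter has to be absorbed
  on the left.\<close>

lemma F_bound:
  assumes t: "t \<in> {0..B}"
  shows "sqn Y Z t \<le> C2 * eps" "sqn Y D t \<le> C2 * eps"
proof -
  have c4: "contS B (\<lambda>t x. (cmod (u t x))^4)"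
    unfolding cmod4 by (intro contS_mult contS_inner contS_all)
  have cZ: "contS B (\<lambda>t x. (cmod (Z t x))\<^sup>2)" and cD: "contS B (\<lambda>t x. (cmod (D t x))\<^sup>2)"
    by (intro contS_sq contS_all)+
  define J where "J t = integral {-Y..Y} (\<lambda>x. (cmod (u t x))^4)" for t
  have F: "F t = sqn Y Z t + 1 / \<Omega>\<^sup>2 * sqn Y D t + \<mu> / 2 * J t" if "t \<in> {0..B}" for t
  proof -
    have "F t = integral {-Y..Y} (\<lambda>x. 1 * ((cmod (Z t x))\<^sup>2 + 1 / \<Omega>\<^sup>2 * (cmod (D t x))\<^sup>2) + \<mu> / 2 * (cmod (u t x))^4)"
      by (simp add: F_def)
    also have "\<dots> = integral {-Y..Y} (\<lambda>x. 1 * (cmod (Z t x))\<^sup>2 + 1 / \<Omega>\<^sup>2 * (cmod (D t x))\<^sup>2) + \<mu> / 2 * J t"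
      unfolding J_def using contS_integral_lin[OF contS_add[OF cZ contS_cmult[where x = "1 / \<Omega>\<^sup>2", OF cD]] c4 that, where p=1 and q="\<mu> / 2"] by simp
    finally show ?thesis unfolding sqn_def contS_integral_lin[OF cZ cD that] by simp
  qed
  have F0: "F 0 \<le> 2 * (R / eps) * (A\<^sup>2 * eps\<^sup>2 / \<Omega>\<^sup>2 + eps\<^sup>2 * \<bar>lam\<bar> / 2 * A^4)"
    unfolding F_def
  proof (rule integral_le_support[OF _ _ _ Y_ge(2,1)])
    show "continuous_on UNIV (\<lambda>x. (cmod (Z 0 x))\<^sup>2 + 1 / \<Omega>\<^sup>2 * (cmod (D 0 x))\<^sup>2 + \<mu> / 2 * (cmod (u 0 x))^4)"
      by (rule contS_ivl[OF contS_add[OF contS_add[OF cZ contS_cmult[OF cD]] contS_cmult[OF c4]] zero_in])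
    fix x
    have "(cmod (D 0 x))\<^sup>2 \<le> (A * eps)\<^sup>2" by (intro power_mono i2) auto
    then have "1 / \<Omega>\<^sup>2 * (cmod (D 0 x))\<^sup>2 \<le> 1 / \<Omega>\<^sup>2 * (A * eps)\<^sup>2" by (intro mult_left_mono) auto
    moreover have "\<mu> / 2 * (cmod (u 0 x))^4 \<le> eps\<^sup>2 * \<bar>lam\<bar> / 2 * A^4"
      unfolding \<mu> by (intro mult_mono power_mono i1 divide_right_mono mult_left_mono) auto
    ultimately show "(cmod (Z 0 x))\<^sup>2 + 1 / \<Omega>\<^sup>2 * (cmod (D 0 x))\<^sup>2 + \<mu> / 2 * (cmod (u 0 x))^4
      \<le> A\<^sup>2 * eps\<^sup>2 / \<Omega>\<^sup>2 + eps\<^sup>2 * \<bar>lam\<bar> / 2 * A^4"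
      by (simp add: i3 power_mult_distrib)
    show "(cmod (Z 0 x))\<^sup>2 + 1 / \<Omega>\<^sup>2 * (cmod (D 0 x))\<^sup>2 + \<mu> / 2 * (cmod (u 0 x))^4 = 0" if "R / eps < \<bar>x\<bar>"
      using init_zero[OF that] by simp
  qed
  define P where "P = sqn Y u t"
  define q where "q = sqn Y D t"
  have P: "0 \<le> P" "P \<le> C1 / eps" unfolding P_def by (rule sqn_nonneg[OF contS_all(1) t], rule u_sqn[OF t])
  have q: "0 \<le> q" unfolding q_def by (rule sqn_nonneg[OF contS_all(4) t])
  have z: "0 \<le> sqn Y Z t" by (rule sqn_nonneg[OF contS_all(5) t])
  \<comment> \<open>Chosen so that the part of the quartic term with q is exactly q/(2\<Omega>^2),
    half of the positive term in \<open>F\<close>, while the other part remains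
    O(\<open>eps\<close>).\<close>
  define \<delta> where "\<delta> = eps * \<bar>lam\<bar> * C1 * \<Omega>\<^sup>2"
  have \<delta>: "\<delta> > 0" using eps lam C1_pos \<Omega>_ge by (simp add: \<delta>_def)
  have J: "J t \<le> (\<delta> * P + q / \<delta>) * P"
  proof -
    have "J t \<le> integral {-Y..Y} (\<lambda>x. (\<delta> * P + q / \<delta>) * (cmod (u t x))\<^sup>2)"
      unfolding J_def
    proof (rule contS_integral_mono[OF c4 contS_cmult[OF contS_sq[OF contS_all(1)]] t])
      fix x
      have "(cmod (u t x))^4 = (cmod (u t x))\<^sup>2 * (cmod (u t x))\<^sup>2" by (simp flip: power_add)
      also have "\<dots> \<le> (\<delta> * P + q / \<delta>) * (cmod (u t x))\<^sup>2"
        unfolding P_def q_def by (intro mult_right_mono sup_bound[OF t \<delta>]) auto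
      finally show "(cmod (u t x))^4 \<le> (\<delta> * P + q / \<delta>) * (cmod (u t x))\<^sup>2" .
    qed
    then show ?thesis by (simp add: P_def sqn_def)
  qed
  have J0: "0 \<le> J t" unfolding J_def by (intro integral_nonneg contS_integrable[OF c4 t]) auto
  have "\<bar>\<mu> / 2 * J t\<bar> \<le> eps\<^sup>2 * \<bar>lam\<bar> / 2 * ((\<delta> * (C1 / eps) + q / \<delta>) * (C1 / eps))"
  proof -
    have "J t \<le> (\<delta> * (C1 / eps) + q / \<delta>) * (C1 / eps)"
      using J P q \<delta> C1_pos eps
      by (intro order_trans[OF J] mult_mono add_mono mult_left_mono) (auto intro!: add_nonneg_nonneg)
    moreover have "\<bar>\<mu> / 2 * J t\<bar> = eps\<^sup>2 * \<bar>lam\<bar> / 2 * J t" using J0 by (simp add: \<mu> abs_mult)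
    ultimately show ?thesis
      using mult_left_mono[of "J t" "(\<delta> * (C1 / eps) + q / \<delta>) * (C1 / eps)" "eps\<^sup>2 * \<bar>lam\<bar> / 2"] by simp
  qed
  also have "\<dots> = eps * (lam\<^sup>2 * C1^3 * \<Omega>\<^sup>2 / 2) + q / (2 * \<Omega>\<^sup>2)"
  proof -
    have "eps\<^sup>2 * \<bar>lam\<bar> / 2 * ((\<delta> * (C1 / eps) + q / \<delta>) * (C1 / eps))
       = eps * \<bar>lam\<bar> / 2 * C1 * (\<delta> * (C1 / eps)) + eps * \<bar>lam\<bar> / 2 * C1 * q / \<delta>"
      using eps \<delta> by (simp add: power2_eq_square field_simps)
    also have "eps * \<bar>lam\<bar> / 2 * C1 * (\<delta> * (C1 / eps)) = eps * (\<bar>lam\<bar>\<^sup>2 * C1^3 * \<Omega>\<^sup>2 / 2)"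
      using eps by (simp add: \<delta>_def power2_eq_square power3_eq_cube)
    also have "eps * \<bar>lam\<bar> / 2 * C1 * q / \<delta> = q / (2 * \<Omega>\<^sup>2)"
      using eps lam C1_pos \<Omega>_ge(2) by (simp add: \<delta>_def)
    finally show ?thesis by simp
  qed
  finally have Jb: "\<bar>\<mu> / 2 * J t\<bar> \<le> eps * (lam\<^sup>2 * C1^3 * \<Omega>\<^sup>2 / 2) + q / (2 * \<Omega>\<^sup>2)" .
  have F0': "F 0 \<le> eps * (2 * R * A\<^sup>2 / \<Omega>\<^sup>2 + \<bar>lam\<bar> * R * A^4)"
  proof -
    have "2 * (R / eps) * (A\<^sup>2 * eps\<^sup>2 / \<Omega>\<^sup>2 + eps\<^sup>2 * \<bar>lam\<bar> / 2 * A^4) = eps * (2 * R * A\<^sup>2 / \<Omega>\<^sup>2 + \<bar>lam\<bar> * R * A^4)"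
      using eps \<Omega>_ge(2) by (simp add: power2_eq_square field_simps)
    then show ?thesis using F0 by (simp only:)
  qed
  have "sqn Y Z t + q / \<Omega>\<^sup>2 + \<mu> / 2 * J t \<le> eps * (2 * R * A\<^sup>2 / \<Omega>\<^sup>2 + \<bar>lam\<bar> * R * A^4)"
    using F[OF t] F_conserved[OF t] F0' by (simp add: q_def)
  then have "sqn Y Z t + q / (2 * \<Omega>\<^sup>2) \<le> C2' * eps"
  proof -
    assume a: "sqn Y Z t + q / \<Omega>\<^sup>2 + \<mu> / 2 * J t \<le> eps * (2 * R * A\<^sup>2 / \<Omega>\<^sup>2 + \<bar>lam\<bar> * R * A^4)"
    have "q / \<Omega>\<^sup>2 = q / (2 * \<Omega>\<^sup>2) + q / (2 * \<Omega>\<^sup>2)" by (simp add: field_simps)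
    moreover have "C2' * eps = eps * (2 * R * A\<^sup>2 / \<Omega>\<^sup>2 + \<bar>lam\<bar> * R * A^4) + eps * (lam\<^sup>2 * C1^3 * \<Omega>\<^sup>2 / 2)"
      by (simp add: C2'_def algebra_simps)
    ultimately show ?thesis using a Jb by (simp only: abs_le_iff) linarith
  qed
  moreover have "0 \<le> q / (2 * \<Omega>\<^sup>2)" using q by simp
  ultimately have 1: "sqn Y Z t \<le> C2' * eps" "q / (2 * \<Omega>\<^sup>2) \<le> C2' * eps" using z by auto
  have "C2' * eps \<le> C2 * eps"
  proof (rule mult_right_mono)
    have "1 * C2' \<le> (2 * \<Omega>\<^sup>2) * C2'" using C2'_nonneg \<Omega>_ge(1) by (intro mult_right_mono) auto
    then show "C2' \<le> C2" by (simp add: C2_def)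
  qed (use eps in simp)
  with 1(1) show "sqn Y Z t \<le> C2 * eps" by simp
  have "q = (2 * \<Omega>\<^sup>2) * (q / (2 * \<Omega>\<^sup>2))" using \<Omega>_ge(2) by simp
  also have "\<dots> \<le> (2 * \<Omega>\<^sup>2) * (C2' * eps)" using 1(2) by (intro mult_left_mono) auto
  finally show "sqn Y D t \<le> C2 * eps" by (simp add: q_def C2_def mult_ac)
qed

lemma C2_nonneg: "C2 \<ge> 0" using C2'_nonneg by (simp add: C2_def)

lemma u_bound:
  assumes t: "t \<in> {0..B}"
  shows "(cmod (u t x))\<^sup>2 \<le> K2"
proof -
  have "(cmod (u t x))\<^sup>2 \<le> eps * sqn Y u t + sqn Y D t / eps" by (rule sup_bound[OF t eps(1)])
  also have "\<dots> \<le> eps * (C1 / eps) + C2 * eps / eps"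
    using u_sqn[OF t] F_bound(2)[OF t] eps by (intro add_mono mult_left_mono divide_right_mono) auto
  also have "\<dots> = K2" using eps by (simp add: K2_def)
  finally show ?thesis .
qed

lemma K2_nonneg: "K2 \<ge> 0" using C1_pos C2_nonneg by (simp add: K2_def)

lemma bil_bound:
  assumes t: "t \<in> {0..B}"
  shows "cmod (of_real \<mu> * bil (u t x) b) \<le> 3 * eps\<^sup>2 * \<bar>lam\<bar> * K2 * cmod b"
proof -
  have "cmod (of_real \<mu> * bil (u t x) b) = \<bar>\<mu>\<bar> * cmod (bil (u t x) b)" by (simp add: norm_mult)
  also have "\<dots> \<le> \<bar>\<mu>\<bar> * (3 * K2 * cmod b)"
    using u_bound[OF t, of x] by (intro mult_left_mono order_trans[OF cmod_bil_le] mult_right_mono) auto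
  finally show ?thesis by (simp add: \<mu> abs_mult mult_ac)
qed

lemma cubic_bound:
  assumes t: "t \<in> {0..B}"
  shows "cmod (of_real \<mu> * cubic (u t x)) \<le> eps\<^sup>2 * \<bar>lam\<bar> * K2 * cmod (u t x)"
proof -
  have "cmod (of_real \<mu> * cubic (u t x)) = \<bar>\<mu>\<bar> * ((cmod (u t x))\<^sup>2 * cmod (u t x))" by (simp add: norm_mult cmod_cubic)
  also have "\<dots> \<le> \<bar>\<mu>\<bar> * (K2 * cmod (u t x))"
    using u_bound[OF t, of x] by (intro mult_left_mono mult_right_mono) auto
  finally show ?thesis by (simp add: \<mu> abs_mult mult_ac)
qed

lemma Zx_0: "Zx 0 x = 0"
proof -
  have "Z 0 = (\<lambda>x. 0)" using i3 by auto
  then have "((\<lambda>x. 0) has_vector_derivative Zx 0 x) (at x)" using pd_x[OF ZU.jets(1) zero_in, of x] by simp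
  from vector_derivative_unique_at[OF has_vector_derivative_const this] show ?thesis by simp
qed

text \<open>Z and Zx vanish at time 0, so only Zt = DD/\<Omega>^2 - \<mu>|u|^2 u contributes, of
  size \<open>eps\<close>^2 on a length O(1/\<open>eps\<close>). The growth rate is
  O(\<open>eps\<close>^2) over a time O(1/\<open>eps\<close>^2), so the order \<open>eps\<close>^3
  persists.\<close>

lemma Z_energy:
  assumes t: "t \<in> {0..B}"
  shows "ZU.E t \<le> C3 * eps^3"
proof -
  let ?a = "eps\<^sup>2 * (A + \<bar>lam\<bar> * A^3)"
  have "ZU.E 0 \<le> 2 * (R / eps) * ?a\<^sup>2"
    unfolding ZU.E_def
  proof (rule integral_le_support[OF contS_ivl[OF ZU.contS_e zero_in] _ _ Y_ge(2,1)])
    fix x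
    have Zt: "Zt 0 x = of_real (1 / \<Omega>\<^sup>2) * DD 0 x - of_real \<mu> * cubic (u 0 x)"
      using frame_relations(1)[OF zero_in, of x] by (simp add: i3 DZ_def Zx_0)
    have "cmod (Zt 0 x) \<le> cmod (of_real (1 / \<Omega>\<^sup>2) * DD 0 x) + cmod (of_real \<mu> * cubic (u 0 x))"
      unfolding Zt by (rule norm_triangle_ineq4)
    also have "cmod (of_real (1 / \<Omega>\<^sup>2) * DD 0 x) = 1 / \<Omega>\<^sup>2 * cmod (DD 0 x)" by (simp add: norm_mult norm_divide norm_power)
    also have "\<dots> \<le> 1 * (A * eps\<^sup>2)" using \<Omega>_ge(1,2) by (intro mult_mono i2) (auto simp: divide_le_eq)
    also have "cmod (of_real \<mu> * cubic (u 0 x)) = \<bar>\<mu>\<bar> * ((cmod (u 0 x))\<^sup>2 * cmod (u 0 x))" by (simp add: norm_mult cmod_cubic)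
    also have "\<dots> \<le> \<bar>\<mu>\<bar> * (A\<^sup>2 * A)" using A by (intro mult_left_mono mult_mono power_mono i1) auto
    finally have "cmod (Zt 0 x) \<le> ?a" by (simp add: \<mu> abs_mult algebra_simps power2_eq_square power3_eq_cube)
    then have "(cmod (Zt 0 x))\<^sup>2 \<le> ?a\<^sup>2" by (intro power_mono) auto
    then show "ZU.e 0 x \<le> ?a\<^sup>2" by (simp add: ZU.e_def i3 Zx_0)
    show "ZU.e 0 x = 0" if "R / eps < \<bar>x\<bar>"
      unfolding ZU.e_def Zt by (simp add: i3 Zx_0 init_zero[OF that])
  qed
  note init = this
  have grow: "ZU.E t \<le> ZU.E 0 * exp (3 * eps\<^sup>2 * \<bar>lam\<bar> * K2 * t)"
    by (rule ZU.energy_growth[OF _ bil_bound t]) (use K2_nonneg in auto)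
  have ex: "exp (3 * eps\<^sup>2 * \<bar>lam\<bar> * K2 * t) \<le> exp (3 * \<bar>lam\<bar> * K2 * T)"
  proof -
    have "eps\<^sup>2 * t \<le> eps\<^sup>2 * B" using t by (intro mult_left_mono) auto
    then have "eps\<^sup>2 * t \<le> T" using BT by linarith
    then have "(3 * \<bar>lam\<bar> * K2) * (eps\<^sup>2 * t) \<le> (3 * \<bar>lam\<bar> * K2) * T" using K2_nonneg by (intro mult_left_mono) auto
    then show ?thesis by (simp add: mult_ac)
  qed
  have "ZU.E t \<le> (2 * (R / eps) * ?a\<^sup>2) * exp (3 * \<bar>lam\<bar> * K2 * T)"
    by (rule order_trans[OF grow mult_mono[OF init ex]]) (use R eps in auto)
  also have "\<dots> = C3 * eps^3"
  proof -
    have "R / eps * (eps\<^sup>2 * b)\<^sup>2 = R * b\<^sup>2 * eps^3" for b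
      using eps by (simp add: power_mult_distrib power2_eq_square power3_eq_cube)
    then have "2 * (R / eps) * ?a\<^sup>2 = 2 * (R * (A + \<bar>lam\<bar> * A^3)\<^sup>2 * eps^3)" by (simp only: mult.assoc)
    then show ?thesis by (simp only: C3_def mult_ac)
  qed
  finally show ?thesis .
qed

text \<open>The equation for \<open>Zt\<close> is solved for \<open>DD\<close>, which is thus
  controlled by first derivatives of Z and the cubic term. The energy of D would not do: it contains
  the carrier and is only of order \<open>eps\<close>.\<close>

lemma second_bound:
  assumes t: "t \<in> {0..B}"
  shows "sqn Y DD t \<le> C4 * eps^3" "sqn Y DZ t + sqn Y DD t \<le> C5 * eps^3"
proof -
  note ct = contS_sq[OF contS_all(1)]
  have "sqn Y DD t \<le> integral {-Y..Y} (\<lambda>x. (4 * \<Omega>^4) * ZU.e t x + (4 * \<Omega>^4 * (eps\<^sup>2 * \<bar>lam\<bar> * K2)\<^sup>2) * (cmod (u t x))\<^sup>2)"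
    unfolding sqn_def
  proof (rule contS_integral_mono[OF contS_sq[OF contS_all(6)] contS_add[OF contS_cmult[OF ZU.contS_e] contS_cmult[OF ct]] t])
    fix x
    define n where "n = cmod (of_real \<mu> * cubic (u t x))"
    have Zt: "of_real (1 / \<Omega>\<^sup>2) * DD t x = Zt t x - of_real c * Zx t x - \<i> * of_real (1 / \<Omega>) * Z t x + of_real \<mu> * cubic (u t x)"
    proof -
      have "of_real (1 / \<Omega>\<^sup>2) * DD t x = Zt t x - of_real c * DZ t x - \<i> * of_real \<Omega> * Z t x + of_real \<mu> * cubic (u t x)"
        using frame_relations(1)[OF t, of x] by algebra
      also have "of_real c * DZ t x = of_real c * Zx t x - \<i> * (of_real c * of_real \<kappa>) * Z t x" by (simp add: DZ_def algebra_simps)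
      also have "(of_real c * of_real \<kappa> :: complex) = of_real \<Omega> - of_real (1 / \<Omega>)" using c\<Omega>_complex(2) by (simp add: algebra_simps)
      finally show ?thesis by (simp add: algebra_simps)
    qed
    have "cmod (DD t x) = \<Omega>\<^sup>2 * cmod (of_real (1 / \<Omega>\<^sup>2) * DD t x)"
      using \<Omega>_ge(2) by (simp add: norm_mult norm_divide norm_power)
    also have "\<dots> \<le> \<Omega>\<^sup>2 * (cmod (Zt t x) + cmod (Zx t x) + cmod (Z t x) + n)"
    proof (rule mult_left_mono)
      have "cmod (of_real c * Zx t x) \<le> cmod (Zx t x)" 
        using mult_right_mono[OF \<Omega>_ge(3), of "cmod (Zx t x)"] by (simp add: norm_mult)
      moreover have "cmod (\<i> * of_real (1 / \<Omega>) * Z t x) \<le> cmod (Z t x)"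
      proof -
        have "1 \<le> \<bar>\<Omega>\<bar>" using \<Omega>_ge(1) abs_le_square_iff[of 1 \<Omega>] by simp
        then have "1 / \<bar>\<Omega>\<bar> * cmod (Z t x) \<le> 1 * cmod (Z t x)" by (intro mult_right_mono) auto
        then show ?thesis by (simp add: norm_mult norm_divide)
      qed
      moreover have "cmod (Zt t x - of_real c * Zx t x - \<i> * of_real (1 / \<Omega>) * Z t x + of_real \<mu> * cubic (u t x))
        \<le> cmod (Zt t x) + cmod (of_real c * Zx t x) + cmod (\<i> * of_real (1 / \<Omega>) * Z t x) + n"
        using norm_triangle_ineq[of "Zt t x - of_real c * Zx t x - \<i> * of_real (1 / \<Omega>) * Z t x" "of_real \<mu> * cubic (u t x)"]
          norm_triangle_ineq4[of "Zt t x - of_real c * Zx t x" "\<i> * of_real (1 / \<Omega>) * Z t x"]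
          norm_triangle_ineq4[of "Zt t x" "of_real c * Zx t x"]
        unfolding n_def by linarith
      ultimately show "cmod (of_real (1 / \<Omega>\<^sup>2) * DD t x) \<le> cmod (Zt t x) + cmod (Zx t x) + cmod (Z t x) + n"
        unfolding Zt by linarith
    qed simp
    finally have "(cmod (DD t x))\<^sup>2 \<le> (\<Omega>\<^sup>2 * (cmod (Zt t x) + cmod (Zx t x) + cmod (Z t x) + n))\<^sup>2"
      by (intro power_mono) auto
    also have "\<dots> = \<Omega>^4 * (cmod (Zt t x) + cmod (Zx t x) + cmod (Z t x) + n)\<^sup>2"
      by (simp add: power_mult_distrib flip: power_mult)
    also have "\<dots> \<le> \<Omega>^4 * (4 * (ZU.e t x + n\<^sup>2))"
    proof (rule mult_left_mono)
      \<comment> \<open>The sum of the six squared differences is four times the sum of squares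
        minus the square of the sum.\<close>
      define a b d where "a = cmod (Zt t x)" and "b = cmod (Zx t x)" and "d = cmod (Z t x)"
      have "0 \<le> (a - b)\<^sup>2 + (a - d)\<^sup>2 + (a - n)\<^sup>2 + (b - d)\<^sup>2 + (b - n)\<^sup>2 + (d - n)\<^sup>2" by simp
      then have "(a + b + d + n)\<^sup>2 \<le> 4 * (a\<^sup>2 + b\<^sup>2 + d\<^sup>2 + n\<^sup>2)" by (simp add: power2_eq_square algebra_simps)
      then show "(cmod (Zt t x) + cmod (Zx t x) + cmod (Z t x) + n)\<^sup>2 \<le> 4 * (ZU.e t x + n\<^sup>2)"
        by (simp add: a_def b_def d_def ZU.e_def)
    qed simp
    also have "\<dots> \<le> \<Omega>^4 * (4 * (ZU.e t x + (eps\<^sup>2 * \<bar>lam\<bar> * K2 * cmod (u t x))\<^sup>2))"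
      unfolding n_def by (intro mult_left_mono add_left_mono power_mono cubic_bound[OF t]) auto
    also have "\<dots> = (4 * \<Omega>^4) * ZU.e t x + (4 * \<Omega>^4 * (eps\<^sup>2 * \<bar>lam\<bar> * K2)\<^sup>2) * (cmod (u t x))\<^sup>2"
      by (simp add: power_mult_distrib algebra_simps)
    finally show "(cmod (DD t x))\<^sup>2 \<le> (4 * \<Omega>^4) * ZU.e t x + (4 * \<Omega>^4 * (eps\<^sup>2 * \<bar>lam\<bar> * K2)\<^sup>2) * (cmod (u t x))\<^sup>2" .
  qed
  also have "\<dots> = (4 * \<Omega>^4) * ZU.E t + (4 * \<Omega>^4 * (eps\<^sup>2 * \<bar>lam\<bar> * K2)\<^sup>2) * sqn Y u t"
    unfolding contS_integral_lin[OF ZU.contS_e ct t] by (simp add: ZU.E_def sqn_def)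
  also have "\<dots> \<le> (4 * \<Omega>^4) * (C3 * eps^3) + (4 * \<Omega>^4 * (eps\<^sup>2 * \<bar>lam\<bar> * K2)\<^sup>2) * (C1 / eps)"
    by (intro add_mono mult_left_mono Z_energy[OF t] u_sqn[OF t]) auto
  also have "\<dots> = C4 * eps^3"
    using eps by (simp add: C4_def power2_eq_square power3_eq_cube field_simps)
  finally show DD: "sqn Y DD t \<le> C4 * eps^3" .
  have "sqn Y DZ t \<le> integral {-Y..Y} (\<lambda>x. (2 * \<Omega>\<^sup>2) * ZU.e t x)"
    unfolding sqn_def
  proof (rule contS_integral_mono[OF contS_sq[OF contS_all(7)] contS_cmult[OF ZU.contS_e] t])
    fix x
    have "cmod (DZ t x) \<le> cmod (Zx t x) + \<bar>\<kappa>\<bar> * cmod (Z t x)"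
      unfolding DZ_def by (rule order_trans[OF norm_triangle_ineq4]) (simp add: norm_mult)
    then have "(cmod (DZ t x))\<^sup>2 \<le> (cmod (Zx t x) + \<bar>\<kappa>\<bar> * cmod (Z t x))\<^sup>2" by (intro power_mono) auto
    also have "\<dots> \<le> 2 * (cmod (Zx t x))\<^sup>2 + 2 * \<kappa>\<^sup>2 * (cmod (Z t x))\<^sup>2"
      using sum_squares_bound[of "cmod (Zx t x)" "\<bar>\<kappa>\<bar> * cmod (Z t x)"] by (simp add: power2_sum power_mult_distrib)
    also have "\<dots> \<le> 2 * \<Omega>\<^sup>2 * (cmod (Zx t x))\<^sup>2 + 2 * \<Omega>\<^sup>2 * (cmod (Z t x))\<^sup>2"
      using \<Omega> by (intro add_mono mult_right_mono) auto
    also have "\<dots> \<le> (2 * \<Omega>\<^sup>2) * ZU.e t x" by (simp add: ZU.e_def algebra_simps)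
    finally show "(cmod (DZ t x))\<^sup>2 \<le> (2 * \<Omega>\<^sup>2) * ZU.e t x" .
  qed
  also have "\<dots> = (2 * \<Omega>\<^sup>2) * ZU.E t" by (simp add: ZU.E_def)
  also have "\<dots> \<le> (2 * \<Omega>\<^sup>2) * (C3 * eps^3)" by (intro mult_left_mono Z_energy[OF t]) auto
  finally show "sqn Y DZ t + sqn Y DD t \<le> C5 * eps^3" using DD by (simp add: C5_def algebra_simps)
qed

lemma D_bound:
  assumes t: "t \<in> {0..B}"
  shows "(cmod (D t x))\<^sup>2 \<le> (C2 + C4) * eps\<^sup>2"
proof -
  have "(cmod (D t x))\<^sup>2 \<le> eps * sqn Y D t + sqn Y DD t / eps" by (rule sup_bound[OF t eps(1)])
  also have "\<dots> \<le> eps * (C2 * eps) + C4 * eps^3 / eps"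
    using second_bound(1)[OF t] F_bound(2)[OF t] eps by (intro add_mono mult_left_mono divide_right_mono) auto
  also have "\<dots> = (C2 + C4) * eps\<^sup>2" using eps by (simp add: power2_eq_square power3_eq_cube algebra_simps)
  finally show ?thesis .
qed

end

section \<open>Collision of two polarized waves\<close>

lemma linear_kg_diff:
  assumes "linear_kg B Y f ft fx ftt ftx fxx S" "linear_kg B Y g gt gx gtt gtx gxx S'"
  shows "linear_kg B Y (\<lambda>t x. f t x - g t x) (\<lambda>t x. ft t x - gt t x) (\<lambda>t x. fx t x - gx t x)
    (\<lambda>t x. ftt t x - gtt t x) (\<lambda>t x. ftx t x - gtx t x) (\<lambda>t x. fxx t x - gxx t x) (\<lambda>t x. S t x - S' t x)"
proof -
  interpret f: linear_kg B Y f ft fx ftt ftx fxx S by fact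
  interpret g: linear_kg B Y g gt gx gtt gtx gxx S' by fact
  show ?thesis
  proof
    show "jet2 B (\<lambda>t x. f t x - g t x) (\<lambda>t x. ft t x - gt t x) (\<lambda>t x. fx t x - gx t x)
      (\<lambda>t x. ftt t x - gtt t x) (\<lambda>t x. ftx t x - gtx t x) (\<lambda>t x. fxx t x - gxx t x)"
      unfolding jet2_def by (intro conjI pd_diff f.jets g.jets)
    show "ftt t x - gtt t x - (fxx t x - gxx t x) + (f t x - g t x) + (S t x - S' t x) = 0" if "t \<in> {0..B}" for t x
      using f.eqn[OF that, of x] g.eqn[OF that, of x] by algebra
  qed (use f.bdry g.bdry f.B_pos f.Y_nonneg in auto)
qed

lemma cubic_cross_le:
  "cmod (cubic (a + b) - cubic a - cubic b) \<le> 3 * (cmod a + cmod b) * (cmod a * cmod b)"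
proof -
  have "cubic (a + b) - cubic a - cubic b = a * a * cnj b + 2 * (a * b * cnj a) + 2 * (a * b * cnj b) + b * b * cnj a"
    by (simp add: cubic_def algebra_simps)
  also have "cmod \<dots> \<le> cmod (a * a * cnj b) + cmod (2 * (a * b * cnj a)) + cmod (2 * (a * b * cnj b)) + cmod (b * b * cnj a)"
    using norm_triangle_ineq[of "a * a * cnj b + 2 * (a * b * cnj a) + 2 * (a * b * cnj b)" "b * b * cnj a"]
      norm_triangle_ineq[of "a * a * cnj b + 2 * (a * b * cnj a)" "2 * (a * b * cnj b)"]
      norm_triangle_ineq[of "a * a * cnj b" "2 * (a * b * cnj a)"] by linarith
  also have "\<dots> = 3 * (cmod a + cmod b) * (cmod a * cmod b)"
    by (simp add: norm_mult algebra_simps)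
  finally show ?thesis .
qed

lemma bil_diff_le:
  "cmod (bil u g - bil a g) \<le> 3 * (cmod u + cmod a) * cmod (u - a) * cmod g"
proof -
  have "bil u g - bil a g = 2 * (u * cnj (u - a) + (u - a) * cnj a) * g + (u + a) * (u - a) * cnj g"
    by (simp add: bil_def algebra_simps)
  also have "cmod \<dots> \<le> cmod (2 * (u * cnj (u - a) + (u - a) * cnj a) * g) + cmod ((u + a) * (u - a) * cnj g)"
    by (rule norm_triangle_ineq)
  also have "\<dots> = 2 * cmod (u * cnj (u - a) + (u - a) * cnj a) * cmod g + cmod (u + a) * cmod (u - a) * cmod g"
    by (simp only: norm_mult complex_mod_cnj norm_numeral)
  also have "\<dots> \<le> 2 * (cmod u * cmod (u - a) + cmod (u - a) * cmod a) * cmod g + (cmod u + cmod a) * cmod (u - a) * cmod g"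
  proof -
    have "cmod (u * cnj (u - a) + (u - a) * cnj a) \<le> cmod u * cmod (u - a) + cmod (u - a) * cmod a"
      by (rule order_trans[OF norm_triangle_ineq]) (simp add: norm_mult del: complex_cnj_diff)
    then show ?thesis by (intro add_mono mult_right_mono mult_left_mono norm_triangle_ineq) auto
  qed
  also have "\<dots> = 3 * (cmod u + cmod a) * cmod (u - a) * cmod g" by (simp add: algebra_simps)
  finally show ?thesis .
qed

context kg_wave
begin

definition "front r t x = ramp' (\<bar>c\<bar> / 2 * t - r - sgn c * x)"
text \<open>The part of the mass of \<phi> behind the front that moves with half the group velocity,
  smoothed over unit length.\<close>

definition "lag r \<phi> t = integral {-Y..Y} (\<lambda>x. front r t x * (cmod (\<phi> t x))\<^sup>2)"
definition "wU r = U.wgt (\<bar>c\<bar> / 2) r (sgn c)"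
definition "wD r = DU.wgt (\<bar>c\<bar> / 2) r (sgn c)"

lemma front_bounds: "0 \<le> front r t x" "front r t x \<le> 1"
  by (simp_all add: front_def ramp'_bounds)

lemma contS_front: "contS B (front r)"
  unfolding contS_def front_def
  by (intro continuous_intros continuous_on_compose2[OF ramp'_cont[of UNIV]]) auto

lemma lag_nonneg: "contS B \<phi> \<Longrightarrow> t \<in> {0..B} \<Longrightarrow> 0 \<le> lag r \<phi> t"
  unfolding lag_def
  by (intro integral_nonneg contS_integrable[OF contS_mult[OF contS_front contS_sq]])
    (auto simp: front_bounds)

lemma wU_deriv:
  assumes \<sigma>: "\<sigma> \<ge> 0" and S: "\<And>t x. t \<in> {0..B} \<Longrightarrow> cmod (of_real \<mu> * cubic (u t x)) \<le> \<sigma> * cmod (u t x)" and t: "t \<in> {0..B}"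
  shows "\<exists>w'. (wU r has_real_derivative w') (at t within {0..B}) \<and>
    w' \<le> - (\<bar>c\<bar> / 2 * \<Omega>\<^sup>2) * lag r u t + (27 / \<bar>c\<bar> + 9 / 2) * (sqn Y Z t + sqn Y D t) + \<sigma> * wU r t"
proof -
  note cs = contS_mult[OF contS_front contS_sq[OF contS_all(1)]] contS_sq[OF contS_all(5)] contS_sq[OF contS_all(4)]
  have I: "integral {-Y..Y} (\<lambda>x. - (\<bar>c\<bar> / 2 * \<Omega>\<^sup>2) * (front r t x * (cmod (u t x))\<^sup>2) + (27 / \<bar>c\<bar> + 9 / 2) * (1 * (cmod (Z t x))\<^sup>2 + 1 * (cmod (D t x))\<^sup>2))
    = - (\<bar>c\<bar> / 2 * \<Omega>\<^sup>2) * lag r u t + (27 / \<bar>c\<bar> + 9 / 2) * (1 * sqn Y Z t + 1 * sqn Y D t)"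
    unfolding lag_def sqn_def contS_integral_lin[OF cs(1) contS_add[OF contS_cmult[OF cs(2)] contS_cmult[OF cs(3)]] t]
      contS_integral_lin[OF cs(2,3) t] ..
  obtain w' where w: "(wU r has_real_derivative w') (at t within {0..B})"
    "w' \<le> integral {-Y..Y} (\<lambda>x. - \<bar>c\<bar> / 2 * \<Omega>\<^sup>2 * ramp' (\<bar>c\<bar> / 2 * t - r - sgn c * x) * (cmod (u t x))\<^sup>2
       + (27 / \<bar>c\<bar> + 9 / 2) * ((cmod (ut t x + of_real c * ux t x + \<i> * of_real (1 / \<Omega>) * u t x))\<^sup>2 + (cmod (ux t x - \<i> * of_real \<kappa> * u t x))\<^sup>2))
      + \<sigma> * wU r t"
    using U.wgt_deriv[where r = r, OF \<Omega> \<kappa> c_def \<sigma> _ t] S unfolding wU_def by blast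
  moreover have "integral {-Y..Y} (\<lambda>x. - \<bar>c\<bar> / 2 * \<Omega>\<^sup>2 * ramp' (\<bar>c\<bar> / 2 * t - r - sgn c * x) * (cmod (u t x))\<^sup>2
       + (27 / \<bar>c\<bar> + 9 / 2) * ((cmod (ut t x + of_real c * ux t x + \<i> * of_real (1 / \<Omega>) * u t x))\<^sup>2 + (cmod (ux t x - \<i> * of_real \<kappa> * u t x))\<^sup>2))
     = integral {-Y..Y} (\<lambda>x. - (\<bar>c\<bar> / 2 * \<Omega>\<^sup>2) * (front r t x * (cmod (u t x))\<^sup>2) + (27 / \<bar>c\<bar> + 9 / 2) * (1 * (cmod (Z t x))\<^sup>2 + 1 * (cmod (D t x))\<^sup>2))"
    by (intro integral_cong) (simp only: Z_def front_def D_def mult_1_left mult_minus_left minus_divide_left mult.assoc)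
  ultimately show ?thesis unfolding I by (intro exI[of _ w']) simp
qed

lemma wD_deriv:
  assumes \<sigma>: "\<sigma> \<ge> 0" and S: "\<And>t x. t \<in> {0..B} \<Longrightarrow> cmod (of_real \<mu> * bil (u t x) (D t x)) \<le> \<sigma> * cmod (D t x)" and t: "t \<in> {0..B}"
  shows "\<exists>w'. (wD r has_real_derivative w') (at t within {0..B}) \<and>
    w' \<le> - (\<bar>c\<bar> / 2 * \<Omega>\<^sup>2) * lag r D t + (27 / \<bar>c\<bar> + 9 / 2) * (sqn Y DZ t + sqn Y DD t) + \<sigma> * wD r t"
proof -
  note cs = contS_mult[OF contS_front contS_sq[OF contS_all(4)]] contS_sq[OF contS_all(7)] contS_sq[OF contS_all(6)]
  have I: "integral {-Y..Y} (\<lambda>x. - (\<bar>c\<bar> / 2 * \<Omega>\<^sup>2) * (front r t x * (cmod (D t x))\<^sup>2) + (27 / \<bar>c\<bar> + 9 / 2) * (1 * (cmod (DZ t x))\<^sup>2 + 1 * (cmod (DD t x))\<^sup>2))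
    = - (\<bar>c\<bar> / 2 * \<Omega>\<^sup>2) * lag r D t + (27 / \<bar>c\<bar> + 9 / 2) * (1 * sqn Y DZ t + 1 * sqn Y DD t)"
    unfolding lag_def sqn_def contS_integral_lin[OF cs(1) contS_add[OF contS_cmult[OF cs(2)] contS_cmult[OF cs(3)]] t]
      contS_integral_lin[OF cs(2,3) t] ..
  have dz: "Dt t x + of_real c * Dx t x + \<i> * of_real (1 / \<Omega>) * D t x = DZ t x" for x
    by (simp add: Dt_def Dx_def D_def DZ_def Zx_def Z_def algebra_simps)
  obtain w' where w: "(wD r has_real_derivative w') (at t within {0..B})"
    "w' \<le> integral {-Y..Y} (\<lambda>x. - \<bar>c\<bar> / 2 * \<Omega>\<^sup>2 * ramp' (\<bar>c\<bar> / 2 * t - r - sgn c * x) * (cmod (D t x))\<^sup>2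
       + (27 / \<bar>c\<bar> + 9 / 2) * ((cmod (Dt t x + of_real c * Dx t x + \<i> * of_real (1 / \<Omega>) * D t x))\<^sup>2 + (cmod (Dx t x - \<i> * of_real \<kappa> * D t x))\<^sup>2))
      + \<sigma> * wD r t"
    using DU.wgt_deriv[where r = r, OF \<Omega> \<kappa> c_def \<sigma> _ t] S unfolding wD_def by blast
  moreover have "integral {-Y..Y} (\<lambda>x. - \<bar>c\<bar> / 2 * \<Omega>\<^sup>2 * ramp' (\<bar>c\<bar> / 2 * t - r - sgn c * x) * (cmod (D t x))\<^sup>2
       + (27 / \<bar>c\<bar> + 9 / 2) * ((cmod (Dt t x + of_real c * Dx t x + \<i> * of_real (1 / \<Omega>) * D t x))\<^sup>2 + (cmod (Dx t x - \<i> * of_real \<kappa> * D t x))\<^sup>2))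
     = integral {-Y..Y} (\<lambda>x. - (\<bar>c\<bar> / 2 * \<Omega>\<^sup>2) * (front r t x * (cmod (D t x))\<^sup>2) + (27 / \<bar>c\<bar> + 9 / 2) * (1 * (cmod (DZ t x))\<^sup>2 + 1 * (cmod (DD t x))\<^sup>2))"
    by (intro integral_cong) (simp only: dz, simp only: front_def DD_def mult_1_left mult_minus_left minus_divide_left mult.assoc)
  ultimately show ?thesis unfolding I by (intro exI[of _ w']) simp
qed

lemma init_vanish:
  assumes "\<And>x. r \<le> \<bar>x\<bar> \<Longrightarrow> u 0 x = 0" "\<And>x. r \<le> \<bar>x\<bar> \<Longrightarrow> ut 0 x = 0" "r < \<bar>x\<bar>"
  shows "u 0 x = 0" "ut 0 x = 0" "ux 0 x = 0" "utx 0 x = 0" "uxx 0 x = 0" "U.e 0 x = 0" "DU.e 0 x = 0"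
proof -
  have 0: "0 \<in> {0..B}" using B_pos by auto
  show u: "u 0 x = 0" and ut: "ut 0 x = 0" using assms by auto
  have ux: "ux 0 x = 0" if "r < \<bar>x\<bar>" for x
    by (rule deriv_zero_outside[OF pd_x[OF jets(1) 0] assms(1) that])
  then show ux': "ux 0 x = 0" using assms(3) by auto
  show utx: "utx 0 x = 0"
    by (rule deriv_zero_outside[OF pd_x[OF jets(2) 0] assms(2) assms(3)])
  obtain r' where r: "r < r'" "r' < \<bar>x\<bar>" using assms(3) dense by blast
  show uxx: "uxx 0 x = 0"
    by (rule deriv_zero_outside[OF pd_x[OF jets(3) 0] _ r(2)]) (use ux r in auto)
  show "U.e 0 x = 0" "DU.e 0 x = 0"
    unfolding U.e_def DU.e_def by (simp_all add: D_def Dt_def Dx_def u ut ux' utx uxx)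
qed

text \<open>At time 0 the ramp vanishes for |x| \<le> r and the energies vanish beyond: the front
  starts at the rear edge of the support.\<close>

lemma weights_0:
  assumes "\<And>x. r \<le> \<bar>x\<bar> \<Longrightarrow> u 0 x = 0" "\<And>x. r \<le> \<bar>x\<bar> \<Longrightarrow> ut 0 x = 0"
  shows "wU r 0 = 0" "wD r 0 = 0"
proof -
  have z: "ramp (\<bar>c\<bar> / 2 * 0 - r - sgn c * x) * U.e 0 x = 0 \<and> ramp (\<bar>c\<bar> / 2 * 0 - r - sgn c * x) * DU.e 0 x = 0" for x
  proof (cases "r < \<bar>x\<bar>")
    case True then show ?thesis using init_vanish(6,7)[OF assms True] by simp
  next
    case False
    have "\<bar>sgn c * x\<bar> \<le> \<bar>x\<bar>" by (simp add: abs_mult sgn_if)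
    then have "\<bar>c\<bar> / 2 * 0 - r - sgn c * x \<le> 0" using False unfolding abs_le_iff by simp
    then show ?thesis by (simp add: ramp_0)
  qed
  then show "wU r 0 = 0" "wD r 0 = 0" 
    unfolding wU_def wD_def U.wgt_def DU.wgt_def using conjunct1[OF z] conjunct2[OF z] by (simp_all only: integral_0)
qed

end

text \<open>\<open>P\<close> and \<open>N\<close> are the polarized waves, with opposite \<Omega>
  and hence opposite velocities; \<open>W\<close> is the full solution. One constant
  \<open>K\<close> carries all bounds of the waves, \<open>M\<close> the sup bounds entering the
  nonlinearity, and \<open>A\<close> the mismatch of the initial velocities, which stems from the
  terms with \<open>c_g\<close>.\<close>

locale collision =
  P: kg_wave B \<mu> X fp gp p pt px ptt ptx pxx pttt pttx ptxx pxxx \<kappa> \<Omega> +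
  N: kg_wave B \<mu> X fn gn n nt nx ntt ntx nxx nttt nttx ntxx nxxx \<kappa> "- \<Omega>" +
  W: kg_wave B \<mu> X f g u ut ux utt utx uxx uttt uttx utxx uxxx \<kappa> \<Omega>
  for B \<mu> X fp gp p pt px ptt ptx pxx pttt pttx ptxx pxxx \<kappa> \<Omega>
    fn gn n nt nx ntt ntx nxx nttt nttx ntxx nxxx
    f g u ut ux utt utx uxx uttt uttx utxx uxxx +
  fixes lam T eps R K M A :: real
  assumes eps: "0 < eps" "eps \<le> 1" and \<mu>: "\<mu> = eps\<^sup>2 * lam" and BT: "eps\<^sup>2 * B \<le> T" and T: "T > 0"
    and R: "R > 0" "R / eps \<le> X" and K: "K \<ge> 0" and M: "M \<ge> 0" and A: "A \<ge> 0"
    and bp: "\<And>t x. t \<in> {0..B} \<Longrightarrow> (cmod (p t x))\<^sup>2 \<le> K" "\<And>t x. t \<in> {0..B} \<Longrightarrow> (cmod (P.D t x))\<^sup>2 \<le> K * eps\<^sup>2"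
      "\<And>t. t \<in> {0..B} \<Longrightarrow> sqn P.Y p t \<le> K / eps" "\<And>t. t \<in> {0..B} \<Longrightarrow> sqn P.Y P.Z t + sqn P.Y P.D t \<le> K * eps"
      "\<And>t. t \<in> {0..B} \<Longrightarrow> sqn P.Y P.DZ t + sqn P.Y P.DD t \<le> K * eps^3"
    and bn: "\<And>t x. t \<in> {0..B} \<Longrightarrow> (cmod (n t x))\<^sup>2 \<le> K" "\<And>t x. t \<in> {0..B} \<Longrightarrow> (cmod (N.D t x))\<^sup>2 \<le> K * eps\<^sup>2"
      "\<And>t. t \<in> {0..B} \<Longrightarrow> sqn N.Y n t \<le> K / eps" "\<And>t. t \<in> {0..B} \<Longrightarrow> sqn N.Y N.Z t + sqn N.Y N.D t \<le> K * eps"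
      "\<And>t. t \<in> {0..B} \<Longrightarrow> sqn N.Y N.DZ t + sqn N.Y N.DD t \<le> K * eps^3"
    and bM: "\<And>t x. t \<in> {0..B} \<Longrightarrow> cmod (u t x) \<le> M" "\<And>t x. t \<in> {0..B} \<Longrightarrow> cmod (p t x) + cmod (n t x) \<le> M"
    and i1: "\<And>x. u 0 x = p 0 x + n 0 x" "\<And>x. cmod (ut 0 x - pt 0 x - nt 0 x) \<le> A * eps"
       "\<And>x. cmod (W.Dt 0 x - P.Dt 0 x - N.Dt 0 x) \<le> A * eps\<^sup>2"
    and i2: "\<And>x. R / eps \<le> \<bar>x\<bar> \<Longrightarrow> p 0 x = 0" "\<And>x. R / eps \<le> \<bar>x\<bar> \<Longrightarrow> pt 0 x = 0"
       "\<And>x. R / eps \<le> \<bar>x\<bar> \<Longrightarrow> n 0 x = 0" "\<And>x. R / eps \<le> \<bar>x\<bar> \<Longrightarrow> nt 0 x = 0"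
       "\<And>x. R / eps \<le> \<bar>x\<bar> \<Longrightarrow> ut 0 x = 0"
begin

abbreviation "Y \<equiv> P.Y"
definition "S0 t x = of_real \<mu> * cubic (u t x) - of_real \<mu> * cubic (p t x) - of_real \<mu> * cubic (n t x)"
definition "S1 t x = of_real \<mu> * bil (u t x) (W.D t x) - of_real \<mu> * bil (p t x) (P.D t x) - of_real \<mu> * bil (n t x) (N.D t x)"

sublocale R0: linear_kg B Y "\<lambda>t x. u t x - p t x - n t x" "\<lambda>t x. ut t x - pt t x - nt t x" "\<lambda>t x. ux t x - px t x - nx t x"
  "\<lambda>t x. utt t x - ptt t x - ntt t x" "\<lambda>t x. utx t x - ptx t x - ntx t x" "\<lambda>t x. uxx t x - pxx t x - nxx t x" S0
  unfolding S0_def[abs_def]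
  by (rule linear_kg_diff[OF linear_kg_diff[OF W.U.linear_kg_axioms P.U.linear_kg_axioms] N.U.linear_kg_axioms])

sublocale R1: linear_kg B Y "\<lambda>t x. W.D t x - P.D t x - N.D t x" "\<lambda>t x. W.Dt t x - P.Dt t x - N.Dt t x" "\<lambda>t x. W.Dx t x - P.Dx t x - N.Dx t x"
  "\<lambda>t x. W.Dtt t x - P.Dtt t x - N.Dtt t x" "\<lambda>t x. W.Dtx t x - P.Dtx t x - N.Dtx t x" "\<lambda>t x. W.Dxx t x - P.Dxx t x - N.Dxx t x" S1
  unfolding S1_def[abs_def]
  by (rule linear_kg_diff[OF linear_kg_diff[OF W.DU.linear_kg_axioms P.DU.linear_kg_axioms] N.DU.linear_kg_axioms])

end

text \<open>Young's inequality at one point. The products \<open>X1\<close> and \<open>X0\<close> of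
  the two waves are charged to \<open>g\<close>, the density of the lagging parts, for which the
  moving weights pay; everything else goes to the energy at rate \<open>eps\<close>^2.\<close>

lemma late_source_le:
  fixes q1 d r q0 s1 s0 X1 X0 eps l M k g K e1 e0 :: real
  assumes nn: "0 \<le> q1" "0 \<le> q0" "0 \<le> l" "0 \<le> M" "0 \<le> k"
    and s1: "s1 \<le> eps\<^sup>2 * l * (3 * M\<^sup>2 * d + 12 * M * k * (eps * r) + 6 * M * X1)"
    and s0: "s0 \<le> eps\<^sup>2 * l * (3 * M\<^sup>2 * r + 3 * M * X0)"
    and X: "X1\<^sup>2 \<le> 2 * K * g" "eps\<^sup>2 * X0\<^sup>2 \<le> K * g"
    and e: "q1\<^sup>2 + d\<^sup>2 \<le> e1" "q0\<^sup>2 + r\<^sup>2 \<le> e0"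
  shows "2 * q1 * s1 + eps\<^sup>2 * (2 * q0 * s0)
    \<le> eps\<^sup>2 * (l * (6 * M\<^sup>2 + 24 * M * k + 9 * M)) * (e1 + eps\<^sup>2 * e0) + eps\<^sup>2 * (15 * l * M * K) * g"
proof -
  have sq: "2 * a * b \<le> a\<^sup>2 + b\<^sup>2" for a b :: real by (rule sum_squares_bound)
  have e0: "0 \<le> eps\<^sup>2 * e0" "0 \<le> e1" "eps\<^sup>2 * (q0\<^sup>2 + r\<^sup>2) \<le> eps\<^sup>2 * e0"
    using e by (auto intro!: mult_left_mono order_trans[OF _ e(2)] order_trans[OF _ e(1)] simp: zero_le_mult_iff)
  define V where "V = e1 + eps\<^sup>2 * e0"
  have b1: "2 * q1 * d \<le> V" using sq[of q1 d] e e0 by (simp add: V_def)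
  have b2: "2 * q1 * (eps * r) \<le> V"
  proof -
    have "2 * q1 * (eps * r) \<le> q1\<^sup>2 + (eps * r)\<^sup>2" by (rule sq)
    also have "\<dots> = q1\<^sup>2 + eps\<^sup>2 * r\<^sup>2" by (simp add: power_mult_distrib)
    also have "eps\<^sup>2 * r\<^sup>2 \<le> eps\<^sup>2 * (q0\<^sup>2 + r\<^sup>2)" by (intro mult_left_mono) auto
    finally show ?thesis using e(1) e0(3) zero_le_power2[of d] unfolding V_def by linarith
  qed
  have b3: "2 * q1 * X1 \<le> V + 2 * K * g"
    using sq[of q1 X1] X(1) e(1) e0(1) zero_le_power2[of d] unfolding V_def by linarith
  have b4: "eps\<^sup>2 * (2 * q0 * r) \<le> V"
  proof -
    have "eps\<^sup>2 * (2 * q0 * r) \<le> eps\<^sup>2 * (q0\<^sup>2 + r\<^sup>2)" by (intro mult_left_mono sq) auto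
    then show ?thesis using e0 unfolding V_def by linarith
  qed
  have b5: "eps\<^sup>2 * (2 * q0 * X0) \<le> V + K * g"
  proof -
    have "eps\<^sup>2 * (2 * q0 * X0) \<le> eps\<^sup>2 * (q0\<^sup>2 + X0\<^sup>2)" by (intro mult_left_mono sq) auto
    also have "\<dots> = eps\<^sup>2 * q0\<^sup>2 + eps\<^sup>2 * X0\<^sup>2" by (simp add: algebra_simps)
    also have "eps\<^sup>2 * q0\<^sup>2 \<le> eps\<^sup>2 * (q0\<^sup>2 + r\<^sup>2)" by (intro mult_left_mono) auto
    finally show ?thesis using e0 X(2) unfolding V_def by linarith
  qed
  have el: "0 \<le> eps\<^sup>2 * l" using nn by simp
  have "2 * q1 * s1 \<le> 2 * q1 * (eps\<^sup>2 * l * (3 * M\<^sup>2 * d + 12 * M * k * (eps * r) + 6 * M * X1))"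
    using nn by (intro mult_left_mono s1) auto
  also have "\<dots> = eps\<^sup>2 * l * (3 * M\<^sup>2 * (2 * q1 * d) + 12 * M * k * (2 * q1 * (eps * r)) + 6 * M * (2 * q1 * X1))"
    by (simp add: algebra_simps)
  also have "\<dots> \<le> eps\<^sup>2 * l * (3 * M\<^sup>2 * V + 12 * M * k * V + 6 * M * (V + 2 * K * g))"
    using nn by (intro mult_left_mono[OF _ el] add_mono mult_left_mono b1 b2 b3) auto
  finally have 1: "2 * q1 * s1 \<le> eps\<^sup>2 * l * (3 * M\<^sup>2 * V + 12 * M * k * V + 6 * M * (V + 2 * K * g))" .
  have "eps\<^sup>2 * (2 * q0 * s0) \<le> eps\<^sup>2 * (2 * q0 * (eps\<^sup>2 * l * (3 * M\<^sup>2 * r + 3 * M * X0)))"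
    using nn by (intro mult_left_mono s0) auto
  also have "\<dots> = eps\<^sup>2 * l * (3 * M\<^sup>2 * (eps\<^sup>2 * (2 * q0 * r)) + 3 * M * (eps\<^sup>2 * (2 * q0 * X0)))"
    by (simp add: algebra_simps)
  also have "\<dots> \<le> eps\<^sup>2 * l * (3 * M\<^sup>2 * V + 3 * M * (V + K * g))"
    using nn by (intro mult_left_mono[OF _ el] add_mono mult_left_mono b4 b5) auto
  finally have "2 * q1 * s1 + eps\<^sup>2 * (2 * q0 * s0) \<le> eps\<^sup>2 * l * (3 * M\<^sup>2 * V + 12 * M * k * V + 6 * M * (V + 2 * K * g))
      + eps\<^sup>2 * l * (3 * M\<^sup>2 * V + 3 * M * (V + K * g))" using 1 by linarith
  also have "\<dots> = eps\<^sup>2 * (l * (6 * M\<^sup>2 + 12 * M * k + 9 * M)) * V + eps\<^sup>2 * (15 * l * M * K) * g" by (simp add: algebra_simps)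
  also have "\<dots> \<le> eps\<^sup>2 * (l * (6 * M\<^sup>2 + 24 * M * k + 9 * M)) * V + eps\<^sup>2 * (15 * l * M * K) * g"
  proof -
    have "0 \<le> V" using e0 by (simp add: V_def)
    then show ?thesis using nn by (intro add_right_mono mult_right_mono mult_left_mono) (auto simp: mult_left_mono)
  qed
  finally show ?thesis by (simp add: V_def)
qed

text \<open>As long as no wave lags, the products are an external force. Young's inequality with
  weight \<open>eps\<close> leaves their squares as source and costs a growth rate
  \<open>eps\<close>, harmless for times O(1/\<open>eps\<close>).\<close>

lemma early_source_le:
  fixes q1 d r q0 s1 s0 X1 X0 eps l M k e1 e0 :: real
  assumes nn: "0 \<le> q1" "0 \<le> q0" "0 \<le> l" "0 \<le> M" "0 \<le> k" and eps: "0 < eps"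
    and s1: "s1 \<le> eps\<^sup>2 * l * (3 * M\<^sup>2 * d + 12 * M * k * (eps * r) + 6 * M * X1)"
    and s0: "s0 \<le> eps\<^sup>2 * l * (3 * M\<^sup>2 * r + 3 * M * X0)"
    and e: "q1\<^sup>2 + d\<^sup>2 \<le> e1" "q0\<^sup>2 + r\<^sup>2 \<le> e0"
  shows "2 * q1 * s1 + eps\<^sup>2 * (2 * q0 * s0)
    \<le> (eps\<^sup>2 * (l * (6 * M\<^sup>2 + 24 * M * k + 9 * M)) + eps) * (e1 + eps\<^sup>2 * e0) + eps^3 * (36 * l\<^sup>2 * M\<^sup>2) * X1\<^sup>2 + eps^5 * (9 * l\<^sup>2 * M\<^sup>2) * X0\<^sup>2"
proof -
  define Y1 where "Y1 = eps\<^sup>2 * l * (6 * M * X1)"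
  define Y0 where "Y0 = eps\<^sup>2 * l * (3 * M * X0)"
  \<comment> \<open>Once \<open>Y1\<close> and \<open>Y0\<close> are removed from the sources, this
    is \<open>late_source_le\<close> without products.\<close>
  have "2 * q1 * (s1 - Y1) + eps\<^sup>2 * (2 * q0 * (s0 - Y0)) \<le> eps\<^sup>2 * (l * (6 * M\<^sup>2 + 24 * M * k + 9 * M)) * (e1 + eps\<^sup>2 * e0) + eps\<^sup>2 * (15 * l * M * 0) * 0"
  proof (rule late_source_le[where ?X1.0 = 0 and ?X0.0 = 0, OF nn _ _ _ _ e])
    show "s1 - Y1 \<le> eps\<^sup>2 * l * (3 * M\<^sup>2 * d + 12 * M * k * (eps * r) + 6 * M * 0)"
      using s1 by (simp add: Y1_def algebra_simps)
    show "s0 - Y0 \<le> eps\<^sup>2 * l * (3 * M\<^sup>2 * r + 3 * M * 0)"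
      using s0 by (simp add: Y0_def algebra_simps)
  qed auto
  then have 1: "2 * q1 * s1 + eps\<^sup>2 * (2 * q0 * s0) \<le> eps\<^sup>2 * (l * (6 * M\<^sup>2 + 24 * M * k + 9 * M)) * (e1 + eps\<^sup>2 * e0)
     + 2 * q1 * Y1 + eps\<^sup>2 * (2 * q0 * Y0)"
    by (simp add: algebra_simps)
  have am: "2 * a * b \<le> eps * a\<^sup>2 + b\<^sup>2 / eps" for a b :: real
  proof -
    have "0 \<le> (eps * a - b)\<^sup>2 / eps" using eps by simp
    also have "\<dots> = eps * a\<^sup>2 + b\<^sup>2 / eps - 2 * a * b" using eps by (simp add: power2_eq_square field_simps)
    finally show ?thesis by simp
  qed
  have 2: "2 * q1 * Y1 \<le> eps * e1 + eps^3 * (36 * l\<^sup>2 * M\<^sup>2) * X1\<^sup>2"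
  proof -
    have "q1\<^sup>2 \<le> e1" using e(1) zero_le_power2[of d] by linarith
    then have "eps * q1\<^sup>2 \<le> eps * e1" using eps by (intro mult_left_mono) auto
    moreover have "Y1\<^sup>2 / eps = eps^3 * (36 * l\<^sup>2 * M\<^sup>2) * X1\<^sup>2"
      using eps by (simp add: Y1_def power2_eq_square power3_eq_cube)
    ultimately show ?thesis using am[of q1 Y1] by linarith
  qed
  have 3: "eps\<^sup>2 * (2 * q0 * Y0) \<le> eps * (eps\<^sup>2 * e0) + eps^5 * (9 * l\<^sup>2 * M\<^sup>2) * X0\<^sup>2"
  proof -
    have "q0\<^sup>2 \<le> e0" using e(2) zero_le_power2[of r] by linarith
    then have "eps * q0\<^sup>2 \<le> eps * e0" using eps by (intro mult_left_mono) auto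
    then have "2 * q0 * Y0 \<le> eps * e0 + Y0\<^sup>2 / eps" using am[of q0 Y0] by linarith
    then have "eps\<^sup>2 * (2 * q0 * Y0) \<le> eps\<^sup>2 * (eps * e0 + Y0\<^sup>2 / eps)" by (intro mult_left_mono) auto
    also have "\<dots> = eps * (eps\<^sup>2 * e0) + eps^5 * (9 * l\<^sup>2 * M\<^sup>2) * X0\<^sup>2"
      using eps by (simp add: Y0_def algebra_simps power2_eq_square eval_nat_numeral)
    finally show ?thesis .
  qed
  show ?thesis using 1 2 3 by (simp add: algebra_simps)
qed

context collision
begin

definition "l = \<bar>lam\<bar>"
definition "cc = \<bar>P.c\<bar>"
definition "m = cc / 2 * \<Omega>\<^sup>2"
definition "Cw = 27 / cc + 9 / 2"
definition "L1 = l * (6 * M\<^sup>2 + 24 * M * sqrt K + 9 * M)"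
definition "L2 = 15 * l * M * K"
definition "L3 = 153 * l\<^sup>2 * M\<^sup>2 * K\<^sup>2"
definition "s = 3 * l * K"
text \<open>At time \<open>q0 / eps\<close> each front has travelled (R + 1)/\<open>eps\<close> and
  is past the origin by 1/\<open>eps\<close> \<ge> 1; from then on every point is behind at least
  one of them.\<close>

definition "q0 = 2 * (R + 1) / cc"
text \<open>The multiple of the weights at which their decay \<open>m * G\<close> just cancels the
  production \<open>L2 * G\<close> of the products.\<close>

definition "a = L2 / m"
definition "L4 = 4 * a * Cw * K"
text \<open>\<open>L6\<close> bounds \<Psi>/\<open>eps\<close>^3 during the early phase,
  \<open>L7\<close> up to the final time.\<close>

definition "L6 = (4 * R * A\<^sup>2 + (L3 + L4) * q0) * exp ((L1 + s + 1) * q0)"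
definition "L7 = (L6 + L4 * T) * exp ((L1 + s) * T)"

abbreviation "r0 \<equiv> R / eps"
text \<open>D-derivatives are one power of \<open>eps\<close> smaller than the functions themselves;
  the factor \<open>eps\<close>^2 puts both energies on the common level
  \<open>eps\<close>^3.\<close>

definition "Ec t = R1.E t + eps\<^sup>2 * R0.E t"
definition "Wt t = (P.wD r0 t + N.wD r0 t) + eps\<^sup>2 * (P.wU r0 t + N.wU r0 t)"
definition "G t = (P.lag r0 P.D t + N.lag r0 N.D t) + eps\<^sup>2 * (P.lag r0 p t + N.lag r0 n t)"
text \<open>\<open>eps\<close>^2 is the strength with which \<open>G\<close> drives
  \<open>Ec\<close>. The weights start at zero and are fed at rate O(\<open>eps\<close>^3) for a
  time O(1/\<open>eps\<close>^2), so the correction does not exceed the order of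
  \<open>Ec\<close>.\<close>

definition "\<Psi> t = Ec t + a * eps\<^sup>2 * Wt t"

lemma Nc: "N.c = - P.c" "\<bar>N.c\<bar> = cc" "cc > 0"
  using P.\<Omega>_ge(4) by (auto simp: N.c_def P.c_def cc_def)

lemma m_pos: "m > 0" using Nc(3) P.\<Omega>_ge(2) by (simp add: m_def)

lemma consts_nonneg: "l \<ge> 0" "L1 \<ge> 0" "L2 \<ge> 0" "L3 \<ge> 0" "s \<ge> 0" "q0 > 0" "a \<ge> 0" "L4 \<ge> 0" "Cw > 0" "L6 \<ge> 0"
proof -
  show l: "l \<ge> 0" by (simp add: l_def)
  show "L1 \<ge> 0" unfolding L1_def using l M K by (intro mult_nonneg_nonneg add_nonneg_nonneg) auto
  show L2: "L2 \<ge> 0" unfolding L2_def using l M K by (intro mult_nonneg_nonneg) auto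
  show L3: "L3 \<ge> 0" unfolding L3_def by (intro mult_nonneg_nonneg) auto
  show "s \<ge> 0" unfolding s_def using l K by simp
  show q: "q0 > 0" unfolding q0_def using R Nc(3) by simp
  show a: "a \<ge> 0" unfolding a_def using L2 m_pos by simp
  show C: "Cw > 0" unfolding Cw_def using Nc(3) by (intro add_pos_pos) auto
  show L4: "L4 \<ge> 0" unfolding L4_def using a C K by simp
  show "L6 \<ge> 0" unfolding L6_def using L3 L4 q R by (intro mult_nonneg_nonneg add_nonneg_nonneg) auto
qed

lemma S_bounds_aux:
  assumes "(cmod v)\<^sup>2 \<le> K"
  shows "cmod (of_real \<mu> * cubic v) \<le> eps\<^sup>2 * s * cmod v" "cmod (of_real \<mu> * bil v w) \<le> eps\<^sup>2 * s * cmod w"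
proof -
  have "cmod (of_real \<mu> * bil v w) \<le> eps\<^sup>2 * l * (3 * (cmod v)\<^sup>2 * cmod w)"
    unfolding norm_mult norm_of_real by (intro mult_mono cmod_bil_le) (auto simp: \<mu> l_def abs_mult)
  also have "\<dots> \<le> eps\<^sup>2 * l * (3 * K * cmod w)"
    using assms consts_nonneg(1) by (intro mult_left_mono mult_right_mono) auto
  finally show "cmod (of_real \<mu> * bil v w) \<le> eps\<^sup>2 * s * cmod w" by (simp add: s_def mult_ac)
  have "cmod (of_real \<mu> * cubic v) = eps\<^sup>2 * l * ((cmod v)\<^sup>2 * cmod v)"
    unfolding norm_mult norm_of_real cmod_cubic by (simp add: \<mu> l_def abs_mult)
  also have "\<dots> \<le> eps\<^sup>2 * l * (3 * K * cmod v)"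
    using assms consts_nonneg(1) K by (intro mult_left_mono mult_right_mono) auto
  finally show "cmod (of_real \<mu> * cubic v) \<le> eps\<^sup>2 * s * cmod v" by (simp add: s_def mult_ac)
qed

text \<open>Both levels have errors of the same order: O(\<open>eps\<close>^3) for the weights of D,
  and O(\<open>eps\<close>) with the prefactor \<open>eps\<close>^2 for those of the waves. Two
  waves on two levels account for the factor 4.\<close>

lemma Wt_deriv:
  assumes t: "t \<in> {0..B}"
  shows "\<exists>w'. (Wt has_real_derivative w') (at t within {0..B}) \<and> w' \<le> - m * G t + 4 * Cw * K * eps^3 + eps\<^sup>2 * s * Wt t"
proof -
  have \<sigma>: "eps\<^sup>2 * s \<ge> 0" using consts_nonneg by simp
  have k: "\<bar>P.c\<bar> / 2 * \<Omega>\<^sup>2 = m" "\<bar>N.c\<bar> / 2 * (- \<Omega>)\<^sup>2 = m" "27 / \<bar>P.c\<bar> + 9 / 2 = Cw" "27 / \<bar>N.c\<bar> + 9 / 2 = Cw"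
    unfolding Nc(2) by (simp_all add: m_def cc_def Cw_def)
  obtain w1 where w1: "(P.wU r0 has_real_derivative w1) (at t within {0..B})"
    "w1 \<le> - m * P.lag r0 p t + Cw * (sqn Y P.Z t + sqn Y P.D t) + eps\<^sup>2 * s * P.wU r0 t"
    using P.wU_deriv[OF \<sigma> S_bounds_aux(1)[OF bp(1)] t, of r0] unfolding k by blast
  obtain w2 where w2: "(P.wD r0 has_real_derivative w2) (at t within {0..B})"
    "w2 \<le> - m * P.lag r0 P.D t + Cw * (sqn Y P.DZ t + sqn Y P.DD t) + eps\<^sup>2 * s * P.wD r0 t"
    using P.wD_deriv[OF \<sigma> S_bounds_aux(2)[OF bp(1)] t, of r0] unfolding k by blast
  obtain w3 where w3: "(N.wU r0 has_real_derivative w3) (at t within {0..B})"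
    "w3 \<le> - m * N.lag r0 n t + Cw * (sqn N.Y N.Z t + sqn N.Y N.D t) + eps\<^sup>2 * s * N.wU r0 t"
    using N.wU_deriv[OF \<sigma> S_bounds_aux(1)[OF bn(1)] t, of r0] unfolding k by blast
  obtain w4 where w4: "(N.wD r0 has_real_derivative w4) (at t within {0..B})"
    "w4 \<le> - m * N.lag r0 N.D t + Cw * (sqn N.Y N.DZ t + sqn N.Y N.DD t) + eps\<^sup>2 * s * N.wD r0 t"
    using N.wD_deriv[OF \<sigma> S_bounds_aux(2)[OF bn(1)] t, of r0] unfolding k by blast
  have D: "(Wt has_real_derivative (w2 + w4) + eps\<^sup>2 * (w1 + w3)) (at t within {0..B})"
    unfolding Wt_def[abs_def]
    by (intro DERIV_add DERIV_cmult w1 w2 w3 w4)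
  have C: "Cw * x \<le> Cw * y" if "x \<le> y" for x y using that consts_nonneg(9) by (intro mult_left_mono) auto
  have "w1 \<le> - m * P.lag r0 p t + Cw * (K * eps) + eps\<^sup>2 * s * P.wU r0 t"
    using w1(2) C[OF bp(4)[OF t]] by linarith
  moreover have "w3 \<le> - m * N.lag r0 n t + Cw * (K * eps) + eps\<^sup>2 * s * N.wU r0 t"
    using w3(2) C[OF bn(4)[OF t]] by linarith
  ultimately have "eps\<^sup>2 * (w1 + w3) \<le> eps\<^sup>2 * (- m * (P.lag r0 p t + N.lag r0 n t) + 2 * (Cw * (K * eps)) + eps\<^sup>2 * s * (P.wU r0 t + N.wU r0 t))"
    by (intro mult_left_mono) (auto simp: algebra_simps)
  moreover have "w2 \<le> - m * P.lag r0 P.D t + Cw * (K * eps^3) + eps\<^sup>2 * s * P.wD r0 t"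
    using w2(2) C[OF bp(5)[OF t]] by linarith
  moreover have "w4 \<le> - m * N.lag r0 N.D t + Cw * (K * eps^3) + eps\<^sup>2 * s * N.wD r0 t"
    using w4(2) C[OF bn(5)[OF t]] by linarith
  ultimately have "(w2 + w4) + eps\<^sup>2 * (w1 + w3) \<le>
     (- m * P.lag r0 P.D t + Cw * (K * eps^3) + eps\<^sup>2 * s * P.wD r0 t) + (- m * N.lag r0 N.D t + Cw * (K * eps^3) + eps\<^sup>2 * s * N.wD r0 t)
     + eps\<^sup>2 * (- m * (P.lag r0 p t + N.lag r0 n t) + 2 * (Cw * (K * eps)) + eps\<^sup>2 * s * (P.wU r0 t + N.wU r0 t))"
    by linarith
  also have "\<dots> = - m * G t + 4 * Cw * K * eps^3 + eps\<^sup>2 * s * Wt t"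
    by (simp add: G_def Wt_def algebra_simps power2_eq_square power3_eq_cube)
  finally show ?thesis using D by blast
qed

lemma sqrtK: "sqrt K \<ge> 0" "(sqrt K)\<^sup>2 = K" using K by auto

text \<open>For \<open>S0\<close>, u is first replaced by p + n at the price of the remainder; since
  each wave carries its own cubic term, only genuine products of p and n are left. In
  \<open>S1\<close> the linearization is moved in the same way from u to the wave whose D it acts
  on.\<close>

lemma source_bounds:
  assumes t: "t \<in> {0..B}"
  shows "cmod (S0 t x) \<le> eps\<^sup>2 * l * (3 * M\<^sup>2 * cmod (u t x - p t x - n t x) + 3 * M * (cmod (p t x) * cmod (n t x)))"
    "cmod (S1 t x) \<le> eps\<^sup>2 * l * (3 * M\<^sup>2 * cmod (W.D t x - P.D t x - N.D t x) + 12 * M * sqrt K * (eps * cmod (u t x - p t x - n t x))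
       + 6 * M * (cmod (n t x) * cmod (P.D t x) + cmod (p t x) * cmod (N.D t x)))"
proof -
  define v where "v = u t x" define b where "b = p t x" define c where "c = n t x"
  define dv where "dv = W.D t x" define db where "db = P.D t x" define dc where "dc = N.D t x"
  have bM': "cmod v \<le> M" "cmod b + cmod c \<le> M" using bM t by (auto simp: v_def b_def c_def)
  then have bM'': "cmod b \<le> M" "cmod c \<le> M" using norm_ge_zero[of b] norm_ge_zero[of c] by linarith+
  have l\<mu>: "\<bar>\<mu>\<bar> = eps\<^sup>2 * l" by (simp add: \<mu> l_def abs_mult)
  have "cmod (cubic v - cubic b - cubic c) \<le> cmod (cubic v - cubic (b + c)) + cmod (cubic (b + c) - cubic b - cubic c)"
  proof -
    have "cubic v - cubic b - cubic c = (cubic v - cubic (b + c)) + (cubic (b + c) - cubic b - cubic c)"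
      by (simp add: algebra_simps)
    then show ?thesis by (simp only: norm_triangle_ineq)
  qed
  also have "\<dots> \<le> 3 * M\<^sup>2 * cmod (v - (b + c)) + 3 * M * (cmod b * cmod c)"
  proof (rule add_mono)
    show "cmod (cubic v - cubic (b + c)) \<le> 3 * M\<^sup>2 * cmod (v - (b + c))"
      by (rule cubic_diff_le[OF bM'(1)]) (rule order_trans[OF norm_triangle_ineq bM'(2)])
    show "cmod (cubic (b + c) - cubic b - cubic c) \<le> 3 * M * (cmod b * cmod c)"
      by (rule order_trans[OF cubic_cross_le]) (use bM' in \<open>auto intro!: mult_right_mono\<close>)
  qed
  finally have 0: "cmod (cubic v - cubic b - cubic c) \<le> 3 * M\<^sup>2 * cmod (v - b - c) + 3 * M * (cmod b * cmod c)"
    by (simp add: diff_diff_eq)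
  have "S0 t x = of_real \<mu> * (cubic v - cubic b - cubic c)" by (simp add: S0_def v_def b_def c_def algebra_simps)
  then have "cmod (S0 t x) = eps\<^sup>2 * l * cmod (cubic v - cubic b - cubic c)" by (simp add: norm_mult l\<mu>)
  also have "\<dots> \<le> eps\<^sup>2 * l * (3 * M\<^sup>2 * cmod (v - b - c) + 3 * M * (cmod b * cmod c))"
    using consts_nonneg(1) by (intro mult_left_mono 0) auto
  finally show "cmod (S0 t x) \<le> eps\<^sup>2 * l * (3 * M\<^sup>2 * cmod (u t x - p t x - n t x) + 3 * M * (cmod (p t x) * cmod (n t x)))"
    by (simp add: v_def b_def c_def)
  have sq_le: "cmod z \<le> sqrt K * eps" if "(cmod z)\<^sup>2 \<le> K * eps\<^sup>2" for z
    by (rule power2_le_imp_le) (use that eps sqrtK in \<open>auto simp: power_mult_distrib\<close>)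
  have db: "cmod db \<le> sqrt K * eps" "cmod dc \<le> sqrt K * eps"
    using bp(2)[OF t, of x] bn(2)[OF t, of x] by (auto intro: sq_le simp: db_def dc_def)
  \<comment> \<open>Used with y = p, w = n and with y = n, w = p: u differs from either wave by the
    other wave plus the remainder.\<close>
  have piece: "cmod (bil v h - bil y h) \<le> 6 * M * (cmod w * cmod h) + 6 * M * sqrt K * (eps * cmod (v - b - c))"
    if "cmod y \<le> M" "v - y = w + (v - b - c)" "cmod h \<le> sqrt K * eps" for h y w
  proof -
    have "cmod (bil v h - bil y h) \<le> 3 * (cmod v + cmod y) * cmod (v - y) * cmod h" by (rule bil_diff_le)
    also have "\<dots> \<le> 3 * (M + M) * (cmod w + cmod (v - b - c)) * cmod h"
      unfolding that(2) using bM' that M by (intro mult_right_mono mult_mono add_mono norm_triangle_ineq) auto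
    also have "\<dots> = 6 * M * (cmod w * cmod h) + 6 * M * (cmod (v - b - c) * cmod h)" by (simp add: algebra_simps)
    also have "\<dots> \<le> 6 * M * (cmod w * cmod h) + 6 * M * (cmod (v - b - c) * (sqrt K * eps))"
      using that M by (intro add_left_mono mult_left_mono) auto
    finally show ?thesis by (simp add: mult_ac)
  qed
  have e: "bil v dv - bil b db - bil c dc = bil v (dv - db - dc) + (bil v db - bil b db) + (bil v dc - bil c dc)"
    by (simp add: bil_def algebra_simps)
  have "cmod (bil v dv - bil b db - bil c dc) \<le> cmod (bil v (dv - db - dc)) + cmod (bil v db - bil b db) + cmod (bil v dc - bil c dc)"
    unfolding e by (intro order_trans[OF norm_triangle_ineq] add_right_mono norm_triangle_ineq)
  also have "\<dots> \<le> 3 * M\<^sup>2 * cmod (dv - db - dc)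
     + (6 * M * (cmod c * cmod db) + 6 * M * sqrt K * (eps * cmod (v - b - c)))
     + (6 * M * (cmod b * cmod dc) + 6 * M * sqrt K * (eps * cmod (v - b - c)))"
  proof (intro add_mono piece bM'' db)
    have "cmod (bil v (dv - db - dc)) \<le> 3 * (cmod v)\<^sup>2 * cmod (dv - db - dc)" by (rule cmod_bil_le)
    also have "\<dots> \<le> 3 * M\<^sup>2 * cmod (dv - db - dc)" using bM' by (intro mult_right_mono mult_left_mono power_mono) auto
    finally show "cmod (bil v (dv - db - dc)) \<le> 3 * M\<^sup>2 * cmod (dv - db - dc)" .
  qed auto
  also have "\<dots> = 3 * M\<^sup>2 * cmod (dv - db - dc) + 12 * M * sqrt K * (eps * cmod (v - b - c)) + 6 * M * (cmod c * cmod db + cmod b * cmod dc)"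
    by (simp add: algebra_simps)
  finally have 1: "cmod (bil v dv - bil b db - bil c dc) \<le> 3 * M\<^sup>2 * cmod (dv - db - dc) + 12 * M * sqrt K * (eps * cmod (v - b - c)) + 6 * M * (cmod c * cmod db + cmod b * cmod dc)" .
  have "S1 t x = of_real \<mu> * (bil v dv - bil b db - bil c dc)" by (simp add: S1_def v_def b_def c_def dv_def db_def dc_def algebra_simps)
  then have "cmod (S1 t x) = eps\<^sup>2 * l * cmod (bil v dv - bil b db - bil c dc)" by (simp add: norm_mult l\<mu>)
  also have "\<dots> \<le> eps\<^sup>2 * l * (3 * M\<^sup>2 * cmod (dv - db - dc) + 12 * M * sqrt K * (eps * cmod (v - b - c)) + 6 * M * (cmod c * cmod db + cmod b * cmod dc))"
    using consts_nonneg(1) by (intro mult_left_mono 1) auto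
  finally show "cmod (S1 t x) \<le> eps\<^sup>2 * l * (3 * M\<^sup>2 * cmod (W.D t x - P.D t x - N.D t x) + 12 * M * sqrt K * (eps * cmod (u t x - p t x - n t x))
       + 6 * M * (cmod (n t x) * cmod (P.D t x) + cmod (p t x) * cmod (N.D t x)))"
    by (simp add: v_def b_def c_def dv_def db_def dc_def)
qed

end

context collision
begin

abbreviation "q1 t x \<equiv> cmod (W.Dt t x - P.Dt t x - N.Dt t x)"
abbreviation "qd t x \<equiv> cmod (W.D t x - P.D t x - N.D t x)"
abbreviation "qt t x \<equiv> cmod (ut t x - pt t x - nt t x)"
abbreviation "qr t x \<equiv> cmod (u t x - p t x - n t x)"
definition "X1 t x = cmod (n t x) * cmod (P.D t x) + cmod (p t x) * cmod (N.D t x)"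
definition "X0 t x = cmod (p t x) * cmod (n t x)"
definition "g' t x = (P.front r0 t x * (cmod (P.D t x))\<^sup>2 + N.front r0 t x * (cmod (N.D t x))\<^sup>2)
   + eps\<^sup>2 * (P.front r0 t x * (cmod (p t x))\<^sup>2 + N.front r0 t x * (cmod (n t x))\<^sup>2)"
definition "ec' t = integral {-Y..Y} (\<lambda>x. - 2 * ((W.Dt t x - P.Dt t x - N.Dt t x) \<bullet> S1 t x))
   + eps\<^sup>2 * integral {-Y..Y} (\<lambda>x. - 2 * ((ut t x - pt t x - nt t x) \<bullet> S0 t x))"

lemma Ec_deriv: "t \<in> {0..B} \<Longrightarrow> (Ec has_real_derivative ec' t) (at t within {0..B})"
  unfolding Ec_def[abs_def] ec'_def
  by (intro DERIV_add DERIV_cmult R0.energy_deriv R1.energy_deriv)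

lemma contS_p: "contS B p" "contS B n" "contS B P.D" "contS B N.D"
  using P.contS_all N.contS_all by blast+

lemma contS_src:
  "contS B (\<lambda>t x. - 2 * ((W.Dt t x - P.Dt t x - N.Dt t x) \<bullet> S1 t x))"
  "contS B (\<lambda>t x. - 2 * ((ut t x - pt t x - nt t x) \<bullet> S0 t x))"
  by (intro contS_cmult contS_inner R1.contS_jets R1.contS_S R0.contS_jets R0.contS_S)+

lemma ec'_le:
  assumes t: "t \<in> {0..B}" and h: "contS B h"
    and le: "\<And>x. 2 * q1 t x * cmod (S1 t x) + eps\<^sup>2 * (2 * qt t x * cmod (S0 t x)) \<le> h t x"
  shows "ec' t \<le> integral {-Y..Y} (h t)"
proof -
  have "ec' t = integral {-Y..Y} (\<lambda>x. 1 * (- 2 * ((W.Dt t x - P.Dt t x - N.Dt t x) \<bullet> S1 t x)) + eps\<^sup>2 * (- 2 * ((ut t x - pt t x - nt t x) \<bullet> S0 t x)))"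
    unfolding contS_integral_lin[OF contS_src t] ec'_def by simp
  also have "\<dots> \<le> integral {-Y..Y} (h t)"
  proof (rule contS_integral_mono[OF contS_add[OF contS_cmult[OF contS_src(1)] contS_cmult[OF contS_src(2)]] h t])
    fix x
    have 1: "- 2 * ((W.Dt t x - P.Dt t x - N.Dt t x) \<bullet> S1 t x) \<le> 2 * q1 t x * cmod (S1 t x)"
      using Cauchy_Schwarz_ineq2[of "W.Dt t x - P.Dt t x - N.Dt t x" "S1 t x"] by linarith
    have "- 2 * ((ut t x - pt t x - nt t x) \<bullet> S0 t x) \<le> 2 * qt t x * cmod (S0 t x)"
      using Cauchy_Schwarz_ineq2[of "ut t x - pt t x - nt t x" "S0 t x"] by linarith
    then have "eps\<^sup>2 * (- 2 * ((ut t x - pt t x - nt t x) \<bullet> S0 t x)) \<le> eps\<^sup>2 * (2 * qt t x * cmod (S0 t x))"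
      by (rule mult_left_mono[OF _ zero_le_power2])
    with 1 le[of x] show "1 * (- 2 * ((W.Dt t x - P.Dt t x - N.Dt t x) \<bullet> S1 t x)) + eps\<^sup>2 * (- 2 * ((ut t x - pt t x - nt t x) \<bullet> S0 t x)) \<le> h t x"
      by linarith
  qed
  finally show ?thesis .
qed

lemma e_ge: "(q1 t x)\<^sup>2 + (qd t x)\<^sup>2 \<le> R1.e t x" "(qt t x)\<^sup>2 + (qr t x)\<^sup>2 \<le> R0.e t x"
  by (simp_all add: R1.e_def R0.e_def)

lemma Ec_integral:
  "t \<in> {0..B} \<Longrightarrow> integral {-Y..Y} (\<lambda>x. 1 * R1.e t x + eps\<^sup>2 * R0.e t x) = Ec t"
  by (subst contS_integral_lin[OF R1.contS_e R0.contS_e]) (simp_all add: Ec_def R1.E_def R0.E_def)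

lemma X1_sq: "(X1 t x)\<^sup>2 \<le> 2 * ((cmod (n t x))\<^sup>2 * (cmod (P.D t x))\<^sup>2 + (cmod (p t x))\<^sup>2 * (cmod (N.D t x))\<^sup>2)"
  unfolding X1_def power_mult_distrib[symmetric]
  using sum_squares_bound[of "cmod (n t x) * cmod (P.D t x)" "cmod (p t x) * cmod (N.D t x)"] by (simp add: power2_sum)

lemma contS_g': "contS B g'"
  unfolding g'_def[abs_def]
  by (intro contS_add contS_cmult contS_mult P.contS_front N.contS_front contS_sq contS_p)

lemma g'_integral: "t \<in> {0..B} \<Longrightarrow> integral {-Y..Y} (g' t) = G t"
proof -
  assume t: "t \<in> {0..B}"
  note c = contS_mult[OF P.contS_front[of r0] contS_sq[OF contS_p(3)]] contS_mult[OF N.contS_front[of r0] contS_sq[OF contS_p(4)]]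
    contS_mult[OF P.contS_front[of r0] contS_sq[OF contS_p(1)]] contS_mult[OF N.contS_front[of r0] contS_sq[OF contS_p(2)]]
  have l: "P.lag r0 P.D t = integral {-Y..Y} (\<lambda>x. P.front r0 t x * (cmod (P.D t x))\<^sup>2)"
    "N.lag r0 N.D t = integral {-Y..Y} (\<lambda>x. N.front r0 t x * (cmod (N.D t x))\<^sup>2)"
    "P.lag r0 p t = integral {-Y..Y} (\<lambda>x. P.front r0 t x * (cmod (p t x))\<^sup>2)"
    "N.lag r0 n t = integral {-Y..Y} (\<lambda>x. N.front r0 t x * (cmod (n t x))\<^sup>2)"
    by (simp_all add: P.lag_def N.lag_def)
  have gl: "g' t = (\<lambda>x. 1 * (1 * (P.front r0 t x * (cmod (P.D t x))\<^sup>2) + 1 * (N.front r0 t x * (cmod (N.D t x))\<^sup>2))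
    + eps\<^sup>2 * (1 * (P.front r0 t x * (cmod (p t x))\<^sup>2) + 1 * (N.front r0 t x * (cmod (n t x))\<^sup>2)))"
    by (auto simp: g'_def)
  show ?thesis
    unfolding gl contS_integral_lin[OF contS_add[OF contS_cmult[OF c(1)] contS_cmult[OF c(2)]] contS_add[OF contS_cmult[OF c(3)] contS_cmult[OF c(4)]] t]
      contS_integral_lin[OF c(1,2) t] contS_integral_lin[OF c(3,4) t] G_def l by simp
qed

lemma ec'_late:
  assumes t: "t \<in> {0..B}" and late: "q0 / eps \<le> t"
  shows "ec' t \<le> eps\<^sup>2 * L1 * Ec t + eps\<^sup>2 * L2 * G t"
proof -
  have "ec' t \<le> integral {-Y..Y} (\<lambda>x. (eps\<^sup>2 * L1) * (1 * R1.e t x + eps\<^sup>2 * R0.e t x) + (eps\<^sup>2 * L2) * g' t x)"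
  proof (rule ec'_le[OF t])
    show "contS B (\<lambda>t x. (eps\<^sup>2 * L1) * (1 * R1.e t x + eps\<^sup>2 * R0.e t x) + (eps\<^sup>2 * L2) * g' t x)"
      by (intro contS_add contS_cmult R1.contS_e R0.contS_e contS_g')
    fix x
    \<comment> \<open>The ramps point in opposite directions, so their two arguments add up to twice
      \<open>cc / 2 * t - r0\<close>, at least 2, and one of them is at least 1.\<close>
    have far: "P.front r0 t x = 1 \<or> N.front r0 t x = 1"
    proof -
      have "cc / 2 * (q0 / eps) \<le> cc / 2 * t" using late Nc(3) by (intro mult_left_mono) auto
      moreover have "cc / 2 * (q0 / eps) = r0 + 1 / eps" using Nc(3) eps by (simp add: q0_def field_simps)
      moreover have "1 \<le> 1 / eps" using eps by simp
      ultimately have "1 \<le> cc / 2 * t - r0" by linarith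
      then have "1 \<le> cc / 2 * t - r0 - sgn P.c * x \<or> 1 \<le> cc / 2 * t - r0 - sgn N.c * x"
        unfolding Nc(1) by (simp only: sgn_minus) linarith
      then show ?thesis unfolding P.front_def N.front_def cc_def[symmetric] Nc(2) using ramp'_bounds(3) by blast
    qed
    note fb = P.front_bounds(1)[of r0 t x] N.front_bounds(1)[of r0 t x]
    have nn: "0 \<le> P.front r0 t x * (cmod (P.D t x))\<^sup>2" "0 \<le> N.front r0 t x * (cmod (N.D t x))\<^sup>2"
      "0 \<le> eps\<^sup>2 * (P.front r0 t x * (cmod (p t x))\<^sup>2)" "0 \<le> eps\<^sup>2 * (N.front r0 t x * (cmod (n t x))\<^sup>2)"
      using fb by auto
    note k = bp(1)[OF t, of x] bp(2)[OF t, of x] bn(1)[OF t, of x] bn(2)[OF t, of x]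
    define np dp nn' dn where "np = (cmod (p t x))\<^sup>2" and "dp = (cmod (P.D t x))\<^sup>2" and "nn' = (cmod (n t x))\<^sup>2" and "dn = (cmod (N.D t x))\<^sup>2"
    have pos: "0 \<le> np" "0 \<le> dp" "0 \<le> nn'" "0 \<le> dn" by (auto simp: np_def dp_def nn'_def dn_def)
    have kk: "np \<le> K" "dp \<le> K * eps\<^sup>2" "nn' \<le> K" "dn \<le> K * eps\<^sup>2" using k by (auto simp: np_def dp_def nn'_def dn_def)
    have gg: "dp + eps\<^sup>2 * np \<le> g' t x \<or> dn + eps\<^sup>2 * nn' \<le> g' t x"
      using far nn by (auto simp: g'_def np_def dp_def nn'_def dn_def algebra_simps)
    \<comment> \<open>Each product has one factor from the lagging wave, whose |D|^2 and
      \<open>eps\<close>^2 |wave|^2 are dominated by g'; the factor from the other wave is replaced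
      by its sup bound, K or K \<open>eps\<close>^2.\<close>
    have cr: "nn' * dp + np * dn \<le> K * g' t x \<and> eps\<^sup>2 * (np * nn') \<le> K * g' t x"
      using gg
    proof
      assume a: "dp + eps\<^sup>2 * np \<le> g' t x"
      have "K * (dp + eps\<^sup>2 * np) \<le> K * g' t x" using a K by (intro mult_left_mono)
      moreover have "nn' * dp \<le> K * dp" using kk pos by (intro mult_right_mono)
      moreover have "np * dn \<le> np * (K * eps\<^sup>2)" using kk pos by (intro mult_left_mono)
      moreover have "eps\<^sup>2 * (np * nn') \<le> eps\<^sup>2 * (np * K)" using kk pos by (intro mult_left_mono) auto
      moreover have "0 \<le> K * dp" using K pos by simp
      ultimately show ?thesis by (simp add: algebra_simps)
    next
      assume a: "dn + eps\<^sup>2 * nn' \<le> g' t x"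
      have "K * (dn + eps\<^sup>2 * nn') \<le> K * g' t x" using a K by (intro mult_left_mono)
      moreover have "np * dn \<le> K * dn" using kk pos by (intro mult_right_mono)
      moreover have "nn' * dp \<le> nn' * (K * eps\<^sup>2)" using kk pos by (intro mult_left_mono)
      moreover have "eps\<^sup>2 * (np * nn') \<le> eps\<^sup>2 * (K * nn')" using kk pos by (intro mult_left_mono mult_right_mono) auto
      moreover have "0 \<le> K * dn" using K pos by simp
      ultimately show ?thesis by (simp add: algebra_simps)
    qed
    have 1: "(X1 t x)\<^sup>2 \<le> 2 * K * g' t x"
      using X1_sq[of t x] cr by (simp add: np_def dp_def nn'_def dn_def)
    have 2: "eps\<^sup>2 * (X0 t x)\<^sup>2 \<le> K * g' t x"
      using cr by (simp add: X0_def power_mult_distrib np_def nn'_def)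
    have "2 * q1 t x * cmod (S1 t x) + eps\<^sup>2 * (2 * qt t x * cmod (S0 t x))
      \<le> eps\<^sup>2 * (l * (6 * M\<^sup>2 + 24 * M * sqrt K + 9 * M)) * (R1.e t x + eps\<^sup>2 * R0.e t x) + eps\<^sup>2 * (15 * l * M * K) * g' t x"
      by (rule late_source_le[OF _ _ consts_nonneg(1) M sqrtK(1) source_bounds(2)[OF t, folded X1_def] source_bounds(1)[OF t, folded X0_def] 1 2 e_ge]) auto
    then show "2 * q1 t x * cmod (S1 t x) + eps\<^sup>2 * (2 * qt t x * cmod (S0 t x))
      \<le> (eps\<^sup>2 * L1) * (1 * R1.e t x + eps\<^sup>2 * R0.e t x) + (eps\<^sup>2 * L2) * g' t x"
      by (simp only: L1_def L2_def mult_1_left)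
  qed
  also have "\<dots> = eps\<^sup>2 * L1 * Ec t + eps\<^sup>2 * L2 * G t"
    by (simp only: contS_integral_lin[OF contS_add[OF contS_cmult[OF R1.contS_e] contS_cmult[OF R0.contS_e]] contS_g' t] Ec_integral[OF t] g'_integral[OF t])
  finally show ?thesis .
qed

lemma ec'_early:
  assumes t: "t \<in> {0..B}"
  shows "ec' t \<le> (eps\<^sup>2 * L1 + eps) * Ec t + eps^4 * L3"
proof -
  \<comment> \<open>The sup bound K on the waves leaves a single square of each product: X1^2 \<le>
    2K(|Dp|^2 + |Dn|^2) and X0^2 \<le> K|p|^2. \<open>b1\<close> and \<open>b0\<close> are the
    resulting coefficients.\<close>
  define b1 where "b1 = eps^3 * (36 * l\<^sup>2 * M\<^sup>2) * (2 * K)"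
  define b0 where "b0 = eps^5 * (9 * l\<^sup>2 * M\<^sup>2) * K"
  have b: "0 \<le> b1" "0 \<le> b0" using K eps by (auto simp: b1_def b0_def)
  note cD = contS_sq[OF contS_p(3)] contS_sq[OF contS_p(4)] and cp = contS_sq[OF contS_p(1)]
  note cE = contS_add[OF contS_cmult[OF R1.contS_e] contS_cmult[OF R0.contS_e]]
  have "ec' t \<le> integral {-Y..Y} (\<lambda>x. 1 * ((eps\<^sup>2 * L1 + eps) * (1 * R1.e t x + eps\<^sup>2 * R0.e t x) + b0 * (cmod (p t x))\<^sup>2)
     + 1 * (b1 * (cmod (P.D t x))\<^sup>2 + b1 * (cmod (N.D t x))\<^sup>2))"
  proof (rule ec'_le[OF t])
    show "contS B (\<lambda>t x. 1 * ((eps\<^sup>2 * L1 + eps) * (1 * R1.e t x + eps\<^sup>2 * R0.e t x) + b0 * (cmod (p t x))\<^sup>2)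
     + 1 * (b1 * (cmod (P.D t x))\<^sup>2 + b1 * (cmod (N.D t x))\<^sup>2))"
      by (intro contS_add contS_cmult R1.contS_e R0.contS_e cD cp)
    fix x
    have "2 * q1 t x * cmod (S1 t x) + eps\<^sup>2 * (2 * qt t x * cmod (S0 t x))
      \<le> (eps\<^sup>2 * (l * (6 * M\<^sup>2 + 24 * M * sqrt K + 9 * M)) + eps) * (R1.e t x + eps\<^sup>2 * R0.e t x)
        + eps^3 * (36 * l\<^sup>2 * M\<^sup>2) * (X1 t x)\<^sup>2 + eps^5 * (9 * l\<^sup>2 * M\<^sup>2) * (X0 t x)\<^sup>2"
      by (rule early_source_le[OF _ _ consts_nonneg(1) M sqrtK(1) eps(1) source_bounds(2)[OF t, folded X1_def] source_bounds(1)[OF t, folded X0_def] e_ge]) auto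
    also have "eps^3 * (36 * l\<^sup>2 * M\<^sup>2) * (X1 t x)\<^sup>2 \<le> b1 * (cmod (P.D t x))\<^sup>2 + b1 * (cmod (N.D t x))\<^sup>2"
    proof -
      have "(X1 t x)\<^sup>2 \<le> 2 * (K * (cmod (P.D t x))\<^sup>2 + K * (cmod (N.D t x))\<^sup>2)"
        by (rule order_trans[OF X1_sq]) (intro mult_left_mono add_mono mult_right_mono bp(1)[OF t] bn(1)[OF t]; simp)
      then have "eps^3 * (36 * l\<^sup>2 * M\<^sup>2) * (X1 t x)\<^sup>2 \<le> eps^3 * (36 * l\<^sup>2 * M\<^sup>2) * (2 * (K * (cmod (P.D t x))\<^sup>2 + K * (cmod (N.D t x))\<^sup>2))"
        using eps by (intro mult_left_mono) auto
      then show ?thesis by (simp add: b1_def algebra_simps)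
    qed
    also have "eps^5 * (9 * l\<^sup>2 * M\<^sup>2) * (X0 t x)\<^sup>2 \<le> b0 * (cmod (p t x))\<^sup>2"
    proof -
      have "(X0 t x)\<^sup>2 \<le> (cmod (p t x))\<^sup>2 * K"
        unfolding X0_def power_mult_distrib by (intro mult_left_mono bn(1)[OF t]) auto
      then have "eps^5 * (9 * l\<^sup>2 * M\<^sup>2) * (X0 t x)\<^sup>2 \<le> eps^5 * (9 * l\<^sup>2 * M\<^sup>2) * ((cmod (p t x))\<^sup>2 * K)"
        using eps by (intro mult_left_mono) auto
      then show ?thesis by (simp add: b0_def mult_ac)
    qed
    finally show "2 * q1 t x * cmod (S1 t x) + eps\<^sup>2 * (2 * qt t x * cmod (S0 t x))
      \<le> 1 * ((eps\<^sup>2 * L1 + eps) * (1 * R1.e t x + eps\<^sup>2 * R0.e t x) + b0 * (cmod (p t x))\<^sup>2)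
     + 1 * (b1 * (cmod (P.D t x))\<^sup>2 + b1 * (cmod (N.D t x))\<^sup>2)"
      by (simp only: L1_def mult_1_left) linarith
  qed
  also have "\<dots> = (eps\<^sup>2 * L1 + eps) * Ec t + b0 * sqn Y p t + (b1 * sqn Y P.D t + b1 * sqn Y N.D t)"
    unfolding contS_integral_lin[OF contS_add[OF contS_cmult[OF cE] contS_cmult[OF cp]] contS_add[OF contS_cmult[OF cD(1)] contS_cmult[OF cD(2)]] t]
      contS_integral_lin[OF cE cp t] contS_integral_lin[OF cD t] Ec_integral[OF t] sqn_def by simp
  also have "\<dots> \<le> (eps\<^sup>2 * L1 + eps) * Ec t + b0 * (K / eps) + (b1 * (K * eps) + b1 * (K * eps))"
  proof (intro add_mono order_refl mult_left_mono b)
    show "sqn Y p t \<le> K / eps" by (rule bp(3)[OF t])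
    show "sqn Y P.D t \<le> K * eps" using bp(4)[OF t] sqn_nonneg[OF P.contS_all(5) t, of Y] by linarith
    show "sqn Y N.D t \<le> K * eps" using bn(4)[OF t] sqn_nonneg[OF N.contS_all(5) t, of Y] by linarith
  qed
  \<comment> \<open>The 153 in \<open>L3\<close> is 9 from the term with \<open>b0\<close> plus 72
    from each of the two terms with \<open>b1\<close>.\<close>
  also have "\<dots> = (eps\<^sup>2 * L1 + eps) * Ec t + eps^4 * L3"
    using eps by (simp add: b0_def b1_def L3_def eval_nat_numeral algebra_simps)
  finally show ?thesis .
qed

lemma zero_in: "0 \<in> {0..B}" using P.B_pos by auto

lemma W_nonneg: "t \<in> {0..B} \<Longrightarrow> 0 \<le> Wt t"
  unfolding Wt_def P.wD_def P.wU_def N.wD_def N.wU_def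
  by (intro add_nonneg_nonneg mult_nonneg_nonneg P.DU.wgt_nonneg P.U.wgt_nonneg N.DU.wgt_nonneg N.U.wgt_nonneg) auto

lemma G_nonneg: "t \<in> {0..B} \<Longrightarrow> 0 \<le> G t"
  unfolding G_def
  by (intro add_nonneg_nonneg mult_nonneg_nonneg P.lag_nonneg N.lag_nonneg contS_p) auto

lemma Ec_nonneg: "t \<in> {0..B} \<Longrightarrow> 0 \<le> Ec t"
  unfolding Ec_def by (intro add_nonneg_nonneg mult_nonneg_nonneg R1.sqn_le_E(4) R0.sqn_le_E(4)) auto

text \<open>One derivative, two estimates: the first discards the decay of the weights and holds at
  all times, the second spends it on the products and holds once every point has a lagging
  wave.\<close>

lemma \<Psi>_deriv:
  assumes t: "t \<in> {0..B}"
  shows "\<exists>\<psi>. (\<Psi> has_real_derivative \<psi>) (at t within {0..B}) \<and>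
     \<psi> \<le> eps * (L1 + s + 1) * \<Psi> t + eps^4 * (L3 + L4) \<and>
     (q0 / eps \<le> t \<longrightarrow> \<psi> \<le> eps\<^sup>2 * (L1 + s) * \<Psi> t + eps^5 * L4)"
proof -
  obtain w' where w': "(Wt has_real_derivative w') (at t within {0..B})" "w' \<le> - m * G t + 4 * Cw * K * eps^3 + eps\<^sup>2 * s * Wt t"
    using Wt_deriv[OF t] by blast
  have D: "(\<Psi> has_real_derivative ec' t + a * eps\<^sup>2 * w') (at t within {0..B})"
    unfolding \<Psi>_def[abs_def] by (intro DERIV_add DERIV_cmult Ec_deriv t w')
  have ae: "0 \<le> a * eps\<^sup>2" using consts_nonneg(7) by simp
  have am: "a * m = L2" using m_pos by (simp add: a_def)
  have "a * eps\<^sup>2 * w' \<le> a * eps\<^sup>2 * (- m * G t + 4 * Cw * K * eps^3 + eps\<^sup>2 * s * Wt t)"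
    by (intro mult_left_mono w' ae)
  also have "\<dots> = - eps\<^sup>2 * (a * m) * G t + eps^5 * L4 + eps\<^sup>2 * s * (a * eps\<^sup>2 * Wt t)"
    by (simp add: L4_def eval_nat_numeral algebra_simps)
  finally have w: "a * eps\<^sup>2 * w' \<le> - eps\<^sup>2 * L2 * G t + eps^5 * L4 + eps\<^sup>2 * s * (a * eps\<^sup>2 * Wt t)" unfolding am .
  have aW: "0 \<le> a * eps\<^sup>2 * Wt t" using ae W_nonneg[OF t] by simp
  have Ec\<Psi>: "Ec t \<le> \<Psi> t" "a * eps\<^sup>2 * Wt t \<le> \<Psi> t" "0 \<le> \<Psi> t" using aW Ec_nonneg[OF t] by (auto simp: \<Psi>_def)
  have ee: "eps\<^sup>2 \<le> eps" using eps by (simp add: power2_eq_square mult_left_le)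
  have late: "ec' t + a * eps\<^sup>2 * w' \<le> eps\<^sup>2 * (L1 + s) * \<Psi> t + eps^5 * L4" if "q0 / eps \<le> t"
  proof -
    have "ec' t + a * eps\<^sup>2 * w' \<le> (eps\<^sup>2 * L1) * Ec t + (eps\<^sup>2 * s) * (a * eps\<^sup>2 * Wt t) + eps^5 * L4"
      using ec'_late[OF t that] w by simp
    also have "\<dots> \<le> (eps\<^sup>2 * L1) * \<Psi> t + (eps\<^sup>2 * s) * \<Psi> t + eps^5 * L4"
      using consts_nonneg eps by (intro add_mono mult_left_mono Ec\<Psi>) auto
    finally show ?thesis by (simp add: algebra_simps)
  qed
  have early: "ec' t + a * eps\<^sup>2 * w' \<le> eps * (L1 + s + 1) * \<Psi> t + eps^4 * (L3 + L4)"
  proof -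
    have "0 \<le> eps\<^sup>2 * L2 * G t" using consts_nonneg G_nonneg[OF t] by simp
    then have "ec' t + a * eps\<^sup>2 * w' \<le> (eps\<^sup>2 * L1 + eps) * Ec t + (eps\<^sup>2 * s) * (a * eps\<^sup>2 * Wt t) + eps^4 * L3 + eps^5 * L4"
      using ec'_early[OF t] w by simp
    also have "\<dots> \<le> (eps * L1 + eps) * \<Psi> t + (eps * s) * \<Psi> t + eps^4 * L3 + eps^4 * L4"
      using consts_nonneg eps ee aW Ec_nonneg[OF t]
      by (intro add_mono mult_mono Ec\<Psi> mult_right_mono power_decreasing) auto
    finally show ?thesis by (simp add: algebra_simps)
  qed
  show ?thesis using D early late by blast
qed

text \<open>u - p - n vanishes initially, together with its x-derivatives. The velocities differ by
  at most A \<open>eps\<close> on a length 2R/\<open>eps\<close>, their D-derivatives by A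
  \<open>eps\<close>^2, and the weights start at zero.\<close>

lemma \<Psi>_0: "\<Psi> 0 \<le> 4 * R * A\<^sup>2 * eps^3"
proof -
  have r: "0 \<le> r0" "r0 \<le> Y" using R eps by (auto simp: P.Y_def)
  have u0: "u 0 x = 0" if "r0 \<le> \<bar>x\<bar>" for x using i1(1)[of x] i2(1,3)[OF that] by simp
  note vP = P.init_vanish[OF i2(1,2)] and vN = N.init_vanish[OF i2(3,4)] and vW = W.init_vanish[OF u0 i2(5)]
  have W0: "Wt 0 = 0"
    using P.weights_0[OF i2(1,2)] N.weights_0[OF i2(3,4)] by (simp add: Wt_def)
  have ux0: "ux 0 x - px 0 x - nx 0 x = 0" for x
  proof -
    have "((\<lambda>x. u 0 x - p 0 x - n 0 x) has_vector_derivative ux 0 x - px 0 x - nx 0 x) (at x)"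
      by (rule pd_x[OF R0.jets(1) zero_in])
    moreover have "(\<lambda>x. u 0 x - p 0 x - n 0 x) = (\<lambda>x. 0)" using i1(1) by auto
    ultimately show ?thesis using vector_derivative_unique_at[OF has_vector_derivative_const] by metis
  qed
  have D0: "W.D 0 x - P.D 0 x - N.D 0 x = 0" for x
    using ux0[of x] i1(1)[of x] by (simp add: W.D_def P.D_def N.D_def algebra_simps)
  have Dx0: "W.Dx 0 x - P.Dx 0 x - N.Dx 0 x = 0" for x
  proof -
    have "((\<lambda>x. W.D 0 x - P.D 0 x - N.D 0 x) has_vector_derivative W.Dx 0 x - P.Dx 0 x - N.Dx 0 x) (at x)"
      by (rule pd_x[OF R1.jets(1) zero_in])
    moreover have "(\<lambda>x. W.D 0 x - P.D 0 x - N.D 0 x) = (\<lambda>x. 0)" using D0 by auto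
    ultimately show ?thesis using vector_derivative_unique_at[OF has_vector_derivative_const] by metis
  qed
  have "R0.E 0 \<le> 2 * r0 * (A * eps)\<^sup>2"
    unfolding R0.E_def
  proof (rule integral_le_support[OF contS_ivl[OF R0.contS_e zero_in] _ _ r])
    fix x
    show "R0.e 0 x \<le> (A * eps)\<^sup>2"
      unfolding R0.e_def ux0 using power_mono[OF i1(2)[of x], of 2] i1(1)[of x] by simp
    show "R0.e 0 x = 0" if "r0 < \<bar>x\<bar>"
      unfolding R0.e_def ux0 using vP(2)[OF _ _ that] vN(2)[OF _ _ that] vW(2)[OF _ _ that] i1(1)[of x] that by simp
  qed
  moreover have "R1.E 0 \<le> 2 * r0 * (A * eps\<^sup>2)\<^sup>2"
    unfolding R1.E_def
  proof (rule integral_le_support[OF contS_ivl[OF R1.contS_e zero_in] _ _ r])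
    fix x
    show "R1.e 0 x \<le> (A * eps\<^sup>2)\<^sup>2"
      unfolding R1.e_def Dx0 D0 using power_mono[OF i1(3)[of x], of 2] by simp
    show "R1.e 0 x = 0" if "r0 < \<bar>x\<bar>"
    proof -
      have "W.Dt 0 x = 0" "P.Dt 0 x = 0" "N.Dt 0 x = 0"
        unfolding W.Dt_def P.Dt_def N.Dt_def
        using vP(2,4)[OF _ _ that] vN(2,4)[OF _ _ that] vW(2,4)[OF _ _ that] that by simp_all
      then show ?thesis unfolding R1.e_def Dx0 D0 by simp
    qed
  qed
  ultimately have "R1.E 0 + eps\<^sup>2 * R0.E 0 \<le> 2 * r0 * (A * eps\<^sup>2)\<^sup>2 + eps\<^sup>2 * (2 * r0 * (A * eps)\<^sup>2)"
    by (intro add_mono mult_left_mono) auto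
  also have "\<dots> = 4 * R * A\<^sup>2 * eps^3" using eps by (simp add: eval_nat_numeral)
  finally show ?thesis by (simp add: \<Psi>_def Ec_def W0)
qed

text \<open>Gronwall in two phases: rate O(\<open>eps\<close>) and source O(\<open>eps\<close>^4)
  for a time O(1/\<open>eps\<close>), then rate O(\<open>eps\<close>^2) and source
  O(\<open>eps\<close>^5) for a time O(1/\<open>eps\<close>^2). Either way the exponent is bounded
  and the source adds up to O(\<open>eps\<close>^3).\<close>

lemma \<Psi>_le:
  assumes t: "t \<in> {0..B}"
  shows "\<Psi> t \<le> L7 * eps^3"
proof -
  obtain \<psi> where \<psi>: "\<And>t. t \<in> {0..B} \<Longrightarrow> (\<Psi> has_real_derivative \<psi> t) (at t within {0..B})"
    "\<And>t. t \<in> {0..B} \<Longrightarrow> \<psi> t \<le> eps * (L1 + s + 1) * \<Psi> t + eps^4 * (L3 + L4)"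
    "\<And>t. t \<in> {0..B} \<Longrightarrow> q0 / eps \<le> t \<Longrightarrow> \<psi> t \<le> eps\<^sup>2 * (L1 + s) * \<Psi> t + eps^5 * L4"
    using \<Psi>_deriv by metis
  have e34: "0 \<le> eps^4 * (L3 + L4)" "0 \<le> eps^5 * L4" using consts_nonneg eps by auto
  have early: "\<Psi> t \<le> L6 * eps^3" if t: "t \<in> {0..B}" "t \<le> q0 / eps" for t
  proof -
    have "\<Psi> t \<le> (\<Psi> 0 + eps^4 * (L3 + L4) * (t - 0)) * exp (eps * (L1 + s + 1) * (t - 0))"
      by (rule gronwall_linear[where \<Psi>' = \<psi> and b = B]) (use \<psi> t e34 consts_nonneg eps in auto)
    also have "\<dots> \<le> (4 * R * A\<^sup>2 * eps^3 + eps^4 * (L3 + L4) * (q0 / eps)) * exp ((L1 + s + 1) * q0)"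
    proof (rule mult_mono)
      show "\<Psi> 0 + eps^4 * (L3 + L4) * (t - 0) \<le> 4 * R * A\<^sup>2 * eps^3 + eps^4 * (L3 + L4) * (q0 / eps)"
        using \<Psi>_0 t e34 by (intro add_mono mult_left_mono) auto
      have "eps * t \<le> q0" using t(2) eps by (simp add: field_simps)
      then have "(L1 + s + 1) * (eps * t) \<le> (L1 + s + 1) * q0" using consts_nonneg by (intro mult_left_mono) auto
      then show "exp (eps * (L1 + s + 1) * (t - 0)) \<le> exp ((L1 + s + 1) * q0)" by (simp add: mult_ac)
      show "0 \<le> 4 * R * A\<^sup>2 * eps^3 + eps^4 * (L3 + L4) * (q0 / eps)"
        using R consts_nonneg eps by (intro add_nonneg_nonneg mult_nonneg_nonneg) auto
    qed simp
    also have "4 * R * A\<^sup>2 * eps^3 + eps^4 * (L3 + L4) * (q0 / eps) = (4 * R * A\<^sup>2 + (L3 + L4) * q0) * eps^3"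
      using eps by (simp add: eval_nat_numeral algebra_simps)
    finally show ?thesis by (simp add: L6_def mult_ac)
  qed
  have L67: "L6 \<le> L7"
  proof -
    have "L6 * 1 \<le> (L6 + L4 * T) * exp ((L1 + s) * T)"
      using consts_nonneg T by (intro mult_mono) auto
    then show ?thesis by (simp add: L7_def)
  qed
  show ?thesis
  proof (cases "t \<le> q0 / eps")
    case True
    have "L6 * eps^3 \<le> L7 * eps^3" using L67 eps by (intro mult_right_mono) auto
    with early[OF t True] show ?thesis by linarith
  next
    case False
    let ?q = "q0 / eps"
    have q: "0 \<le> ?q" "?q \<in> {0..B}" using False t consts_nonneg eps by auto
    have "\<Psi> t \<le> (\<Psi> ?q + eps^5 * L4 * (t - ?q)) * exp (eps\<^sup>2 * (L1 + s) * (t - ?q))"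
    proof (rule gronwall_linear[where \<Psi>' = \<psi> and b = B])
      fix x assume x: "x \<in> {?q..B}"
      then have x': "x \<in> {0..B}" using q by auto
      show "(\<Psi> has_real_derivative \<psi> x) (at x within {?q..B})"
        by (rule DERIV_subset[OF \<psi>(1)[OF x']]) (use q in auto)
      show "\<psi> x \<le> eps\<^sup>2 * (L1 + s) * \<Psi> x + eps^5 * L4" using \<psi>(3)[OF x'] x by auto
    qed (use e34 consts_nonneg False t in auto)
    also have "\<dots> \<le> (L6 * eps^3 + eps^3 * (L4 * T)) * exp ((L1 + s) * T)"
    proof (rule mult_mono)
      have tB: "t - ?q \<le> B" using t q by auto
      then have "eps\<^sup>2 * (t - ?q) \<le> eps\<^sup>2 * B" by (intro mult_left_mono) auto
      then have eT: "eps\<^sup>2 * (t - ?q) \<le> T" using BT by linarith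
      have "eps^5 * L4 * (t - ?q) = (eps^3 * L4) * (eps\<^sup>2 * (t - ?q))" by (simp add: eval_nat_numeral mult_ac)
      also have "\<dots> \<le> (eps^3 * L4) * T" using eT consts_nonneg eps by (intro mult_left_mono) auto
      finally show "\<Psi> ?q + eps^5 * L4 * (t - ?q) \<le> L6 * eps^3 + eps^3 * (L4 * T)"
        using early[OF q(2)] by simp
      have "(L1 + s) * (eps\<^sup>2 * (t - ?q)) \<le> (L1 + s) * T" using eT consts_nonneg by (intro mult_left_mono) auto
      then show "exp (eps\<^sup>2 * (L1 + s) * (t - ?q)) \<le> exp ((L1 + s) * T)" by (simp only: exp_le_cancel_iff mult_ac)
      show "0 \<le> L6 * eps^3 + eps^3 * (L4 * T)" using consts_nonneg eps T by auto
    qed simp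
    also have "\<dots> = L7 * eps^3" by (simp add: L7_def algebra_simps)
    finally show ?thesis .
  qed
qed

text \<open>With \<delta> = \<open>eps\<close> the Sobolev inequality gives \<open>eps\<close> E(r)
  + E(Dr)/\<open>eps\<close>; as E(r) = O(\<open>eps\<close>) and E(Dr) = O(\<open>eps\<close>^3),
  both terms are O(\<open>eps\<close>^2).\<close>

lemma remainder_bound:
  assumes t: "t \<in> {0..B}"
  shows "(cmod (u t x - p t x - n t x))\<^sup>2 \<le> 2 * L7 * eps\<^sup>2"
proof -
  have Y: "\<bar>-Y\<bar> = Y" using P.X_nonneg by (auto simp: P.Y_def)
  have E: "sqn Y (\<lambda>t x. u t x - p t x - n t x) t \<le> R0.E t" "sqn Y (\<lambda>t x. W.D t x - P.D t x - N.D t x) t \<le> R1.E t"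
    by (rule R0.sqn_le_E(1)[OF t], rule R1.sqn_le_E(1)[OF t])
  have EN: "0 \<le> R0.E t" "0 \<le> R1.E t" by (rule R0.sqn_le_E(4)[OF t], rule R1.sqn_le_E(4)[OF t])
  have "0 \<le> a * eps\<^sup>2 * Wt t" using consts_nonneg(7) W_nonneg[OF t] by simp
  then have Ps: "R1.E t + eps\<^sup>2 * R0.E t \<le> L7 * eps^3" using \<Psi>_le[OF t] by (simp add: \<Psi>_def Ec_def)
  have e1: "R1.E t / eps \<le> L7 * eps\<^sup>2"
  proof -
    have "0 \<le> eps\<^sup>2 * R0.E t" using EN by simp
    then have "R1.E t \<le> L7 * eps^3" using Ps by linarith
    then have "R1.E t / eps \<le> L7 * eps^3 / eps" using eps by (intro divide_right_mono) auto
    then show ?thesis using eps by (simp add: eval_nat_numeral)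
  qed
  have e0: "eps * R0.E t \<le> L7 * eps\<^sup>2"
  proof -
    have "eps\<^sup>2 * R0.E t \<le> L7 * eps^3" using Ps EN by linarith
    then have "eps\<^sup>2 * R0.E t / eps \<le> L7 * eps^3 / eps" using eps by (intro divide_right_mono) auto
    then show ?thesis using eps by (simp add: eval_nat_numeral)
  qed
  have nn: "0 \<le> 2 * L7 * eps\<^sup>2" using e0 mult_nonneg_nonneg[OF less_imp_le[OF eps(1)] EN(1)] by linarith
  show ?thesis
  proof (cases "x \<in> {-Y..Y}")
    case True
    have rD: "(ux t y - px t y - nx t y) - \<i> * of_real \<kappa> * (u t y - p t y - n t y) = W.D t y - P.D t y - N.D t y" for y
      by (simp add: W.D_def P.D_def N.D_def algebra_simps)
    have "(cmod (u t x - p t x - n t x))\<^sup>2 \<le> eps * integral {-Y..Y} (\<lambda>y. (cmod (u t y - p t y - n t y))\<^sup>2)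
       + integral {-Y..Y} (\<lambda>y. (cmod ((ux t y - px t y - nx t y) - \<i> * of_real \<kappa> * (u t y - p t y - n t y)))\<^sup>2) / eps"
    proof (rule sup_le_integral[OF pd_x[OF R0.jets(1) t] contS_ivl[OF R0.contS_jets(1) t] contS_ivl[OF R0.contS_jets(3) t] _ True eps(1)])
      show "u t (-Y) - p t (-Y) - n t (-Y) = 0"
        using P.vanish_Y(1)[OF t Y] N.vanish_Y(1)[OF t, of "-Y"] W.vanish_Y(1)[OF t, of "-Y"] Y by simp
    qed
    also have "\<dots> \<le> eps * R0.E t + R1.E t / eps"
      unfolding rD using E eps by (intro add_mono mult_left_mono divide_right_mono) (auto simp: sqn_def)
    finally show ?thesis using e0 e1 by linarith
  next
    case False
    then have "X < \<bar>x\<bar>" by (auto simp: P.Y_def)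
    then have "u t x - p t x - n t x = 0" using P.vanish(1)[OF t] N.vanish(1)[OF t] W.vanish(1)[OF t] by simp
    then show ?thesis using nn by simp
  qed
qed

end

section \<open>Polarized solutions and the decomposition\<close>

context polarized
begin

definition "Kc = C1 + 2 * C2 + C4 + C5 + K2"

lemma C_nonneg: "C3 \<ge> 0" "C4 \<ge> 0" "C5 \<ge> 0" "Kc \<ge> 0"
proof -
  show 3: "C3 \<ge> 0" unfolding C3_def using R by simp
  show 4: "C4 \<ge> 0" unfolding C4_def using 3 C1_pos by simp
  show 5: "C5 \<ge> 0" unfolding C5_def using 3 4 by simp
  show "Kc \<ge> 0" unfolding Kc_def using 4 5 C1_pos C2_nonneg K2_nonneg by simp
qed

lemma bounds:
  assumes "t \<in> {0..B}" and K: "Kc \<le> K"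
  shows "(cmod (u t x))\<^sup>2 \<le> K" "(cmod (D t x))\<^sup>2 \<le> K * eps\<^sup>2" "sqn Y u t \<le> K / eps"
    "sqn Y Z t + sqn Y D t \<le> K * eps" "sqn Y DZ t + sqn Y DD t \<le> K * eps^3"
proof -
  note nn = C_nonneg C1_pos C2_nonneg K2_nonneg
  have le: "K2 \<le> K" "C2 + C4 \<le> K" "C1 \<le> K" "2 * C2 \<le> K" "C5 \<le> K"
    using K nn by (auto simp: Kc_def)
  have m: "x * eps^k \<le> K * eps^k" if "x \<le> K" for x k using that eps by (intro mult_right_mono) auto
  show "(cmod (u t x))\<^sup>2 \<le> K" using u_bound[OF assms(1)] le(1) by (rule order_trans)
  show "(cmod (D t x))\<^sup>2 \<le> K * eps\<^sup>2" using D_bound[OF assms(1)] m[OF le(2)] by (rule order_trans)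
  have "C1 / eps \<le> K / eps" using le(3) eps by (intro divide_right_mono) auto
  then show "sqn Y u t \<le> K / eps" using u_sqn[OF assms(1)] by linarith
  show "sqn Y Z t + sqn Y D t \<le> K * eps" using F_bound[OF assms(1)] m[OF le(4), of 1] by simp
  show "sqn Y DZ t + sqn Y DD t \<le> K * eps^3" using second_bound(2)[OF assms(1)] m[OF le(5)] by (rule order_trans)
qed

end

section \<open>Modulated plane waves as initial data\<close>

definition wave :: "real \<Rightarrow> real \<Rightarrow> (real \<Rightarrow> complex) \<Rightarrow> real \<Rightarrow> complex" where
  "wave \<kappa> eps a y = a (eps * y) * exp (\<i> * of_real (\<kappa> * y))"

text \<open>The product rule separates slow from fast: on such a function D differentiates the
  amplitude only and contributes a factor \<open>eps\<close>.\<close>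

lemma wave_deriv:
  assumes "\<And>x. (a has_vector_derivative a1 x) (at x)"
  shows "(wave \<kappa> eps a has_vector_derivative wave \<kappa> eps (\<lambda>x. of_real eps * a1 x) y + \<i> * of_real \<kappa> * wave \<kappa> eps a y) (at y)"
proof -
  have 1: "((\<lambda>x. eps * x) has_vector_derivative eps) (at y)"
    by (auto intro!: derivative_eq_intros simp: has_real_derivative_iff_has_vector_derivative[symmetric])
  have 2: "((\<lambda>x. a (eps * x)) has_vector_derivative of_real eps * a1 (eps * y)) (at y)"
    using vector_diff_chain_at[OF 1 assms] by (simp add: o_def scaleR_conv_of_real)
  have "((\<lambda>z. exp (\<i> * (of_real \<kappa> * z))) has_field_derivative \<i> * of_real \<kappa> * exp (\<i> * of_real (\<kappa> * y))) (at (of_real y))"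
    by (auto intro!: derivative_eq_intros)
  from has_vector_derivative_real_field[OF this]
  have 3: "((\<lambda>x. exp (\<i> * of_real (\<kappa> * x))) has_vector_derivative \<i> * of_real \<kappa> * exp (\<i> * of_real (\<kappa> * y))) (at y)" by simp
  from has_vector_derivative_mult[OF 2 3] show ?thesis
    by (simp add: wave_def[abs_def] algebra_simps)
qed

lemma dk_wave: "(\<And>n. dk n a) \<Longrightarrow> dk n (wave \<kappa> eps a)"
  unfolding wave_def[abs_def] by (intro dk_mult dk_scale dk_exp)

lemma cmod_wave: "cmod (wave \<kappa> eps a y) = cmod (a (eps * y))"
  by (simp add: wave_def norm_mult)

lemma wave_support: "eps > 0 \<Longrightarrow> (\<And>x. R \<le> \<bar>x\<bar> \<Longrightarrow> a x = 0) \<Longrightarrow> R / eps \<le> \<bar>y\<bar> \<Longrightarrow> wave \<kappa> eps a y = 0"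
  by (simp add: wave_def abs_mult divide_le_eq mult.commute)

lemma kg_solution_mono:
  assumes "kg_solution B \<mu> X f g u ut ux utt utx uxx uttt uttx utxx uxxx" "0 < B'" "B' \<le> B"
  shows "kg_solution B' \<mu> X f g u ut ux utt utx uxx uttt uttx utxx uxxx"
proof -
  interpret kg_solution B \<mu> X f g u ut ux utt utx uxx uttt uttx utxx uxxx by fact
  show ?thesis
  proof
    show "jet3 B' u ut ux utt utx uxx uttt uttx utxx uxxx"
      using jet assms(3) unfolding jet3_def jet2_def by (auto intro: pd_mono)
  qed (use assms eqn supp init in auto)
qed

text \<open>The velocity of a polarized datum is chosen such that \<open>u\<^sub>t + c u\<^sub>x + \<i> u / \<Omega>\<close> vanishes initially.\<close>

definition pvel :: "real \<Rightarrow> real \<Rightarrow> real \<Rightarrow> (real \<Rightarrow> complex) \<Rightarrow> (real \<Rightarrow> complex) \<Rightarrow> real \<Rightarrow> complex" where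
  "pvel \<kappa> \<Omega> eps a a1 x = - (\<i> * of_real \<Omega> * a x + of_real (eps * (\<kappa> / \<Omega>)) * a1 x)"

text \<open>At time 0 \<open>D\<close> and \<open>DD\<close> see only the slow amplitude and bring
  the required powers of \<open>eps\<close>, and \<open>Z\<close> vanishes by the dispersion
  relation in \<open>c\<Omega>_complex\<close>. The factor 2 + |\<Omega>| + |\<kappa>| takes care of
  the carrier derivatives.\<close>

lemma polarized_intro:
  assumes sol: "kg_solution B (eps\<^sup>2 * lam) X (wave \<kappa> eps a) (wave \<kappa> eps (pvel \<kappa> \<Omega> eps a a1)) u ut ux utt utx uxx uttt uttx utxx uxxx"
    and \<Omega>: "\<Omega>\<^sup>2 = 1 + \<kappa>\<^sup>2" and \<kappa>: "\<kappa> \<noteq> 0"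
    and a: "\<And>x. (a has_vector_derivative a1 x) (at x)" "\<And>x. (a1 has_vector_derivative a2 x) (at x)"
    and bd: "\<And>x. cmod (a x) \<le> A0" "\<And>x. cmod (a1 x) \<le> A0" "\<And>x. cmod (a2 x) \<le> A0" and A0: "A0 > 0"
    and R: "R > 0" "\<And>x. R \<le> \<bar>x\<bar> \<Longrightarrow> a x = 0" and eps: "0 < eps" "eps \<le> 1" and lam: "lam \<noteq> 0"
    and T: "eps\<^sup>2 * B \<le> T" "T > 0" "R / eps \<le> X" and M: "\<bar>eps\<^sup>2 * lam\<bar> * M\<^sup>2 \<le> 1"
    and uM: "\<And>t x. t \<in> {0..B} \<Longrightarrow> cmod (u t x) \<le> M"
  shows "polarized B (eps\<^sup>2 * lam) X (wave \<kappa> eps a) (wave \<kappa> eps (pvel \<kappa> \<Omega> eps a a1)) u ut ux utt utx uxx uttt uttx utxx uxxx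
    \<kappa> \<Omega> lam T eps (A0 * (2 + \<bar>\<Omega>\<bar> + \<bar>\<kappa>\<bar>)) R M"
proof -
  have X: "0 \<le> X" using T(3) R eps by (meson divide_nonneg_nonneg less_imp_le order_trans)
  interpret kg_wave B "eps\<^sup>2 * lam" X "wave \<kappa> eps a" "wave \<kappa> eps (pvel \<kappa> \<Omega> eps a a1)" u ut ux utt utx uxx uttt uttx utxx uxxx \<kappa> \<Omega>
    by (intro kg_wave.intro sol) (unfold_locales, fact \<Omega>, fact \<kappa>, fact X)
  have 0: "0 \<in> {0..B}" using B_pos by auto
  let ?A = "A0 * (2 + \<bar>\<Omega>\<bar> + \<bar>\<kappa>\<bar>)"
  have A: "A0 \<le> ?A" "A0 * (\<bar>\<Omega>\<bar> + 1) \<le> ?A" "A0 * (1 + \<bar>\<kappa>\<bar>) \<le> ?A" "0 < ?A"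
  proof -
    show "A0 \<le> ?A" using mult_left_mono[of 1 "2 + \<bar>\<Omega>\<bar> + \<bar>\<kappa>\<bar>" A0] A0 by auto
    show "A0 * (\<bar>\<Omega>\<bar> + 1) \<le> ?A" "A0 * (1 + \<bar>\<kappa>\<bar>) \<le> ?A" using A0 by (intro mult_left_mono; auto)+
    show "0 < ?A" using A0 by (intro mult_pos_pos) auto
  qed
  have u0: "u 0 = wave \<kappa> eps a" by (rule ext) (rule init(1))
  have ux0: "ux 0 y = wave \<kappa> eps (\<lambda>x. of_real eps * a1 x) y + \<i> * of_real \<kappa> * wave \<kappa> eps a y" for y
    using vector_derivative_unique_at[OF pd_x[OF jets(1) 0, of y, unfolded u0] wave_deriv[OF a(1)]] .
  have D0: "D 0 = wave \<kappa> eps (\<lambda>x. of_real eps * a1 x)"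
    by (rule ext) (simp add: D_def ux0 u0)
  have ea: "((\<lambda>x. of_real eps * a1 x) has_vector_derivative of_real eps * a2 x) (at x)" for x
    by (rule bounded_linear.has_vector_derivative[OF bounded_linear_mult_right a(2)])
  have Dx0: "Dx 0 y = wave \<kappa> eps (\<lambda>x. of_real eps * (of_real eps * a2 x)) y + \<i> * of_real \<kappa> * wave \<kappa> eps (\<lambda>x. of_real eps * a1 x) y" for y
    using vector_derivative_unique_at[OF pd_x[OF DU.jets(1) 0, of y, unfolded D0] wave_deriv[OF ea]] .
  have DD0: "DD 0 y = wave \<kappa> eps (\<lambda>x. of_real eps * (of_real eps * a2 x)) y" for y
    by (simp add: DD_def Dx0 D0)
  have Z0: "Z 0 y = 0" for y
  proof -
    have "Z 0 y = (- (\<i> * of_real \<Omega>) + of_real c * \<i> * of_real \<kappa> + \<i> * of_real (1 / \<Omega>)) * wave \<kappa> eps a y"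
      unfolding Z_def ux0 u0 init(2) by (simp add: wave_def pvel_def c_def algebra_simps)
    also have "- (\<i> * of_real \<Omega>) + of_real c * \<i> * of_real \<kappa> + \<i> * of_real (1 / \<Omega>)
       = \<i> * (of_real c * of_real \<kappa> + of_real (1 / \<Omega>) - of_real \<Omega>)" by (simp add: algebra_simps)
    also have "\<dots> = 0" unfolding c\<Omega>_complex(2) by simp
    finally show ?thesis by simp
  qed
  have ea1: "eps * cmod (a1 y) \<le> A0" for y
    using mult_mono[OF eps(2) bd(2)[of y]] A0 by simp
  show ?thesis
  proof (unfold_locales)
    fix y
    show "cmod (u 0 y) \<le> ?A" unfolding u0 cmod_wave using bd(1) A(1) by (rule order_trans)
    have "cmod (ut 0 y) = cmod (\<i> * of_real \<Omega> * a (eps * y) + of_real (eps * (\<kappa> / \<Omega>)) * a1 (eps * y))"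
      unfolding init(2) cmod_wave pvel_def by (rule norm_minus_cancel)
    also have "\<dots> \<le> \<bar>\<Omega>\<bar> * cmod (a (eps * y)) + \<bar>c\<bar> * (eps * cmod (a1 (eps * y)))"
      by (rule order_trans[OF norm_triangle_ineq]) (use eps in \<open>simp add: norm_mult norm_divide c_def mult_ac\<close>)
    also have "\<dots> \<le> \<bar>\<Omega>\<bar> * A0 + 1 * A0"
      using \<Omega>_ge(3) A0 eps by (intro add_mono mult_mono bd ea1) auto
    also have "\<dots> \<le> ?A" using A(2) by (simp add: algebra_simps)
    finally show "cmod (ut 0 y) \<le> ?A" .
    have "cmod (ux 0 y) \<le> eps * cmod (a1 (eps * y)) + \<bar>\<kappa>\<bar> * cmod (a (eps * y))"
      unfolding ux0 by (rule order_trans[OF norm_triangle_ineq]) (use eps in \<open>simp add: norm_mult cmod_wave\<close>)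
    also have "\<dots> \<le> A0 + \<bar>\<kappa>\<bar> * A0" by (intro add_mono mult_left_mono bd ea1) auto
    also have "\<dots> \<le> ?A" using A(3) by (simp add: algebra_simps)
    finally show "cmod (ux 0 y) \<le> ?A" .
    have "cmod (D 0 y) = eps * cmod (a1 (eps * y))" unfolding D0 cmod_wave using eps by (simp add: norm_mult)
    also have "\<dots> \<le> eps * ?A" using bd(2) A(1) eps by (intro mult_left_mono order_trans[OF bd(2) A(1)]) auto
    finally show "cmod (D 0 y) \<le> ?A * eps" by (simp add: mult.commute)
    have "cmod (DD 0 y) = eps\<^sup>2 * cmod (a2 (eps * y))" unfolding DD0 cmod_wave using eps by (simp add: norm_mult power2_eq_square)
    also have "\<dots> \<le> eps\<^sup>2 * ?A" by (intro mult_left_mono order_trans[OF bd(3) A(1)]) auto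
    finally show "cmod (DD 0 y) \<le> ?A * eps\<^sup>2" by (simp add: mult.commute)
    show "Z 0 y = 0" by (rule Z0)
    show "u 0 y = 0" if "R / eps \<le> \<bar>y\<bar>" unfolding u0 using wave_support[OF eps(1) R(2) that] .
  qed (use eps lam T R M uM A in auto)
qed

text \<open>The order of choices matters: \<open>K2\<close> comes from the profile,
  \<open>lam\<close> and \<Omega>, then \<open>M\<close> with M^2 above it, then \<open>eps\<close>
  so small that |\<mu>| M^2 \<le> 1. Under |u| \<le> M, \<open>u_bound\<close> yields |u|^2 \<le> K2
  < M^2, the strict inequality required for continuation.\<close>

lemma polarized_exists:
  assumes \<Omega>: "\<Omega>\<^sup>2 = 1 + \<kappa>\<^sup>2" and \<kappa>: "\<kappa> \<noteq> 0"
    and a: "\<And>n. dk n a" "\<And>n. dk n a1" "\<And>x. (a has_vector_derivative a1 x) (at x)" "\<And>x. (a1 has_vector_derivative a2 x) (at x)"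
    and bd: "\<And>x. cmod (a x) \<le> A0" "\<And>x. cmod (a1 x) \<le> A0" "\<And>x. cmod (a2 x) \<le> A0" and A0: "A0 > 0"
    and R: "R > 0" "\<And>x. R \<le> \<bar>x\<bar> \<Longrightarrow> a x = 0" "\<And>x. R \<le> \<bar>x\<bar> \<Longrightarrow> a1 x = 0" and lam: "lam \<noteq> 0" and T: "T > 0"
    and M: "A0 < M" "polarized.K2 \<Omega> lam (A0 * (2 + \<bar>\<Omega>\<bar> + \<bar>\<kappa>\<bar>)) R < M\<^sup>2"
    and eps: "0 < eps" "eps \<le> 1 / (1 + \<bar>lam\<bar> * M\<^sup>2)"
  shows "\<exists>u ut ux utt utx uxx uttt uttx utxx uxxx.
    polarized (T / eps\<^sup>2) (eps\<^sup>2 * lam) (R / eps + 1 + T / eps\<^sup>2) (wave \<kappa> eps a) (wave \<kappa> eps (pvel \<kappa> \<Omega> eps a a1))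
      u ut ux utt utx uxx uttt uttx utxx uxxx \<kappa> \<Omega> lam T eps (A0 * (2 + \<bar>\<Omega>\<bar> + \<bar>\<kappa>\<bar>)) R M"
proof -
  define X where "X = R / eps + 1 + T / eps\<^sup>2"
  have pos: "0 < 1 + \<bar>lam\<bar> * M\<^sup>2" by (intro add_pos_nonneg) auto
  have e1: "eps * (1 + \<bar>lam\<bar> * M\<^sup>2) \<le> 1" using eps pos by (simp add: pos_le_divide_eq)
  have eps1: "eps \<le> 1"
  proof -
    have "eps * 1 \<le> eps * (1 + \<bar>lam\<bar> * M\<^sup>2)" using eps by (intro mult_left_mono) auto
    then show ?thesis using e1 by simp
  qed
  have M1: "\<bar>eps\<^sup>2 * lam\<bar> * M\<^sup>2 \<le> 1"
  proof -
    have "\<bar>eps\<^sup>2 * lam\<bar> * M\<^sup>2 = eps * (eps * (\<bar>lam\<bar> * M\<^sup>2))" using eps by (simp add: abs_mult power2_eq_square)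
    also have "\<dots> \<le> 1 * (eps * (1 + \<bar>lam\<bar> * M\<^sup>2))" using eps eps1 by (intro mult_mono mult_left_mono) auto
    finally show ?thesis using e1 by simp
  qed
  have B: "T / eps\<^sup>2 > 0" using T eps by simp
  have X: "R / eps \<le> X" using B by (simp add: X_def)
  have BT: "eps\<^sup>2 * t1 \<le> T" if "t1 \<le> T / eps\<^sup>2" for t1 using that eps by (simp add: pos_le_divide_eq mult.commute)
  have M0: "M > 0" using A0 M(1) by simp
  note KM = M(2)
  have dg: "dk n (pvel \<kappa> \<Omega> eps a a1)" for n
    unfolding pvel_def[abs_def]
    by (intro dk_linear[OF bounded_linear_minus[OF bounded_linear_ident]] dk_add dk_linear[OF bounded_linear_mult_right] a)
  obtain u ut ux utt utx uxx uttt uttx utxx uxxx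
    where u: "kg_solution (T / eps\<^sup>2) (eps\<^sup>2 * lam) X (wave \<kappa> eps a) (wave \<kappa> eps (pvel \<kappa> \<Omega> eps a a1)) u ut ux utt utx uxx uttt uttx utxx uxxx"
      "\<And>t x. t \<in> {0..T / eps\<^sup>2} \<Longrightarrow> cmod (u t x) < M"
  proof (rule kg_exists[OF B M0, where f = "wave \<kappa> eps a" and g = "wave \<kappa> eps (pvel \<kappa> \<Omega> eps a a1)" and r = "R / eps" and \<mu> = "eps\<^sup>2 * lam"])
    show "dk n (wave \<kappa> eps a)" "dk n (wave \<kappa> eps (pvel \<kappa> \<Omega> eps a a1))" for n by (intro dk_wave a dg)+
    show "wave \<kappa> eps a x = 0" if "R / eps \<le> \<bar>x\<bar>" for x by (rule wave_support[OF eps(1) R(2) that])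
    show "wave \<kappa> eps (pvel \<kappa> \<Omega> eps a a1) x = 0" if "R / eps \<le> \<bar>x\<bar>" for x
      by (rule wave_support[OF eps(1) _ that]) (simp add: pvel_def R)
    show "cmod (wave \<kappa> eps a x) < M" for x unfolding cmod_wave using bd(1) M(1) by (rule le_less_trans)
    fix t1 u ut ux utt utx uxx uttt uttx utxx uxxx t x
    assume t1: "t1 \<le> T / eps\<^sup>2" and sol: "kg_solution t1 (eps\<^sup>2 * lam) (R / eps + 1 + T / eps\<^sup>2) (wave \<kappa> eps a) (wave \<kappa> eps (pvel \<kappa> \<Omega> eps a a1)) u ut ux utt utx uxx uttt uttx utxx uxxx"
      and uM: "\<And>t x. t \<in> {0..t1} \<Longrightarrow> cmod (u t x) \<le> M" and t: "t \<in> {0..t1}"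
    interpret polarized t1 "eps\<^sup>2 * lam" X "wave \<kappa> eps a" "wave \<kappa> eps (pvel \<kappa> \<Omega> eps a a1)" u ut ux utt utx uxx uttt uttx utxx uxxx
      \<kappa> \<Omega> lam T eps "A0 * (2 + \<bar>\<Omega>\<bar> + \<bar>\<kappa>\<bar>)" R M
      by (rule polarized_intro[OF sol[folded X_def] \<Omega> \<kappa> a(3,4) bd A0 R(1,2) eps(1) eps1 lam BT[OF t1] T X M1 uM])
    have "(cmod (u t x))\<^sup>2 < M\<^sup>2" using u_bound[OF t, of x] KM by linarith
    then show "cmod (u t x) < M" using M0 by (simp add: power_less_imp_less_base)
  qed (rule that, auto simp: X_def)
  show ?thesis
    unfolding X_def[symmetric]
    by (intro exI) (rule polarized_intro[OF u(1) \<Omega> \<kappa> a(3,4) bd A0 R(1,2) eps(1) eps1 lam BT[OF order_refl] T X M1 less_imp_le[OF u(2)]])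
qed

text \<open>The polarized waves are known on \<open>{0..B}\<close>, the full solution possibly only
  on \<open>{0..t1}\<close>, so all three are restricted to the shorter interval. In this form the
  estimate can act as the a priori bound for the existence of the full solution.\<close>

lemma collision_estimate:
  assumes P: "polarized B (eps\<^sup>2 * lam) X (wave \<kappa> eps ap) (wave \<kappa> eps (pvel \<kappa> \<Omega> eps ap ap1)) p pt px ptt ptx pxx pttt pttx ptxx pxxx \<kappa> \<Omega> lam T eps Ap R Mp"
    and N: "polarized B (eps\<^sup>2 * lam) X (wave \<kappa> eps an) (wave \<kappa> eps (pvel \<kappa> (- \<Omega>) eps an an1)) n nt nx ntt ntx nxx nttt nttx ntxx nxxx \<kappa> (- \<Omega>) lam T eps An R Mn"
    and W: "kg_solution t1 (eps\<^sup>2 * lam) X (wave \<kappa> eps a) (wave \<kappa> eps b) u ut ux utt utx uxx uttt uttx utxx uxxx" and t1: "t1 \<le> B"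
    and K: "polarized.Kc \<Omega> lam T Ap R \<le> K" "polarized.Kc (- \<Omega>) lam T An R \<le> K"
    and ab: "\<And>x. a x = ap x + an x" "\<And>x. b x = - (\<i> * of_real \<Omega> * (ap x - an x))"
    and dp: "\<And>x. (ap1 has_vector_derivative ap2 x) (at x)" and dn: "\<And>x. (an1 has_vector_derivative an2 x) (at x)"
    and A: "\<And>x. cmod (ap1 x - an1 x) \<le> A" "\<And>x. cmod (ap2 x - an2 x) \<le> A"
    and z: "\<And>x. R \<le> \<bar>x\<bar> \<Longrightarrow> ap x = 0" "\<And>x. R \<le> \<bar>x\<bar> \<Longrightarrow> ap1 x = 0" "\<And>x. R \<le> \<bar>x\<bar> \<Longrightarrow> an x = 0" "\<And>x. R \<le> \<bar>x\<bar> \<Longrightarrow> an1 x = 0"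
    and M: "2 * sqrt K \<le> M" "\<And>t x. t \<in> {0..t1} \<Longrightarrow> cmod (u t x) \<le> M" and t: "t \<in> {0..t1}"
  shows "(cmod (u t x - p t x - n t x))\<^sup>2 \<le> 2 * collision.L7 \<kappa> \<Omega> lam T R K M A * eps\<^sup>2"
    and "cmod (p t x) \<le> sqrt K" "cmod (n t x) \<le> sqrt K"
proof -
  interpret PB: polarized B "eps\<^sup>2 * lam" X "wave \<kappa> eps ap" "wave \<kappa> eps (pvel \<kappa> \<Omega> eps ap ap1)" p pt px ptt ptx pxx pttt pttx ptxx pxxx \<kappa> \<Omega> lam T eps Ap R Mp
    by (rule P)
  interpret NB: polarized B "eps\<^sup>2 * lam" X "wave \<kappa> eps an" "wave \<kappa> eps (pvel \<kappa> (- \<Omega>) eps an an1)" n nt nx ntt ntx nxx nttt nttx ntxx nxxx \<kappa> "- \<Omega>" lam T eps An R Mn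
    by (rule N)
  have t1p: "0 < t1" using W by (simp add: kg_solution_def)
  have ax: "kg_wave_axioms X \<kappa> \<Omega>" "kg_wave_axioms X \<kappa> (- \<Omega>)"
    using PB.\<Omega> PB.\<kappa> PB.X_nonneg by (auto simp: kg_wave_axioms_def)
  have wP: "kg_wave t1 (eps\<^sup>2 * lam) X (wave \<kappa> eps ap) (wave \<kappa> eps (pvel \<kappa> \<Omega> eps ap ap1)) p pt px ptt ptx pxx pttt pttx ptxx pxxx \<kappa> \<Omega>"
    by (rule kg_wave.intro[OF kg_solution_mono[OF PB.kg_solution_axioms t1p t1] ax(1)])
  have wN: "kg_wave t1 (eps\<^sup>2 * lam) X (wave \<kappa> eps an) (wave \<kappa> eps (pvel \<kappa> (- \<Omega>) eps an an1)) n nt nx ntt ntx nxx nttt nttx ntxx nxxx \<kappa> (- \<Omega>)"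
    by (rule kg_wave.intro[OF kg_solution_mono[OF NB.kg_solution_axioms t1p t1] ax(2)])
  have wW: "kg_wave t1 (eps\<^sup>2 * lam) X (wave \<kappa> eps a) (wave \<kappa> eps b) u ut ux utt utx uxx uttt uttx utxx uxxx \<kappa> \<Omega>"
    by (rule kg_wave.intro[OF W ax(1)])
  interpret P1: kg_wave t1 "eps\<^sup>2 * lam" X "wave \<kappa> eps ap" "wave \<kappa> eps (pvel \<kappa> \<Omega> eps ap ap1)" p pt px ptt ptx pxx pttt pttx ptxx pxxx \<kappa> \<Omega>
    by (rule wP)
  interpret N1: kg_wave t1 "eps\<^sup>2 * lam" X "wave \<kappa> eps an" "wave \<kappa> eps (pvel \<kappa> (- \<Omega>) eps an an1)" n nt nx ntt ntx nxx nttt nttx ntxx nxxx \<kappa> "- \<Omega>"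
    by (rule wN)
  interpret W1: kg_wave t1 "eps\<^sup>2 * lam" X "wave \<kappa> eps a" "wave \<kappa> eps b" u ut ux utt utx uxx uttt uttx utxx uxxx \<kappa> \<Omega>
    by (rule wW)
  have tB: "t \<in> {0..B}" if "t \<in> {0..t1}" for t using that t1 by auto
  have K0: "0 \<le> K" using PB.C_nonneg(4) K(1) by linarith
  have pn: "cmod (p t x) \<le> sqrt K" "cmod (n t x) \<le> sqrt K" if "t \<in> {0..t1}" for t x
    using PB.bounds(1)[OF tB[OF that] K(1), of x] NB.bounds(1)[OF tB[OF that] K(2), of x] by (auto intro: real_le_rsqrt)
  note eps = PB.eps
  let ?c = "\<kappa> / \<Omega>"
  \<comment> \<open>The splitting into polarized amplitudes is exact, so the terms with i\<Omega>
    cancel; the mismatch of the velocities consists of the two group velocity corrections, which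
    carry a factor \<open>eps\<close>. D adds another one.\<close>
  let ?d = "\<lambda>x. of_real (eps * ?c) * (ap1 x - an1 x)"
  have d0: "ut 0 y - pt 0 y - nt 0 y = wave \<kappa> eps ?d y" for y
    unfolding W1.init(2) P1.init(2) N1.init(2) wave_def pvel_def ab(2)
    by (simp add: algebra_simps)
  have cle: "\<bar>?c\<bar> \<le> 1" using PB.\<Omega>_ge(3) by (simp add: PB.c_def)
  have A0: "0 \<le> A" using A(1)[of 0] norm_ge_zero order_trans by blast
  have cA: "\<bar>?c\<bar> * v \<le> A" if "v \<le> A" "0 \<le> v" for v
    using mult_mono[OF cle that(1)] that by simp
  have zero1: "0 \<in> {0..t1}" using t1p by auto
  have d1: "W1.Dt 0 y - P1.Dt 0 y - N1.Dt 0 y = wave \<kappa> eps (\<lambda>x. of_real eps * (of_real (eps * ?c) * (ap2 x - an2 x))) y" for y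
  proof -
    have hd: "(?d has_vector_derivative of_real (eps * ?c) * (ap2 x - an2 x)) (at x)" for x
      by (intro bounded_linear.has_vector_derivative[OF bounded_linear_mult_right] has_vector_derivative_diff dp dn)
    have "((\<lambda>y. ut 0 y - pt 0 y - nt 0 y) has_vector_derivative utx 0 y - ptx 0 y - ntx 0 y) (at y)"
      by (intro has_vector_derivative_diff pd_x[OF W1.jets(2) zero1] pd_x[OF P1.jets(2) zero1] pd_x[OF N1.jets(2) zero1])
    then have "(wave \<kappa> eps ?d has_vector_derivative utx 0 y - ptx 0 y - ntx 0 y) (at y)" unfolding d0 .
    from vector_derivative_unique_at[OF this wave_deriv[OF hd]]
    have "utx 0 y - ptx 0 y - ntx 0 y = wave \<kappa> eps (\<lambda>x. of_real eps * (of_real (eps * ?c) * (ap2 x - an2 x))) y + \<i> * of_real \<kappa> * wave \<kappa> eps ?d y" .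
    then show ?thesis unfolding d0[symmetric] by (simp add: W1.Dt_def P1.Dt_def N1.Dt_def algebra_simps)
  qed
  interpret collision t1 "eps\<^sup>2 * lam" X "wave \<kappa> eps ap" "wave \<kappa> eps (pvel \<kappa> \<Omega> eps ap ap1)" p pt px ptt ptx pxx pttt pttx ptxx pxxx \<kappa> \<Omega>
    "wave \<kappa> eps an" "wave \<kappa> eps (pvel \<kappa> (- \<Omega>) eps an an1)" n nt nx ntt ntx nxx nttt nttx ntxx nxxx
    "wave \<kappa> eps a" "wave \<kappa> eps b" u ut ux utt utx uxx uttt uttx utxx uxxx lam T eps R K M A
  proof (intro collision.intro wP wN wW collision_axioms.intro)
    show "0 < eps" "eps \<le> 1" "eps\<^sup>2 * lam = eps\<^sup>2 * lam" "0 < T" "0 < R" "R / eps \<le> X" "0 \<le> K" "0 \<le> A"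
      using eps PB.T PB.R K0 A0 by auto
    show "0 \<le> M" using M(1) K0 real_sqrt_ge_zero[OF K0] by linarith
    have "eps\<^sup>2 * t1 \<le> eps\<^sup>2 * B" using t1 by (intro mult_left_mono) auto
    then show "eps\<^sup>2 * t1 \<le> T" using PB.BT by linarith
  next
    fix t x assume t: "t \<in> {0..t1}"
    show "cmod (p t x) + cmod (n t x) \<le> M" using pn[OF t, of x] M(1) by linarith
  next
    fix x
    show "u 0 x = p 0 x + n 0 x"
      unfolding W1.init(1) P1.init(1) N1.init(1) wave_def ab(1) by (simp add: algebra_simps)
    have "cmod (wave \<kappa> eps ?d x) = eps * (\<bar>?c\<bar> * cmod (ap1 (eps * x) - an1 (eps * x)))"
      unfolding cmod_wave norm_mult norm_of_real using eps by (simp add: abs_mult)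
    also have "\<dots> \<le> eps * A" using eps by (intro mult_left_mono cA A) auto
    finally show "cmod (ut 0 x - pt 0 x - nt 0 x) \<le> A * eps" unfolding d0 by (simp add: mult.commute)
    have "cmod (W1.Dt 0 x - P1.Dt 0 x - N1.Dt 0 x) = eps * (eps * (\<bar>?c\<bar> * cmod (ap2 (eps * x) - an2 (eps * x))))"
      unfolding d1 cmod_wave norm_mult norm_of_real using eps by (simp add: abs_mult)
    also have "\<dots> \<le> eps * (eps * A)" using eps by (intro mult_left_mono cA A) auto
    finally show "cmod (W1.Dt 0 x - P1.Dt 0 x - N1.Dt 0 x) \<le> A * eps\<^sup>2" by (simp add: power2_eq_square mult_ac)
  next
    fix x assume x: "R / eps \<le> \<bar>x\<bar>"
    show "p 0 x = 0" unfolding P1.init(1) by (rule wave_support[OF eps(1) z(1) x])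
    show "n 0 x = 0" unfolding N1.init(1) by (rule wave_support[OF eps(1) z(3) x])
    show "pt 0 x = 0" unfolding P1.init(2) by (rule wave_support[OF eps(1) _ x]) (simp add: pvel_def z)
    show "nt 0 x = 0" unfolding N1.init(2) by (rule wave_support[OF eps(1) _ x]) (simp add: pvel_def z)
    show "ut 0 x = 0" unfolding W1.init(2) by (rule wave_support[OF eps(1) _ x]) (simp add: ab z)
  qed (use PB.bounds[OF tB K(1)] NB.bounds[OF tB K(2)] M(2) in auto)
  show "(cmod (u t x - p t x - n t x))\<^sup>2 \<le> 2 * L7 * eps\<^sup>2" by (rule remainder_bound[OF t])
  show "cmod (p t x) \<le> sqrt K" "cmod (n t x) \<le> sqrt K" by (rule pn[OF t])+
qed

section \<open>Return to the original variables\<close>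

definition kg2 :: "real \<Rightarrow> real \<Rightarrow> (real \<Rightarrow> complex) \<Rightarrow> (real \<Rightarrow> complex) \<Rightarrow> (real \<Rightarrow> real \<Rightarrow> complex) \<Rightarrow> bool" where
  "kg2 B \<mu> f g u \<longleftrightarrow> (\<exists>ut ux utt utx uxx. jet2 B u ut ux utt utx uxx \<and>
     (\<forall>t\<in>{0..B}. \<forall>x. utt t x - uxx t x + u t x + of_real \<mu> * cubic (u t x) = 0) \<and>
     (\<forall>x. u 0 x = f x \<and> ut 0 x = g x))"

lemma kg_solution_imp_kg2:
  assumes "kg_solution B \<mu> X f g u ut ux utt utx uxx uttt uttx utxx uxxx"
  shows "kg2 B \<mu> f g u"
proof -
  interpret kg_solution B \<mu> X f g u ut ux utt utx uxx uttt uttx utxx uxxx by fact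
  show ?thesis unfolding kg2_def using jet eqn init unfolding jet3_def by blast
qed

lemma kg2_unique:
  assumes "B > 0" "kg2 B \<mu> f g u" "kg2 B \<mu> f g v" "t \<in> {0..B}"
  shows "u t x = v t x"
proof -
  obtain ut ux utt utx uxx where u: "jet2 B u ut ux utt utx uxx"
     "\<And>t x. t \<in> {0..B} \<Longrightarrow> utt t x - uxx t x + u t x + of_real \<mu> * cubic (u t x) = 0" "\<And>x. u 0 x = f x" "\<And>x. ut 0 x = g x"
    using assms(2) unfolding kg2_def by blast
  obtain vt vx vtt vtx vxx where v: "jet2 B v vt vx vtt vtx vxx"
     "\<And>t x. t \<in> {0..B} \<Longrightarrow> vtt t x - vxx t x + v t x + of_real \<mu> * cubic (v t x) = 0" "\<And>x. v 0 x = f x" "\<And>x. vt 0 x = g x"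
    using assms(3) unfolding kg2_def by blast
  show ?thesis
    by (rule kg_unique[OF assms(1) u(1) v(1) u(2) v(2) _ _ assms(4)]) (simp_all add: u v)
qed

lemma pd_rescale:
  fixes u :: "real \<Rightarrow> real \<Rightarrow> complex"
  assumes u: "pd B u ut ux" and \<alpha>: "\<alpha> > 0"
  shows "pd (B / \<alpha>) (\<lambda>t x. u (\<alpha> * t) (\<beta> * x)) (\<lambda>t x. of_real \<alpha> * ut (\<alpha> * t) (\<beta> * x)) (\<lambda>t x. of_real \<beta> * ux (\<alpha> * t) (\<beta> * x))"
proof -
  have im: "\<alpha> * t \<in> {0..B}" if "t \<in> {0..B / \<alpha>}" for t
    using that \<alpha> by (auto simp: pos_le_divide_eq mult.commute)
  have c: "contS (B / \<alpha>) (\<lambda>t x. f (\<alpha> * t) (\<beta> * x))" if "contS B f" for f :: "real \<Rightarrow> real \<Rightarrow> complex"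
    unfolding contS_def using im by (intro contS_compose[OF that] continuous_intros) auto
  have lin: "((\<lambda>t. k * t) has_vector_derivative k) (at t within S)" for k t :: real and S
    by (auto intro!: derivative_eq_intros simp: has_real_derivative_iff_has_vector_derivative[symmetric])
  show ?thesis unfolding pd_def
  proof (intro conjI ballI allI contS_cmult c pd_cont[OF u])
    fix t x assume t: "t \<in> {0..B / \<alpha>}"
    have "((\<lambda>s. u s (\<beta> * x)) has_vector_derivative ut (\<alpha> * t) (\<beta> * x)) (at (\<alpha> * t) within (\<lambda>t. \<alpha> * t) ` {0..B / \<alpha>})"
      by (rule has_vector_derivative_within_subset[OF pd_t[OF u im[OF t]]]) (use im in auto)
    from vector_diff_chain_within[OF lin this]
    show "((\<lambda>s. u (\<alpha> * s) (\<beta> * x)) has_vector_derivative of_real \<alpha> * ut (\<alpha> * t) (\<beta> * x)) (at t within {0..B / \<alpha>})"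
      by (simp add: o_def scaleR_conv_of_real)
    from vector_diff_chain_at[OF lin pd_x[OF u im[OF t]]]
    show "((\<lambda>x. u (\<alpha> * t) (\<beta> * x)) has_vector_derivative of_real \<beta> * ux (\<alpha> * t) (\<beta> * x)) (at x)"
      by (simp add: o_def scaleR_conv_of_real)
  qed
qed

lemma jet2_rescale:
  fixes u :: "real \<Rightarrow> real \<Rightarrow> complex"
  assumes u: "jet2 B u ut ux utt utx uxx" and \<alpha>: "\<alpha> > 0"
  shows "jet2 (B / \<alpha>) (\<lambda>t x. u (\<alpha> * t) (\<beta> * x)) (\<lambda>t x. of_real \<alpha> * ut (\<alpha> * t) (\<beta> * x)) (\<lambda>t x. of_real \<beta> * ux (\<alpha> * t) (\<beta> * x))
    (\<lambda>t x. of_real \<alpha> * (of_real \<alpha> * utt (\<alpha> * t) (\<beta> * x))) (\<lambda>t x. of_real \<alpha> * (of_real \<beta> * utx (\<alpha> * t) (\<beta> * x)))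
    (\<lambda>t x. of_real \<beta> * (of_real \<beta> * uxx (\<alpha> * t) (\<beta> * x)))"
proof -
  note p = u[unfolded jet2_def]
  have "pd (B / \<alpha>) (\<lambda>t x. of_real \<beta> * ux (\<alpha> * t) (\<beta> * x)) (\<lambda>t x. of_real \<beta> * (of_real \<alpha> * utx (\<alpha> * t) (\<beta> * x))) (\<lambda>t x. of_real \<beta> * (of_real \<beta> * uxx (\<alpha> * t) (\<beta> * x)))"
    using p by (intro pd_cmult pd_rescale \<alpha>) auto
  then have "pd (B / \<alpha>) (\<lambda>t x. of_real \<beta> * ux (\<alpha> * t) (\<beta> * x)) (\<lambda>t x. of_real \<alpha> * (of_real \<beta> * utx (\<alpha> * t) (\<beta> * x))) (\<lambda>t x. of_real \<beta> * (of_real \<beta> * uxx (\<alpha> * t) (\<beta> * x)))"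
    by (simp only: mult.left_commute)
  moreover have "pd (B / \<alpha>) (\<lambda>t x. of_real \<alpha> * ut (\<alpha> * t) (\<beta> * x)) (\<lambda>t x. of_real \<alpha> * (of_real \<alpha> * utt (\<alpha> * t) (\<beta> * x))) (\<lambda>t x. of_real \<alpha> * (of_real \<beta> * utx (\<alpha> * t) (\<beta> * x)))"
    using p by (intro pd_cmult pd_rescale \<alpha>) auto
  moreover have "pd (B / \<alpha>) (\<lambda>t x. u (\<alpha> * t) (\<beta> * x)) (\<lambda>t x. of_real \<alpha> * ut (\<alpha> * t) (\<beta> * x)) (\<lambda>t x. of_real \<beta> * ux (\<alpha> * t) (\<beta> * x))"
    using p by (intro pd_rescale \<alpha>) auto
  ultimately show ?thesis unfolding jet2_def by blast
qed

lemma contS_slab: "contS T u \<longleftrightarrow> continuous_on (slab T) (case_prod u)"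
  by (simp add: contS_def slab_def case_prod_beta')

lemma C1_slab_pd: "C1_slab T u \<Longrightarrow> pd T u (partial_t T u) (partial_x u)"
  unfolding C1_slab_def pd_def contS_slab partial_t_def partial_x_def
  by (auto simp: vector_derivative_works)

lemma pd_C1_slab:
  assumes "pd T u ut ux" "T > 0"
  shows "C1_slab T u" "\<And>t x. t \<in> {0..T} \<Longrightarrow> partial_t T u t x = ut t x" "\<And>t x. t \<in> {0..T} \<Longrightarrow> partial_x u t x = ux t x"
proof -
  show e: "partial_t T u t x = ut t x" if "t \<in> {0..T}" for t x
    unfolding partial_t_def box_real(2)[symmetric]
    by (rule vector_derivative_within_cbox) (use pd_t[OF assms(1) that, of x] that assms(2) in auto)
  show f: "partial_x u t x = ux t x" if "t \<in> {0..T}" for t x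
    unfolding partial_x_def by (rule vector_derivative_at[OF pd_x[OF assms(1) that]])
  have "contS T (partial_t T u)" by (rule contS_cong[OF pd_cont(2)[OF assms(1)]]) (simp add: e)
  moreover have "contS T (partial_x u)" by (rule contS_cong[OF pd_cont(3)[OF assms(1)]]) (simp add: f)
  ultimately show "C1_slab T u"
    unfolding C1_slab_def contS_slab[symmetric]
    using pd_cont(1)[OF assms(1)]
      differentiableI_vector[OF pd_t[OF assms(1)]] differentiableI_vector[OF pd_x[OF assms(1)]] by blast
qed

text \<open>Passes between \<open>vector_derivative\<close> and the relational jets. In one
  direction the equality of the mixed derivatives has to be proved; in the other, T > 0 makes the
  one-sided time derivatives unique.\<close>

lemma KG_solution_iff:
  assumes T: "T > 0"
  shows "KG_solution lam eps T f g u \<longleftrightarrow> (\<exists>ut ux utt utx uxx. jet2 T u ut ux utt utx uxx \<and>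
     (\<forall>t\<in>{0..T}. \<forall>x. of_real (eps\<^sup>2) * utt t x - uxx t x + of_real (1 / eps\<^sup>2) * u t x + of_real lam * cubic (u t x) = 0) \<and>
     (\<forall>x. u 0 x = f x \<and> ut 0 x = g x))" (is "_ \<longleftrightarrow> ?R")
proof
  assume s: "KG_solution lam eps T f g u"
  then have C: "C1_slab T u" "C1_slab T (partial_t T u)" "C1_slab T (partial_x u)"
    by (auto simp: KG_solution_def C2_slab_def)
  note p = C[THEN C1_slab_pd]
  have "pd T (partial_x u) (partial_x (partial_t T u)) (partial_x (partial_x u))"
    by (rule pd_cong[OF p(3)]) (auto simp: pd_symmetric[OF p(1,2,3) _ T])
  then have "jet2 T u (partial_t T u) (partial_x u) (partial_t T (partial_t T u)) (partial_x (partial_t T u)) (partial_x (partial_x u))"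
    using p unfolding jet2_def by blast
  then show ?R using s unfolding KG_solution_def KG_equation_def cubic_eq
    by (intro exI conjI) (auto simp: mult.assoc)
next
  assume ?R
  then obtain ut ux utt utx uxx where j: "jet2 T u ut ux utt utx uxx" and
    e: "\<And>t x. t \<in> {0..T} \<Longrightarrow> of_real (eps\<^sup>2) * utt t x - uxx t x + of_real (1 / eps\<^sup>2) * u t x + of_real lam * cubic (u t x) = 0"
    and i: "\<And>x. u 0 x = f x" "\<And>x. ut 0 x = g x" by blast
  note p = j[unfolded jet2_def]
  have p1: "pd T u ut ux" and p2: "pd T ut utt utx" and p3: "pd T ux utx uxx" using p by auto
  note c1 = pd_C1_slab[OF p1 T]
  have q2: "pd T (partial_t T u) utt utx" by (rule pd_cong[OF p2]) (auto simp: c1)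
  have q3: "pd T (partial_x u) utx uxx" by (rule pd_cong[OF p3]) (auto simp: c1)
  note c2 = pd_C1_slab[OF q2 T] and c3 = pd_C1_slab[OF q3 T]
  show "KG_solution lam eps T f g u"
    unfolding KG_solution_def C2_slab_def KG_equation_def
  proof (intro conjI ballI allI c1(1) c2(1) c3(1) i(1))
    show "partial_t T u 0 x = g x" for x using c1(2)[of 0 x] i(2) T by simp
    fix t x assume t: "t \<in> {0..T}"
    show "of_real (eps\<^sup>2) * partial_t T (partial_t T u) t x - partial_x (partial_x u) t x + of_real (1 / eps\<^sup>2) * u t x + of_real (lam * (cmod (u t x))\<^sup>2) * u t x = 0"
      using e[OF t, of x] unfolding c2(2)[OF t] c3(3)[OF t] cubic_eq by (simp add: mult.assoc)
  qed
qed

lemma KG_solution_rescale: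
  assumes T: "T > 0" and eps: "eps > 0" and u: "KG_solution lam eps T f g u"
  shows "kg2 (T / eps\<^sup>2) (eps\<^sup>2 * lam) (\<lambda>y. f (eps * y)) (\<lambda>y. of_real (eps\<^sup>2) * g (eps * y)) (\<lambda>t y. u (eps\<^sup>2 * t) (eps * y))"
proof -
  obtain ut ux utt utx uxx where j: "jet2 T u ut ux utt utx uxx" and
    e: "\<And>t x. t \<in> {0..T} \<Longrightarrow> of_real (eps\<^sup>2) * utt t x - uxx t x + of_real (1 / eps\<^sup>2) * u t x + of_real lam * cubic (u t x) = 0"
    and i: "\<And>x. u 0 x = f x" "\<And>x. ut 0 x = g x" using u unfolding KG_solution_iff[OF T] by blast
  have e2: "eps\<^sup>2 > 0" using eps by simp
  show ?thesis unfolding kg2_def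
  proof (intro exI conjI ballI allI)
    show "jet2 (T / eps\<^sup>2) (\<lambda>t y. u (eps\<^sup>2 * t) (eps * y)) (\<lambda>t y. of_real (eps\<^sup>2) * ut (eps\<^sup>2 * t) (eps * y)) (\<lambda>t y. of_real eps * ux (eps\<^sup>2 * t) (eps * y))
      (\<lambda>t y. of_real (eps\<^sup>2) * (of_real (eps\<^sup>2) * utt (eps\<^sup>2 * t) (eps * y))) (\<lambda>t y. of_real (eps\<^sup>2) * (of_real eps * utx (eps\<^sup>2 * t) (eps * y)))
      (\<lambda>t y. of_real eps * (of_real eps * uxx (eps\<^sup>2 * t) (eps * y)))"
      by (rule jet2_rescale[OF j e2])
    fix t x assume "t \<in> {0..T / eps\<^sup>2}"
    then have "eps\<^sup>2 * t \<in> {0..T}" using e2 by (auto simp: pos_le_divide_eq mult.commute)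
    from e[OF this, of "eps * x"]
    have "of_real (eps\<^sup>2) * (of_real (eps\<^sup>2) * utt (eps\<^sup>2 * t) (eps * x) - uxx (eps\<^sup>2 * t) (eps * x) + of_real (1 / eps\<^sup>2) * u (eps\<^sup>2 * t) (eps * x)
       + of_real lam * cubic (u (eps\<^sup>2 * t) (eps * x))) = 0" by simp
    moreover have "of_real (eps\<^sup>2) * (of_real (1 / eps\<^sup>2) * u (eps\<^sup>2 * t) (eps * x)) = u (eps\<^sup>2 * t) (eps * x)" using eps by simp
    ultimately show "of_real (eps\<^sup>2) * (of_real (eps\<^sup>2) * utt (eps\<^sup>2 * t) (eps * x)) - of_real eps * (of_real eps * uxx (eps\<^sup>2 * t) (eps * x))
       + u (eps\<^sup>2 * t) (eps * x) + of_real (eps\<^sup>2 * lam) * cubic (u (eps\<^sup>2 * t) (eps * x)) = 0"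
      by (simp add: distrib_left right_diff_distrib power2_eq_square mult.assoc)
  qed (simp_all add: i)
qed

lemma kg2_rescale:
  assumes T: "T > 0" and eps: "eps > 0"
    and w: "kg2 (T / eps\<^sup>2) (eps\<^sup>2 * lam) (\<lambda>y. f (eps * y)) (\<lambda>y. of_real (eps\<^sup>2) * g (eps * y)) w"
  shows "KG_solution lam eps T f g (\<lambda>t x. w (1 / eps\<^sup>2 * t) (1 / eps * x))"
proof -
  obtain ut ux utt utx uxx where j: "jet2 (T / eps\<^sup>2) w ut ux utt utx uxx" and
    e: "\<And>t x. t \<in> {0..T / eps\<^sup>2} \<Longrightarrow> utt t x - uxx t x + w t x + of_real (eps\<^sup>2 * lam) * cubic (w t x) = 0"
    and i: "\<And>x. w 0 x = f (eps * x)" "\<And>x. ut 0 x = of_real (eps\<^sup>2) * g (eps * x)" using w unfolding kg2_def by blast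
  have e2: "1 / eps\<^sup>2 > 0" using eps by simp
  have TT: "T / eps\<^sup>2 / (1 / eps\<^sup>2) = T" using eps by simp
  show ?thesis unfolding KG_solution_iff[OF T]
  proof (intro exI conjI ballI allI)
    show "jet2 T (\<lambda>t x. w (1 / eps\<^sup>2 * t) (1 / eps * x)) (\<lambda>t x. of_real (1 / eps\<^sup>2) * ut (1 / eps\<^sup>2 * t) (1 / eps * x)) (\<lambda>t x. of_real (1 / eps) * ux (1 / eps\<^sup>2 * t) (1 / eps * x))
      (\<lambda>t x. of_real (1 / eps\<^sup>2) * (of_real (1 / eps\<^sup>2) * utt (1 / eps\<^sup>2 * t) (1 / eps * x))) (\<lambda>t x. of_real (1 / eps\<^sup>2) * (of_real (1 / eps) * utx (1 / eps\<^sup>2 * t) (1 / eps * x)))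
      (\<lambda>t x. of_real (1 / eps) * (of_real (1 / eps) * uxx (1 / eps\<^sup>2 * t) (1 / eps * x)))"
      using jet2_rescale[OF j e2, of "1 / eps"] unfolding TT .
    fix t x assume "t \<in> {0..T}"
    then have "1 / eps\<^sup>2 * t \<in> {0..T / eps\<^sup>2}" using eps by (auto simp: divide_right_mono)
    from e[OF this, of "1 / eps * x"]
    have "of_real (1 / eps\<^sup>2) * (utt (1 / eps\<^sup>2 * t) (1 / eps * x) - uxx (1 / eps\<^sup>2 * t) (1 / eps * x) + w (1 / eps\<^sup>2 * t) (1 / eps * x)
      + of_real (eps\<^sup>2 * lam) * cubic (w (1 / eps\<^sup>2 * t) (1 / eps * x))) = 0" by simp
    moreover have "of_real (eps\<^sup>2) * (of_real (1 / eps\<^sup>2) * a) = (a::complex)" for a using eps by simp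
    moreover have "of_real (1 / eps) * (of_real (1 / eps) * a) = of_real (1 / eps\<^sup>2) * (a::complex)" for a by (simp add: power2_eq_square)
    moreover have "of_real (1 / eps\<^sup>2) * (of_real (eps\<^sup>2 * lam) * a) = of_real lam * (a::complex)" for a using eps by simp
    ultimately show "of_real (eps\<^sup>2) * (of_real (1 / eps\<^sup>2) * (of_real (1 / eps\<^sup>2) * utt (1 / eps\<^sup>2 * t) (1 / eps * x)))
       - of_real (1 / eps) * (of_real (1 / eps) * uxx (1 / eps\<^sup>2 * t) (1 / eps * x)) + of_real (1 / eps\<^sup>2) * w (1 / eps\<^sup>2 * t) (1 / eps * x)
       + of_real lam * cubic (w (1 / eps\<^sup>2 * t) (1 / eps * x)) = 0"
      by (simp only: distrib_left right_diff_distrib)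
  qed (use eps in \<open>simp_all add: i\<close>)
qed

text \<open>A competitor is rescaled as well, and uniqueness applies to it because
  \<open>kg2\<close> asks for a classical solution only, with no condition on its support.\<close>

lemma is_the_KG_solution_rescale:
  assumes T: "T > 0" and eps: "eps > 0"
    and w: "kg2 (T / eps\<^sup>2) (eps\<^sup>2 * lam) (\<lambda>y. f (eps * y)) (\<lambda>y. of_real (eps\<^sup>2) * g (eps * y)) w"
  shows "is_the_KG_solution lam eps T f g (\<lambda>t x. w (1 / eps\<^sup>2 * t) (1 / eps * x))"
  unfolding is_the_KG_solution_def
proof (intro conjI allI impI ballI)
  show "KG_solution lam eps T f g (\<lambda>t x. w (1 / eps\<^sup>2 * t) (1 / eps * x))" by (rule kg2_rescale[OF assms])
  fix v t x assume v: "KG_solution lam eps T f g v" and t: "t \<in> {0..T}"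
  have B: "T / eps\<^sup>2 > 0" using T eps by simp
  have "1 / eps\<^sup>2 * t \<in> {0..T / eps\<^sup>2}" using eps t by (auto simp: divide_right_mono)
  from kg2_unique[OF B KG_solution_rescale[OF T eps v] w this, of "1 / eps * x"]
  show "v t x = w (1 / eps\<^sup>2 * t) (1 / eps * x)" using eps by simp
qed

lemma bounded_of_support:
  fixes f :: "real \<Rightarrow> complex"
  assumes "continuous_on UNIV f" "\<And>x. R \<le> \<bar>x\<bar> \<Longrightarrow> f x = 0"
  obtains A where "\<And>x. cmod (f x) \<le> A"
proof -
  have "compact (f ` {-R..R})" by (intro compact_continuous_image continuous_on_subset[OF assms(1)]) auto
  then obtain A where A: "\<And>x. x \<in> {-R..R} \<Longrightarrow> cmod (f x) \<le> A"
    by (meson bounded_iff compact_imp_bounded image_eqI)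
  show thesis
  proof (rule that[of "max A 0"])
    fix x
    show "cmod (f x) \<le> max A 0"
    proof (cases "R \<le> \<bar>x\<bar>")
      case False
      then have "x \<in> {-R..R}" by auto
      from A[OF this] show ?thesis by simp
    qed (simp add: assms(2))
  qed
qed

text \<open>The gap between R - 1 and R lets the derivative vanish on the closed set |x| \<ge>
  R.\<close>

lemma amplitude_jet:
  assumes a: "\<And>n. dk n a" "\<And>x. R - 1 \<le> \<bar>x\<bar> \<Longrightarrow> a x = 0"
  obtains a1 a2 A where "\<And>n. dk n a1" "\<And>x. (a has_vector_derivative a1 x) (at x)" "\<And>x. (a1 has_vector_derivative a2 x) (at x)"
    "\<And>x. R \<le> \<bar>x\<bar> \<Longrightarrow> a1 x = 0" "\<And>x. cmod (a x) \<le> A" "\<And>x. cmod (a1 x) \<le> A" "\<And>x. cmod (a2 x) \<le> A" "A > 0"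
proof -
  obtain a1 where a1: "\<And>x. (a has_vector_derivative a1 x) (at x)" "\<And>n. dk n a1" using dk_deriv[OF a(1)] by blast
  obtain a2 where a2: "\<And>x. (a1 has_vector_derivative a2 x) (at x)" "\<And>n. dk n a2" using dk_deriv[OF a1(2)] by blast
  have z1: "a1 x = 0" if "R \<le> \<bar>x\<bar>" for x by (rule deriv_zero_outside[OF a1(1) a(2)]) (use that in auto)
  have z2: "a2 x = 0" if "R + 1 \<le> \<bar>x\<bar>" for x by (rule deriv_zero_outside[OF a2(1) z1]) (use that in auto)
  obtain A0 where A0: "\<And>x. cmod (a x) \<le> A0" using bounded_of_support[OF dk_continuous[OF a(1)] a(2)] by blast
  obtain A1 where A1: "\<And>x. cmod (a1 x) \<le> A1" using bounded_of_support[OF dk_continuous[OF a1(2)] z1] by blast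
  obtain A2 where A2: "\<And>x. cmod (a2 x) \<le> A2" using bounded_of_support[OF dk_continuous[OF a2(2)] z2] by blast
  have nn: "0 \<le> A0" "0 \<le> A1" "0 \<le> A2" using A0 A1 A2 norm_ge_zero order_trans by blast+
  show thesis
  proof (rule that[OF a1(2) a1(1) a2(1) z1, of "A0 + A1 + A2 + 1"])
    show "cmod (a x) \<le> A0 + A1 + A2 + 1" "cmod (a1 x) \<le> A0 + A1 + A2 + 1" "cmod (a2 x) \<le> A0 + A1 + A2 + 1" for x
      using A0[of x] A1[of x] A2[of x] nn by linarith+
  qed (use nn in auto)
qed

lemma omega_sq: "(omega \<kappa>)\<^sup>2 = 1 + \<kappa>\<^sup>2" "omega \<kappa> > 0"
  unfolding omega_def by (simp_all add: add_pos_nonneg)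

lemma smooth_pol_amp:
  assumes "smooth a0" "smooth b0"
  shows "dk n (pol_amp \<kappa> s a0 b0)"
proof -
  have "dk n (\<lambda>x. 1 / 2 * (a0 x + (of_real s * \<i> / of_real (omega \<kappa>)) * b0 x))"
    by (intro dk_linear[OF bounded_linear_mult_right] dk_add smooth_imp_dk assms)
  moreover have "pol_amp \<kappa> s a0 b0 = (\<lambda>x. 1 / 2 * (a0 x + (of_real s * \<i> / of_real (omega \<kappa>)) * b0 x))"
    by (rule ext) (simp add: pol_amp_def)
  ultimately show ?thesis by simp
qed

lemma plane_wave_scale: "eps > 0 \<Longrightarrow> plane_wave \<kappa> eps (eps * y) = exp (\<i> * of_real (\<kappa> * y))"
  by (simp add: plane_wave_def)

lemma pol_init_wave: "eps > 0 \<Longrightarrow> pol_init \<kappa> eps s a0 b0 (eps * y) = wave \<kappa> eps (pol_amp \<kappa> s a0 b0) y"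
  by (simp only: pol_init_def wave_def plane_wave_scale)

text \<open>The sign s is absorbed into \<Omega> = s \<omega>: as 1/s = s, the velocity
  \<kappa>/\<Omega> becomes s times \<open>c_g\<close>, and both polarized data take the form
  \<open>pvel\<close>.\<close>

lemma pol_init_dt_wave:
  assumes eps: "eps > 0" and s: "s * s = 1" and a1: "\<And>x. (pol_amp \<kappa> s a0 b0 has_vector_derivative a1 x) (at x)"
  shows "of_real (eps\<^sup>2) * pol_init_dt \<kappa> eps s a0 b0 (eps * y)
    = wave \<kappa> eps (pvel \<kappa> (s * omega \<kappa>) eps (pol_amp \<kappa> s a0 b0) a1) y"
proof -
  have sc: "\<kappa> / (s * omega \<kappa>) = s * c_g \<kappa>"
  proof -
    have "s \<noteq> 0" using s by auto
    then have i: "1 / s = s" using s by (simp add: field_simps)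
    have "\<kappa> / (s * omega \<kappa>) = (1 / s) * (\<kappa> / omega \<kappa>)" by (simp only: times_divide_times_eq mult_1_left)
    then show ?thesis unfolding i c_g_def .
  qed
  have e: "of_real (eps\<^sup>2) * (- of_real (1 / eps\<^sup>2) * z * w) = - (z * w)" for z w :: complex
    using eps by simp
  show ?thesis
    unfolding pol_init_dt_def e plane_wave_scale[OF eps] wave_def pvel_def sc vector_derivative_at[OF a1]
    by (simp add: algebra_simps)
qed

theorem proposition3:
  fixes lam \<kappa> T :: real and a0 b0 :: "real \<Rightarrow> complex"
  assumes "lam \<noteq> 0" and "\<kappa> \<noteq> 0" and "T > 0"
    and "smooth a0" and "bounded {x. a0 x \<noteq> 0}"
    and "smooth b0" and "bounded {x. b0 x \<noteq> 0}"
  shows "\<exists>eps0 > 0. \<exists>C :: real. \<forall>eps :: real. 0 < eps \<and> eps \<le> eps0 \<longrightarrow>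
    (\<exists>u up um r :: real \<Rightarrow> real \<Rightarrow> complex.
       is_the_KG_solution lam eps T
         (\<lambda>x. a0 x * plane_wave \<kappa> eps x)
         (\<lambda>x. of_real (1 / eps\<^sup>2) * b0 x * plane_wave \<kappa> eps x) u \<and>
       is_the_KG_solution lam eps T
         (pol_init \<kappa> eps 1 a0 b0) (pol_init_dt \<kappa> eps 1 a0 b0) up \<and>
       is_the_KG_solution lam eps T
         (pol_init \<kappa> eps (-1) a0 b0) (pol_init_dt \<kappa> eps (-1) a0 b0) um \<and>
       (\<forall>t\<in>{0..T}. \<forall>x. u t x = up t x + um t x + r t x) \<and>
       Linfty_norm T r \<le> ereal (C * eps))"
proof -
  define \<Omega> where "\<Omega> = omega \<kappa>"
  have \<Omega>: "\<Omega>\<^sup>2 = 1 + \<kappa>\<^sup>2" "(- \<Omega>)\<^sup>2 = 1 + \<kappa>\<^sup>2" "\<Omega> > 0" using omega_sq by (auto simp: \<Omega>_def)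
  note lam = assms(1) and \<kappa> = assms(2) and T = assms(3)
  obtain Ra where Ra: "\<And>x. a0 x \<noteq> 0 \<Longrightarrow> \<bar>x\<bar> \<le> Ra" using assms(5) unfolding bounded_iff by auto
  obtain Rb where Rb: "\<And>x. b0 x \<noteq> 0 \<Longrightarrow> \<bar>x\<bar> \<le> Rb" using assms(7) unfolding bounded_iff by auto
  \<comment> \<open>Of the 2 in excess, one unit leaves room for the derivatives of the amplitudes,
    the other makes the inequalities with Ra and Rb strict.\<close>
  define R where "R = \<bar>Ra\<bar> + \<bar>Rb\<bar> + 2"
  have R: "R > 0" by (simp add: R_def)
  have z0: "a0 x = 0" "b0 x = 0" if "R - 1 \<le> \<bar>x\<bar>" for x
    using Ra[of x] Rb[of x] that unfolding R_def by (smt (verit))+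
  define ap where "ap = pol_amp \<kappa> 1 a0 b0"
  define an where "an = pol_amp \<kappa> (-1) a0 b0"
  have dkp: "dk n ap" and dkn: "dk n an" for n
    unfolding ap_def an_def by (intro smooth_pol_amp assms)+
  have zp: "ap x = 0" and zn: "an x = 0" if "R - 1 \<le> \<bar>x\<bar>" for x
    using z0[OF that] by (simp_all add: ap_def an_def pol_amp_def)
  obtain ap1 ap2 Ap where p: "\<And>n. dk n ap1" "\<And>x. (ap has_vector_derivative ap1 x) (at x)" "\<And>x. (ap1 has_vector_derivative ap2 x) (at x)"
    "\<And>x. R \<le> \<bar>x\<bar> \<Longrightarrow> ap1 x = 0" "\<And>x. cmod (ap x) \<le> Ap" "\<And>x. cmod (ap1 x) \<le> Ap" "\<And>x. cmod (ap2 x) \<le> Ap" "Ap > 0"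
    using amplitude_jet[OF dkp zp] by metis
  obtain an1 an2 An where n: "\<And>n. dk n an1" "\<And>x. (an has_vector_derivative an1 x) (at x)" "\<And>x. (an1 has_vector_derivative an2 x) (at x)"
    "\<And>x. R \<le> \<bar>x\<bar> \<Longrightarrow> an1 x = 0" "\<And>x. cmod (an x) \<le> An" "\<And>x. cmod (an1 x) \<le> An" "\<And>x. cmod (an2 x) \<le> An" "An > 0"
    using amplitude_jet[OF dkn zn] by metis
  have zR: "ap x = 0" "an x = 0" "a0 x = 0" "b0 x = 0" if "R \<le> \<bar>x\<bar>" for x using zp[of x] zn[of x] z0[of x] that by auto
  have ab: "a0 x = ap x + an x" "b0 x = - (\<i> * of_real \<Omega> * (ap x - an x))" for x
    using \<Omega>(3) unfolding ap_def an_def pol_amp_def \<Omega>_def[symmetric] by (simp_all add: field_simps)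
  define bp where "bp = Ap * (2 + \<bar>\<Omega>\<bar> + \<bar>\<kappa>\<bar>)"
  define bn where "bn = An * (2 + \<bar>- \<Omega>\<bar> + \<bar>\<kappa>\<bar>)"
  \<comment> \<open>Exceeds both 1 and |K2|, so its square exceeds K2; the summand \<open>Ap\<close>
    dominates the data.\<close>
  define Mp where "Mp = Ap + \<bar>polarized.K2 \<Omega> lam bp R\<bar> + 1"
  define Mn where "Mn = An + \<bar>polarized.K2 (- \<Omega>) lam bn R\<bar> + 1"
  have sq: "x < (a + \<bar>x\<bar> + 1)\<^sup>2" if "a > 0" for a x :: real
  proof -
    have "x < a + \<bar>x\<bar> + 1" using that by linarith
    also have "\<dots> \<le> (a + \<bar>x\<bar> + 1)\<^sup>2" by (rule self_le_power) (use that in auto)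
    finally show ?thesis .
  qed
  have Mp: "Ap < Mp" "polarized.K2 \<Omega> lam bp R < Mp\<^sup>2" unfolding Mp_def using sq[OF p(8)] by auto
  have Mn: "An < Mn" "polarized.K2 (- \<Omega>) lam bn R < Mn\<^sup>2" unfolding Mn_def using sq[OF n(8)] by auto
  define K where "K = \<bar>polarized.Kc \<Omega> lam T bp R\<bar> + \<bar>polarized.Kc (- \<Omega>) lam T bn R\<bar>"
  have K: "polarized.Kc \<Omega> lam T bp R \<le> K" "polarized.Kc (- \<Omega>) lam T bn R \<le> K" "0 \<le> K" by (auto simp: K_def)
  \<comment> \<open>2 \<open>sqrt K\<close> is for the two polarized waves and Ap + An for the
    initial data; the 2 leaves 1 for the remainder and makes the inequality strict.\<close>
  define M where "M = 2 * sqrt K + 2 + (Ap + An)"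
  define A where "A = Ap + An"
  define L where "L = sqrt (2 * \<bar>collision.L7 \<kappa> \<Omega> lam T R K M A\<bar>)"
  have L0: "L \<ge> 0" by (simp add: L_def)
  \<comment> \<open>\<open>L\<close> depends on M, which is admissible since \<open>eps0\<close> is
    chosen last. The third bound ensures L \<open>eps\<close> \<le> 1.\<close>
  define eps0 where "eps0 = min (min (1 / (1 + \<bar>lam\<bar> * Mp\<^sup>2)) (1 / (1 + \<bar>lam\<bar> * Mn\<^sup>2))) (1 / (1 + L))"
  have eps0: "eps0 > 0" unfolding eps0_def using L0 by (auto intro!: add_pos_nonneg)
  have main: "\<exists>u up um r. is_the_KG_solution lam eps T (\<lambda>x. a0 x * plane_wave \<kappa> eps x)
         (\<lambda>x. of_real (1 / eps\<^sup>2) * b0 x * plane_wave \<kappa> eps x) u \<and>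
       is_the_KG_solution lam eps T (pol_init \<kappa> eps 1 a0 b0) (pol_init_dt \<kappa> eps 1 a0 b0) up \<and>
       is_the_KG_solution lam eps T (pol_init \<kappa> eps (-1) a0 b0) (pol_init_dt \<kappa> eps (-1) a0 b0) um \<and>
       (\<forall>t\<in>{0..T}. \<forall>x. u t x = up t x + um t x + r t x) \<and> Linfty_norm T r \<le> ereal (L * eps)"
    if e: "0 < eps" "eps \<le> eps0" for eps
  proof -
    have e3: "eps \<le> 1 / (1 + \<bar>lam\<bar> * Mp\<^sup>2)" "eps \<le> 1 / (1 + \<bar>lam\<bar> * Mn\<^sup>2)" "eps \<le> 1 / (1 + L)" using e(2) by (auto simp: eps0_def)
    have Le: "L * eps \<le> 1"
    proof -
      have "eps * (1 + L) \<le> 1" using e3(3) L0 by (simp add: pos_le_divide_eq)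
      then show ?thesis using e(1) by (simp add: algebra_simps)
    qed
    define B where "B = T / eps\<^sup>2"
    define X where "X = R / eps + 1 + B"
    have B: "B > 0" using T e by (simp add: B_def)
    obtain pp pt px ptt ptx pxx pttt pttx ptxx pxxx where P: "polarized B (eps\<^sup>2 * lam) X (wave \<kappa> eps ap) (wave \<kappa> eps (pvel \<kappa> \<Omega> eps ap ap1))
      pp pt px ptt ptx pxx pttt pttx ptxx pxxx \<kappa> \<Omega> lam T eps bp R Mp"
      using polarized_exists[OF \<Omega>(1) \<kappa> dkp p(1,2,3,5,6,7,8) R zR(1) p(4) lam T Mp(1) Mp(2)[unfolded bp_def] e(1) e3(1)]
      unfolding X_def B_def bp_def by blast
    obtain nn nt nx ntt ntx nxx nttt nttx ntxx nxxx where N: "polarized B (eps\<^sup>2 * lam) X (wave \<kappa> eps an) (wave \<kappa> eps (pvel \<kappa> (- \<Omega>) eps an an1))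
      nn nt nx ntt ntx nxx nttt nttx ntxx nxxx \<kappa> (- \<Omega>) lam T eps bn R Mn"
      using polarized_exists[OF \<Omega>(2) \<kappa> dkn n(1,2,3,5,6,7,8) R zR(2) n(4) lam T Mn(1) Mn(2)[unfolded bn_def] e(1) e3(2)]
      unfolding X_def B_def bn_def by blast
    have M0: "M > 0" unfolding M_def using K(3) p(8) n(8) by (intro add_pos_pos add_nonneg_pos) auto
    have dA: "cmod (ap1 x - an1 x) \<le> A" "cmod (ap2 x - an2 x) \<le> A" for x
      unfolding A_def using p(6,7)[of x] n(6,7)[of x] by (auto intro: order_trans[OF norm_triangle_ineq4])
    \<comment> \<open>Stated for every t1 \<le> B because it is used twice: for partial solutions
      during the continuation, and with t1 = B for the final estimate.\<close>
    have est: "(cmod (u t x - pp t x - nn t x))\<^sup>2 \<le> 2 * collision.L7 \<kappa> \<Omega> lam T R K M A * eps\<^sup>2 \<and> cmod (pp t x) \<le> sqrt K \<and> cmod (nn t x) \<le> sqrt K"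
      if W: "kg_solution t1 (eps\<^sup>2 * lam) X (wave \<kappa> eps a0) (wave \<kappa> eps b0) u ut ux utt utx uxx uttt uttx utxx uxxx" and t1: "t1 \<le> B"
        and uM: "\<And>t x. t \<in> {0..t1} \<Longrightarrow> cmod (u t x) \<le> M" and t: "t \<in> {0..t1}"
      for t1 u ut ux utt utx uxx uttt uttx utxx uxxx t x
    proof -
      have M2: "2 * sqrt K \<le> M" using p(8) n(8) by (simp add: M_def)
      note ce = collision_estimate[OF P N W t1 K(1,2) ab p(3) n(3) dA zR(1) p(4) zR(2) n(4) M2 uM t]
      show ?thesis using ce by blast
    qed
    have est': "cmod (u t x - pp t x - nn t x) \<le> L * eps" if "(cmod (u t x - pp t x - nn t x))\<^sup>2 \<le> 2 * collision.L7 \<kappa> \<Omega> lam T R K M A * eps\<^sup>2" for u :: "real \<Rightarrow> real \<Rightarrow> complex" and t x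
    proof (rule power2_le_imp_le)
      have "2 * collision.L7 \<kappa> \<Omega> lam T R K M A * eps\<^sup>2 \<le> 2 * \<bar>collision.L7 \<kappa> \<Omega> lam T R K M A\<bar> * eps\<^sup>2"
        by (intro mult_right_mono) auto
      then show "(cmod (u t x - pp t x - nn t x))\<^sup>2 \<le> (L * eps)\<^sup>2" using that by (simp add: L_def power_mult_distrib)
      show "0 \<le> L * eps" using L0 e by simp
    qed
    obtain w wt wx wtt wtx wxx wttt wttx wtxx wxxx
      where w: "kg_solution B (eps\<^sup>2 * lam) X (wave \<kappa> eps a0) (wave \<kappa> eps b0) w wt wx wtt wtx wxx wttt wttx wtxx wxxx"
        "\<And>t x. t \<in> {0..B} \<Longrightarrow> cmod (w t x) < M"
    proof (rule kg_exists[OF B M0, where f = "wave \<kappa> eps a0" and g = "wave \<kappa> eps b0" and r = "R / eps" and \<mu> = "eps\<^sup>2 * lam"])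
      show "dk k (wave \<kappa> eps a0)" "dk k (wave \<kappa> eps b0)" for k by (intro dk_wave smooth_imp_dk assms)+
      show "wave \<kappa> eps a0 x = 0" "wave \<kappa> eps b0 x = 0" if "R / eps \<le> \<bar>x\<bar>" for x
        using wave_support[OF e(1) zR(3) that] wave_support[OF e(1) zR(4) that] by auto
      show "cmod (wave \<kappa> eps a0 x) < M" for x
      proof -
        have "cmod (a0 (eps * x)) \<le> cmod (ap (eps * x)) + cmod (an (eps * x))" unfolding ab(1) by (rule norm_triangle_ineq)
        also have "\<dots> \<le> Ap + An" by (intro add_mono p n)
        also have "\<dots> < M" using real_sqrt_ge_zero[OF K(3)] unfolding M_def by linarith
        finally show ?thesis by (simp add: cmod_wave)
      qed
      fix t1 u ut ux utt utx uxx uttt uttx utxx uxxx t x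
      assume t1: "t1 \<le> B" and W: "kg_solution t1 (eps\<^sup>2 * lam) (R / eps + 1 + B) (wave \<kappa> eps a0) (wave \<kappa> eps b0) u ut ux utt utx uxx uttt uttx utxx uxxx"
        and uM: "\<And>t x. t \<in> {0..t1} \<Longrightarrow> cmod (u t x) \<le> M" and t: "t \<in> {0..t1}"
      note es = est[OF W[folded X_def] t1 uM t, of x]
      \<comment> \<open>The decomposition is itself the a priori bound: the remainder is at most L
        \<open>eps\<close> \<le> 1 and each wave at most \<open>sqrt K\<close>, in total less than
        M.\<close>
      have "cmod (u t x) \<le> cmod (u t x - pp t x - nn t x) + cmod (pp t x) + cmod (nn t x)"
        using norm_triangle_ineq[of "u t x - pp t x - nn t x" "pp t x + nn t x"] norm_triangle_ineq[of "pp t x" "nn t x"] by simp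
      also have "\<dots> \<le> 1 + sqrt K + sqrt K"
        using es est'[of u t x] Le by linarith
      also have "\<dots> < M" using p(8) n(8) by (simp add: M_def)
      finally show "cmod (u t x) < M" .
    qed (rule that, auto simp: X_def)
    let ?sc = "\<lambda>v t x. v (1 / eps\<^sup>2 * t) (1 / eps * x)"
    define u where "u = ?sc w"
    define up where "up = ?sc pp"
    define um where "um = ?sc nn"
    define r where "r t x = u t x - up t x - um t x" for t x
    have sol0: "is_the_KG_solution lam eps T (\<lambda>x. a0 x * plane_wave \<kappa> eps x) (\<lambda>x. of_real (1 / eps\<^sup>2) * b0 x * plane_wave \<kappa> eps x) u"
      unfolding u_def
    proof (rule is_the_KG_solution_rescale[OF T e(1)])
      have "(\<lambda>y. a0 (eps * y) * plane_wave \<kappa> eps (eps * y)) = wave \<kappa> eps a0"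
        by (rule ext) (simp only: wave_def plane_wave_scale[OF e(1)])
      moreover have "(\<lambda>y. of_real (eps\<^sup>2) * (of_real (1 / eps\<^sup>2) * b0 (eps * y) * plane_wave \<kappa> eps (eps * y))) = wave \<kappa> eps b0"
        by (rule ext) (use e(1) in \<open>simp only: wave_def plane_wave_scale[OF e(1)], simp\<close>)
      ultimately show "kg2 (T / eps\<^sup>2) (eps\<^sup>2 * lam) (\<lambda>y. a0 (eps * y) * plane_wave \<kappa> eps (eps * y))
         (\<lambda>y. of_real (eps\<^sup>2) * (of_real (1 / eps\<^sup>2) * b0 (eps * y) * plane_wave \<kappa> eps (eps * y))) w"
        using kg_solution_imp_kg2[OF w(1)] unfolding B_def by simp
    qed
    have ksP: "kg_solution B (eps\<^sup>2 * lam) X (wave \<kappa> eps ap) (wave \<kappa> eps (pvel \<kappa> \<Omega> eps ap ap1)) pp pt px ptt ptx pxx pttt pttx ptxx pxxx"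
      using P by (simp add: polarized_def kg_wave_def)
    have ksN: "kg_solution B (eps\<^sup>2 * lam) X (wave \<kappa> eps an) (wave \<kappa> eps (pvel \<kappa> (- \<Omega>) eps an an1)) nn nt nx ntt ntx nxx nttt nttx ntxx nxxx"
      using N by (simp add: polarized_def kg_wave_def)
    have solp: "is_the_KG_solution lam eps T (pol_init \<kappa> eps 1 a0 b0) (pol_init_dt \<kappa> eps 1 a0 b0) up"
      unfolding up_def
    proof (rule is_the_KG_solution_rescale[OF T e(1)])
      have "(\<lambda>y. pol_init \<kappa> eps 1 a0 b0 (eps * y)) = wave \<kappa> eps ap"
        unfolding ap_def by (rule ext) (rule pol_init_wave[OF e(1)])
      moreover have "(\<lambda>y. of_real (eps\<^sup>2) * pol_init_dt \<kappa> eps 1 a0 b0 (eps * y)) = wave \<kappa> eps (pvel \<kappa> \<Omega> eps ap ap1)"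
        using pol_init_dt_wave[OF e(1) _ p(2)[unfolded ap_def]] by (auto simp: ap_def \<Omega>_def)
      ultimately show "kg2 (T / eps\<^sup>2) (eps\<^sup>2 * lam) (\<lambda>y. pol_init \<kappa> eps 1 a0 b0 (eps * y)) (\<lambda>y. of_real (eps\<^sup>2) * pol_init_dt \<kappa> eps 1 a0 b0 (eps * y)) pp"
        using kg_solution_imp_kg2[OF ksP] unfolding B_def by simp
    qed
    have soln: "is_the_KG_solution lam eps T (pol_init \<kappa> eps (-1) a0 b0) (pol_init_dt \<kappa> eps (-1) a0 b0) um"
      unfolding um_def
    proof (rule is_the_KG_solution_rescale[OF T e(1)])
      have "(\<lambda>y. pol_init \<kappa> eps (-1) a0 b0 (eps * y)) = wave \<kappa> eps an"
        unfolding an_def by (rule ext) (rule pol_init_wave[OF e(1)])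
      moreover have "(\<lambda>y. of_real (eps\<^sup>2) * pol_init_dt \<kappa> eps (-1) a0 b0 (eps * y)) = wave \<kappa> eps (pvel \<kappa> (- \<Omega>) eps an an1)"
        using pol_init_dt_wave[OF e(1) _ n(2)[unfolded an_def]] by (auto simp: an_def \<Omega>_def)
      ultimately show "kg2 (T / eps\<^sup>2) (eps\<^sup>2 * lam) (\<lambda>y. pol_init \<kappa> eps (-1) a0 b0 (eps * y)) (\<lambda>y. of_real (eps\<^sup>2) * pol_init_dt \<kappa> eps (-1) a0 b0 (eps * y)) nn"
        using kg_solution_imp_kg2[OF ksN] unfolding B_def by simp
    qed
    have rle: "cmod (r t x) \<le> L * eps" if t: "t \<in> {0..T}" for t x
    proof -
      have tB: "1 / eps\<^sup>2 * t \<in> {0..B}" using t e by (auto simp: B_def divide_right_mono)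
      show ?thesis unfolding r_def u_def up_def um_def
        using est[OF w(1) order_refl less_imp_le[OF w(2)] tB, of "1 / eps * x"] est' by blast
    qed
    have "Linfty_norm T r \<le> ereal (L * eps)"
      unfolding Linfty_norm_def
    proof (rule esssup_I)
      have c: "continuous_on (slab T) (\<lambda>z. v (fst z) (snd z))" if "is_the_KG_solution lam eps T f g v" for f g v
        using that unfolding is_the_KG_solution_def KG_solution_def C2_slab_def C1_slab_def by (simp add: case_prod_beta')
      have "continuous_on (slab T) (\<lambda>z. cmod (r (fst z) (snd z)))"
        unfolding r_def by (intro continuous_intros c[OF sol0] c[OF solp] c[OF soln])
      moreover have "slab T \<in> sets lebesgue"
      proof -
        have "closed (slab T)" unfolding slab_def by (intro closed_Times) auto
        then show ?thesis by (metis borel_closed sets_completionI_sets sets_lborel)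
      qed
      ultimately have "(\<lambda>z. cmod (r (fst z) (snd z))) \<in> borel_measurable (lebesgue_on (slab T))"
        by (rule continuous_imp_measurable_on_sets_lebesgue)
      then show "(\<lambda>(t, x). ereal (cmod (r t x))) \<in> borel_measurable (lebesgue_on (slab T))"
        by (simp add: case_prod_beta')
      show "AE z in lebesgue_on (slab T). (case z of (t, x) \<Rightarrow> ereal (cmod (r t x))) \<le> ereal (L * eps)"
        by (rule AE_I2) (auto simp: slab_def rle)
    qed
    then show ?thesis
      using sol0 solp soln by (intro exI[of _ u] exI[of _ up] exI[of _ um] exI[of _ r]) (simp add: r_def)
  qed
  show ?thesis by (intro exI[of _ eps0] exI[of _ L] conjI eps0 allI impI main) auto
qed


end
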